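(* Let $W$ be the exact solution of the Maxwell equations of the relativistic Vlasov-Maxwell system, $W^{h,i}$ the streamline diffusion solution at iteration step $i$, and $W^i$ the exact solution of the approximated Maxwell equations at iteration step $i$. Assume that the iteration error is dominated by the numerical error, i.e. for all sufficiently large $i$ $$\|W-W^i\|_{H^{-1}(\tilde Q_T)}\le\|W^i-W^{h,i}\|_{H^{-1}(\tilde Q_T)}.$$ Then there exists a constant $C$ (independent of the mesh parameter $h$, of $i$, and of the exact and discrete solutions; it may depend on $T$) such that for all sufficiently large $i$ $$\|W-W^{h,i}\|_{H^{-1}(\tilde Q_T)}\le C\left(\|h\tilde R_1^i\|_{L_2(\tilde Q_T)}+\|h\tilde R_2^i\|_{L_2(\tilde Q_T)}\right).$$
   Context: **Continuous problem.** Let $T>0$, let $\Omega_x\subset\mathbb R$ and $\Omega_v\subset\mathbb R^2$ be bounded space and velocity domains, $\tilde Q_T=[0,T]\times\Omega_x$, $\hat v=v/\sqrt{1+|v|^2}$ for $v\in\mathbb R^2$. The one and one-half dimensional relativistic Vlasov-Maxwell system, with unknowns $f(t,x,v)$, $E_1,E_2,B$ (functions of $(t,x)$) and given background density $\rho_b$, is $$\partial_t f+\hat v_1\partial_x f+(E_1+\hat v_2B)\partial_{v_1}f+(E_2-\hat v_1B)\partial_{v_2}f=0,$$ $$\partial_xE_1=\int f\,dv-\rho_b,\quad \partial_tE_1=-\int\hat v_1f\,dv,\quad \partial_tE_2+\partial_xB=-\int\hat v_2f\,dv,\quad \partial_tB+\partial_xE_2=0,$$ with initial data $f^0\ge0$,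 $E_2^0$, $B^0$ and $E_1^0(x)=\int_{-\infty}^x(\int f^0(y,v)\,dv-\rho_b(y))\,dy$. The background density is smooth, compactly supported and neutralizing: $\int(\int f^0\,dv-\rho_b)\,dx=0$. All functions of $x$ involved in the Maxwell problem are assumed to have compact support in $\Omega_x$, and $f$ has compact support in $\Omega_v$ as a function of $v$. **Matrix form.** Put $W=(E_1,E_2,B)^T$, $W^0=(E_1^0,E_2^0,B^0)^T$ and $$M_1=\begin{pmatrix}0&0&0\\1&0&0\\0&1&0\\0&0&1\end{pmatrix},\qquad M_2=\begin{pmatrix}1&0&0\\0&0&0\\0&0&1\\0&1&0\end{pmatrix}.$$ The Maxwell equations are $M_1W_t+M_2W_x=b$, $W(0,\cdot)=W^0$, with $b=(\int f\,dv-\rho_b,\,-\int\hat v_1f\,dv,\,-\int\hat v_2f\,dv,\,0)^T$. **Discretization.** Let $0=t_0<\dots<t_M=T$, $I_m=(t_{m-1},t_m]$, $S_m=I_m\times\Omega_x$. Let $\{\tau_x\}$ be a finite element subdivision of $\Omega_x$ and let $h$ be the mesh parameter (diameter of the elements; time steps have length $h$). For a fixed $k\in\{0,1,2,\dots\}$ let $P_k$ denote polynomials of degree at most $k$ and $$\tilde V_h=\{g\in[\tilde{\mathcal H}_0]^3:\ g_l|_{I_m\times\tau_x}\in P_k(I_m)\times P_k(\tau_x)\ \forall m,\tau_x,\ l=1,2,3\},$$ where $\tilde{\mathcal H}_0=\prod_{m=1}^M\{w\in H^1(I_m\times\Omega_x): w=0\text{ on }\partial\Omega_x\}$; functions may jump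 in time across the $t_m$. Write $g_\pm(t,x)=\lim_{s\to0^\pm}g(t+s,x)$, $[g]=g_+-g_-$, $(\cdot,\cdot)_m$ for the $L_2(S_m)$ inner product, $\langle f,g\rangle_m=(f(t_m,\cdot),g(t_m,\cdot))_{L_2(\Omega_x)}$, and $\hat g=(g_1,g_1,g_2,g_3)^T$ for $g=(g_1,g_2,g_3)^T$. **Iteration and streamline diffusion scheme.** Given a numerical approximation $f^{h,i-1}$ of $f$ from the previous iteration step, let $b^{h,i-1}$ be $b$ with $f$ replaced by $f^{h,i-1}$. The streamline diffusion solution $W^{h,i}\in\tilde V_h$ satisfies, for $m=1,\dots,M$ and all $g\in\tilde V_h$, $$(M_1W^{h,i}_t+M_2W^{h,i}_x,\ \hat g+\delta(M_1g_t+M_2g_x))_m+\langle W^{h,i}_+,g_+\rangle_{m-1}=(b^{h,i-1},\ \hat g+\delta(M_1g_t+M_2g_x))_m+\langle W^{h,i}_-,g_+\rangle_{m-1},$$ with $W^{h,i}_-(0,\cdot)=W^0$ and $\delta$ a fixed multiple of $h$. The function $W^i$ is the exact solution of $M_1W^i_t+M_2W^i_x=b^{h,i-1}$, $W^i(0,\cdot)=W^0$. **Residuals.** $\tilde R_1^i=b^{h,i-1}-M_1W^{h,i}_t-M_2W^{h,i}_x$ (computed slab-wise) and $\tilde R_2^i|_{S_m}=\big(W^{h,i}_+(t_{m-1},x)-W^{h,i}_-(t_{m-1},x)\big)/h$, constant in time on each slab. **Negative norm.** For a domain $G$, $\|u\|_{H^{-1}(G)}=\sup_{\psi}\,(u,\psi)_{L_2(G)}/\|\psi\|_{H^1(G)}$,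 the supremum being over nonzero (vector-valued, if $u$ is) $\psi\in C_0^\infty(G)$.
   Formalization: The degree k is taken to be at least 1 (for k = 0 the discrete space is {0} and the bound fails), and all x-supports lie in one fixed compact subset of the space domain on which C may depend (for supports within O(h) of the boundary no uniform C exists). *)

theory Defs
  imports "HOL-Analysis.Analysis"
begin

text \<open>
  Functions of time and space are curried, \<open>u t x\<close>; sets in space-time are subsets of
  \<open>real \<times> real\<close>. Integrals over space-time are taken with respect to the completed Lebesgue
  measure, because the classical partial derivatives of piecewise polynomials are only determined
  off the (null) grid lines.
\<close>

definition domain :: "'a::euclidean_space set \<Rightarrow> bool" where
  "domain G \<longleftrightarrow> open G \<and> connected G \<and> bounded G \<and> G \<noteq> {}"

definition dt :: "(real \<Rightarrow> real \<Rightarrow> 'a::real_normed_vector) \<Rightarrow> real \<Rightarrow> real \<Rightarrow> 'a" where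
  "dt u t x = vector_derivative (\<lambda>s. u s x) (at t)"

definition dx :: "(real \<Rightarrow> real \<Rightarrow> 'a::real_normed_vector) \<Rightarrow> real \<Rightarrow> real \<Rightarrow> 'a" where
  "dx u t x = vector_derivative (\<lambda>y. u t y) (at x)"

definition smooth1 :: "(real \<Rightarrow> real) \<Rightarrow> bool" where
  "smooth1 r \<longleftrightarrow> (\<exists>D. D 0 = r \<and>
     (\<forall>n x. (D n has_real_derivative D (Suc n) x) (at x)))"

text \<open>\<open>D i j\<close> is the derivative of order \<open>i\<close> in \<open>t\<close> and \<open>j\<close> in \<open>x\<close>.\<close>

definition smooth2 :: "(real \<Rightarrow> real \<Rightarrow> 'a::real_normed_vector) \<Rightarrow> bool" where
  "smooth2 u \<longleftrightarrow> (\<exists>D. D 0 0 = u \<and>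
     (\<forall>i j. continuous_on UNIV (\<lambda>(t, x). D i j t x)) \<and>
     (\<forall>i j t x.
        ((\<lambda>s. D i j s x) has_vector_derivative D (Suc i) j t x) (at t) \<and>
        ((\<lambda>y. D i j t y) has_vector_derivative D i (Suc j) t x) (at x)))"

definition C0_infinity :: "(real \<times> real) set \<Rightarrow> (real \<Rightarrow> real \<Rightarrow> 'a::real_normed_vector) set" where
  "C0_infinity G = {u. smooth2 u \<and>
     (\<exists>A. compact A \<and> A \<subseteq> G \<and> (\<forall>t x. (t, x) \<notin> A \<longrightarrow> u t x = 0))}"

definition inner_L2 ::
  "(real \<times> real) set \<Rightarrow> (real \<Rightarrow> real \<Rightarrow> 'a::euclidean_space) \<Rightarrow> (real \<Rightarrow> real \<Rightarrow> 'a) \<Rightarrow> real" where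
  "inner_L2 S u w = (LINT z:S|lebesgue. u (fst z) (snd z) \<bullet> w (fst z) (snd z))"

definition norm_L2 :: "(real \<times> real) set \<Rightarrow> (real \<Rightarrow> real \<Rightarrow> 'a::euclidean_space) \<Rightarrow> real" where
  "norm_L2 S u = sqrt (inner_L2 S u u)"

definition in_L2 :: "(real \<times> real) set \<Rightarrow> (real \<Rightarrow> real \<Rightarrow> 'a::euclidean_space) \<Rightarrow> bool" where
  "in_L2 S u \<longleftrightarrow> set_borel_measurable lebesgue S (\<lambda>(t, x). u t x) \<and>
     set_integrable lebesgue S (\<lambda>(t, x). (norm (u t x))\<^sup>2)"

text \<open>The Sobolev space of order one on the interior of \<open>S\<close>, via weak derivatives.\<close>

definition in_H1 :: "(real \<times> real) set \<Rightarrow> (real \<Rightarrow> real \<Rightarrow> real) \<Rightarrow> bool" where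
  "in_H1 S w \<longleftrightarrow> in_L2 S w \<and>
     (\<exists>wt wx. in_L2 S wt \<and> in_L2 S wx \<and>
       (\<forall>\<phi> \<in> C0_infinity (interior S).
          inner_L2 S w (dt \<phi>) = - inner_L2 S wt \<phi> \<and>
          inner_L2 S w (dx \<phi>) = - inner_L2 S wx \<phi>))"

definition norm_H1 :: "(real \<times> real) set \<Rightarrow> (real \<Rightarrow> real \<Rightarrow> 'a::euclidean_space) \<Rightarrow> real" where
  "norm_H1 G \<psi> = sqrt ((norm_L2 G \<psi>)\<^sup>2 + (norm_L2 G (dt \<psi>))\<^sup>2 + (norm_L2 G (dx \<psi>))\<^sup>2)"

definition norm_Hneg1 :: "(real \<times> real) set \<Rightarrow> (real \<Rightarrow> real \<Rightarrow> 'a::euclidean_space) \<Rightarrow> ereal" where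
  "norm_Hneg1 G u =
     (SUP \<psi> \<in> C0_infinity G - {\<lambda>_ _. 0}. ereal (inner_L2 G u \<psi> / norm_H1 G \<psi>))"

definition vhat :: "real ^ 2 \<Rightarrow> real ^ 2" where
  "vhat v = v /\<^sub>R sqrt (1 + (norm v)\<^sup>2)"

definition M1 :: "real ^ 3 ^ 4" where
  "M1 = vector [vector [0, 0, 0], vector [1, 0, 0], vector [0, 1, 0], vector [0, 0, 1]]"

definition M2 :: "real ^ 3 ^ 4" where
  "M2 = vector [vector [1, 0, 0], vector [0, 0, 0], vector [0, 0, 1], vector [0, 1, 0]]"

text \<open>The right-hand side \<open>b\<close> generated by a density \<open>f\<close> and the background density \<open>\<rho>\<close>.\<close>

definition source ::
  "(real \<Rightarrow> real) \<Rightarrow> (real \<Rightarrow> real \<Rightarrow> real ^ 2 \<Rightarrow> real) \<Rightarrow> real \<Rightarrow> real \<Rightarrow> real ^ 4" where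
  "source \<rho> f t x = vector
     [(LINT v|lborel. f t x v) - \<rho> x,
      - (LINT v|lborel. vhat v $ 1 * f t x v),
      - (LINT v|lborel. vhat v $ 2 * f t x v),
      0]"

definition initial_E1 :: "(real \<Rightarrow> real) \<Rightarrow> (real \<Rightarrow> real ^ 2 \<Rightarrow> real) \<Rightarrow> real \<Rightarrow> real" where
  "initial_E1 \<rho> f0 x = (LINT y:{..x}|lborel. (LINT v|lborel. f0 y v) - \<rho> y)"

definition fields :: "(real \<Rightarrow> real \<Rightarrow> real) \<Rightarrow> (real \<Rightarrow> real \<Rightarrow> real) \<Rightarrow> (real \<Rightarrow> real \<Rightarrow> real)
    \<Rightarrow> real \<Rightarrow> real \<Rightarrow> real ^ 3" where
  "fields E1 E2 B t x = vector [E1 t x, E2 t x, B t x]"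

definition initial_fields :: "(real \<Rightarrow> real) \<Rightarrow> (real \<Rightarrow> real ^ 2 \<Rightarrow> real)
    \<Rightarrow> (real \<Rightarrow> real) \<Rightarrow> (real \<Rightarrow> real) \<Rightarrow> real \<Rightarrow> real ^ 3" where
  "initial_fields \<rho> f0 E20 B0 x = vector [initial_E1 \<rho> f0 x, E20 x, B0 x]"

text \<open>
  The compact set \<open>K \<subseteq> \<Omega>x\<close> carries the \<open>x\<close>-supports of all data, densities and exact solutions.
  It belongs to the setting, like \<open>\<Omega>x\<close>; discrete solutions are not required to vanish outside it.
\<close>

definition vm_data :: "real set \<Rightarrow> (real ^ 2) set
    \<Rightarrow> (real \<Rightarrow> real) \<Rightarrow> (real \<Rightarrow> real ^ 2 \<Rightarrow> real) \<Rightarrow> (real \<Rightarrow> real) \<Rightarrow> (real \<Rightarrow> real) \<Rightarrow> bool" where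
  "vm_data K \<Omega>v \<rho> f0 E20 B0 \<longleftrightarrow>
     smooth1 \<rho> \<and> (\<forall>x v. 0 \<le> f0 x v) \<and>
     (LINT x|lborel. (LINT v|lborel. f0 x v) - \<rho> x) = 0 \<and>
     (\<forall>x. x \<notin> K \<longrightarrow> \<rho> x = 0 \<and> E20 x = 0 \<and> B0 x = 0 \<and> (\<forall>v. f0 x v = 0)) \<and>
     (\<exists>Kv. compact Kv \<and> Kv \<subseteq> \<Omega>v \<and> (\<forall>x v. v \<notin> Kv \<longrightarrow> f0 x v = 0))"

text \<open>Classical solutions. At \<open>t = 0\<close> and \<open>t = T\<close> the time derivatives are one-sided.\<close>

definition vm_solution :: "real \<Rightarrow> real set \<Rightarrow> real set \<Rightarrow> (real ^ 2) set
    \<Rightarrow> (real \<Rightarrow> real) \<Rightarrow> (real \<Rightarrow> real ^ 2 \<Rightarrow> real) \<Rightarrow> (real \<Rightarrow> real) \<Rightarrow> (real \<Rightarrow> real)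
    \<Rightarrow> (real \<Rightarrow> real \<Rightarrow> real ^ 2 \<Rightarrow> real)
    \<Rightarrow> (real \<Rightarrow> real \<Rightarrow> real) \<Rightarrow> (real \<Rightarrow> real \<Rightarrow> real) \<Rightarrow> (real \<Rightarrow> real \<Rightarrow> real) \<Rightarrow> bool" where
  "vm_solution T \<Omega>x K \<Omega>v \<rho> f0 E20 B0 f E1 E2 B \<longleftrightarrow>
     continuous_on ({0..T} \<times> UNIV \<times> UNIV) (\<lambda>(t, x, v). f t x v) \<and>
     continuous_on ({0..T} \<times> UNIV) (\<lambda>(t, x). fields E1 E2 B t x) \<and>
     (\<forall>t\<in>{0..T}. \<forall>x. x \<notin> K \<longrightarrow> fields E1 E2 B t x = 0 \<and> (\<forall>v. f t x v = 0)) \<and>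
     (\<exists>Kv. compact Kv \<and> Kv \<subseteq> \<Omega>v \<and> (\<forall>t\<in>{0..T}. \<forall>x v. v \<notin> Kv \<longrightarrow> f t x v = 0)) \<and>
     (\<forall>t\<in>{0..T}. \<forall>x\<in>\<Omega>x. \<forall>v\<in>\<Omega>v. \<exists>ft fx fv1 fv2.
        ((\<lambda>s. f s x v) has_real_derivative ft) (at t within {0..T}) \<and>
        ((\<lambda>y. f t y v) has_real_derivative fx) (at x) \<and>
        ((\<lambda>r. f t x (v + r *\<^sub>R axis 1 1)) has_real_derivative fv1) (at 0) \<and>
        ((\<lambda>r. f t x (v + r *\<^sub>R axis 2 1)) has_real_derivative fv2) (at 0) \<and>
        ft + vhat v $ 1 * fx + (E1 t x + vhat v $ 2 * B t x) * fv1
           + (E2 t x - vhat v $ 1 * B t x) * fv2 = 0) \<and>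
     (\<forall>t\<in>{0..T}. \<forall>x\<in>\<Omega>x.
        ((\<lambda>y. E1 t y) has_real_derivative (LINT v|lborel. f t x v) - \<rho> x) (at x) \<and>
        ((\<lambda>s. E1 s x) has_real_derivative - (LINT v|lborel. vhat v $ 1 * f t x v))
          (at t within {0..T}) \<and>
        (\<exists>E2t E2x Bt Bx.
           ((\<lambda>s. E2 s x) has_real_derivative E2t) (at t within {0..T}) \<and>
           ((\<lambda>y. E2 t y) has_real_derivative E2x) (at x) \<and>
           ((\<lambda>s. B s x) has_real_derivative Bt) (at t within {0..T}) \<and>
           ((\<lambda>y. B t y) has_real_derivative Bx) (at x) \<and>
           E2t + Bx = - (LINT v|lborel. vhat v $ 2 * f t x v) \<and>
           Bt + E2x = 0)) \<and>
     (\<forall>x v. f 0 x v = f0 x v) \<and>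
     (\<forall>x. fields E1 E2 B 0 x = initial_fields \<rho> f0 E20 B0 x)"

text \<open>
  Exact solutions of \<open>M\<^sub>1 W\<^sub>t + M\<^sub>2 W\<^sub>x = b\<close>, \<open>W(0,\<cdot>) = W\<^sup>0\<close> for a source \<open>b\<close> that may be
  discontinuous, as it is when it comes from a numerical density. The equation and the initial
  condition are therefore understood in the weak sense; classical solutions are included.
  The test functions need not vanish at \<open>t = 0\<close>.
\<close>

definition maxwell_solution :: "real \<Rightarrow> real set \<Rightarrow> real set
    \<Rightarrow> (real \<Rightarrow> real \<Rightarrow> real ^ 4) \<Rightarrow> (real \<Rightarrow> real ^ 3) \<Rightarrow> (real \<Rightarrow> real \<Rightarrow> real ^ 3) \<Rightarrow> bool" where
  "maxwell_solution T \<Omega>x K b W0 W \<longleftrightarrow>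
     in_L2 ({0..T} \<times> \<Omega>x) W \<and>
     (\<forall>t\<in>{0..T}. \<forall>x. x \<notin> K \<longrightarrow> W t x = 0) \<and>
     (\<forall>\<phi> \<in> C0_infinity ({..<T} \<times> \<Omega>x).
        - inner_L2 ({0..T} \<times> \<Omega>x) (\<lambda>t x. M1 *v W t x) (dt \<phi>)
        - inner_L2 ({0..T} \<times> \<Omega>x) (\<lambda>t x. M2 *v W t x) (dx \<phi>)
        - (LINT x:\<Omega>x|lebesgue. (M1 *v W0 x) \<bullet> \<phi> 0 x)
        = inner_L2 ({0..T} \<times> \<Omega>x) b \<phi>)"

text \<open>
  The densities that may enter the Maxwell step as numerical approximations. Only square
  integrability and the support conditions are required of them, not a particular discretization
  of the Vlasov equation.
\<close>

definition approx_density :: "real \<Rightarrow> real set \<Rightarrow> real set \<Rightarrow> (real ^ 2) set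
    \<Rightarrow> (real \<Rightarrow> real \<Rightarrow> real ^ 2 \<Rightarrow> real) \<Rightarrow> bool" where
  "approx_density T \<Omega>x K \<Omega>v f \<longleftrightarrow>
     (\<lambda>(t, x, v). f t x v) \<in> borel_measurable borel \<and>
     set_integrable lborel ({0..T} \<times> \<Omega>x \<times> \<Omega>v) (\<lambda>(t, x, v). (f t x v)\<^sup>2) \<and>
     (\<forall>t x v. x \<notin> K \<or> v \<notin> \<Omega>v \<longrightarrow> f t x v = 0)"

definition slab_time :: "real \<Rightarrow> nat \<Rightarrow> real set" where
  "slab_time h m = {(real m - 1) * h<..real m * h}"

definition discretization :: "real \<Rightarrow> real set \<Rightarrow> real \<Rightarrow> nat \<Rightarrow> real set set \<Rightarrow> bool" where
  "discretization T \<Omega>x h M \<T> \<longleftrightarrow>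
     1 \<le> M \<and> real M * h = T \<and>
     \<T> division_of closure \<Omega>x \<and> (\<forall>\<tau>\<in>\<T>. interior \<tau> \<noteq> {}) \<and>
     h = Max (diameter ` \<T>)"

definition H0_space :: "real set \<Rightarrow> real \<Rightarrow> nat \<Rightarrow> (real \<Rightarrow> real \<Rightarrow> real) set" where
  "H0_space \<Omega>x h M = {w. \<forall>m\<in>{1..M}. in_H1 (slab_time h m \<times> \<Omega>x) w \<and>
     (\<forall>t\<in>slab_time h m. \<forall>x\<in>frontier \<Omega>x. w t x = 0)}"

text \<open>
  \<open>P\<^sub>k(I\<^sub>m) \<times> P\<^sub>k(\<tau>)\<close> is the tensor product space. As elements \<open>\<tau>\<close> are closed, members are
  represented by functions that are pointwise continuous in \<open>x\<close> up to the boundary, so that the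
  pointwise boundary condition above agrees with the one in the sense of traces.
\<close>

definition V_space ::
  "real set \<Rightarrow> real \<Rightarrow> nat \<Rightarrow> real set set \<Rightarrow> nat \<Rightarrow> (real \<Rightarrow> real \<Rightarrow> real ^ 3) set" where
  "V_space \<Omega>x h M \<T> k = {g. \<forall>l.
     (\<lambda>t x. g t x $ l) \<in> H0_space \<Omega>x h M \<and>
     (\<forall>m\<in>{1..M}. \<forall>\<tau>\<in>\<T>. \<exists>c :: nat \<Rightarrow> nat \<Rightarrow> real.
        \<forall>t\<in>slab_time h m. \<forall>x\<in>\<tau>. g t x $ l = (\<Sum>i\<le>k. \<Sum>j\<le>k. c i j * t ^ i * x ^ j))}"

definition hat :: "real ^ 3 \<Rightarrow> real ^ 4" where
  "hat g = vector [g $ 1, g $ 1, g $ 2, g $ 3]"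

definition trace_plus :: "(real \<Rightarrow> real \<Rightarrow> real ^ 3) \<Rightarrow> real \<Rightarrow> real \<Rightarrow> real ^ 3" where
  "trace_plus g t x = Lim (at_right t) (\<lambda>s. g s x)"

text \<open>The left limit, with the convention that it is the initial value \<open>W0\<close> at \<open>t = 0\<close>.\<close>

definition trace_minus ::
  "(real \<Rightarrow> real ^ 3) \<Rightarrow> (real \<Rightarrow> real \<Rightarrow> real ^ 3) \<Rightarrow> real \<Rightarrow> real \<Rightarrow> real ^ 3" where
  "trace_minus W0 g t x = (if t = 0 then W0 x else Lim (at_left t) (\<lambda>s. g s x))"

definition maxwell_op :: "(real \<Rightarrow> real \<Rightarrow> real ^ 3) \<Rightarrow> real \<Rightarrow> real \<Rightarrow> real ^ 4" where
  "maxwell_op w t x = M1 *v dt w t x + M2 *v dx w t x"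

definition sd_solution :: "real set \<Rightarrow> real \<Rightarrow> nat \<Rightarrow> real set set \<Rightarrow> nat \<Rightarrow> real
    \<Rightarrow> (real \<Rightarrow> real \<Rightarrow> real ^ 4) \<Rightarrow> (real \<Rightarrow> real ^ 3) \<Rightarrow> (real \<Rightarrow> real \<Rightarrow> real ^ 3) \<Rightarrow> bool" where
  "sd_solution \<Omega>x h M \<T> k \<delta> b W0 W \<longleftrightarrow>
     W \<in> V_space \<Omega>x h M \<T> k \<and>
     (\<forall>m\<in>{1..M}. \<forall>g \<in> V_space \<Omega>x h M \<T> k.
        inner_L2 (slab_time h m \<times> \<Omega>x) (maxwell_op W)
          (\<lambda>t x. hat (g t x) + \<delta> *\<^sub>R maxwell_op g t x)
        + (LINT x:\<Omega>x|lebesgue.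
             trace_plus W ((real m - 1) * h) x \<bullet> trace_plus g ((real m - 1) * h) x)
        = inner_L2 (slab_time h m \<times> \<Omega>x) b
          (\<lambda>t x. hat (g t x) + \<delta> *\<^sub>R maxwell_op g t x)
        + (LINT x:\<Omega>x|lebesgue.
             trace_minus W0 W ((real m - 1) * h) x \<bullet> trace_plus g ((real m - 1) * h) x))"

definition residual1 ::
  "(real \<Rightarrow> real \<Rightarrow> real ^ 4) \<Rightarrow> (real \<Rightarrow> real \<Rightarrow> real ^ 3) \<Rightarrow> real \<Rightarrow> real \<Rightarrow> real ^ 4" where
  "residual1 b W t x = b t x - maxwell_op W t x"

text \<open>For \<open>t\<close> in the \<open>m\<close>-th slab, \<open>\<lceil>t / h\<rceil> = m\<close>.\<close>

definition residual2 ::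
  "real \<Rightarrow> (real \<Rightarrow> real ^ 3) \<Rightarrow> (real \<Rightarrow> real \<Rightarrow> real ^ 3) \<Rightarrow> real \<Rightarrow> real \<Rightarrow> real ^ 3" where
  "residual2 h W0 W t x =
     (let s = (of_int \<lceil>t / h\<rceil> - 1) * h
      in (trace_plus W s x - trace_minus W0 W s x) /\<^sub>R h)"

end

theory Submission
  imports Defs
begin

text \<open>
  Since \<open>W - Wh = (W - Wi) + (Wi - Wh)\<close> and the first term is dominated by the second one, it
  suffices to bound the discretization error \<open>Wi - Wh\<close> in the dual norm by the residuals. This is
  done by duality. The Maxwell operator in one space dimension decouples: for each of the
  directions \<open>e = (1, 0, 0)\<close>, \<open>(0, 1, 1)\<close>, \<open>(0, 1, - 1)\<close> the component \<open>u = W \<bullet> e\<close> satisfies a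
  scalar transport equation \<open>u\<^sub>t + \<sigma> u\<^sub>x = b \<bullet> hat e\<close> with speed \<open>\<sigma> = 1\<close> or \<open>\<sigma> = - 1\<close>
  (\<open>characteristic_e\<close>), and the three components recover the inner product (\<open>inner_expand_e\<close>). For
  a scalar test function \<open>g\<close> supported inside the cylinder the dual solution is explicit, \<open>\<psi>(t, x)
  = \<integral> g(t + r, x + \<sigma> r) dr\<close> over \<open>0 \<le> r \<le> T\<close>: it solves \<open>- \<psi>\<^sub>t - \<sigma> \<psi>\<^sub>x = g\<close> for \<open>t \<ge> 0\<close> and
  vanishes at the final time, and \<open>\<psi>\<close> and its derivatives are bounded by \<open>T\<close> times the norms of
  \<open>g\<close> and its derivatives (\<open>along_transport\<close>, \<open>along_norm\<close>). Integration by parts, once in the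
  weak form of the exact problem (\<open>weak_identity\<close>) and once slab by slab, turns the pairing of the
  error with \<open>g\<close> into the residual paired with \<open>\<psi>\<close> minus the jumps paired with the values of \<open>\<psi>\<close>
  at the beginning of the slabs (\<open>error_identity\<close>).

  By Galerkin orthogonality a discrete function may be subtracted from \<open>\<psi>\<close>. Subtracting an
  interpolant gains the factor \<open>h\<close> in front of the residuals (\<open>interpolation_error\<close>). The
  difficulty is the boundary: \<open>\<psi>\<close> vanishes at the downstream end of the interval, because
  characteristics leave the domain there, but not at the upstream end, whereas all discrete
  functions vanish at both ends. Near the upstream end one uses instead that exact data and source
  vanish there, since \<open>K\<close> has a positive distance \<open>d\<close> from the boundary. With a cutoff \<open>\<eta>\<close> that
  vanishes at the upstream end, \<open>\<eta> \<psi>\<close> is interpolated, and for \<open>(1 - \<eta>) \<psi>\<close> one integrates by parts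
  back onto the discrete solution \<open>U\<close>. What remains is to show that \<open>U\<close> itself is small near the
  upstream end, namely bounded by \<open>h\<close> times the residuals (\<open>upstream_mass\<close>).

  This is an energy estimate for \<open>U\<close>, localized by the test function that equals \<open>U\<close> upstream of a
  node \<open>p\<close> and decays linearly to zero between \<open>p\<close> and a node \<open>q\<close> at distance between \<open>h\<close> and \<open>2
  h\<close>. The energy controls the mass at \<open>p\<close>, and the ramp contributes terms that are either
  residuals or are absorbed by the mass. Only inverse inequalities in time enter, because elements
  may be arbitrarily small compared with \<open>h\<close> (\<open>mass_at_node\<close>, \<open>upstream_estimate\<close>). If \<open>h\<close> is not
  small compared with \<open>d\<close>, then \<open>1 / h\<close> is bounded and nothing has to be gained (\<open>plain_error\<close>).
  All constants depend only on \<open>T\<close>, \<open>\<delta>0\<close>, \<open>k\<close> and \<open>d\<close>.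
\<close>

section \<open>Inverse inequalities for polynomials\<close>

definition tpoly :: "nat \<Rightarrow> (nat \<Rightarrow> real) \<Rightarrow> real \<Rightarrow> real" where
  "tpoly k c t = (\<Sum>i\<le>k. c i * t ^ i)"

definition tpoly' :: "nat \<Rightarrow> (nat \<Rightarrow> real) \<Rightarrow> real \<Rightarrow> real" where
  "tpoly' k c t = (\<Sum>i\<le>k. c i * (real i * t ^ (i - 1)))"

lemma tpoly_has_derivative [derivative_intros]:
  "(tpoly k c has_real_derivative tpoly' k c t) (at t within S)"
  unfolding tpoly_def [abs_def] tpoly'_def
  by (auto intro!: derivative_eq_intros sum.cong)

lemma continuous_on_tpoly [continuous_intros]:
  "continuous_on S f \<Longrightarrow> continuous_on S (\<lambda>x. tpoly k c (f x))"
  unfolding tpoly_def by (intro continuous_intros)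

lemma continuous_on_tpoly' [continuous_intros]:
  "continuous_on S f \<Longrightarrow> continuous_on S (\<lambda>x. tpoly' k c (f x))"
  unfolding tpoly'_def by (intro continuous_intros)

lemma tpoly_Suc: "tpoly (Suc k) c t = tpoly k c t + c (Suc k) * t ^ Suc k"
  by (simp add: tpoly_def)

lemma integral_affine_real:
  fixes f :: "real \<Rightarrow> real"
  assumes "0 < m" and "continuous_on {a..b} f" and "a \<le> b"
  shows "integral {a..b} f = m * integral {(a - c) / m..(b - c) / m} (\<lambda>s. f (c + m * s))"
proof -
  have "((\<lambda>s. m *\<^sub>R f (c + m * s)) has_integral integral {c + m * ((a - c) / m)..c + m * ((b - c) / m)} f
      - integral {c + m * ((b - c) / m)..c + m * ((a - c) / m)} f) {(a - c) / m..(b - c) / m}"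
    by (rule has_integral_substitution_general[of "{}" _ _ _ a b])
       (use assms in \<open>auto intro!: continuous_intros derivative_eq_intros divide_right_mono simp: field_simps\<close>)
  moreover have "integral {b..a} f = 0" using assms(3) by (cases "a = b") auto
  ultimately show ?thesis
    using assms by (auto dest!: integral_unique)
qed

text \<open>
  A quantitative form of the equivalence of norms on polynomials, by induction on the degree:
  \<open>P(s) - E P(s / 2)\<close> has no leading term if \<open>E = 2^(k + 1)\<close>, while the lower coefficients do not
  become smaller.
\<close>

lemma coeffs_le_integral:
  "\<exists>C>0. \<forall>c. (\<Sum>i\<le>k. (c i)\<^sup>2) \<le> C * integral {0..1} (\<lambda>s. (tpoly k c s)\<^sup>2)"
proof (induction k)
  case 0
  show ?case by (rule exI[of _ 1]) (simp add: tpoly_def)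
next
  case (Suc k)
  then obtain C where C: "C > 0" "\<And>c. (\<Sum>i\<le>k. (c i)\<^sup>2) \<le> C * integral {0..1} (\<lambda>s. (tpoly k c s)\<^sup>2)"
    by blast
  define E where "E = (2::real) ^ Suc k"
  define D where "D = C * (2 + 4 * E\<^sup>2)"
  define F where "F = (2 * real k + 3) * (2 + 2 * (real k + 1) * D)"
  have "E > 0" by (simp add: E_def)
  then have "D > 0" using C by (simp add: D_def add_pos_nonneg)
  moreover have "2 + 2 * (real k + 1) * D > 0" using \<open>D > 0\<close> by (intro add_pos_nonneg) auto
  ultimately have "F > 0" unfolding F_def by (intro mult_pos_pos) auto
  show ?case
  proof (intro exI[of _ "D + F"] conjI allI)
    show "D + F > 0" using \<open>D > 0\<close> \<open>F > 0\<close> by simp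
    fix c :: "nat \<Rightarrow> real"
    define P where "P = tpoly (Suc k) c"
    \<comment> \<open>The choice of \<open>E\<close> makes the coefficient of order \<open>k + 1\<close> vanish.\<close>
    define c' where "c' i = c i * (1 - E / 2 ^ i)" for i
    define N where "N = integral {0..1} (\<lambda>s. (P s)\<^sup>2)"
    have cP: "continuous_on S P" for S unfolding P_def by (intro continuous_intros)
    have N0: "N \<ge> 0" unfolding N_def by (intro integral_nonneg integrable_continuous_real continuous_intros cP) auto
    have c': "tpoly k c' s = P s - E * P (s / 2)" for s
    proof -
      have "P s - E * P (s / 2) = (\<Sum>i\<le>Suc k. c i * s ^ i - E * (c i * (s / 2) ^ i))"
        by (simp add: P_def tpoly_def sum_subtractf sum_distrib_left algebra_simps)
      also have "\<dots> = (\<Sum>i\<le>Suc k. c' i * s ^ i)"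
        by (intro sum.cong refl) (simp add: c'_def power_divide field_simps)
      also have "\<dots> = tpoly k c' s" by (simp add: tpoly_def c'_def E_def)
      finally show ?thesis by simp
    qed
    \<comment> \<open>Stretching by two costs at most a factor two in the square integral.\<close>
    have half: "integral {0..1} (\<lambda>s. (P (s / 2))\<^sup>2) \<le> 2 * N"
    proof -
      have "integral {0..1/2} (\<lambda>s. (P s)\<^sup>2) = (1/2) * integral {0..1} (\<lambda>s. (P (s / 2))\<^sup>2)"
        using integral_affine_real[of "1/2" 0 "1/2" "\<lambda>s. (P s)\<^sup>2" 0] cP
        by (simp add: continuous_intros)
      moreover have "integral {0..1/2} (\<lambda>s. (P s)\<^sup>2) \<le> N"
        unfolding N_def by (intro integral_subset_le integrable_continuous_real continuous_intros cP) auto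
      ultimately show ?thesis by simp
    qed
    have "integral {0..1} (\<lambda>s. (tpoly k c' s)\<^sup>2) \<le> integral {0..1} (\<lambda>s. 2 * (P s)\<^sup>2 + 2 * E\<^sup>2 * (P (s / 2))\<^sup>2)"
    proof (intro integral_le integrable_continuous_real continuous_intros cP continuous_on_compose2[OF cP])
      fix s show "(tpoly k c' s)\<^sup>2 \<le> 2 * (P s)\<^sup>2 + 2 * E\<^sup>2 * (P (s / 2))\<^sup>2"
        using sum_squares_bound[of "P s" "- E * P (s / 2)"]
        by (simp add: c' power2_eq_square algebra_simps)
    qed auto
    also have "\<dots> = 2 * N + 2 * E\<^sup>2 * integral {0..1} (\<lambda>s. (P (s / 2))\<^sup>2)"
      unfolding N_def
      by (subst integral_add) (auto intro!: integrable_continuous_real continuous_intros cP continuous_on_compose2[OF cP])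
    also have "\<dots> \<le> 2 * N + 2 * E\<^sup>2 * (2 * N)"
      using half by (intro add_left_mono mult_left_mono) auto
    finally have "C * integral {0..1} (\<lambda>s. (tpoly k c' s)\<^sup>2) \<le> C * (2 * N + 2 * E\<^sup>2 * (2 * N))"
      using C(1) by simp
    then have "(\<Sum>i\<le>k. (c' i)\<^sup>2) \<le> D * N" using C(2)[of c'] by (simp add: D_def algebra_simps)
    moreover have "(\<Sum>i\<le>k. (c i)\<^sup>2) \<le> (\<Sum>i\<le>k. (c' i)\<^sup>2)"
    proof (intro sum_mono)
      fix i assume "i \<in> {..k}"
      then have "(2::real) * 2 ^ i \<le> E" unfolding E_def power_Suc[symmetric] by (intro power_increasing) auto
      then have "2 \<le> E / 2 ^ i" by (simp add: field_simps)
      then have "1 \<le> (1 - E / 2 ^ i)\<^sup>2"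
        by (metis abs_le_square_iff abs_minus_commute abs_one abs_of_nonneg diff_ge_0_iff_ge add_le_imp_le_diff one_add_one one_power2 order_trans one_le_numeral)
      then show "(c i)\<^sup>2 \<le> (c' i)\<^sup>2" by (simp add: c'_def power_mult_distrib mult_le_cancel_left1)
    qed
    ultimately have low: "(\<Sum>i\<le>k. (c i)\<^sup>2) \<le> D * N" by simp
    \<comment> \<open>The leading monomial is \<open>P\<close> minus the part of lower order, which is already controlled.\<close>
    have "(c (Suc k))\<^sup>2 / (2 * real k + 3) = integral {0..1} (\<lambda>s. (c (Suc k))\<^sup>2 * s ^ (2 * k + 2))"
    proof -
      have "integral {0..1::real} (\<lambda>s. s ^ n) = 1 / (real n + 1)" for n
      proof -
        have "((\<lambda>s. s ^ n) has_integral 1 ^ Suc n / real (Suc n) - 0 ^ Suc n / real (Suc n)) {0..1::real}"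
        proof (rule fundamental_theorem_of_calculus)
          show "((\<lambda>s. s ^ Suc n / real (Suc n)) has_vector_derivative x ^ n) (at x within {0..1})" for x :: real
            using DERIV_cdivide[OF DERIV_pow[of "Suc n" x "{0..1}"], of "real (Suc n)"]
            by (simp add: has_real_derivative_iff_has_vector_derivative[symmetric] del: power_Suc)
        qed simp
        then show ?thesis by (simp add: integral_unique add.commute)
      qed
      from this[of "2 * k + 2"] have "integral {0..1::real} (\<lambda>s. s ^ (2 * k + 2)) = 1 / (2 * real k + 3)"
        by (simp add: algebra_simps)
      then show ?thesis by simp
    qed
    also have "\<dots> \<le> integral {0..1} (\<lambda>s. 2 * (P s)\<^sup>2 + 2 * ((real k + 1) * (D * N)))"
    proof (intro integral_le integrable_continuous_real continuous_intros cP)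
      fix s :: real assume s: "s \<in> {0..1}"
      have "(tpoly k c s)\<^sup>2 \<le> (\<Sum>i\<le>k. \<bar>c i\<bar>)\<^sup>2"
      proof (rule power2_le_iff_abs_le[THEN iffD2])
        have "\<bar>tpoly k c s\<bar> \<le> (\<Sum>i\<le>k. \<bar>c i * s ^ i\<bar>)" unfolding tpoly_def by (rule sum_abs)
        also have "\<dots> \<le> (\<Sum>i\<le>k. \<bar>c i\<bar>)"
          using s by (intro sum_mono) (auto simp: abs_mult power_abs intro!: mult_left_le power_le_one)
        finally show "\<bar>tpoly k c s\<bar> \<le> (\<Sum>i\<le>k. \<bar>c i\<bar>)" .
      qed (auto intro: sum_nonneg)
      also have "\<dots> \<le> (real k + 1) * (\<Sum>i\<le>k. (c i)\<^sup>2)"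
        using sum_squared_le_sum_of_squares[of "\<lambda>i. \<bar>c i\<bar>" "{..k}"] by (simp add: algebra_simps)
      also have "\<dots> \<le> (real k + 1) * (D * N)" using low by (intro mult_left_mono) auto
      finally have 1: "(tpoly k c s)\<^sup>2 \<le> (real k + 1) * (D * N)" .
      have "(c (Suc k))\<^sup>2 * s ^ (2 * k + 2) = (P s - tpoly k c s)\<^sup>2"
        by (simp add: P_def tpoly_Suc power_mult_distrib power_mult[symmetric] algebra_simps power2_eq_square power_add[symmetric] mult_2_right)
      also have "\<dots> \<le> 2 * (P s)\<^sup>2 + 2 * (tpoly k c s)\<^sup>2"
        using sum_squares_bound[of "P s" "- tpoly k c s"] by (simp add: power2_eq_square algebra_simps)
      finally show "(c (Suc k))\<^sup>2 * s ^ (2 * k + 2) \<le> 2 * (P s)\<^sup>2 + 2 * ((real k + 1) * (D * N))"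
        using 1 by simp
    qed
    also have "\<dots> = 2 * N + 2 * ((real k + 1) * (D * N))"
      unfolding N_def
      by (subst integral_add) (auto intro!: integrable_continuous_real continuous_intros cP)
    finally have "(c (Suc k))\<^sup>2 \<le> F * N" by (simp add: F_def field_simps)
    then have "(\<Sum>i\<le>Suc k. (c i)\<^sup>2) \<le> (D + F) * N" using low by (simp add: algebra_simps)
    then show "(\<Sum>i\<le>Suc k. (c i)\<^sup>2) \<le> (D + F) * integral {0..1} (\<lambda>s. (tpoly (Suc k) c s)\<^sup>2)"
      by (simp add: N_def P_def)
  qed
qed

lemma tpoly_affine: "\<exists>c'. \<forall>s. tpoly k c (t + h * s) = tpoly k c' s"
proof -
  have ex: "\<exists>c'. \<forall>s. tpoly k c (t + h * s) = tpoly n c' s" if "k \<le> n" for n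
    using that
  proof (induction k)
    case 0
    have "tpoly 0 c (t + h * s) = tpoly n (\<lambda>i. if i = 0 then c 0 else 0) s" for s
      by (simp add: tpoly_def if_distrib[of "\<lambda>x. x * _"] sum.delta cong: if_cong)
    then show ?case by blast
  next
    case (Suc k)
    then obtain c' where c': "\<And>s. tpoly k c (t + h * s) = tpoly n c' s" by auto
    define b where "b i = c (Suc k) * (real (Suc k choose i) * h ^ i * t ^ (Suc k - i))" for i
    have "c (Suc k) * (t + h * s) ^ Suc k = tpoly n b s" for s
    proof -
      have "c (Suc k) * (t + h * s) ^ Suc k = (\<Sum>i\<le>Suc k. b i * s ^ i)"
        using binomial_ring[of "h * s" t "Suc k"]
        by (simp add: b_def sum_distrib_left add.commute power_mult_distrib mult_ac del: power_Suc sum.atMost_Suc binomial_Suc_Suc)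
      also have "\<dots> = (\<Sum>i\<le>n. b i * s ^ i)"
        using Suc.prems by (intro sum.mono_neutral_left) (auto simp: b_def binomial_eq_0)
      finally show ?thesis by (simp add: tpoly_def)
    qed
    then have "tpoly (Suc k) c (t + h * s) = tpoly n (\<lambda>i. c' i + b i) s" for s
      by (simp add: tpoly_Suc c' del: power_Suc) (simp add: tpoly_def sum.distrib algebra_simps)
    then show ?case by blast
  qed
  then show ?thesis by blast
qed

text \<open>
  On a time interval of length \<open>h\<close> a polynomial controls its initial value and, up to a factor \<open>1
  / h\<close>, its derivative. Both follow by scaling to the unit interval. The constant depends only on
  the degree.
\<close>

lemma inverse_inequality:
  "\<exists>C\<ge>1. \<forall>c t h. 0 < h \<longrightarrow>
     (tpoly k c t)\<^sup>2 \<le> C / h * integral {t..t + h} (\<lambda>s. (tpoly k c s)\<^sup>2) \<and>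
     integral {t..t + h} (\<lambda>s. (tpoly' k c s)\<^sup>2) \<le> C / h\<^sup>2 * integral {t..t + h} (\<lambda>s. (tpoly k c s)\<^sup>2)"
proof -
  obtain C where C: "C > 0" "\<And>c. (\<Sum>i\<le>k. (c i)\<^sup>2) \<le> C * integral {0..1} (\<lambda>s. (tpoly k c s)\<^sup>2)"
    using coeffs_le_integral by blast
  define D where "D = C * (real (Suc k))^3 + 1"
  have CD: "C * (real (Suc k))^3 \<le> D" by (simp add: D_def)
  have "C * 1 \<le> C * (real (Suc k))^3" using C(1) by (intro mult_left_mono one_le_power) auto
  then have CD1: "C \<le> D" by (simp add: D_def)
  show ?thesis
  proof (intro exI[of _ D] conjI allI impI)
    show "1 \<le> D" using C(1) by (simp add: D_def)
    fix c :: "nat \<Rightarrow> real" and t h :: real assume h: "0 < h"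
    obtain c' where c': "\<And>s. tpoly k c (t + h * s) = tpoly k c' s" using tpoly_affine by blast
    have d': "h * tpoly' k c (t + h * s) = tpoly' k c' s" for s
    proof -
      have "((\<lambda>s. tpoly k c (t + h * s)) has_real_derivative tpoly' k c (t + h * s) * h) (at s)"
        by (rule DERIV_chain'[OF _ tpoly_has_derivative]) (auto intro!: derivative_eq_intros)
      moreover have "((\<lambda>s. tpoly k c (t + h * s)) has_real_derivative tpoly' k c' s) (at s)"
        unfolding c' by (rule tpoly_has_derivative)
      ultimately show ?thesis by (metis DERIV_unique mult.commute)
    qed
    define I where "I = integral {0..1} (\<lambda>s. (tpoly k c' s)\<^sup>2)"
    have I0: "I \<ge> 0" unfolding I_def by (intro integral_nonneg integrable_continuous_real continuous_intros) auto
    have sc: "integral {t..t+h} f = h * integral {0..1} (\<lambda>s. f (t + h * s))"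
      if "continuous_on {t..t+h} f" for f :: "real \<Rightarrow> real"
      using integral_affine_real[of h t "t+h" f t] that h by simp
    have I: "integral {t..t + h} (\<lambda>s. (tpoly k c s)\<^sup>2) = h * I"
      by (subst sc) (auto intro!: continuous_intros simp: c' I_def)
    have "(tpoly k c t)\<^sup>2 = (c' 0)\<^sup>2"
    proof -
      have "tpoly k c' 0 = c' 0" by (simp add: tpoly_def power_0_left if_distrib sum.delta cong: if_cong)
      then show ?thesis using c'[of 0] by simp
    qed
    also have "\<dots> \<le> (\<Sum>i\<le>k. (c' i)\<^sup>2)" by (rule member_le_sum) auto
    also have "\<dots> \<le> D * I" using C(2)[of c'] CD1 I0 mult_right_mono[OF CD1 I0] by (simp add: I_def)
    finally show "(tpoly k c t)\<^sup>2 \<le> D / h * integral {t..t + h} (\<lambda>s. (tpoly k c s)\<^sup>2)"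
      using h by (simp add: I)
    have bnd: "(tpoly' k c' s)\<^sup>2 \<le> D * I" if s: "s \<in> {0..1}" for s
    proof -
      have "(tpoly' k c' s)\<^sup>2 \<le> real (Suc k) * (\<Sum>i\<le>k. (c' i * (real i * s ^ (i - 1)))\<^sup>2)"
        unfolding tpoly'_def
        using sum_squared_le_sum_of_squares[of "\<lambda>i. c' i * (real i * s ^ (i - 1))" "{..k}"]
        by (simp add: algebra_simps)
      also have "\<dots> \<le> real (Suc k) * (\<Sum>i\<le>k. (c' i)\<^sup>2 * (real (Suc k))\<^sup>2)"
      proof (intro mult_left_mono sum_mono)
        fix i assume i: "i \<in> {..k}"
        have "(real i * s ^ (i - 1))\<^sup>2 \<le> (real (Suc k))\<^sup>2"
          using i s mult_mono[of "real i" "real (Suc k)" "s ^ (i - 1)" 1]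
          by (intro power_mono) (auto intro!: power_le_one)
        then show "(c' i * (real i * s ^ (i - 1)))\<^sup>2 \<le> (c' i)\<^sup>2 * (real (Suc k))\<^sup>2"
          unfolding power_mult_distrib[of "c' i"] by (intro mult_left_mono) auto
      qed auto
      also have "\<dots> = (real (Suc k))^3 * (\<Sum>i\<le>k. (c' i)\<^sup>2)"
        by (simp add: sum_distrib_right[symmetric] power3_eq_cube power2_eq_square)
      also have "\<dots> \<le> (real (Suc k))^3 * (C * I)"
        using C(2)[of c'] by (intro mult_left_mono) (auto simp: I_def)
      also have "\<dots> \<le> D * I" using mult_right_mono[OF CD I0] by (simp add: mult_ac)
      finally show ?thesis .
    qed
    have "integral {t..t + h} (\<lambda>s. (tpoly' k c s)\<^sup>2) = h * integral {0..1} (\<lambda>s. (tpoly' k c' s)\<^sup>2 / h\<^sup>2)"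
      by (subst sc) (use h in \<open>auto intro!: continuous_intros simp: d'[symmetric] power_mult_distrib\<close>)
    also have "\<dots> \<le> h * integral {0..1::real} (\<lambda>s. D * I / h\<^sup>2)"
      using h bnd by (intro mult_left_mono integral_le integrable_continuous_real continuous_intros divide_right_mono) auto
    finally show "integral {t..t + h} (\<lambda>s. (tpoly' k c s)\<^sup>2) \<le> D / h\<^sup>2 * integral {t..t + h} (\<lambda>s. (tpoly k c s)\<^sup>2)"
      using h by (simp add: I mult.left_commute)
  qed
qed

section \<open>Integrals over rectangles\<close>

lemma bounded_set_integrable:
  fixes f :: "'a::euclidean_space \<Rightarrow> real"
  assumes "f \<in> borel_measurable borel" "S \<in> sets borel" "bounded S" "\<And>x. x \<in> S \<Longrightarrow> \<bar>f x\<bar> \<le> B"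
  shows "set_integrable lborel S f"
  unfolding set_integrable_def
proof (rule integrableI_bounded_set_indicator[where B = B])
  show "emeasure lborel S < \<infinity>" using assms(3) by (rule emeasure_bounded_finite)
qed (use assms in auto)

lemma continuous_on_imp_integrable_lborel:
  fixes f :: "'a::euclidean_space \<Rightarrow> real"
  assumes "continuous_on UNIV f" "compact S"
  shows "set_integrable lborel S f"
  unfolding set_integrable_def
  by (rule borel_integrable_compact[OF assms(2)]) (use assms(1) continuous_on_subset in auto)

text \<open>
  A bounded function on a rectangle has iterated integrals in both orders. They are stated for the
  gauge integral on intervals, where the fundamental theorem of calculus is available.
\<close>

lemma rectangle_integral:
  fixes F :: "real \<Rightarrow> real \<Rightarrow> real"
  assumes F: "(\<lambda>z. F (fst z) (snd z)) \<in> borel_measurable borel"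
    and B: "\<And>t x. t \<in> {c..d} \<Longrightarrow> x \<in> {a..b} \<Longrightarrow> \<bar>F t x\<bar> \<le> B"
  defines "J \<equiv> (LINT z:{c..d} \<times> {a..b}|lborel. F (fst z) (snd z))"
  shows "set_integrable lborel ({c..d} \<times> {a..b}) (\<lambda>z. F (fst z) (snd z))"
    and "((\<lambda>x. integral {c..d} (\<lambda>t. F t x)) has_integral J) {a..b}"
    and "((\<lambda>t. integral {a..b} (F t)) has_integral J) {c..d}"
    and "x \<in> {a..b} \<Longrightarrow> (\<lambda>t. F t x) integrable_on {c..d}"
    and "t \<in> {c..d} \<Longrightarrow> F t integrable_on {a..b}"
proof -
  have F1 [measurable]: "(\<lambda>t. F t x) \<in> borel_measurable borel" for x
    using measurable_compose[OF _ F, of "\<lambda>t. (t, x)" borel] by simp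
  have F2 [measurable]: "F t \<in> borel_measurable borel" for t
    using measurable_compose[OF _ F, of "\<lambda>x. (t, x)" borel] by simp
  have i1: "set_integrable lborel {c..d} (\<lambda>t. F t x)" if "x \<in> {a..b}" for x
    by (rule bounded_set_integrable) (use B that in auto)
  have i2: "set_integrable lborel {a..b} (F t)" if "t \<in> {c..d}" for t
    by (rule bounded_set_integrable) (use B that in auto)
  show I: "set_integrable lborel ({c..d} \<times> {a..b}) (\<lambda>z. F (fst z) (snd z))"
    by (rule bounded_set_integrable[OF F, where B = B]) (use B in \<open>auto intro: bounded_Times borel_closed closed_Times\<close>)
  define G where "G t x = indicator {c..d} t * (indicator {a..b} x * F t x)" for t x
  have G: "integrable (lborel \<Otimes>\<^sub>M lborel) (\<lambda>(t, x). G t x)"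
    using I by (simp add: set_integrable_def lborel_prod G_def case_prod_unfold indicator_times mult.assoc)
  have J: "J = integral\<^sup>L (lborel \<Otimes>\<^sub>M lborel) (\<lambda>(t, x). G t x)"
    by (simp add: J_def set_lebesgue_integral_def lborel_prod G_def case_prod_unfold indicator_times mult.assoc)
  have G1: "(LINT t|lborel. G t x) = indicator {a..b} x * integral {c..d} (\<lambda>t. F t x)" for x
  proof (cases "x \<in> {a..b}")
    case True
    then show ?thesis
      using set_borel_integral_eq_integral(2)[OF i1[OF True]] by (simp add: G_def set_lebesgue_integral_def)
  qed (simp add: G_def)
  have G2: "(LINT x|lborel. G t x) = indicator {c..d} t * integral {a..b} (F t)" for t
  proof (cases "t \<in> {c..d}")
    case True
    then show ?thesis
      using set_borel_integral_eq_integral(2)[OF i2[OF True]] by (simp add: G_def set_lebesgue_integral_def)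
  qed (simp add: G_def)
  have "integrable lborel (\<lambda>x. LINT t|lborel. G t x)" "(LINT x|lborel. LINT t|lborel. G t x) = J"
    using lborel_pair.integrable_snd[OF G] lborel_pair.integral_snd[OF G] by (simp_all add: J)
  then have "set_integrable lborel {a..b} (\<lambda>x. integral {c..d} (\<lambda>t. F t x))"
    "(LINT x:{a..b}|lborel. integral {c..d} (\<lambda>t. F t x)) = J"
    by (simp_all add: G1 set_integrable_def set_lebesgue_integral_def)
  then show "((\<lambda>x. integral {c..d} (\<lambda>t. F t x)) has_integral J) {a..b}"
    using set_borel_integral_eq_integral by (metis has_integral_iff)
  have "integrable lborel (\<lambda>t. LINT x|lborel. G t x)" "(LINT t|lborel. LINT x|lborel. G t x) = J"
    using lborel_pair.integrable_fst[OF G] lborel_pair.integral_fst[OF G] by (simp_all add: J)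
  then have "set_integrable lborel {c..d} (\<lambda>t. integral {a..b} (F t))"
    "(LINT t:{c..d}|lborel. integral {a..b} (F t)) = J"
    by (simp_all add: G2 set_integrable_def set_lebesgue_integral_def)
  then show "((\<lambda>t. integral {a..b} (F t)) has_integral J) {c..d}"
    using set_borel_integral_eq_integral by (metis has_integral_iff)
  show "x \<in> {a..b} \<Longrightarrow> (\<lambda>t. F t x) integrable_on {c..d}" by (rule set_borel_integral_eq_integral(1)[OF i1])
  show "t \<in> {c..d} \<Longrightarrow> F t integrable_on {a..b}" by (rule set_borel_integral_eq_integral(1)[OF i2])
qed

lemma square_integral_le:
  fixes f :: "real \<Rightarrow> real"
  assumes f: "continuous_on {c..d} f" and "c \<le> d"
  shows "(integral {c..d} f)\<^sup>2 \<le> (d - c) * integral {c..d} (\<lambda>x. (f x)\<^sup>2)"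
    and "integral {c..d} (\<lambda>x. (f x - integral {c..d} f / (d - c))\<^sup>2) \<le> integral {c..d} (\<lambda>x. (f x)\<^sup>2)"
proof -
  define \<mu> where "\<mu> = integral {c..d} f / (d - c)"
  define I where "I = integral {c..d} (\<lambda>x. (f x)\<^sup>2)"
  have \<mu>: "integral {c..d} f = \<mu> * (d - c)" using \<open>c \<le> d\<close> by (cases "c = d") (auto simp: \<mu>_def)
  have "integral {c..d} (\<lambda>x. (f x - \<mu>)\<^sup>2) = integral {c..d} (\<lambda>x. (f x)\<^sup>2 - 2 * \<mu> * f x + \<mu>\<^sup>2)"
    by (intro integral_cong) (simp add: power2_eq_square algebra_simps)
  also have "\<dots> = I - 2 * \<mu> * integral {c..d} f + \<mu>\<^sup>2 * (d - c)"
    unfolding I_def using \<open>c \<le> d\<close>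
    by (subst integral_add; (subst integral_diff)?)
       (auto intro!: integrable_continuous_real continuous_intros f)
  finally have *: "integral {c..d} (\<lambda>x. (f x - \<mu>)\<^sup>2) = I - \<mu>\<^sup>2 * (d - c)"
    by (simp add: \<mu> power2_eq_square)
  have "0 \<le> integral {c..d} (\<lambda>x. (f x - \<mu>)\<^sup>2)"
    by (intro integral_nonneg integrable_continuous_real continuous_intros f) auto
  then have "\<mu>\<^sup>2 * (d - c) \<le> I" using * by simp
  then have "(d - c) * (\<mu>\<^sup>2 * (d - c)) \<le> (d - c) * I" using \<open>c \<le> d\<close> by (intro mult_left_mono) auto
  then show "(integral {c..d} f)\<^sup>2 \<le> (d - c) * integral {c..d} (\<lambda>x. (f x)\<^sup>2)"
    by (simp add: \<mu> I_def power2_eq_square mult_ac)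
  show "integral {c..d} (\<lambda>x. (f x - integral {c..d} f / (d - c))\<^sup>2) \<le> integral {c..d} (\<lambda>x. (f x)\<^sup>2)"
    using * \<open>c \<le> d\<close> by (simp add: \<mu>_def[symmetric] I_def)
qed

lemma young:
  fixes x y \<epsilon> :: real
  assumes "0 < \<epsilon>"
  shows "2 * (x * y) \<le> \<epsilon> * x\<^sup>2 + y\<^sup>2 / \<epsilon>"
proof -
  have "0 \<le> (sqrt \<epsilon> * x - y / sqrt \<epsilon>)\<^sup>2" by simp
  also have "\<dots> = \<epsilon> * x\<^sup>2 + y\<^sup>2 / \<epsilon> - 2 * (x * y)"
    using assms by (simp add: power2_diff power_mult_distrib power_divide)
  finally show ?thesis by simp
qed

text \<open>
  Estimates are kept in the additive form that Young's inequality yields, with a free \<open>\<epsilon>\<close>. This is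
  the final step back to a product of norms.
\<close>

lemma le_sqrt_of_young:
  fixes E X Y :: real
  assumes "\<And>\<epsilon>. 0 < \<epsilon> \<Longrightarrow> 2 * E \<le> \<epsilon> * X + Y / \<epsilon>" and "0 \<le> X" "0 \<le> Y"
  shows "E \<le> sqrt X * sqrt Y"
proof (cases "X = 0 \<or> Y = 0")
  case True
  have "E \<le> \<epsilon>" if "\<epsilon> > 0" for \<epsilon> :: real
  proof (cases "X = 0")
    case True
    have "Y / ((Y + 1) / \<epsilon>) \<le> \<epsilon>" using assms(3) that by (simp add: field_simps)
    then show ?thesis using assms(1)[of "(Y + 1) / \<epsilon>"] True assms(3) that by (simp add: divide_pos_pos)
  next
    case False
    then show ?thesis using \<open>X = 0 \<or> Y = 0\<close> assms(1)[of "\<epsilon> / X"] assms(2) that by (simp add: divide_pos_pos)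
  qed
  then have "E \<le> 0" by (rule field_le_epsilon[of E 0, simplified])
  then show ?thesis using True by auto
next
  case False
  define x y where "x = sqrt X" and "y = sqrt Y"
  have xy: "x > 0" "y > 0" "X = x\<^sup>2" "Y = y\<^sup>2" using False assms(2,3) by (auto simp: x_def y_def)
  have "2 * E \<le> y / x * x\<^sup>2 + y\<^sup>2 / (y / x)"
    using assms(1)[of "y / x"] xy by (simp add: divide_pos_pos)
  also have "\<dots> = 2 * (x * y)" using xy by (simp add: power2_eq_square)
  finally show ?thesis by (simp add: x_def y_def)
qed

section \<open>Smooth cutoffs\<close>

definition deriv_chain :: "(nat \<Rightarrow> real \<Rightarrow> real) \<Rightarrow> bool" where
  "deriv_chain D \<longleftrightarrow> (\<forall>n x. (D n has_real_derivative D (Suc n) x) (at x))"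

text \<open>
  The derivative of order \<open>n\<close> of the product of the derivatives of orders \<open>p\<close> and \<open>q\<close>. Unfolding
  the product rule one derivative at a time avoids binomial coefficients.
\<close>

fun leibniz :: "(nat \<Rightarrow> real) \<Rightarrow> (nat \<Rightarrow> real) \<Rightarrow> nat \<Rightarrow> nat \<Rightarrow> nat \<Rightarrow> real" where
  "leibniz f g 0 p q = f p * g q"
| "leibniz f g (Suc n) p q = leibniz f g n (Suc p) q + leibniz f g n p (Suc q)"

lemma leibniz_has_derivative:
  assumes "\<And>p. ((\<lambda>x. f p x) has_real_derivative f (Suc p) x) (at x)"
    and "\<And>q. ((\<lambda>x. g q x) has_real_derivative g (Suc q) x) (at x)"
  shows "((\<lambda>x. leibniz (\<lambda>p. f p x) (\<lambda>q. g q x) n p q) has_real_derivative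
     leibniz (\<lambda>p. f p x) (\<lambda>q. g q x) (Suc n) p q) (at x)"
  by (induction n arbitrary: p q)
     (auto intro!: derivative_eq_intros assms simp: mult.commute add.commute)

lemma leibniz_has_derivative_right:
  assumes "\<And>q. ((\<lambda>t. g q t) has_real_derivative g' q t) (at t)"
  shows "((\<lambda>t. leibniz f (\<lambda>q. g q t) n p q) has_real_derivative leibniz f (\<lambda>q. g' q t) n p q) (at t)"
  by (induction n arbitrary: p q) (auto intro!: derivative_eq_intros assms)

lemma leibniz_continuous:
  assumes "\<And>p. continuous_on S (f p)" and "\<And>q. continuous_on S (g q)"
  shows "continuous_on S (\<lambda>z. leibniz (\<lambda>p. f p z) (\<lambda>q. g q z) n p q)"
  by (induction n arbitrary: p q) (auto intro!: continuous_intros assms)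

lemma deriv_chain_mult:
  assumes "deriv_chain f" and "deriv_chain g"
  shows "deriv_chain (\<lambda>n x. leibniz (\<lambda>p. f p x) (\<lambda>q. g q x) n 0 0)"
  using assms unfolding deriv_chain_def by (blast intro: leibniz_has_derivative)

lemma deriv_chain_affine:
  assumes "deriv_chain f"
  shows "deriv_chain (\<lambda>n x. s ^ n * f n (s * x + c))"
  unfolding deriv_chain_def
proof (intro allI)
  fix n x
  have "((\<lambda>x. f n (s * x + c)) has_real_derivative f (Suc n) (s * x + c) * s) (at x)"
    by (rule DERIV_chain'[of _ s]) (use assms in \<open>auto simp: deriv_chain_def intro!: derivative_eq_intros\<close>)
  from DERIV_cmult[OF this, of "s ^ n"]
  show "((\<lambda>x. s ^ n * f n (s * x + c)) has_real_derivative s ^ Suc n * f (Suc n) (s * x + c)) (at x)"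
    by (simp add: mult_ac)
qed

text \<open>
  The derivatives of \<open>exp (- 1 / x)\<close> are \<open>exp (- 1 / x)\<close> times these polynomials in \<open>1 / x\<close>; the
  factor \<open>monom 1 2\<close> comes from the derivative \<open>- 1 / x^2\<close> of \<open>1 / x\<close>.
\<close>

primrec flat_poly :: "nat \<Rightarrow> real poly" where
  "flat_poly 0 = 1"
| "flat_poly (Suc n) = monom 1 2 * (flat_poly n - pderiv (flat_poly n))"

definition flat :: "nat \<Rightarrow> real \<Rightarrow> real" where
  "flat n x = (if 0 < x then poly (flat_poly n) (1 / x) * exp (- (1 / x)) else 0)"

lemma poly_times_exp_tendsto_0:
  "((\<lambda>z::real. poly p z * exp (- z)) \<longlongrightarrow> 0) at_top"
proof -
  have "((\<lambda>z::real. \<Sum>i\<le>degree p. coeff p i * (z ^ i / exp z)) \<longlongrightarrow> (\<Sum>i\<le>degree p. coeff p i * 0)) at_top"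
    by (intro tendsto_intros tendsto_power_div_exp_0)
  then show ?thesis
    by (simp add: poly_altdef sum_distrib_right exp_minus divide_inverse mult.assoc)
qed

lemma deriv_chain_flat: "deriv_chain flat"
  unfolding deriv_chain_def
proof (intro allI)
  fix n and x :: real
  consider "x < 0" | "x = 0" | "x > 0" by linarith
  then show "(flat n has_real_derivative flat (Suc n) x) (at x)"
  proof cases
    case 1
    have "((\<lambda>_. 0) has_real_derivative 0) (at x)" by simp
    then have "(flat n has_real_derivative 0) (at x)"
      by (rule DERIV_cong_ev[THEN iffD1, rotated -1])
         (use 1 in \<open>auto simp: flat_def eventually_at_topological intro!: eventually_mono[OF order_tendstoD(2)[OF tendsto_ident_at 1]] filterlim_ident
            exI[of _ "{..<0}"] simp: eventually_nhds\<close>)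
    then show ?thesis using 1 by (simp add: flat_def)
  next
    case 3
    have "((\<lambda>x. poly (flat_poly n) (1 / x) * exp (- (1 / x))) has_real_derivative flat (Suc n) x) (at x)"
      using 3 by (auto intro!: derivative_eq_intros poly_DERIV[THEN DERIV_chain2]
          simp: flat_def poly_monom power2_eq_square field_simps)
    then show ?thesis
      by (rule DERIV_cong_ev[THEN iffD1, rotated -1])
         (use 3 in \<open>auto simp: flat_def eventually_nhds intro!: exI[of _ "{0<..}"]\<close>)
  next
    case 2
    have "((\<lambda>y. flat n y / y) \<longlongrightarrow> 0) (at_right 0)"
      unfolding filterlim_at_right_to_top
    proof (rule Lim_transform_eventually[OF poly_times_exp_tendsto_0[of "[:0, 1:] * flat_poly n"]])
      show "\<forall>\<^sub>F z in at_top. poly ([:0, 1:] * flat_poly n) z * exp (- z) = flat n (inverse z) / inverse z"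
        using eventually_gt_at_top[of "0::real"] by eventually_elim (simp add: flat_def divide_inverse)
    qed
    moreover have "((\<lambda>y. flat n y / y) \<longlongrightarrow> 0) (at_left 0)"
      by (rule Lim_transform_eventually[OF tendsto_const])
         (auto simp: flat_def eventually_at_filter)
    ultimately show ?thesis
      using 2 by (simp add: has_field_derivative_iff filterlim_at_split flat_def)
  qed
qed

text \<open>The primitive of a bump between \<open>a\<close> and \<open>b\<close>, normalized.\<close>

lemma smooth_step:
  fixes a b :: real
  assumes "a < b"
  shows "\<exists>D. deriv_chain D \<and> (\<forall>x\<le>a. D 0 x = 0) \<and> (\<forall>x\<ge>b. D 0 x = 1 \<and> D 1 x = 0)"
proof -
  define f where "f n x = leibniz (\<lambda>p. 1 ^ p * flat p (1 * x + - a)) (\<lambda>q. (- 1) ^ q * flat q (- 1 * x + b)) n 0 0" for n x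
  have f: "deriv_chain f"
    unfolding f_def [abs_def] by (intro deriv_chain_mult deriv_chain_affine deriv_chain_flat)
  have f0: "f 0 x = (if a < x \<and> x < b then exp (- (1 / (x - a))) * exp (- (1 / (b - x))) else 0)" for x
    by (simp add: f_def flat_def)
  have "isCont (f 0) x" for x
    using f by (auto simp: deriv_chain_def intro: DERIV_isCont)
  then obtain F where F: "\<And>x. (F has_real_derivative f 0 x) (at x)"
    using einterval_antiderivative[of "-\<infinity>" "\<infinity>" "f 0"]
    by (auto simp: has_real_derivative_iff_has_vector_derivative)
  have const: "F x = F y" if "x \<le> y" "\<And>z. x < z \<Longrightarrow> z < y \<Longrightarrow> f 0 z = 0" for x y
  proof (cases "x = y")
    case False
    then show ?thesis
      by (intro DERIV_isconst_end[of x y F, symmetric])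
         (use that F in \<open>auto intro!: DERIV_continuous_on[of _ F "f 0"] intro: has_field_derivative_at_within DERIV_cong[OF F]\<close>)
  qed simp
  have left: "F x = F a" if "x \<le> a" for x by (rule const) (use that in \<open>auto simp: f0\<close>)
  have right: "F x = F b" if "x \<ge> b" for x by (rule const[symmetric]) (use that in \<open>auto simp: f0\<close>)
  have less: "F a < F b"
  proof (rule DERIV_pos_imp_increasing_open[OF assms])
    show "\<exists>y. (F has_real_derivative y) (at x) \<and> 0 < y" if "a < x" "x < b" for x
      using F[of x] that by (intro exI[of _ "f 0 x"]) (auto simp: f0)
    show "continuous_on {a..b} F"
      using F by (intro DERIV_continuous_on[of _ F "f 0"]) (auto intro: has_field_derivative_at_within)
  qed
  define D where "D n x = (case n of 0 \<Rightarrow> (F x - F a) / (F b - F a) | Suc m \<Rightarrow> f m x / (F b - F a))" for n x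
  have "deriv_chain D"
    unfolding deriv_chain_def
  proof (intro allI)
    fix n x show "(D n has_real_derivative D (Suc n) x) (at x)"
      using F f less by (cases n) (auto simp: D_def [abs_def] deriv_chain_def intro!: derivative_eq_intros)
  qed
  moreover have "D 0 x = 0" if "x \<le> a" for x using left[OF that] by (simp add: D_def)
  moreover have "D 0 x = 1 \<and> D 1 x = 0" if "x \<ge> b" for x
    using right[OF that] that less by (auto simp: D_def f0)
  ultimately show ?thesis by blast
qed

lemma smooth_cutoff:
  fixes a a' b' b :: real
  assumes "a < a'" "b' < b"
  shows "\<exists>D. deriv_chain D \<and> (\<forall>x. x \<notin> {a..b} \<longrightarrow> D 0 x = 0) \<and> (\<forall>x\<in>{a'..b'}. D 0 x = 1 \<and> D 1 x = 0)"
proof -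
  obtain D where D: "deriv_chain D" "\<And>x. x \<le> a \<Longrightarrow> D 0 x = 0" "\<And>x. x \<ge> a' \<Longrightarrow> D 0 x = 1 \<and> D 1 x = 0"
    using smooth_step[OF assms(1)] by blast
  obtain E where E: "deriv_chain E" "\<And>x. x \<le> - b \<Longrightarrow> E 0 x = 0" "\<And>x. x \<ge> - b' \<Longrightarrow> E 0 x = 1 \<and> E 1 x = 0"
    using smooth_step[of "- b" "- b'"] assms(2) by auto
  let ?D = "\<lambda>n x. leibniz (\<lambda>p. D p x) (\<lambda>q. (- 1) ^ q * E q (- 1 * x + 0)) n 0 0"
  show ?thesis
  proof (intro exI[of _ ?D] conjI allI impI ballI)
    show "deriv_chain ?D" by (intro deriv_chain_mult deriv_chain_affine D E)
  qed (use D(2,3) E(2,3) in \<open>auto simp: not_le\<close>)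
qed

section \<open>Smooth functions of time and space\<close>

text \<open>
  A smooth function together with all its partial derivatives. Keeping the derivatives as data
  lets operations such as products and integrals along lines act on all of them at once.
\<close>

definition smooth_family :: "(nat \<Rightarrow> nat \<Rightarrow> real \<Rightarrow> real \<Rightarrow> 'a::real_normed_vector) \<Rightarrow> bool" where
  "smooth_family D \<longleftrightarrow>
     (\<forall>i j. continuous_on UNIV (\<lambda>(t, x). D i j t x)) \<and>
     (\<forall>i j t x.
        ((\<lambda>s. D i j s x) has_vector_derivative D (Suc i) j t x) (at t) \<and>
        ((\<lambda>y. D i j t y) has_vector_derivative D i (Suc j) t x) (at x))"

lemma smooth2_iff: "smooth2 u \<longleftrightarrow> (\<exists>D. smooth_family D \<and> D 0 0 = u)"
  unfolding smooth2_def smooth_family_def by blast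

lemma smooth_family_continuous:
  assumes "smooth_family D" and "continuous_on S f" and "continuous_on S g"
  shows "continuous_on S (\<lambda>z. D i j (f z) (g z))"
proof -
  have "continuous_on UNIV (\<lambda>(t, x). D i j t x)" using assms(1) by (simp add: smooth_family_def)
  from continuous_on_compose2[OF this continuous_on_Pair[OF assms(2,3)]] show ?thesis by auto
qed

lemma smooth_family_deriv:
  assumes "smooth_family D"
  shows "((\<lambda>s. D i j s x) has_vector_derivative D (Suc i) j t x) (at t)"
    and "((\<lambda>y. D i j t y) has_vector_derivative D i (Suc j) t x) (at x)"
  using assms by (auto simp: smooth_family_def)

lemma smooth_family_inner:
  assumes "smooth_family D"
  shows "smooth_family (\<lambda>i j t x. D i j t x \<bullet> d)"
  unfolding smooth_family_def
  using smooth_family_continuous[OF assms continuous_on_fst[OF continuous_on_id] continuous_on_snd[OF continuous_on_id], of UNIV] smooth_family_deriv[OF assms]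
  by (auto simp: case_prod_unfold intro!: continuous_intros
      bounded_linear.has_vector_derivative[OF bounded_linear_inner_left])

lemma smooth_family_scaleR:
  fixes D :: "nat \<Rightarrow> nat \<Rightarrow> real \<Rightarrow> real \<Rightarrow> real"
  assumes "smooth_family D"
  shows "smooth_family (\<lambda>i j t x. D i j t x *\<^sub>R d)"
  unfolding smooth_family_def
  using smooth_family_continuous[OF assms continuous_on_fst[OF continuous_on_id] continuous_on_snd[OF continuous_on_id], of UNIV] smooth_family_deriv[OF assms]
  by (auto simp: case_prod_unfold intro!: continuous_intros
      bounded_linear.has_vector_derivative[OF bounded_linear_scaleR_left])

lemma smooth_family_mult_x:
  assumes "deriv_chain \<theta>" and "smooth_family D"
  shows "smooth_family (\<lambda>i j t x. leibniz (\<lambda>p. \<theta> p x) (\<lambda>q. D i q t x) j 0 0)"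
  unfolding smooth_family_def
proof (intro conjI allI)
  have \<theta>: "continuous_on S (\<theta> p)" for p S
    using assms(1) by (intro DERIV_continuous_on) (auto simp: deriv_chain_def intro: has_field_derivative_at_within)
  show "continuous_on UNIV (\<lambda>(t, x). leibniz (\<lambda>p. \<theta> p x) (\<lambda>q. D i q t x) j 0 0)" for i j
    unfolding case_prod_unfold
    by (intro leibniz_continuous smooth_family_continuous[OF assms(2)] continuous_on_compose2[OF \<theta>] continuous_intros) auto
  show "((\<lambda>s. leibniz (\<lambda>p. \<theta> p x) (\<lambda>q. D i q s x) j 0 0) has_vector_derivative
       leibniz (\<lambda>p. \<theta> p x) (\<lambda>q. D (Suc i) q t x) j 0 0) (at t)" for i j t x
    unfolding has_real_derivative_iff_has_vector_derivative[symmetric]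
    by (rule leibniz_has_derivative_right)
       (use smooth_family_deriv(1)[OF assms(2)] in \<open>simp add: has_real_derivative_iff_has_vector_derivative\<close>)
  show "((\<lambda>y. leibniz (\<lambda>p. \<theta> p y) (\<lambda>q. D i q t y) j 0 0) has_vector_derivative
       leibniz (\<lambda>p. \<theta> p x) (\<lambda>q. D i q t x) (Suc j) 0 0) (at x)" for i j t x
    unfolding has_real_derivative_iff_has_vector_derivative[symmetric]
    by (rule leibniz_has_derivative)
       (use smooth_family_deriv(2)[OF assms(2)] assms(1) in
         \<open>auto simp: has_real_derivative_iff_has_vector_derivative[symmetric] deriv_chain_def\<close>)
qed

section \<open>Integration along characteristics\<close>

text \<open>
  The solution of the transport equation with vanishing data at late times and right-hand side \<open>-
  g\<close>, if \<open>g\<close> vanishes for times after \<open>T\<close>.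
\<close>

definition along :: "real \<Rightarrow> real \<Rightarrow> (real \<Rightarrow> real \<Rightarrow> real) \<Rightarrow> real \<Rightarrow> real \<Rightarrow> real" where
  "along T \<sigma> g t x = integral {0..T} (\<lambda>r. g (t + r) (x + \<sigma> * r))"

text \<open>Differentiation under the integral sign.\<close>

lemma smooth_family_along:
  assumes D: "smooth_family D"
  shows "smooth_family (\<lambda>i j. along T \<sigma> (D i j))"
  unfolding smooth_family_def
proof (intro conjI allI)
  have c: "continuous_on S (\<lambda>z. D i j (f z) (g z))"
    if "continuous_on S f" "continuous_on S g" for S i j and f g :: "'z::topological_space \<Rightarrow> real"
    by (rule smooth_family_continuous[OF D that])
  show "continuous_on UNIV (\<lambda>(t, x). along T \<sigma> (D i j) t x)" for i j
  proof -
    have "continuous_on UNIV (\<lambda>z::real \<times> real. integral (cbox 0 T) (\<lambda>r. D i j (fst z + r) (snd z + \<sigma> * r)))"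
      by (rule integral_continuous_on_param) (auto simp: case_prod_unfold intro!: c continuous_intros)
    then show ?thesis by (simp add: along_def case_prod_unfold)
  qed
  show "((\<lambda>s. along T \<sigma> (D i j) s x) has_vector_derivative along T \<sigma> (D (Suc i) j) t x) (at t)" for i j t x
    unfolding along_def box_real[symmetric]
  proof (rule leibniz_rule_vector_derivative[of UNIV])
    fix s r
    have "((\<lambda>s. D i j s (x + \<sigma> * r)) \<circ> (\<lambda>s. s + r) has_vector_derivative 1 *\<^sub>R D (Suc i) j (s + r) (x + \<sigma> * r)) (at s)"
      by (rule vector_diff_chain_at) (auto intro!: derivative_eq_intros smooth_family_deriv(1)[OF D])
    then show "((\<lambda>s. D i j (s + r) (x + \<sigma> * r)) has_vector_derivative D (Suc i) j (s + r) (x + \<sigma> * r)) (at s)"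
      by (simp add: o_def)
  qed (auto simp: case_prod_unfold intro!: c continuous_intros integrable_continuous_real)
  show "((\<lambda>y. along T \<sigma> (D i j) t y) has_vector_derivative along T \<sigma> (D i (Suc j)) t x) (at x)" for i j t x
    unfolding along_def box_real[symmetric]
  proof (rule leibniz_rule_vector_derivative[of UNIV])
    fix y r
    have "((\<lambda>y. D i j (t + r) y) \<circ> (\<lambda>y. y + \<sigma> * r) has_vector_derivative 1 *\<^sub>R D i (Suc j) (t + r) (y + \<sigma> * r)) (at y)"
      by (rule vector_diff_chain_at) (auto intro!: derivative_eq_intros smooth_family_deriv(2)[OF D])
    then show "((\<lambda>y. D i j (t + r) (y + \<sigma> * r)) has_vector_derivative D i (Suc j) (t + r) (y + \<sigma> * r)) (at y)"
      by (simp add: o_def)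
  qed (auto simp: case_prod_unfold intro!: c continuous_intros integrable_continuous_real)
qed

section \<open>Piecewise polynomials on a mesh\<close>

locale mesh =
  fixes a b h :: real and \<T> :: "real set set" and k :: nat
  assumes ab: "a < b" and h_pos: "0 < h" and k: "1 \<le> k"
    and division: "\<T> division_of {a..b}"
    and interior_ne: "\<And>\<tau>. \<tau> \<in> \<T> \<Longrightarrow> interior \<tau> \<noteq> {}"
    and diameter_le: "\<And>\<tau>. \<tau> \<in> \<T> \<Longrightarrow> diameter \<tau> \<le> h"
begin

definition nodes :: "real set" where
  "nodes = (\<Union>\<tau>\<in>\<T>. {Inf \<tau>, Sup \<tau>})"

lemma finite_\<T>: "finite \<T>" using division by (rule division_of_finite)

lemma finite_nodes: "finite nodes" unfolding nodes_def using finite_\<T> by auto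

lemma elementE:
  assumes "\<tau> \<in> \<T>"
  obtains c d where "\<tau> = {c..d}" "c < d" "d - c \<le> h" "a \<le> c" "d \<le> b" "c \<in> nodes" "d \<in> nodes"
proof -
  obtain c d where cd: "\<tau> = {c..d}" using division_ofD(4)[OF division assms] by auto
  with interior_ne[OF assms] have "c < d" by (auto simp: not_le intro: ccontr)
  moreover have "{c..d} \<subseteq> {a..b}" using division_ofD(2)[OF division assms] cd by simp
  moreover have "d - c \<le> h" using diameter_le[OF assms] cd \<open>c < d\<close> by (simp add: diameter_closed_interval)
  moreover have "c \<in> nodes" "d \<in> nodes" using assms cd \<open>c < d\<close> by (force simp: nodes_def)+
  ultimately show ?thesis using cd by (intro that[of c d]; simp)
qed

lemma cover: "x \<in> {a..b} \<Longrightarrow> \<exists>\<tau>\<in>\<T>. x \<in> \<tau>"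
  using division_ofD(6)[OF division] by blast

text \<open>
  Two elements that share an interior point coincide, so no element contains the end point of
  another one in its interior.
\<close>

lemma node_not_inside:
  assumes "p \<in> nodes" and "{c..d} \<in> \<T>"
  shows "p \<le> c \<or> d \<le> p"
proof (rule ccontr)
  assume "\<not> ?thesis"
  then have p: "c < p" "p < d" by auto
  obtain \<tau> where \<tau>: "\<tau> \<in> \<T>" "p = Inf \<tau> \<or> p = Sup \<tau>" using assms(1) by (auto simp: nodes_def)
  obtain c' d' where cd': "\<tau> = {c'..d'}" "c' < d'" using elementE[OF \<tau>(1)] by metis
  have p': "p = c' \<or> p = d'" using \<tau>(2) cd' by auto
  then have "{c..d} \<noteq> {c'..d'}" using p by auto
  then have "interior {c..d} \<inter> interior {c'..d'} = {}"
    using division_ofD(5)[OF division assms(2) \<tau>(1)] cd' by simp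
  then have *: "\<not> (c < y \<and> y < d \<and> c' < y \<and> y < d')" for y by auto
  show False using p' p cd' *[of "(p + min d d') / 2"] *[of "(p + max c c') / 2"] by (auto simp: min_def max_def split: if_splits)
qed

lemma node_sides:
  assumes "p \<in> nodes" "\<tau> \<in> \<T>"
  shows "(\<forall>x\<in>\<tau>. x \<le> p) \<or> (\<forall>x\<in>\<tau>. p \<le> x)"
  using elementE[OF assms(2)] node_not_inside[OF assms(1)] assms(2)
  by (metis atLeastAtMost_iff order_trans)

lemma nodes_subset: "nodes \<subseteq> {a..b}"
proof
  fix p assume "p \<in> nodes"
  then obtain \<tau> where \<tau>: "\<tau> \<in> \<T>" "p = Inf \<tau> \<or> p = Sup \<tau>" by (auto simp: nodes_def)
  with elementE[OF \<tau>(1)] show "p \<in> {a..b}" by (metis atLeastAtMost_iff cInf_atLeastAtMost cSup_atLeastAtMost less_imp_le order_trans)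
qed

lemma ends_nodes: "a \<in> nodes" "b \<in> nodes"
proof -
  obtain \<tau> where \<tau>: "\<tau> \<in> \<T>" "a \<in> \<tau>" using cover[of a] ab by auto
  show "a \<in> nodes" by (rule elementE[OF \<tau>(1)]) (use \<tau>(2) in \<open>metis atLeastAtMost_iff order_antisym\<close>)
  obtain \<tau> where \<tau>: "\<tau> \<in> \<T>" "b \<in> \<tau>" using cover[of b] ab by auto
  show "b \<in> nodes" by (rule elementE[OF \<tau>(1)]) (use \<tau>(2) in \<open>metis atLeastAtMost_iff order_antisym\<close>)
qed

lemma node_right: "x \<in> {a..b} \<Longrightarrow> \<exists>p\<in>nodes. x \<le> p \<and> p \<le> x + h"
  using cover[of x] elementE by (smt (verit, best) atLeastAtMost_iff)

lemma node_left: "x \<in> {a..b} \<Longrightarrow> \<exists>p\<in>nodes. x - h \<le> p \<and> p \<le> x"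
  using cover[of x] elementE by (smt (verit, best) atLeastAtMost_iff)

lemma off_nodes:
  assumes "x \<in> {a..b} - nodes"
  obtains c d where "{c..d} \<in> \<T>" "x \<in> {c<..<d}"
proof -
  obtain \<tau> where \<tau>: "\<tau> \<in> \<T>" "x \<in> \<tau>" using cover[of x] assms by auto
  show ?thesis
  proof (rule elementE[OF \<tau>(1)])
    fix c d assume *: "\<tau> = {c..d}" "c \<in> nodes" "d \<in> nodes"
    with assms \<tau> have "x \<noteq> c" "x \<noteq> d" by auto
    with * \<tau> show ?thesis by (intro that[of c d]) auto
  qed
qed

text \<open>
  Functions of space that are polynomials on each element and vanish at the ends of the interval.
  Continuity across the nodes is implied because the elements are closed. The functions are
  extended by zero.
\<close>

definition pw0 :: "(real \<Rightarrow> real) \<Rightarrow> bool" where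
  "pw0 f \<longleftrightarrow> (\<forall>\<tau>\<in>\<T>. \<exists>c. \<forall>x\<in>\<tau>. f x = tpoly k c x) \<and> (\<forall>x. x \<notin> {a<..<b} \<longrightarrow> f x = 0)"

text \<open>
  The value zero at the nodes and outside makes the derivative a Borel function that is defined
  everywhere.
\<close>

definition pwd :: "(real \<Rightarrow> real) \<Rightarrow> real \<Rightarrow> real" where
  "pwd f x = (if x \<in> {a..b} - nodes then deriv f x else 0)"

lemma pw0_outside: "pw0 f \<Longrightarrow> x \<notin> {a<..<b} \<Longrightarrow> f x = 0" by (simp add: pw0_def)

lemma pwd_outside: "x \<notin> {a..b} \<Longrightarrow> pwd f x = 0" by (auto simp: pwd_def)

lemma pwd_eqI:
  assumes "x \<in> {a..b} - nodes" and "(f has_real_derivative D) (at x)"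
  shows "pwd f x = D"
  using assms by (simp add: pwd_def DERIV_imp_deriv)

lemma pw0_derivative:
  assumes "pw0 f" and x: "x \<in> {a..b} - nodes"
  shows "(f has_real_derivative pwd f x) (at x)"
proof -
  obtain c d where cd: "{c..d} \<in> \<T>" "x \<in> {c<..<d}" using x by (rule off_nodes)
  obtain g where g: "\<And>y. y \<in> {c..d} \<Longrightarrow> f y = tpoly k g y" using assms(1) cd(1) by (auto simp: pw0_def)
  have "(f has_real_derivative tpoly' k g x) (at x)"
    by (rule has_field_derivative_transform_within_open[OF tpoly_has_derivative, where S = "{c<..<d}"])
       (use cd g in auto)
  then show ?thesis using pwd_eqI[OF x] by simp
qed

lemma pw0_continuous:
  assumes "pw0 f"
  shows "continuous_on UNIV f"
proof -
  have "continuous_on (\<Union>\<tau>\<in>\<T>. \<tau>) f"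
  proof (rule continuous_on_closed_Union[OF finite_\<T>])
    fix \<tau> assume \<tau>: "\<tau> \<in> \<T>"
    show "closed \<tau>" by (rule elementE[OF \<tau>]) simp
    obtain g where "\<And>y. y \<in> \<tau> \<Longrightarrow> f y = tpoly k g y" using assms \<tau> by (auto simp: pw0_def)
    then show "continuous_on \<tau> f" by (subst continuous_on_cong[OF refl]) (auto intro: continuous_on_tpoly continuous_intros)
  qed
  then have "continuous_on {a..b} f" using division_ofD(6)[OF division] by simp
  moreover have "continuous_on {..a} f" "continuous_on {b..} f"
    using assms by (subst continuous_on_cong[OF refl, of _ _ "\<lambda>_. 0"]; auto simp: pw0_def)+
  ultimately have "continuous_on ({..a} \<union> {a..b} \<union> {b..}) f"
    by (intro continuous_on_closed_Un) auto
  moreover have "{..a} \<union> {a..b} \<union> {b..} = UNIV" using ab by auto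
  ultimately show ?thesis by simp
qed

lemma pwd_regular:
  assumes "pw0 f"
  shows "pwd f \<in> borel_measurable borel" and "\<exists>B. \<forall>x. \<bar>pwd f x\<bar> \<le> B"
proof -
  have "\<forall>\<tau>\<in>\<T>. \<exists>c. \<forall>x\<in>\<tau>. f x = tpoly k c x" using assms by (simp add: pw0_def)
  then obtain g where g: "\<And>\<tau> x. \<tau> \<in> \<T> \<Longrightarrow> x \<in> \<tau> \<Longrightarrow> f x = tpoly k (g \<tau>) x" by metis
  have eq: "pwd f x = (\<Sum>\<tau>\<in>\<T>. indicator (interior \<tau> - nodes) x * tpoly' k (g \<tau>) x)" for x
  proof (cases "x \<in> {a..b} - nodes")
    case True
    then obtain c d where cd: "{c..d} \<in> \<T>" "x \<in> {c<..<d}" by (rule off_nodes)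
    have other: "x \<notin> interior \<tau>" if "\<tau> \<in> \<T>" "\<tau> \<noteq> {c..d}" for \<tau>
      using division_ofD(5)[OF division that(1) cd(1) that(2)] cd(2) by auto
    have "(f has_real_derivative tpoly' k (g {c..d}) x) (at x)"
      by (rule has_field_derivative_transform_within_open[OF tpoly_has_derivative, where S = "{c<..<d}"])
         (use cd g in auto)
    then have "pwd f x = tpoly' k (g {c..d}) x" by (rule pwd_eqI[OF True])
    also have "\<dots> = (\<Sum>\<tau>\<in>{{c..d}}. indicator (interior \<tau> - nodes) x * tpoly' k (g \<tau>) x)"
      using cd True by simp
    also have "\<dots> = (\<Sum>\<tau>\<in>\<T>. indicator (interior \<tau> - nodes) x * tpoly' k (g \<tau>) x)"
      using finite_\<T> cd other by (intro sum.mono_neutral_left) (auto simp: indicator_def)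
    finally show ?thesis .
  next
    case False
    have "x \<notin> interior \<tau> - nodes" if "\<tau> \<in> \<T>" for \<tau>
      using False division_ofD(2)[OF division that] interior_subset[of \<tau>] by auto
    then show ?thesis using False by (auto simp: pwd_def)
  qed
  have eq': "pwd f = (\<lambda>x. \<Sum>\<tau>\<in>\<T>. indicator (interior \<tau> - nodes) x * tpoly' k (g \<tau>) x)" using eq by blast
  have m: "tpoly' k c \<in> borel_measurable borel" for c
    by (rule borel_measurable_continuous_onI) (auto intro: continuous_on_tpoly' continuous_intros)
  have n: "interior \<tau> - nodes \<in> sets borel" for \<tau> :: "real set"
    using finite_imp_closed[OF finite_nodes] by (intro sets.Diff borel_open borel_closed) auto
  show "pwd f \<in> borel_measurable borel" unfolding eq'
    by (intro borel_measurable_sum borel_measurable_times m borel_measurable_indicator n)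
  have "\<exists>B. \<forall>x\<in>{a..b}. \<bar>tpoly' k (g \<tau>) x\<bar> \<le> B" for \<tau>
    using compact_imp_bounded[OF compact_continuous_image[OF continuous_on_tpoly'[OF continuous_on_id] compact_Icc], of k "g \<tau>" a b]
    by (auto simp: bounded_iff)
  then obtain B where B: "\<And>\<tau> x. x \<in> {a..b} \<Longrightarrow> \<bar>tpoly' k (g \<tau>) x\<bar> \<le> B \<tau>" by metis
  show "\<exists>B. \<forall>x. \<bar>pwd f x\<bar> \<le> B"
  proof (intro exI allI)
    fix x
    show "\<bar>pwd f x\<bar> \<le> (\<Sum>\<tau>\<in>\<T>. \<bar>B \<tau>\<bar>)"
    proof (cases "x \<in> {a..b}")
      case True
      show ?thesis unfolding eq
      proof (rule order_trans[OF sum_abs sum_mono])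
        fix \<tau> show "\<bar>indicator (interior \<tau> - nodes) x * tpoly' k (g \<tau>) x\<bar> \<le> \<bar>B \<tau>\<bar>"
          using B[OF True, of \<tau>] by (auto simp: indicator_def)
      qed
    qed (auto simp: pwd_outside intro: sum_nonneg)
  qed
qed

lemma pw0_zero: "pw0 (\<lambda>_. 0)"
  unfolding pw0_def by (auto intro!: exI[of _ "\<lambda>_. 0"] simp: tpoly_def)

lemma affine_tpoly: "\<exists>c. \<forall>x. \<alpha> + \<beta> * x = tpoly k c x"
proof (intro exI allI)
  fix x
  have "tpoly k (\<lambda>i. if i = 0 then \<alpha> else if i = 1 then \<beta> else 0) x = (\<Sum>i\<in>{0,1}. (if i = 0 then \<alpha> else if i = 1 then \<beta> else 0) * x ^ i)"
    unfolding tpoly_def using k by (intro sum.mono_neutral_right) auto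
  then show "\<alpha> + \<beta> * x = tpoly k (\<lambda>i. if i = 0 then \<alpha> else if i = 1 then \<beta> else 0) x" by simp
qed

text \<open>
  The piecewise linear interpolant at the nodes. On an element its slope is the mean of \<open>v'\<close>,
  whence the stability of the derivative; the error at a point is the integral of \<open>v' - g'\<close> from a
  node over a length of at most \<open>h\<close>.
\<close>

lemma nodal_interpolation:
  assumes v: "\<And>x. (v has_real_derivative v' x) (at x)" and v': "continuous_on UNIV v'"
    and "v a = 0" "v b = 0"
  shows "\<exists>g. pw0 g \<and> integral {a..b} (\<lambda>x. (v x - g x)\<^sup>2) \<le> h\<^sup>2 * integral {a..b} (\<lambda>x. (v' x)\<^sup>2)
    \<and> integral {a..b} (\<lambda>x. (pwd g x)\<^sup>2) \<le> integral {a..b} (\<lambda>x. (v' x)\<^sup>2)"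
proof -
  define lin where "lin \<tau> x = v (Inf \<tau>) + (x - Inf \<tau>) * ((v (Sup \<tau>) - v (Inf \<tau>)) / (Sup \<tau> - Inf \<tau>))" for \<tau> x
  define g where "g x = (if x \<in> {a..b} then lin (SOME \<tau>. \<tau> \<in> \<T> \<and> x \<in> \<tau>) x else 0)" for x
  have lin_ends: "lin {c..d} c = v c" "lin {c..d} d = v d" if "c < d" for c d
    using that by (auto simp: lin_def)
  have cv: "continuous_on S v" for S using v by (intro DERIV_continuous_on) (auto intro: has_field_derivative_at_within)
  have cv': "continuous_on S v'" for S using v' continuous_on_subset by blast
  \<comment> \<open>Two elements share at most a node, where both linear pieces take the value of \<open>v\<close>.\<close>
  have g: "g x = lin \<tau> x" if \<tau>: "\<tau> \<in> \<T>" "x \<in> \<tau>" for \<tau> x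
  proof -
    define \<tau>' where "\<tau>' = (SOME \<tau>. \<tau> \<in> \<T> \<and> x \<in> \<tau>)"
    have \<tau>': "\<tau>' \<in> \<T>" "x \<in> \<tau>'" unfolding \<tau>'_def using someI[of "\<lambda>\<tau>. \<tau> \<in> \<T> \<and> x \<in> \<tau>"] \<tau> by blast+
    obtain c d where cd: "\<tau> = {c..d}" "c < d" "c \<in> nodes" "d \<in> nodes" "a \<le> c" "d \<le> b" by (rule elementE[OF \<tau>(1)])
    obtain c' d' where cd': "\<tau>' = {c'..d'}" "c' < d'" "c' \<in> nodes" "d' \<in> nodes" by (rule elementE[OF \<tau>'(1)])
    have "lin \<tau>' x = lin \<tau> x"
    proof (cases "x \<in> nodes")
      case True
      then have "x = c \<or> x = d" "x = c' \<or> x = d'"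
        using node_not_inside[OF True] \<tau> \<tau>' cd cd' by (metis atLeastAtMost_iff order_antisym)+
      then show ?thesis using lin_ends cd cd' by metis
    next
      case False
      then have "x \<noteq> c" "x \<noteq> d" "x \<noteq> c'" "x \<noteq> d'" using cd cd' by auto
      then have "x \<in> interior \<tau> \<inter> interior \<tau>'" using \<tau>(2) \<tau>'(2) cd(1) cd'(1) by simp
      then show ?thesis using division_ofD(5)[OF division \<tau>(1) \<tau>'(1)] by blast
    qed
    moreover have "x \<in> {a..b}" using \<tau> cd by auto
    ultimately show ?thesis by (simp add: g_def \<tau>'_def)
  qed
  have pw: "pw0 g" unfolding pw0_def
  proof (intro conjI ballI allI impI)
    fix \<tau> assume \<tau>: "\<tau> \<in> \<T>"
    define s where "s = (v (Sup \<tau>) - v (Inf \<tau>)) / (Sup \<tau> - Inf \<tau>)"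
    obtain c where c: "\<And>x. (v (Inf \<tau>) - Inf \<tau> * s) + s * x = tpoly k c x" using affine_tpoly by blast
    have "g x = tpoly k c x" if "x \<in> \<tau>" for x
      unfolding g[OF \<tau> that] c[symmetric] by (simp add: lin_def s_def[symmetric] algebra_simps)
    then show "\<exists>c. \<forall>x\<in>\<tau>. g x = tpoly k c x" by blast
  next
    fix x assume x: "x \<notin> {a<..<b}"
    have "g p = v p" if p: "p \<in> nodes" for p
    proof -
      obtain \<tau> where \<tau>: "\<tau> \<in> \<T>" "p = Inf \<tau> \<or> p = Sup \<tau>" using p by (auto simp: nodes_def)
      obtain c d where cd: "\<tau> = {c..d}" "c < d" by (rule elementE[OF \<tau>(1)])
      then show ?thesis using g[OF \<tau>(1), of p] \<tau>(2) lin_ends[OF cd(2)] by auto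
    qed
    then have "g a = 0" "g b = 0" using ends_nodes assms(3,4) by auto
    then show "g x = 0" using x by (cases "x = a \<or> x = b") (auto simp: g_def)
  qed
  have elem: "integral \<tau> (\<lambda>x. (v x - g x)\<^sup>2) \<le> h\<^sup>2 * integral \<tau> (\<lambda>x. (v' x)\<^sup>2)
     \<and> integral \<tau> (\<lambda>x. (pwd g x)\<^sup>2) \<le> integral \<tau> (\<lambda>x. (v' x)\<^sup>2)" if \<tau>: "\<tau> \<in> \<T>" for \<tau>
  proof -
    obtain c d where cd: "\<tau> = {c..d}" "c < d" "d - c \<le> h" "a \<le> c" "d \<le> b" and nd: "c \<in> nodes" "d \<in> nodes"
      by (rule elementE[OF \<tau>])
    define \<mu> where "\<mu> = (v d - v c) / (d - c)"
    define I where "I = integral {c..d} (\<lambda>x. (v' x)\<^sup>2)"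
    have I0: "0 \<le> I" unfolding I_def by (intro integral_nonneg integrable_continuous_real continuous_intros cv') auto
    have lin: "g x = v c + (x - c) * \<mu>" if "x \<in> {c..d}" for x
      using g[OF \<tau>, of x] that cd by (simp add: lin_def \<mu>_def)
    have ftc: "integral {c..x} v' = v x - v c" if "x \<in> {c..d}" for x
      using that by (intro integral_unique fundamental_theorem_of_calculus)
        (auto intro!: has_field_derivative_at_within v simp: has_real_derivative_iff_has_vector_derivative[symmetric])
    have \<mu>: "\<mu> = integral {c..d} v' / (d - c)" using ftc[of d] cd by (simp add: \<mu>_def)
    have dev: "integral {c..d} (\<lambda>x. (v' x - \<mu>)\<^sup>2) \<le> I"
      unfolding \<mu> I_def using cd by (intro square_integral_le(2) cv') auto
    have point: "(v x - g x)\<^sup>2 \<le> h * I" if x: "x \<in> {c..d}" for x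
    proof -
      have "integral {c..x} (\<lambda>y. v' y - \<mu>) = v x - g x"
        using ftc[OF x] x lin[OF x] by (subst integral_diff) (auto intro: integrable_continuous_real cv' simp: algebra_simps)
      then have "(v x - g x)\<^sup>2 \<le> (x - c) * integral {c..x} (\<lambda>y. (v' y - \<mu>)\<^sup>2)"
        using square_integral_le(1)[OF continuous_on_diff[OF cv' continuous_on_const], of c x \<mu>] x by simp
      also have "\<dots> \<le> (x - c) * integral {c..d} (\<lambda>y. (v' y - \<mu>)\<^sup>2)"
        using x by (intro mult_left_mono integral_subset_le integrable_continuous_real continuous_intros cv') auto
      also have "\<dots> \<le> (x - c) * I" using x dev by (intro mult_left_mono) auto
      also have "\<dots> \<le> h * I" using x cd I0 by (intro mult_right_mono) auto
      finally show ?thesis .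
    qed
    have cg: "continuous_on S g" for S using pw0_continuous[OF pw] continuous_on_subset by blast
    have "integral {c..d} (\<lambda>x. (v x - g x)\<^sup>2) \<le> integral {c..d} (\<lambda>x. h * I)"
      using point by (intro integral_le integrable_continuous_real continuous_intros cv cg) auto
    also have "\<dots> = (d - c) * (h * I)" using cd by simp
    also have "\<dots> \<le> h * (h * I)" using cd I0 h_pos by (intro mult_right_mono) auto
    finally have 1: "integral {c..d} (\<lambda>x. (v x - g x)\<^sup>2) \<le> h\<^sup>2 * I" by (simp add: power2_eq_square mult_ac)
    have "pwd g x = \<mu>" if "x \<in> {c..d} - nodes" for x
    proof (rule pwd_eqI)
      have "x \<noteq> c" "x \<noteq> d" using that nd by auto
      then have x: "x \<in> {c<..<d}" using that by auto
      have "((\<lambda>x. v c + (x - c) * \<mu>) has_real_derivative \<mu>) (at x)" by (auto intro!: derivative_eq_intros)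
      then show "(g has_real_derivative \<mu>) (at x)"
        by (rule has_field_derivative_transform_within_open[where S = "{c<..<d}"]) (use x lin in auto)
    qed (use that cd in auto)
    then have "integral {c..d} (\<lambda>x. (pwd g x)\<^sup>2) = integral {c..d} (\<lambda>x. \<mu>\<^sup>2)"
      by (intro integral_spike[of nodes]) (auto intro: negligible_finite finite_nodes)
    also have "\<dots> = (d - c) * \<mu>\<^sup>2" using cd by simp
    also have "\<dots> = (integral {c..d} v')\<^sup>2 / (d - c)" using cd by (simp add: \<mu> power_divide power2_eq_square)
    also have "\<dots> \<le> I" using square_integral_le(1)[of c d v'] cd cv' by (simp add: I_def divide_le_eq mult.commute)
    finally show ?thesis using 1 cd by (simp add: I_def)
  qed
  have split: "integral {a..b} f = (\<Sum>\<tau>\<in>\<T>. integral \<tau> f)" if "f integrable_on {a..b}" for f :: "real \<Rightarrow> real"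
    using integral_combine_division_topdown[OF that division] .
  have cg: "continuous_on S g" for S using pw0_continuous[OF pw] continuous_on_subset by blast
  have i1: "(\<lambda>x. (v x - g x)\<^sup>2) integrable_on {a..b}" by (intro integrable_continuous_real continuous_intros cv cg)
  have i2: "(\<lambda>x. (v' x)\<^sup>2) integrable_on {a..b}" by (intro integrable_continuous_real continuous_intros cv')
  have i3: "(\<lambda>x. (pwd g x)\<^sup>2) integrable_on {a..b}"
  proof -
    obtain B where B: "\<And>x. \<bar>pwd g x\<bar> \<le> B" using pwd_regular(2)[OF pw] by blast
    have "\<bar>(pwd g x)\<^sup>2\<bar> \<le> B\<^sup>2" for x using power_mono[OF B[of x], of 2] by simp
    then show ?thesis
      using pwd_regular(1)[OF pw]
      by (intro set_borel_integral_eq_integral(1) bounded_set_integrable[of _ _ "B\<^sup>2"]) auto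
  qed
  show ?thesis
  proof (intro exI[of _ g] conjI pw)
    show "integral {a..b} (\<lambda>x. (v x - g x)\<^sup>2) \<le> h\<^sup>2 * integral {a..b} (\<lambda>x. (v' x)\<^sup>2)"
      unfolding split[OF i1] split[OF i2] sum_distrib_left using elem by (intro sum_mono) blast
    show "integral {a..b} (\<lambda>x. (pwd g x)\<^sup>2) \<le> integral {a..b} (\<lambda>x. (v' x)\<^sup>2)"
      unfolding split[OF i3] split[OF i2] using elem by (intro sum_mono) blast
  qed
qed

text \<open>
  The test functions of the local energy estimate, for either direction of transport: unchanged
  upstream of \<open>p\<close>, a linear ramp from \<open>p\<close> to \<open>q\<close>, zero afterwards. They stay in the discrete space
  because \<open>p\<close> and \<open>q\<close> are nodes and the value on the ramp is frozen at \<open>p\<close>, so that the degree in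
  space is one there.
\<close>

lemma cut_pw0:
  assumes f: "pw0 f" and p: "p \<in> nodes" and q: "q \<in> nodes" and \<sigma>: "\<sigma> = 1 \<or> \<sigma> = - 1" and pq: "\<sigma> * p < \<sigma> * q"
  defines "g \<equiv> \<lambda>x. if \<sigma> * x \<le> \<sigma> * p then f x else if \<sigma> * x \<le> \<sigma> * q then f p * ((q - x) / (q - p)) else 0"
  shows "pw0 g"
    and "x \<in> {a..b} - nodes \<Longrightarrow> pwd g x = (if \<sigma> * x \<le> \<sigma> * p then pwd f x else if \<sigma> * x \<le> \<sigma> * q then - (f p / (q - p)) else 0)"
proof -
  have "p \<noteq> q" using pq by (metis less_irrefl)
  have sides: "(\<forall>x\<in>\<tau>. \<sigma> * x \<le> \<sigma> * r) \<or> (\<forall>x\<in>\<tau>. \<sigma> * r \<le> \<sigma> * x)" if "r \<in> nodes" "\<tau> \<in> \<T>" for r \<tau>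
    using node_sides[OF that] \<sigma> by auto
  have \<sigma>eq: "\<sigma> * x = \<sigma> * y \<longleftrightarrow> x = y" for x y using \<sigma> by auto
  have gp: "f p * ((q - x) / (q - p)) = f p * q / (q - p) + (- (f p / (q - p))) * x" for x
    by (simp add: diff_divide_distrib algebra_simps)
  show "pw0 g" unfolding pw0_def
  proof (intro conjI ballI allI impI)
    fix \<tau> assume \<tau>: "\<tau> \<in> \<T>"
    obtain c1 where c1: "\<And>x. x \<in> \<tau> \<Longrightarrow> f x = tpoly k c1 x" using f \<tau> by (auto simp: pw0_def)
    obtain c2 where c2: "\<And>x. f p * q / (q - p) + (- (f p / (q - p))) * x = tpoly k c2 x" using affine_tpoly by blast
    consider "\<forall>x\<in>\<tau>. \<sigma> * x \<le> \<sigma> * p" | "\<forall>x\<in>\<tau>. \<sigma> * p \<le> \<sigma> * x" "\<forall>x\<in>\<tau>. \<sigma> * x \<le> \<sigma> * q" | "\<forall>x\<in>\<tau>. \<sigma> * q \<le> \<sigma> * x"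
      using sides[OF p \<tau>] sides[OF q \<tau>] by blast
    then show "\<exists>c. \<forall>x\<in>\<tau>. g x = tpoly k c x"
    proof cases
      case 1 then show ?thesis using c1 by (auto simp: g_def)
    next
      case 2
      have "g x = tpoly k c2 x" if "x \<in> \<tau>" for x
        using 2 that \<open>p \<noteq> q\<close> \<sigma>eq unfolding c2[symmetric] gp[symmetric] g_def by (auto dest!: bspec[OF _ that] simp: order_antisym_conv)
      then show ?thesis by blast
    next
      case 3
      have "g x = tpoly k (\<lambda>_. 0) x" if "x \<in> \<tau>" for x
        using bspec[OF 3 that] pq \<sigma>eq by (auto simp: g_def tpoly_def order_antisym_conv)
      then show ?thesis by blast
    qed
  next
    fix x assume x: "x \<notin> {a<..<b}"
    have "f x = 0" using f x by (rule pw0_outside)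
    moreover have "p \<in> {a..b}" "q \<in> {a..b}" using p q nodes_subset by auto
    ultimately show "g x = 0" using x \<sigma> pq by (auto simp: g_def not_less)
  qed
  assume x: "x \<in> {a..b} - nodes"
  then have ne: "x \<noteq> p" "x \<noteq> q" using p q by auto
  have op: "open {y. \<sigma> * y < r}" "open {y. r < \<sigma> * y}" for r
    by (auto intro!: open_Collect_less continuous_intros)
  show "pwd g x = (if \<sigma> * x \<le> \<sigma> * p then pwd f x else if \<sigma> * x \<le> \<sigma> * q then - (f p / (q - p)) else 0)"
  proof (rule pwd_eqI[OF x])
    consider "\<sigma> * x < \<sigma> * p" | "\<sigma> * p < \<sigma> * x" "\<sigma> * x < \<sigma> * q" | "\<sigma> * q < \<sigma> * x"
      using ne \<sigma>eq by (metis linorder_neqE)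
    then show "(g has_real_derivative (if \<sigma> * x \<le> \<sigma> * p then pwd f x else if \<sigma> * x \<le> \<sigma> * q then - (f p / (q - p)) else 0)) (at x)"
    proof cases
      case 1
      have "(g has_real_derivative pwd f x) (at x)"
        by (rule has_field_derivative_transform_within_open[OF pw0_derivative[OF f x] op(1)[of "\<sigma> * p"]])
           (use 1 in \<open>auto simp: g_def\<close>)
      then show ?thesis using 1 by simp
    next
      case 2
      have "((\<lambda>x. f p * ((q - x) / (q - p))) has_real_derivative - (f p / (q - p))) (at x)"
        using \<open>p \<noteq> q\<close> by (auto intro!: derivative_eq_intros simp: gp)
      then have "(g has_real_derivative - (f p / (q - p))) (at x)"
        by (rule has_field_derivative_transform_within_open[OF _ open_Int[OF op(2)[of "\<sigma> * p"] op(1)[of "\<sigma> * q"]]])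
           (use 2 in \<open>auto simp: g_def\<close>)
      then show ?thesis using 2 by simp
    next
      case 3
      have "(g has_real_derivative 0) (at x)"
        by (rule has_field_derivative_transform_within_open[OF DERIV_const[of 0] op(2)[of "\<sigma> * q"]])
           (use 3 pq in \<open>auto simp: g_def\<close>)
      then show ?thesis using 3 pq by simp
    qed
  qed
qed

end

section \<open>Bounded Borel functions on rectangles\<close>

text \<open>
  This class contains discrete functions, their derivatives and continuous functions, is closed
  under sums and products, and all its members may be integrated over slabs in either order.
\<close>

definition regular :: "real set \<Rightarrow> real set \<Rightarrow> (real \<Rightarrow> real \<Rightarrow> real) \<Rightarrow> bool" where
  "regular I X F \<longleftrightarrow> (\<lambda>z. F (fst z) (snd z)) \<in> borel_measurable borel \<and>
     (\<exists>B. \<forall>t\<in>I. \<forall>x\<in>X. \<bar>F t x\<bar> \<le> B)"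

lemma regular_const [intro]: "regular I X (\<lambda>_ _. c)"
  by (auto simp: regular_def)

lemma regular_add [intro]:
  assumes "regular I X F" "regular I X G" shows "regular I X (\<lambda>t x. F t x + G t x)"
proof -
  obtain B C where "\<And>t x. t \<in> I \<Longrightarrow> x \<in> X \<Longrightarrow> \<bar>F t x\<bar> \<le> B" "\<And>t x. t \<in> I \<Longrightarrow> x \<in> X \<Longrightarrow> \<bar>G t x\<bar> \<le> C"
    using assms unfolding regular_def by metis
  then have "\<forall>t\<in>I. \<forall>x\<in>X. \<bar>F t x + G t x\<bar> \<le> B + C" by (metis abs_triangle_ineq add_mono order_trans)
  with assms show ?thesis by (auto simp: regular_def)
qed

lemma regular_mult [intro]:
  assumes "regular I X F" "regular I X G" shows "regular I X (\<lambda>t x. F t x * G t x)"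
proof -
  obtain B C where "\<And>t x. t \<in> I \<Longrightarrow> x \<in> X \<Longrightarrow> \<bar>F t x\<bar> \<le> B" "\<And>t x. t \<in> I \<Longrightarrow> x \<in> X \<Longrightarrow> \<bar>G t x\<bar> \<le> C"
    using assms unfolding regular_def by metis
  then have "\<forall>t\<in>I. \<forall>x\<in>X. \<bar>F t x * G t x\<bar> \<le> \<bar>B\<bar> * \<bar>C\<bar>"
    unfolding abs_mult by (smt (verit) mult_mono abs_ge_zero)
  with assms show ?thesis by (auto simp: regular_def)
qed

lemma regular_minus [intro]: "regular I X F \<Longrightarrow> regular I X (\<lambda>t x. - F t x)"
  by (auto simp: regular_def)

lemma regular_diff [intro]:
  assumes "regular I X F" "regular I X G" shows "regular I X (\<lambda>t x. F t x - G t x)"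
  using regular_add[OF assms(1) regular_minus[OF assms(2)]] by simp

lemma regular_power [intro]: "regular I X F \<Longrightarrow> regular I X (\<lambda>t x. (F t x) ^ n)"
  by (induction n) auto

lemma regular_sum [intro]: "(\<And>i. i \<in> S \<Longrightarrow> regular I X (F i)) \<Longrightarrow> regular I X (\<lambda>t x. \<Sum>i\<in>S. F i t x)"
  by (induction S rule: infinite_finite_induct) auto

lemma regular_time:
  assumes "continuous_on UNIV f" shows "regular {c..d} X (\<lambda>t x. f t)"
proof -
  have "compact (f ` {c..d})" by (intro compact_continuous_image continuous_on_subset[OF assms]) auto
  then have "\<exists>B. \<forall>t\<in>{c..d}. \<bar>f t\<bar> \<le> B" by (auto dest!: compact_imp_bounded simp: bounded_iff)
  moreover have "(\<lambda>z::real \<times> real. f (fst z)) \<in> borel_measurable borel"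
    by (intro borel_measurable_continuous_onI continuous_on_compose2[OF assms] continuous_intros) auto
  ultimately show ?thesis by (auto simp: regular_def)
qed

lemma regular_space:
  assumes "f \<in> borel_measurable borel" "\<And>x. x \<in> X \<Longrightarrow> \<bar>f x\<bar> \<le> B" shows "regular I X (\<lambda>t x. f x)"
  using assms by (auto simp: regular_def borel_prod[symmetric])

lemma regular_continuous:
  assumes "continuous_on UNIV (\<lambda>z. F (fst z) (snd z))" shows "regular {c..d} {a..b} F"
proof -
  have "compact ((\<lambda>z. F (fst z) (snd z)) ` ({c..d} \<times> {a..b}))"
    by (intro compact_continuous_image continuous_on_subset[OF assms] compact_Times) auto
  from compact_imp_bounded[OF this] obtain B where "\<forall>y \<in> (\<lambda>z. F (fst z) (snd z)) ` ({c..d} \<times> {a..b}). norm y \<le> B"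
    unfolding bounded_iff by blast
  then have "\<forall>t\<in>{c..d}. \<forall>x\<in>{a..b}. \<bar>F t x\<bar> \<le> B" by force
  then show ?thesis using borel_measurable_continuous_onI[OF assms] by (auto simp: regular_def)
qed

lemma regular_continuous_space:
  assumes "continuous_on UNIV f" shows "regular I {a..b} (\<lambda>t x. f x)"
proof -
  have "compact (f ` {a..b})" by (intro compact_continuous_image continuous_on_subset[OF assms]) auto
  then have "\<exists>B. \<forall>x\<in>{a..b}. \<bar>f x\<bar> \<le> B" by (auto dest!: compact_imp_bounded simp: bounded_iff)
  then show ?thesis using regular_space[OF borel_measurable_continuous_onI[OF assms]] by blast
qed

lemma regular_tpoly:
  assumes "\<And>i. regular {c..d} X (\<lambda>t x. f i x)"
  shows "regular {c..d} X (\<lambda>t x. tpoly k (\<lambda>i. f i x) t)"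
    and "regular {c..d} X (\<lambda>t x. tpoly' k (\<lambda>i. f i x) t)"
  unfolding tpoly_def tpoly'_def
  by (intro regular_sum regular_mult assms regular_time continuous_intros)+

lemma regular_integral:
  assumes "regular {c..d} {a..b} F"
  shows "(\<lambda>x. integral {c..d} (\<lambda>t. F t x)) integrable_on {a..b}"
    and "(\<lambda>t. integral {a..b} (F t)) integrable_on {c..d}"
    and "set_integrable lborel ({c..d} \<times> {a..b}) (\<lambda>z. F (fst z) (snd z))"
    and "(LINT z:{c..d} \<times> {a..b}|lborel. F (fst z) (snd z)) = integral {a..b} (\<lambda>x. integral {c..d} (\<lambda>t. F t x))"
    and "(LINT z:{c..d} \<times> {a..b}|lborel. F (fst z) (snd z)) = integral {c..d} (\<lambda>t. integral {a..b} (F t))"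
proof -
  obtain B where "(\<lambda>z. F (fst z) (snd z)) \<in> borel_measurable borel"
    "\<And>t x. t \<in> {c..d} \<Longrightarrow> x \<in> {a..b} \<Longrightarrow> \<bar>F t x\<bar> \<le> B" using assms unfolding regular_def by blast
  note * = rectangle_integral(1)[OF this] rectangle_integral(2)[OF this] rectangle_integral(3)[OF this]
  show "set_integrable lborel ({c..d} \<times> {a..b}) (\<lambda>z. F (fst z) (snd z))" by (rule *(1))
  show "(\<lambda>x. integral {c..d} (\<lambda>t. F t x)) integrable_on {a..b}" by (rule has_integral_integrable[OF *(2)])
  show "(\<lambda>t. integral {a..b} (F t)) integrable_on {c..d}" by (rule has_integral_integrable[OF *(3)])
  show "(LINT z:{c..d} \<times> {a..b}|lborel. F (fst z) (snd z)) = integral {a..b} (\<lambda>x. integral {c..d} (\<lambda>t. F t x))"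
    by (rule integral_unique[OF *(2), symmetric])
  show "(LINT z:{c..d} \<times> {a..b}|lborel. F (fst z) (snd z)) = integral {c..d} (\<lambda>t. integral {a..b} (F t))"
    by (rule integral_unique[OF *(3), symmetric])
qed

section \<open>The energy method upstream of the data\<close>

lemma tpoly_product_integral:
  "integral {c..d} (\<lambda>t. tpoly k \<alpha> t * tpoly k \<beta> t) = (\<Sum>i\<le>k. \<Sum>j\<le>k. \<alpha> i * \<beta> j * integral {c..d} (\<lambda>t. t ^ i * t ^ j))"
proof -
  have "integral {c..d} (\<lambda>t. tpoly k \<alpha> t * tpoly k \<beta> t) = integral {c..d} (\<lambda>t. \<Sum>i\<le>k. \<Sum>j\<le>k. \<alpha> i * \<beta> j * (t ^ i * t ^ j))"
    by (simp add: tpoly_def sum_product mult_ac)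
  also have "\<dots> = (\<Sum>i\<le>k. \<Sum>j\<le>k. integral {c..d} (\<lambda>t. \<alpha> i * \<beta> j * (t ^ i * t ^ j)))"
    by (subst integral_sum; (subst integral_sum)?) (auto intro!: integrable_continuous_real continuous_intros)
  finally show ?thesis by simp
qed

text \<open>
  Discrete functions \<open>U\<close> to the right of the upstream end \<open>a\<close>, with transport to the right and
  with sources and initial data that vanish up to \<open>c0\<close>. \<open>A\<close> and \<open>A'\<close> are the coefficients in time
  and their space derivatives, \<open>N\<close> are the nodes. Transport to the left is reduced to this setting
  by reflection, which is why the coefficients are not tied to a mesh here. In \<open>prev\<close> the initial
  value is zero because the data vanish up to \<open>c0\<close>.

  \<open>Q\<close> is the density of the stabilizing term: \<open>(u\<^sub>t + u\<^sub>x)^2\<close> for \<open>\<kappa> = 1\<close>, and \<open>u\<^sub>t^2 + u\<^sub>x^2\<close> for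
  \<open>\<kappa> = 0\<close>, which is the case of the direction of \<open>E\<^sub>1\<close>, where two equations hold. \<open>mass\<close> is to be
  estimated by \<open>defect\<close>, which upstream of the data consists of residuals. \<open>energy_form\<close> is the
  scheme tested with \<open>U\<close> itself, and \<open>cut_form\<close> is the scheme tested with the ramp from \<open>p\<close> to \<open>q\<close>
  with time profile \<open>U m t p\<close>; both are densities in space.
\<close>

locale upwind =
  fixes h \<delta>0 \<kappa> Ci a c0 :: real and k M :: nat and N :: "real set"
    and A A' :: "nat \<Rightarrow> nat \<Rightarrow> real \<Rightarrow> real"
  assumes h: "0 < h" and \<delta>0: "0 < \<delta>0" and \<kappa>: "\<kappa> = 0 \<or> \<kappa> = 1" and Ci: "1 \<le> Ci" and M: "1 \<le> M"
    and trace_inverse: "\<And>c t. (tpoly k c t)\<^sup>2 \<le> Ci / h * integral {t..t + h} (\<lambda>s. (tpoly k c s)\<^sup>2)"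
    and deriv_inverse: "\<And>c t. integral {t..t + h} (\<lambda>s. (tpoly' k c s)\<^sup>2) \<le> Ci / h\<^sup>2 * integral {t..t + h} (\<lambda>s. (tpoly k c s)\<^sup>2)"
    and N: "finite N" and ac0: "a \<le> c0"
    and A_cont: "\<And>m i. continuous_on UNIV (A m i)"
    and A'_meas: "\<And>m i. A' m i \<in> borel_measurable borel"
    and A'_bdd: "\<And>m i. \<exists>B. \<forall>x. \<bar>A' m i x\<bar> \<le> B"
    and A_deriv: "\<And>m i x. x \<in> {a<..<c0} - N \<Longrightarrow> (A m i has_real_derivative A' m i x) (at x)"
    and A_a: "\<And>m i. A m i a = 0"
    and next_node: "\<And>x. a \<le> x \<Longrightarrow> x \<le> c0 - h \<Longrightarrow> \<exists>p\<in>N. x \<le> p \<and> p \<le> x + h"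
begin

definition "start m = (real m - 1) * h"
abbreviation "slab m \<equiv> {start m..start m + h}"
definition "U m t x = tpoly k (\<lambda>i. A m i x) t"
definition "Ut m t x = tpoly' k (\<lambda>i. A m i x) t"
definition "Ux m t x = tpoly k (\<lambda>i. A' m i x) t"
definition "prev m x = (if m = 1 then 0 else U (m - 1) (start m) x)"
definition "jump m x = U m (start m) x - prev m x"
definition "Q m t x = (Ut m t x)\<^sup>2 + 2 * \<kappa> * (Ut m t x * Ux m t x) + (Ux m t x)\<^sup>2"
definition "mass x = (\<Sum>m=1..M. integral (slab m) (\<lambda>t. (U m t x)\<^sup>2))"
definition "defect x = (\<Sum>m=1..M. h * integral (slab m) (\<lambda>t. Q m t x) + (jump m x)\<^sup>2)"

definition "U_fin x = U M (start M + h) x"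

definition "energy_form x = (\<Sum>m=1..M. integral (slab m) (\<lambda>t. (Ut m t x + Ux m t x) * U m t x + \<delta>0 * h * Q m t x)
   + jump m x * U m (start m) x)"

definition "cut_form p q x = (let w = (q - x) / (q - p); d = q - p in
   \<Sum>m=1..M. integral (slab m) (\<lambda>t. (Ut m t x + Ux m t x) * (U m t p * w)
     + \<delta>0 * h * (Ut m t x * (Ut m t p * w)
        + \<kappa> * (Ut m t x * (- (U m t p / d)) + Ux m t x * (Ut m t p * w))
        + Ux m t x * (- (U m t p / d))))
   + jump m x * (U m (start m) p * w))"

lemma start_Suc: "start (Suc m) = start m + h" by (simp add: start_def algebra_simps)

lemma cont_t [continuous_intros]:
  "continuous_on S (\<lambda>t. U m t x)" "continuous_on S (\<lambda>t. Ut m t x)" "continuous_on S (\<lambda>t. Ux m t x)"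
  unfolding U_def Ut_def Ux_def by (intro continuous_intros)+

lemma cont_Q [continuous_intros]: "continuous_on S (\<lambda>t. Q m t x)"
  unfolding Q_def by (intro continuous_intros)

lemma U_continuous: "continuous_on S (\<lambda>x. U m t x)"
  unfolding U_def tpoly_def using A_cont by (intro continuous_intros) (auto intro: continuous_on_subset)

lemma regular_U: "regular {c..d} {x..y} (U m)" "regular {c..d} {x..y} (Ut m)" "regular {c..d} {x..y} (Ux m)"
proof -
  have 1: "regular {c..d} {x..y} (\<lambda>t x. A m i x)" for i by (rule regular_continuous_space[OF A_cont])
  have 2: "regular {c..d} {x..y} (\<lambda>t x. A' m i x)" for i
    using A'_bdd[of m i] regular_space[OF A'_meas[of m i]] by blast
  show "regular {c..d} {x..y} (U m)" "regular {c..d} {x..y} (Ut m)" "regular {c..d} {x..y} (Ux m)"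
    unfolding U_def [abs_def] Ut_def [abs_def] Ux_def [abs_def] by (intro regular_tpoly 1 2)+
qed

lemma regular_Q: "regular {c..d} {x..y} (Q m)"
  unfolding Q_def [abs_def] by (intro regular_add regular_mult regular_power regular_const regular_U)

lemma jump_continuous: "continuous_on S (jump m)"
  unfolding jump_def prev_def by (cases "m = 1") (auto intro!: continuous_intros U_continuous)

lemma jump_sq_integrable: "(\<lambda>x. (jump m x)\<^sup>2) integrable_on {x..y}"
  by (intro integrable_continuous_real continuous_intros jump_continuous)

lemma defect_integrable: "defect integrable_on {x..y}"
  unfolding defect_def [abs_def]
  by (intro integrable_sum integrable_add integrable_on_mult_right regular_integral(1)[OF regular_Q]
      jump_sq_integrable) auto

lemma Q_bound: "(Ut m t x + Ux m t x)\<^sup>2 \<le> 2 * Q m t x" and Q_nonneg: "0 \<le> Q m t x"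
proof -
  have "(Ut m t x + Ux m t x)\<^sup>2 \<le> 2 * Q m t x \<and> 0 \<le> Q m t x"
    using \<kappa>
  proof
    assume "\<kappa> = 0"
    then show ?thesis using sum_squares_bound[of "Ut m t x" "Ux m t x"] unfolding Q_def by (simp add: power2_sum)
  next
    assume "\<kappa> = 1"
    then have "Q m t x = (Ut m t x + Ux m t x)\<^sup>2" unfolding Q_def by (simp add: power2_sum)
    then show ?thesis by simp
  qed
  then show "(Ut m t x + Ux m t x)\<^sup>2 \<le> 2 * Q m t x" "0 \<le> Q m t x" by blast+
qed

lemma int_Q_nonneg: "0 \<le> integral (slab m) (\<lambda>t. Q m t x)"
  by (intro integral_nonneg integrable_continuous_real continuous_intros Q_nonneg)

lemma defect_nonneg: "0 \<le> defect x"
  unfolding defect_def using h int_Q_nonneg by (intro sum_nonneg add_nonneg_nonneg mult_nonneg_nonneg) auto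

lemma mass_nonneg: "0 \<le> mass x"
  unfolding mass_def by (intro sum_nonneg integral_nonneg integrable_continuous_real continuous_intros) auto

lemma mass_a: "mass a = 0" by (simp add: mass_def U_def tpoly_def A_a)

lemma mass_eq: "mass x = (\<Sum>m=1..M. \<Sum>i\<le>k. \<Sum>j\<le>k. A m i x * A m j x * integral (slab m) (\<lambda>t. t ^ i * t ^ j))"
  by (simp add: mass_def U_def power2_eq_square tpoly_product_integral)

lemma mass_continuous: "continuous_on S mass"
  unfolding mass_eq [abs_def] using A_cont by (intro continuous_intros) (auto intro: continuous_on_subset)

text \<open>
  In space the mass is differentiable off the nodes only, but it is continuous, so that the
  fundamental theorem of calculus applies across the nodes.
\<close>

lemma mass_derivative:
  assumes "x \<in> {a<..<c0} - N"
  shows "(mass has_real_derivative 2 * (\<Sum>m=1..M. integral (slab m) (\<lambda>t. Ux m t x * U m t x))) (at x)"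
proof -
  have "(mass has_real_derivative (\<Sum>m=1..M. \<Sum>i\<le>k. \<Sum>j\<le>k.
      (A' m i x * A m j x + A m i x * A' m j x) * integral (slab m) (\<lambda>t. t ^ i * t ^ j))) (at x)"
    unfolding mass_eq [abs_def]
    by (intro DERIV_sum) (auto intro!: derivative_eq_intros A_deriv[OF assms] simp: algebra_simps)
  also have "(\<Sum>m=1..M. \<Sum>i\<le>k. \<Sum>j\<le>k. (A' m i x * A m j x + A m i x * A' m j x) * integral (slab m) (\<lambda>t. t ^ i * t ^ j))
     = (\<Sum>m=1..M. integral (slab m) (\<lambda>t. Ux m t x * U m t x) + integral (slab m) (\<lambda>t. U m t x * Ux m t x))"
    unfolding U_def Ux_def tpoly_product_integral
    by (simp add: sum.distrib distrib_right)
  also have "\<dots> = 2 * (\<Sum>m=1..M. integral (slab m) (\<lambda>t. Ux m t x * U m t x))"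
    by (simp add: sum_distrib_left mult.commute)
  finally show ?thesis .
qed

lemma mass_ftc:
  assumes "a \<le> x" "x \<le> y" "y \<le> c0"
  shows "((\<lambda>x. 2 * (\<Sum>m=1..M. integral (slab m) (\<lambda>t. Ux m t x * U m t x))) has_integral mass y - mass x) {x..y}"
  by (rule fundamental_theorem_of_calculus_interior_strong[OF N])
     (use assms mass_derivative in \<open>auto intro: mass_continuous simp: has_real_derivative_iff_has_vector_derivative[symmetric]\<close>)

text \<open>The time derivative and the jumps telescope over the slabs.\<close>

lemma time_energy:
  "(\<Sum>m=1..M. integral (slab m) (\<lambda>t. Ut m t x * U m t x) + jump m x * U m (start m) x)
   = ((U_fin x)\<^sup>2 + (\<Sum>m=1..M. (jump m x)\<^sup>2)) / 2"
proof -
  have slab: "integral (slab m) (\<lambda>t. Ut m t x * U m t x) = ((U m (start m + h) x)\<^sup>2 - (U m (start m) x)\<^sup>2) / 2" for m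
  proof -
    have "((\<lambda>t. Ut m t x * U m t x) has_integral (U m (start m + h) x)\<^sup>2 / 2 - (U m (start m) x)\<^sup>2 / 2) (slab m)"
      by (rule fundamental_theorem_of_calculus)
         (use h in \<open>auto simp: has_real_derivative_iff_has_vector_derivative[symmetric] U_def Ut_def intro!: derivative_eq_intros\<close>)
    then show ?thesis by (simp add: integral_unique diff_divide_distrib)
  qed
  have "(\<Sum>m=1..n. integral (slab m) (\<lambda>t. Ut m t x * U m t x) + jump m x * U m (start m) x)
     = (if n = 0 then 0 else (U n (start n + h) x)\<^sup>2 / 2) + (\<Sum>m=1..n. (jump m x)\<^sup>2) / 2" for n
  proof (induction n)
    case (Suc n)
    have "(prev (Suc n) x)\<^sup>2 = (if n = 0 then 0 else (U n (start n + h) x)\<^sup>2)" by (simp add: prev_def start_Suc)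
    moreover have "jump (Suc n) x * U (Suc n) (start (Suc n)) x
      = ((U (Suc n) (start (Suc n)) x)\<^sup>2 + (jump (Suc n) x)\<^sup>2 - (prev (Suc n) x)\<^sup>2) / 2"
      by (simp add: jump_def power2_eq_square algebra_simps)
    ultimately show ?case using Suc slab[of "Suc n"] by (auto simp: field_simps)
  qed simp
  from this[of M] M show ?thesis by (simp add: U_fin_def add_divide_distrib)
qed

lemma split_Ux:
  "(\<Sum>m=1..M. integral (slab m) (\<lambda>t. (Ut m t x + Ux m t x) * U m t x) + jump m x * U m (start m) x)
   = (\<Sum>m=1..M. integral (slab m) (\<lambda>t. Ux m t x * U m t x)) + ((U_fin x)\<^sup>2 + (\<Sum>m=1..M. (jump m x)\<^sup>2)) / 2"
proof -
  have "integral (slab m) (\<lambda>t. (Ut m t x + Ux m t x) * U m t x)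
     = integral (slab m) (\<lambda>t. Ut m t x * U m t x) + integral (slab m) (\<lambda>t. Ux m t x * U m t x)" for m
    by (subst integral_add[symmetric]) (auto intro!: integrable_continuous_real continuous_intros simp: distrib_right)
  then show ?thesis using time_energy[of x] by (simp add: sum.distrib)
qed

lemma U_fin_continuous: "continuous_on S U_fin"
  unfolding U_fin_def [abs_def] by (rule U_continuous)

text \<open>
  Testing with \<open>U\<close> controls the flux through \<open>p\<close>, which is the mass, and the final values; the
  jumps and the stabilizing term have the right sign. There is no contribution from \<open>a\<close>, where \<open>U\<close>
  vanishes.
\<close>

lemma energy_lower:
  assumes "a \<le> p" "p \<le> c0"
  shows "mass p / 2 + integral {a..p} (\<lambda>x. (U_fin x)\<^sup>2) / 2 \<le> integral {a..p} energy_form"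
proof -
  have low: "(\<Sum>m=1..M. integral (slab m) (\<lambda>t. Ux m t x * U m t x)) + (U_fin x)\<^sup>2 / 2 \<le> energy_form x" for x
  proof -
    have "energy_form x = (\<Sum>m=1..M. integral (slab m) (\<lambda>t. (Ut m t x + Ux m t x) * U m t x) + jump m x * U m (start m) x)
       + \<delta>0 * h * (\<Sum>m=1..M. integral (slab m) (\<lambda>t. Q m t x))"
      unfolding energy_form_def
      by (subst integral_add) (auto intro!: integrable_continuous_real continuous_intros simp: sum.distrib sum_distrib_left)
    moreover have "0 \<le> \<delta>0 * h * (\<Sum>m=1..M. integral (slab m) (\<lambda>t. Q m t x))"
      using \<delta>0 h by (intro mult_nonneg_nonneg sum_nonneg int_Q_nonneg) auto
    moreover have "0 \<le> (\<Sum>m=1..M. (jump m x)\<^sup>2)" by (intro sum_nonneg) auto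
    moreover have "u + f / 2 \<le> e" if "e = s + q" "0 \<le> q" "0 \<le> j" "s = u + (f + j) / 2" for e s q j u f :: real
      using that by (simp add: field_simps)
    ultimately show ?thesis using split_Ux[of x] by blast
  qed
  have "(\<lambda>x. jump m x * U m (start m) x) integrable_on {a..p}" for m
    by (intro integrable_continuous_real continuous_intros jump_continuous U_continuous)
  then have energy: "energy_form integrable_on {a..p}"
    unfolding energy_form_def [abs_def]
    by (intro integrable_sum integrable_add regular_integral(1) regular_add regular_mult regular_const regular_U regular_Q) auto
  have ftc: "((\<lambda>x. \<Sum>m=1..M. integral (slab m) (\<lambda>t. Ux m t x * U m t x)) has_integral mass p / 2) {a..p}"
    using has_integral_mult_right[OF mass_ftc[of a p], of "1/2"] assms mass_a by simp
  have fin: "((\<lambda>x. (U_fin x)\<^sup>2 / 2) has_integral integral {a..p} (\<lambda>x. (U_fin x)\<^sup>2) / 2) {a..p}"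
    by (intro has_integral_divide integrable_integral integrable_continuous_real continuous_intros U_fin_continuous)
  show ?thesis
    by (rule has_integral_le[OF has_integral_add[OF ftc fin] integrable_integral[OF energy]]) (rule low)
qed

definition "C1 = 8 * (1 + 2 * \<delta>0 * (Ci + 1) + Ci) * (2 + \<delta>0)"

text \<open>
  The stabilizing term is a nonnegative quadratic form in both cases of \<open>\<kappa>\<close>, so that it satisfies
  a Cauchy-Schwarz inequality.
\<close>

lemma form_young:
  assumes "0 < \<epsilon>"
  shows "- 2 * (Ut m t x * gt + \<kappa> * (Ut m t x * gx + Ux m t x * gt) + Ux m t x * gx) \<le> Q m t x / \<epsilon> + 2 * \<epsilon> * (gt\<^sup>2 + gx\<^sup>2)"
  using \<kappa>
proof
  assume \<kappa>: "\<kappa> = 0"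
  have "- 2 * (Ut m t x * gt) \<le> (Ut m t x)\<^sup>2 / \<epsilon> + \<epsilon> * gt\<^sup>2" "- 2 * (Ux m t x * gx) \<le> (Ux m t x)\<^sup>2 / \<epsilon> + \<epsilon> * gx\<^sup>2"
    using young[OF assms, of gt "- Ut m t x"] young[OF assms, of gx "- Ux m t x"] by (auto simp: mult.commute)
  moreover have "0 \<le> \<epsilon> * gt\<^sup>2" "0 \<le> \<epsilon> * gx\<^sup>2" using assms by auto
  ultimately show ?thesis unfolding Q_def by (simp add: \<kappa> add_divide_distrib distrib_left)
next
  assume \<kappa>: "\<kappa> = 1"
  define X where "X = Ut m t x + Ux m t x"
  have "Ut m t x * gt + \<kappa> * (Ut m t x * gx + Ux m t x * gt) + Ux m t x * gx = (gt + gx) * X"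
    by (simp add: \<kappa> X_def algebra_simps)
  moreover have "Q m t x = X\<^sup>2" unfolding Q_def by (simp add: \<kappa> X_def power2_sum)
  moreover have "\<epsilon> * (gt + gx)\<^sup>2 \<le> \<epsilon> * (2 * (gt\<^sup>2 + gx\<^sup>2))"
    using sum_squares_bound[of gt gx] assms by (intro mult_left_mono) (auto simp: power2_sum)
  ultimately show ?thesis using young[OF assms, of "gt + gx" "- X"] by (simp add: algebra_simps)
qed

text \<open>
  The scheme is tested with \<open>U\<close> upstream of \<open>p\<close>, continued by a ramp of length between \<open>h\<close> and \<open>2
  h\<close>. The first part contains the mass at \<open>p\<close>. On the ramp the test function and its derivatives
  are controlled by the trace \<open>U m t p\<close>: its time derivative by the inverse inequality, its slope
  since the ramp is not shorter than \<open>h\<close>. As the ramp is not longer than \<open>2 h\<close>, these terms add up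
  to a multiple of the mass, which can be made small by the choice of \<open>\<epsilon>\<close>.
\<close>

lemma mass_at_node:
  assumes p: "a \<le> p" "p \<le> c0" and q: "q \<le> c0" "h \<le> q - p" "q - p \<le> 2 * h"
    and cut: "integral {a..p} energy_form + integral {p..q} (cut_form p q) = 0"
  shows "mass p + integral {a..p} (\<lambda>x. (U_fin x)\<^sup>2) \<le> C1 * integral {p..q} defect"
proof -
  define c where "c = 1 + 2 * \<delta>0 * (Ci + 1) + Ci"
  \<comment> \<open>With this choice the mass on the right-hand side has the factor \<open>2 h \<sqdot> \<epsilon> c / h = 1 / 2\<close>.\<close>
  define \<epsilon> where "\<epsilon> = 1 / (4 * c)"
  have "c > 0" using \<delta>0 Ci by (auto simp: c_def intro!: add_pos_pos)
  then have \<epsilon>: "\<epsilon> > 0" "\<epsilon> * c = 1 / 4" by (auto simp: \<epsilon>_def)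
  have pq: "p < q" using q h by linarith
  have point: "- 2 * cut_form p q x \<le> (2 + \<delta>0) / \<epsilon> * defect x + \<epsilon> / h * c * mass p" if x: "x \<in> {p..q}" for x
  proof -
    define w where "w = (q - x) / (q - p)"
    have w: "0 \<le> w" "w \<le> 1" using x pq by (auto simp: w_def)
    then have w2: "w\<^sup>2 \<le> 1" by (simp add: power_le_one)
    have wle: "(y * w)\<^sup>2 \<le> y\<^sup>2" for y :: real
      using mult_left_mono[OF w2, of "y\<^sup>2"] by (simp add: power_mult_distrib)
    define d where "d = q - p"
    have d: "h \<le> d" "0 < d" using q pq by (auto simp: d_def)
    define G where "G m t = (Ut m t x + Ux m t x) * (U m t p * w)
     + \<delta>0 * h * (Ut m t x * (Ut m t p * w)
        + \<kappa> * (Ut m t x * (- (U m t p / d)) + Ux m t x * (Ut m t p * w))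
        + Ux m t x * (- (U m t p / d)))" for m t
    have cG: "continuous_on S (G m)" for S m unfolding G_def by (intro continuous_intros) (use d in auto)
    have form: "cut_form p q x = (\<Sum>m=1..M. integral (slab m) (G m) + jump m x * (U m (start m) p * w))"
      by (simp add: cut_form_def Let_def w_def d_def G_def [abs_def])
    have G: "- 2 * G m t \<le> (2 + \<delta>0) * h / \<epsilon> * Q m t x + \<epsilon> / h * (1 + 2 * \<delta>0) * (U m t p)\<^sup>2 + 2 * \<epsilon> * \<delta>0 * h * (Ut m t p)\<^sup>2" for m t
    proof -
      have "- 2 * ((Ut m t x + Ux m t x) * (U m t p * w)) \<le> (h / \<epsilon>) * (Ut m t x + Ux m t x)\<^sup>2 + (U m t p * w)\<^sup>2 / (h / \<epsilon>)"
        using young[of "h / \<epsilon>" "Ut m t x + Ux m t x" "- (U m t p * w)"] h \<epsilon> by simp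
      also have "\<dots> \<le> (h / \<epsilon>) * (2 * Q m t x) + (U m t p)\<^sup>2 / (h / \<epsilon>)"
        using h \<epsilon> by (intro add_mono mult_left_mono divide_right_mono Q_bound wle) auto
      finally have 1: "- 2 * ((Ut m t x + Ux m t x) * (U m t p * w)) \<le> 2 * h / \<epsilon> * Q m t x + \<epsilon> / h * (U m t p)\<^sup>2"
        by (simp add: mult_ac)
      have "(- (U m t p / d))\<^sup>2 \<le> (U m t p)\<^sup>2 / h\<^sup>2"
        using d h by (auto simp: power_divide intro!: divide_left_mono power_mono mult_pos_pos)
      then have "2 * \<epsilon> * ((Ut m t p * w)\<^sup>2 + (- (U m t p / d))\<^sup>2) \<le> 2 * \<epsilon> * ((Ut m t p)\<^sup>2 + (U m t p)\<^sup>2 / h\<^sup>2)"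
        using \<epsilon> wle by (intro mult_left_mono add_mono) auto
      with form_young[OF \<epsilon>(1), of m t x "Ut m t p * w" "- (U m t p / d)"]
      have "- 2 * (Ut m t x * (Ut m t p * w)
        + \<kappa> * (Ut m t x * (- (U m t p / d)) + Ux m t x * (Ut m t p * w))
        + Ux m t x * (- (U m t p / d))) \<le> Q m t x / \<epsilon> + 2 * \<epsilon> * ((Ut m t p)\<^sup>2 + (U m t p)\<^sup>2 / h\<^sup>2)"
        by linarith
      from mult_left_mono[OF this, of "\<delta>0 * h"] \<delta>0 h
      have "- 2 * (\<delta>0 * h * (Ut m t x * (Ut m t p * w)
        + \<kappa> * (Ut m t x * (- (U m t p / d)) + Ux m t x * (Ut m t p * w))
        + Ux m t x * (- (U m t p / d)))) \<le> \<delta>0 * h * (Q m t x / \<epsilon> + 2 * \<epsilon> * ((Ut m t p)\<^sup>2 + (U m t p)\<^sup>2 / h\<^sup>2))"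
        by (simp add: mult_ac)
      also have "\<dots> = \<delta>0 * h / \<epsilon> * Q m t x + 2 * \<epsilon> * \<delta>0 * h * (Ut m t p)\<^sup>2 + \<epsilon> / h * (2 * \<delta>0) * (U m t p)\<^sup>2"
        using h by (simp add: power2_eq_square field_simps)
      finally have 2: "- 2 * (\<delta>0 * h * (Ut m t x * (Ut m t p * w)
        + \<kappa> * (Ut m t x * (- (U m t p / d)) + Ux m t x * (Ut m t p * w))
        + Ux m t x * (- (U m t p / d)))) \<le> \<delta>0 * h / \<epsilon> * Q m t x + 2 * \<epsilon> * \<delta>0 * h * (Ut m t p)\<^sup>2 + \<epsilon> / h * (2 * \<delta>0) * (U m t p)\<^sup>2" .
      have "- 2 * G m t = - 2 * ((Ut m t x + Ux m t x) * (U m t p * w)) + - 2 * (\<delta>0 * h * (Ut m t x * (Ut m t p * w)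
        + \<kappa> * (Ut m t x * (- (U m t p / d)) + Ux m t x * (Ut m t p * w))
        + Ux m t x * (- (U m t p / d))))"
        unfolding G_def by (rule distrib_left)
      also have "\<dots> \<le> (2 * h / \<epsilon> * Q m t x + \<epsilon> / h * (U m t p)\<^sup>2)
        + (\<delta>0 * h / \<epsilon> * Q m t x + 2 * \<epsilon> * \<delta>0 * h * (Ut m t p)\<^sup>2 + \<epsilon> / h * (2 * \<delta>0) * (U m t p)\<^sup>2)"
        by (rule add_mono[OF 1 2])
      also have "\<dots> = (2 + \<delta>0) * h / \<epsilon> * Q m t x + \<epsilon> / h * (1 + 2 * \<delta>0) * (U m t p)\<^sup>2 + 2 * \<epsilon> * \<delta>0 * h * (Ut m t p)\<^sup>2"
        by (simp add: algebra_simps add_divide_distrib)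
      finally show ?thesis .
    qed
    have m: "- 2 * (integral (slab m) (G m) + jump m x * (U m (start m) p * w))
      \<le> (2 + \<delta>0) / \<epsilon> * (h * integral (slab m) (\<lambda>t. Q m t x) + (jump m x)\<^sup>2) + \<epsilon> / h * c * integral (slab m) (\<lambda>t. (U m t p)\<^sup>2)" for m
    proof -
      let ?I = "integral (slab m) (\<lambda>t. (U m t p)\<^sup>2)"
      have "- 2 * integral (slab m) (G m) = integral (slab m) (\<lambda>t. - 2 * G m t)" by simp
      also have "\<dots> \<le> integral (slab m) (\<lambda>t. (2 + \<delta>0) * h / \<epsilon> * Q m t x + \<epsilon> / h * (1 + 2 * \<delta>0) * (U m t p)\<^sup>2 + 2 * \<epsilon> * \<delta>0 * h * (Ut m t p)\<^sup>2)"
        by (intro integral_le integrable_continuous_real continuous_intros cG G) (use h \<epsilon> in auto)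
      also have "\<dots> = (2 + \<delta>0) * h / \<epsilon> * integral (slab m) (\<lambda>t. Q m t x) + \<epsilon> / h * (1 + 2 * \<delta>0) * ?I
          + 2 * \<epsilon> * \<delta>0 * h * integral (slab m) (\<lambda>t. (Ut m t p)\<^sup>2)"
        by (subst integral_add; (subst integral_add)?) (use h \<epsilon> in \<open>auto intro!: integrable_continuous_real continuous_intros\<close>)
      also have "\<dots> \<le> (2 + \<delta>0) * h / \<epsilon> * integral (slab m) (\<lambda>t. Q m t x) + \<epsilon> / h * (1 + 2 * \<delta>0) * ?I
          + 2 * \<epsilon> * \<delta>0 * h * (Ci / h\<^sup>2 * ?I)"
        unfolding U_def Ut_def using \<epsilon> \<delta>0 h by (intro add_left_mono mult_left_mono deriv_inverse) auto
      finally have 1: "- 2 * integral (slab m) (G m) \<le> (2 + \<delta>0) * h / \<epsilon> * integral (slab m) (\<lambda>t. Q m t x) + \<epsilon> / h * (1 + 2 * \<delta>0) * ?I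
          + 2 * \<epsilon> * \<delta>0 * h * (Ci / h\<^sup>2 * ?I)" .
      have "- 2 * (jump m x * (U m (start m) p * w)) \<le> (jump m x)\<^sup>2 / \<epsilon> + \<epsilon> * (U m (start m) p * w)\<^sup>2"
        using young[OF \<epsilon>(1), of "U m (start m) p * w" "- jump m x"] by (simp add: mult.commute)
      also have "\<dots> \<le> (jump m x)\<^sup>2 / \<epsilon> + \<epsilon> * (Ci / h * ?I)"
        using \<epsilon> by (intro add_left_mono mult_left_mono order_trans[OF wle]) (use trace_inverse[of "\<lambda>i. A m i p" "start m"] in \<open>auto simp: U_def\<close>)
      also have "\<dots> \<le> (2 + \<delta>0) / \<epsilon> * (jump m x)\<^sup>2 + \<epsilon> * (Ci / h * ?I)"
        using mult_right_mono[of 1 "2 + \<delta>0" "(jump m x)\<^sup>2 / \<epsilon>"] \<epsilon> \<delta>0 by (simp add: mult.assoc)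
      finally have 2: "- 2 * (jump m x * (U m (start m) p * w)) \<le> (2 + \<delta>0) / \<epsilon> * (jump m x)\<^sup>2 + \<epsilon> * (Ci / h * ?I)" .
      have 3: "\<epsilon> / h * (1 + 2 * \<delta>0) * ?I + 2 * \<epsilon> * \<delta>0 * h * (Ci / h\<^sup>2 * ?I) + \<epsilon> * (Ci / h * ?I) = \<epsilon> / h * c * ?I"
        using h by (simp add: c_def power2_eq_square field_simps)
      show ?thesis using 1 2 3 by (simp add: distrib_left mult.assoc)
    qed
    have "- 2 * cut_form p q x = (\<Sum>m=1..M. - 2 * (integral (slab m) (G m) + jump m x * (U m (start m) p * w)))"
      by (simp add: form sum_distrib_left)
    also have "\<dots> \<le> (\<Sum>m=1..M. (2 + \<delta>0) / \<epsilon> * (h * integral (slab m) (\<lambda>t. Q m t x) + (jump m x)\<^sup>2) + \<epsilon> / h * c * integral (slab m) (\<lambda>t. (U m t p)\<^sup>2))"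
      by (intro sum_mono m)
    also have "\<dots> = (2 + \<delta>0) / \<epsilon> * defect x + \<epsilon> / h * c * mass p"
      unfolding defect_def mass_def by (subst sum.distrib) (simp only: sum_distrib_left)
    finally show ?thesis .
  qed
  have cut_int: "cut_form p q integrable_on {p..q}"
  proof -
    have t: "regular {c..d} {p..q} (\<lambda>t x. U m t p)" "regular {c..d} {p..q} (\<lambda>t x. Ut m t p)" for m c d
      by (intro regular_time continuous_intros)+
    have w: "regular I {p..q} (\<lambda>t x. (q - x) / (q - p))" for I
      by (intro regular_continuous_space continuous_intros) (use pq in auto)
    have ut: "regular {c..d} {p..q} (\<lambda>t x. U m t p / (q - p))" for m c d
      by (intro regular_time continuous_intros) (use pq in auto)
    have "(\<lambda>x. jump m x * (U m (start m) p * ((q - x) / (q - p)))) integrable_on {p..q}" for m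
      by (intro integrable_continuous_real continuous_intros jump_continuous) (use pq in auto)
    then show ?thesis
      unfolding cut_form_def [abs_def] Let_def
      by (intro integrable_sum integrable_add regular_integral(1) regular_add regular_mult regular_minus regular_const regular_U t w ut) auto
  qed
  have "- 2 * integral {p..q} (cut_form p q) = integral {p..q} (\<lambda>x. - 2 * cut_form p q x)" by simp
  also have "\<dots> \<le> integral {p..q} (\<lambda>x. (2 + \<delta>0) / \<epsilon> * defect x + \<epsilon> / h * c * mass p)"
    by (rule integral_le[OF _ _ point])
       (intro integrable_on_mult_right cut_int integrable_add defect_integrable integrable_const_ivl | assumption)+
  also have "\<dots> = integral {p..q} (\<lambda>x. (2 + \<delta>0) / \<epsilon> * defect x) + integral {p..q} (\<lambda>x. \<epsilon> / h * c * mass p)"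
    by (rule integral_add) (intro integrable_on_mult_right defect_integrable integrable_const_ivl)+
  also have "\<dots> = (2 + \<delta>0) / \<epsilon> * integral {p..q} defect + (q - p) * (\<epsilon> / h * c * mass p)"
    using pq by simp
  also have "\<dots> \<le> (2 + \<delta>0) / \<epsilon> * integral {p..q} defect + 2 * h * (\<epsilon> / h * c * mass p)"
    using q \<epsilon> \<open>c > 0\<close> h mass_nonneg by (intro add_left_mono mult_right_mono) auto
  also have "2 * h * (\<epsilon> / h * c * mass p) = mass p / 2" using h \<epsilon>(2) by (simp add: mult.assoc)
  finally have "- 2 * integral {p..q} (cut_form p q) \<le> (2 + \<delta>0) / \<epsilon> * integral {p..q} defect + mass p / 2" .
  moreover have "0 \<le> integral {a..p} (\<lambda>x. (U_fin x)\<^sup>2)"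
    by (intro integral_nonneg integrable_continuous_real continuous_intros U_fin_continuous) auto
  moreover have "2 * ((2 + \<delta>0) / \<epsilon> * integral {p..q} defect) = C1 * integral {p..q} defect"
    by (simp add: C1_def \<epsilon>_def c_def[symmetric])
  moreover have "u + f \<le> 2 * d" if "- 2 * y \<le> d + u / 2" "0 \<le> f" "u / 2 + f / 2 \<le> e" "e + y = 0" for u f d e y :: real
    using that by linarith
  ultimately show ?thesis using energy_lower[OF p] cut by metis
qed

definition "C2 = 2 * (C1 + 5 + 4 * Ci)"

lemma C1_pos: "0 < C1" using \<delta>0 Ci by (auto simp: C1_def intro!: mult_pos_pos add_pos_pos)

text \<open>
  Points that are not nodes are compared with the next node. The derivative of the mass is bounded
  by the defect, the final value and the mass itself divided by \<open>2 h\<close>; over a distance of at most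
  \<open>h\<close> the latter is half of the maximal mass, which is absorbed by taking \<open>y\<close> to be the point of
  the maximum.
\<close>

lemma mass_before_node:
  assumes x: "a \<le> x" "x \<le> p" "p \<le> x + h" and p: "p \<le> c0"
  shows "mass x \<le> 2 * (mass p + integral {x..p} (\<lambda>x. (U_fin x)\<^sup>2) + (5 + 4 * Ci) * integral {x..p} defect)"
proof -
  define \<epsilon> where "\<epsilon> = 1 / (2 * (1 + Ci))"
  have \<epsilon>: "\<epsilon> > 0" "\<epsilon> * (1 + Ci) = 1 / 2" "1 + 2 / \<epsilon> = 5 + 4 * Ci" using Ci by (auto simp: \<epsilon>_def)
  define Ux_term where "Ux_term y = (\<Sum>m=1..M. integral (slab m) (\<lambda>t. Ux m t y * U m t y))" for y
  have point: "- 2 * Ux_term y \<le> (U_fin y)\<^sup>2 + (5 + 4 * Ci) * defect y + mass y / (2 * h)" for y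
  proof -
    have m: "- 2 * (integral (slab m) (\<lambda>t. (Ut m t y + Ux m t y) * U m t y) + jump m y * U m (start m) y)
      \<le> 2 / \<epsilon> * (h * integral (slab m) (\<lambda>t. Q m t y) + (jump m y)\<^sup>2) + integral (slab m) (\<lambda>t. (U m t y)\<^sup>2) / (2 * h)" for m
    proof -
      let ?I = "integral (slab m) (\<lambda>t. (U m t y)\<^sup>2)"
      have "- 2 * integral (slab m) (\<lambda>t. (Ut m t y + Ux m t y) * U m t y) = integral (slab m) (\<lambda>t. - 2 * ((Ut m t y + Ux m t y) * U m t y))"
        by simp
      also have "\<dots> \<le> integral (slab m) (\<lambda>t. 2 * h / \<epsilon> * Q m t y + \<epsilon> / h * (U m t y)\<^sup>2)"
      proof (intro integral_le integrable_continuous_real continuous_intros)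
        fix t
        have "- 2 * ((Ut m t y + Ux m t y) * U m t y) \<le> (h / \<epsilon>) * (Ut m t y + Ux m t y)\<^sup>2 + (U m t y)\<^sup>2 / (h / \<epsilon>)"
          using young[of "h / \<epsilon>" "Ut m t y + Ux m t y" "- U m t y"] h \<epsilon> by simp
        also have "\<dots> \<le> (h / \<epsilon>) * (2 * Q m t y) + (U m t y)\<^sup>2 / (h / \<epsilon>)"
          using h \<epsilon> by (intro add_mono mult_left_mono Q_bound) auto
        finally show "- 2 * ((Ut m t y + Ux m t y) * U m t y) \<le> 2 * h / \<epsilon> * Q m t y + \<epsilon> / h * (U m t y)\<^sup>2"
          by (simp add: mult_ac)
      qed
      also have "\<dots> = 2 * h / \<epsilon> * integral (slab m) (\<lambda>t. Q m t y) + \<epsilon> / h * ?I"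
        by (subst integral_add) (use h \<epsilon> in \<open>auto intro!: integrable_continuous_real continuous_intros\<close>)
      finally have 1: "- 2 * integral (slab m) (\<lambda>t. (Ut m t y + Ux m t y) * U m t y) \<le> 2 * h / \<epsilon> * integral (slab m) (\<lambda>t. Q m t y) + \<epsilon> / h * ?I" .
      have "- 2 * (jump m y * U m (start m) y) \<le> (jump m y)\<^sup>2 / \<epsilon> + \<epsilon> * (U m (start m) y)\<^sup>2"
        using young[OF \<epsilon>(1), of "U m (start m) y" "- jump m y"] by (simp add: mult.commute)
      also have "\<dots> \<le> 2 * ((jump m y)\<^sup>2 / \<epsilon>) + \<epsilon> * (Ci / h * ?I)"
      proof (intro add_mono mult_left_mono)
        have "0 \<le> (jump m y)\<^sup>2 / \<epsilon>" using \<epsilon> by simp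
        then show "(jump m y)\<^sup>2 / \<epsilon> \<le> 2 * ((jump m y)\<^sup>2 / \<epsilon>)" by linarith
      qed (use \<epsilon> trace_inverse[of "\<lambda>i. A m i y" "start m"] in \<open>auto simp: U_def\<close>)
      finally have 2: "- 2 * (jump m y * U m (start m) y) \<le> 2 * ((jump m y)\<^sup>2 / \<epsilon>) + \<epsilon> * (Ci / h * ?I)" .
      have 3: "\<epsilon> / h * ?I + \<epsilon> * (Ci / h * ?I) = ?I / (2 * h)"
      proof -
        have "\<epsilon> / h * ?I + \<epsilon> * (Ci / h * ?I) = (\<epsilon> * (1 + Ci)) * ?I / h" by (simp add: algebra_simps add_divide_distrib)
        then show ?thesis by (simp add: \<epsilon>(2))
      qed
      show ?thesis using 1 2 3 by (simp add: distrib_left mult.assoc)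
    qed
    have J: "(\<Sum>m=1..M. (jump m y)\<^sup>2) \<le> defect y"
      unfolding defect_def using h by (intro sum_mono) (simp add: int_Q_nonneg)
    define X where "X = (\<Sum>m=1..M. integral (slab m) (\<lambda>t. (Ut m t y + Ux m t y) * U m t y) + jump m y * U m (start m) y)"
    have "- 2 * X \<le> (\<Sum>m=1..M. 2 / \<epsilon> * (h * integral (slab m) (\<lambda>t. Q m t y) + (jump m y)\<^sup>2) + integral (slab m) (\<lambda>t. (U m t y)\<^sup>2) / (2 * h))"
      unfolding X_def sum_distrib_left by (intro sum_mono m)
    also have "\<dots> = 2 / \<epsilon> * defect y + mass y / (2 * h)"
      unfolding defect_def mass_def by (subst sum.distrib) (simp only: sum_distrib_left sum_divide_distrib)
    finally have "- 2 * X \<le> 2 / \<epsilon> * defect y + mass y / (2 * h)" .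
    moreover have "X = Ux_term y + ((U_fin y)\<^sup>2 + (\<Sum>m=1..M. (jump m y)\<^sup>2)) / 2"
      unfolding X_def Ux_term_def by (rule split_Ux)
    moreover have "(1 + 2 / \<epsilon>) * defect y = defect y + 2 / \<epsilon> * defect y" by (simp add: distrib_right)
    ultimately show ?thesis using J unfolding \<epsilon>(3) by (simp add: field_simps)
  qed
  have "\<exists>y\<in>{x..p}. \<forall>z\<in>{x..p}. mass z \<le> mass y"
    by (rule continuous_attains_sup) (use x mass_continuous in auto)
  then obtain y where y: "y \<in> {x..p}" "\<And>z. z \<in> {x..p} \<Longrightarrow> mass z \<le> mass y" by blast
  have ftc: "((\<lambda>z. - 2 * Ux_term z) has_integral mass y - mass p) {y..p}"
    using has_integral_neg[OF mass_ftc[of y p]] x y p by (simp add: Ux_term_def)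
  have int: "(\<lambda>z. (U_fin z)\<^sup>2) integrable_on {u..v}" for u v
    by (intro integrable_continuous_real continuous_intros U_fin_continuous)
  have "((\<lambda>z. (U_fin z)\<^sup>2 + (5 + 4 * Ci) * defect z + mass y / (2 * h)) has_integral
     integral {y..p} (\<lambda>z. (U_fin z)\<^sup>2) + (5 + 4 * Ci) * integral {y..p} defect + (p - y) * (mass y / (2 * h))) {y..p}"
    using y by (intro has_integral_add has_integral_mult_right integrable_integral int defect_integrable)
      (auto intro!: has_integral_const_real[of _ y p, simplified] simp: has_integral_iff)
  from has_integral_le[OF ftc this]
  have "mass y - mass p \<le> integral {y..p} (\<lambda>z. (U_fin z)\<^sup>2) + (5 + 4 * Ci) * integral {y..p} defect + (p - y) * (mass y / (2 * h))"
  proof -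
    assume *: "(\<And>z. z \<in> {y..p} \<Longrightarrow> - 2 * Ux_term z \<le> (U_fin z)\<^sup>2 + (5 + 4 * Ci) * defect z + mass y / (2 * h)) \<Longrightarrow>
      mass y - mass p \<le> integral {y..p} (\<lambda>z. (U_fin z)\<^sup>2) + (5 + 4 * Ci) * integral {y..p} defect + (p - y) * (mass y / (2 * h))"
    show ?thesis
    proof (rule *)
      fix z assume "z \<in> {y..p}"
      then have "mass z / (2 * h) \<le> mass y / (2 * h)" using y h by (intro divide_right_mono) auto
      with point[of z] show "- 2 * Ux_term z \<le> (U_fin z)\<^sup>2 + (5 + 4 * Ci) * defect z + mass y / (2 * h)" by linarith
    qed
  qed
  moreover have "(p - y) * (mass y / (2 * h)) \<le> h * (mass y / (2 * h))"
    using x y h mass_nonneg by (intro mult_right_mono) auto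
  moreover have "h * (mass y / (2 * h)) = mass y / 2" using h by simp
  moreover have "integral {y..p} (\<lambda>z. (U_fin z)\<^sup>2) \<le> integral {x..p} (\<lambda>z. (U_fin z)\<^sup>2)"
    using y by (intro integral_subset_le int) auto
  moreover have "(5 + 4 * Ci) * integral {y..p} defect \<le> (5 + 4 * Ci) * integral {x..p} defect"
    using y Ci by (intro mult_left_mono integral_subset_le defect_integrable) (auto simp: defect_nonneg)
  moreover have "mass x \<le> mass y" using y x by auto
  moreover have "m0 \<le> 2 * (m2 + i2 + d2)"
    if "m1 - m2 \<le> i1 + d1 + r" "r \<le> r'" "r' = m1 / 2" "i1 \<le> i2" "d1 \<le> d2" "m0 \<le> m1" for m0 m1 m2 i1 i2 d1 d2 r r' :: real
    using that by (simp add: field_simps)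
  ultimately show ?thesis by blast
qed

text \<open>
  Two nodes are found within distance \<open>3 h\<close>: \<open>p\<close> after \<open>x\<close> and \<open>q\<close> at distance at least \<open>h\<close> after
  \<open>p\<close>.
\<close>

lemma mass_le_defect:
  assumes x: "a \<le> x" "x + 3 * h \<le> c0"
    and cut: "\<And>p q. p \<in> N \<Longrightarrow> q \<in> N \<Longrightarrow> a \<le> p \<Longrightarrow> p < q \<Longrightarrow> q \<le> c0 \<Longrightarrow> integral {a..p} energy_form + integral {p..q} (cut_form p q) = 0"
  shows "mass x \<le> C2 * integral {x..x + 3 * h} defect"
proof -
  obtain p where p: "p \<in> N" "x \<le> p" "p \<le> x + h" using next_node[of x] x h by auto
  obtain q where q: "q \<in> N" "p + h \<le> q" "q \<le> p + h + h" using next_node[of "p + h"] x p h by auto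
  have I: "integral {a..p} (\<lambda>x. (U_fin x)\<^sup>2) \<ge> integral {x..p} (\<lambda>x. (U_fin x)\<^sup>2)"
    using x by (intro integral_subset_le integrable_continuous_real continuous_intros U_fin_continuous) auto
  have "mass p + integral {a..p} (\<lambda>x. (U_fin x)\<^sup>2) \<le> C1 * integral {p..q} defect"
    by (rule mass_at_node) (use p q x h cut in auto)
  also have "\<dots> \<le> C1 * integral {x..x + 3 * h} defect"
    using p q C1_pos by (intro mult_left_mono integral_subset_le defect_integrable) (auto simp: defect_nonneg)
  finally have 1: "mass p + integral {a..p} (\<lambda>x. (U_fin x)\<^sup>2) \<le> C1 * integral {x..x + 3 * h} defect" .
  have 2: "(5 + 4 * Ci) * integral {x..p} defect \<le> (5 + 4 * Ci) * integral {x..x + 3 * h} defect"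
    using p h Ci by (intro mult_left_mono integral_subset_le defect_integrable) (auto simp: defect_nonneg)
  have "mass x \<le> 2 * (mass p + integral {x..p} (\<lambda>x. (U_fin x)\<^sup>2) + (5 + 4 * Ci) * integral {x..p} defect)"
    by (rule mass_before_node) (use p x h in auto)
  also have "\<dots> \<le> 2 * (C1 * integral {x..x + 3 * h} defect + (5 + 4 * Ci) * integral {x..x + 3 * h} defect)"
    using 1 2 I by simp
  finally show ?thesis by (simp add: C2_def algebra_simps)
qed

text \<open>
  Integrating the pointwise bound gains a factor \<open>h\<close>, because every point lies in a window of
  length \<open>3 h\<close> only for \<open>x\<close> from a set of length \<open>3 h\<close>.
\<close>

lemma upstream_estimate:
  assumes x1: "a \<le> x1" "x1 + 3 * h \<le> c0"
    and cut: "\<And>p q. p \<in> N \<Longrightarrow> q \<in> N \<Longrightarrow> a \<le> p \<Longrightarrow> p < q \<Longrightarrow> q \<le> c0 \<Longrightarrow> integral {a..p} energy_form + integral {p..q} (cut_form p q) = 0"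
  shows "integral {a..x1} mass \<le> 3 * C2 * h * integral {a..c0} defect"
proof -
  define F where "F x = integral {a..x} defect" for x
  have F: "continuous_on {a..b} F" for b
    unfolding F_def [abs_def] by (rule indefinite_integral_continuous_1[OF defect_integrable])
  have Fmono: "F x \<le> F y" if "x \<le> y" for x y
    unfolding F_def using that by (intro integral_subset_le defect_integrable) (auto simp: defect_nonneg)
  have F0: "0 \<le> F x" for x unfolding F_def by (intro integral_nonneg defect_integrable defect_nonneg)
  have Fdiff: "integral {x..x + 3 * h} defect = F (x + 3 * h) - F x" if "a \<le> x" for x
  proof -
    have "integral {a..x} defect + integral {x..x + 3 * h} defect = integral {a..x + 3 * h} defect"
      using that h by (intro Henstock_Kurzweil_Integration.integral_combine defect_integrable) auto
    then show ?thesis by (simp add: F_def)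
  qed
  have C2: "C2 \<ge> 0" using C1_pos Ci by (simp add: C2_def)
  have Fi: "F integrable_on {u..v}" if "a \<le> u" for u v
    by (rule integrable_continuous_real[OF continuous_on_subset[OF F[of v]]]) (use that in auto)
  have sF: "continuous_on {a..x1} (\<lambda>x. F (x + 3 * h))"
    by (rule continuous_on_compose2[OF F[of "x1 + 3 * h"]]) (use h in \<open>auto intro!: continuous_intros\<close>)
  have "integral {a..x1} mass \<le> integral {a..x1} (\<lambda>x. C2 * (F (x + 3 * h) - F x))"
  proof (rule integral_le)
    show "mass integrable_on {a..x1}" by (intro integrable_continuous_real mass_continuous)
    show "(\<lambda>x. C2 * (F (x + 3 * h) - F x)) integrable_on {a..x1}"
      by (intro integrable_continuous_real continuous_intros sF F)
    show "mass x \<le> C2 * (F (x + 3 * h) - F x)" if "x \<in> {a..x1}" for x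
      using mass_le_defect[OF _ _ cut, of x] that x1 by (simp add: Fdiff)
  qed
  also have "\<dots> = C2 * (integral {a..x1} (\<lambda>x. F (x + 3 * h)) - integral {a..x1} F)"
    by (simp add: integral_diff integrable_continuous_real sF F)
  also have "\<dots> \<le> C2 * (3 * h * F c0)"
  proof (rule mult_left_mono[OF _ C2])
    have "integral {a..x1} (\<lambda>x. F (x + 3 * h)) = integral {a + 3 * h..x1 + 3 * h} F"
      using integral_affine_real[of 1 "a + 3 * h" "x1 + 3 * h" F "3 * h"] x1 continuous_on_subset[OF F[of "x1 + 3 * h"]] h
      by (simp add: add.commute)
    moreover have "integral {a..x1} F + integral {x1..x1 + 3 * h} F = integral {a..x1 + 3 * h} F"
      using x1 h Fi by (intro Henstock_Kurzweil_Integration.integral_combine) auto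
    moreover have "integral {a + 3 * h..x1 + 3 * h} F \<le> integral {a..x1 + 3 * h} F"
      using h F0 by (intro integral_subset_le Fi) auto
    moreover have "integral {x1..x1 + 3 * h} F \<le> integral {x1..x1 + 3 * h} (\<lambda>x. F c0)"
      using x1 by (intro integral_le Fi Fmono) auto
    moreover have "integral {x1..x1 + 3 * h} (\<lambda>x. F c0) = 3 * h * F c0" using h by simp
    ultimately show "integral {a..x1} (\<lambda>x. F (x + 3 * h)) - integral {a..x1} F \<le> 3 * h * F c0" by linarith
  qed
  finally show ?thesis by (simp add: F_def mult_ac)
qed

end

section \<open>A scalar transport scheme\<close>

lemma integrable_product:
  fixes f g :: "'a::euclidean_space \<Rightarrow> real"
  assumes "f \<in> borel_measurable borel" "g \<in> borel_measurable borel" "S \<in> sets borel"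
    and "set_integrable lborel S (\<lambda>z. (f z)\<^sup>2)" "set_integrable lborel S (\<lambda>z. (g z)\<^sup>2)"
  shows "set_integrable lborel S (\<lambda>z. f z * g z)"
  unfolding set_integrable_def
proof (rule Bochner_Integration.integrable_bound)
  show "integrable lborel (\<lambda>z. indicator S z *\<^sub>R (f z)\<^sup>2 + indicator S z *\<^sub>R (g z)\<^sup>2)"
    using assms(4,5) by (simp add: set_integrable_def)
  show "(\<lambda>z. indicator S z *\<^sub>R (f z * g z)) \<in> borel_measurable lborel" using assms(1-3) by simp
  show "AE z in lborel. norm (indicator S z *\<^sub>R (f z * g z)) \<le> norm (indicator S z *\<^sub>R (f z)\<^sup>2 + indicator S z *\<^sub>R (g z)\<^sup>2)"
  proof (rule AE_I2)
    fix z
    have "2 * (\<bar>f z\<bar> * \<bar>g z\<bar>) \<le> (f z)\<^sup>2 + (g z)\<^sup>2" using young[of 1 "\<bar>f z\<bar>" "\<bar>g z\<bar>"] by simp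
    moreover have "0 \<le> \<bar>f z\<bar> * \<bar>g z\<bar>" by simp
    ultimately have "\<bar>f z\<bar> * \<bar>g z\<bar> \<le> (f z)\<^sup>2 + (g z)\<^sup>2" by linarith
    then show "norm (indicator S z *\<^sub>R (f z * g z)) \<le> norm (indicator S z *\<^sub>R (f z)\<^sup>2 + indicator S z *\<^sub>R (g z)\<^sup>2)"
      by (auto simp: indicator_def abs_mult)
  qed
qed

text \<open>
  Continuously differentiable functions with their partial derivatives as explicit arguments;
  products with a cutoff that is only continuously differentiable stay in this class.
\<close>

definition C1_function :: "(real \<Rightarrow> real \<Rightarrow> real) \<Rightarrow> (real \<Rightarrow> real \<Rightarrow> real) \<Rightarrow> (real \<Rightarrow> real \<Rightarrow> real) \<Rightarrow> bool" where
  "C1_function \<psi> \<psi>t \<psi>x \<longleftrightarrow>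
     continuous_on UNIV (\<lambda>z. \<psi> (fst z) (snd z)) \<and> continuous_on UNIV (\<lambda>z. \<psi>t (fst z) (snd z)) \<and>
     continuous_on UNIV (\<lambda>z. \<psi>x (fst z) (snd z)) \<and>
     (\<forall>t x. ((\<lambda>s. \<psi> s x) has_real_derivative \<psi>t t x) (at t) \<and> (\<psi> t has_real_derivative \<psi>x t x) (at x))"

lemma C1_functionD:
  assumes "C1_function \<psi> \<psi>t \<psi>x"
  shows "continuous_on S f \<Longrightarrow> continuous_on S g \<Longrightarrow> continuous_on S (\<lambda>z. \<psi> (f z) (g z))"
    and "continuous_on S f \<Longrightarrow> continuous_on S g \<Longrightarrow> continuous_on S (\<lambda>z. \<psi>t (f z) (g z))"
    and "continuous_on S f \<Longrightarrow> continuous_on S g \<Longrightarrow> continuous_on S (\<lambda>z. \<psi>x (f z) (g z))"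
    and "((\<lambda>s. \<psi> s x) has_real_derivative \<psi>t t x) (at t within A)"
    and "(\<psi> t has_real_derivative \<psi>x t x) (at x within A)"
    and "regular {c..d} {a..b} \<psi>" "regular {c..d} {a..b} \<psi>t" "regular {c..d} {a..b} \<psi>x"
proof -
  have *: "continuous_on S (\<lambda>z. F (f z) (g z))"
    if "continuous_on S f" "continuous_on S g" "continuous_on UNIV (\<lambda>z. F (fst z) (snd z))" for F :: "real \<Rightarrow> real \<Rightarrow> real" and f g S
    using continuous_on_compose2[OF that(3) continuous_on_Pair[OF that(1,2)]] by simp
  show "continuous_on S f \<Longrightarrow> continuous_on S g \<Longrightarrow> continuous_on S (\<lambda>z. \<psi> (f z) (g z))"
    "continuous_on S f \<Longrightarrow> continuous_on S g \<Longrightarrow> continuous_on S (\<lambda>z. \<psi>t (f z) (g z))"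
    "continuous_on S f \<Longrightarrow> continuous_on S g \<Longrightarrow> continuous_on S (\<lambda>z. \<psi>x (f z) (g z))"
    using assms * unfolding C1_function_def by blast+
  show "((\<lambda>s. \<psi> s x) has_real_derivative \<psi>t t x) (at t within A)" "(\<psi> t has_real_derivative \<psi>x t x) (at x within A)"
    using assms unfolding C1_function_def by (blast intro: has_field_derivative_at_within)+
  show "regular {c..d} {a..b} \<psi>" "regular {c..d} {a..b} \<psi>t" "regular {c..d} {a..b} \<psi>x"
    using assms regular_continuous unfolding C1_function_def by blast+
qed

lemma C1_function_mult_x:
  assumes "C1_function \<psi> \<psi>t \<psi>x" and \<eta>: "\<And>x. (\<eta> has_real_derivative \<eta>' x) (at x)" and \<eta>': "continuous_on UNIV \<eta>'"
  shows "C1_function (\<lambda>t x. \<eta> x * \<psi> t x) (\<lambda>t x. \<eta> x * \<psi>t t x) (\<lambda>t x. \<eta>' x * \<psi> t x + \<eta> x * \<psi>x t x)"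
proof -
  have "continuous_on UNIV \<eta>" using \<eta> by (intro DERIV_continuous_on) auto
  note c = continuous_on_compose2[OF this continuous_on_snd[OF continuous_on_id] subset_UNIV]
    continuous_on_compose2[OF \<eta>' continuous_on_snd[OF continuous_on_id] subset_UNIV]
  show ?thesis
    unfolding C1_function_def
  proof (intro conjI allI)
    fix t x
    show "((\<lambda>s. \<eta> x * \<psi> s x) has_real_derivative \<eta> x * \<psi>t t x) (at t)"
      by (rule DERIV_cmult[OF C1_functionD(4)[OF assms(1)]])
    show "((\<lambda>x. \<eta> x * \<psi> t x) has_real_derivative \<eta>' x * \<psi> t x + \<eta> x * \<psi>x t x) (at x)"
      using DERIV_mult[OF \<eta> C1_functionD(5)[OF assms(1), of t x UNIV]] by (simp add: mult.commute)
  qed (intro continuous_intros c C1_functionD(1-3)[OF assms(1)])+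
qed

context mesh
begin

lemma regular_tensor:
  assumes "\<And>i. pw0 (B i)"
  shows "regular {c..d} {a..b} (\<lambda>t x. tpoly k (\<lambda>i. B i x) t)" "regular {c..d} {a..b} (\<lambda>t x. tpoly' k (\<lambda>i. B i x) t)"
    "regular {c..d} {a..b} (\<lambda>t x. tpoly k (\<lambda>i. pwd (B i) x) t)"
proof -
  have 1: "regular {c..d} {a..b} (\<lambda>t x. B i x)" for i by (rule regular_continuous_space[OF pw0_continuous[OF assms]])
  have 2: "regular {c..d} {a..b} (\<lambda>t x. pwd (B i) x)" for i
    using pwd_regular(2)[OF assms, of i] regular_space[OF pwd_regular(1)[OF assms, of i]] by blast
  show "regular {c..d} {a..b} (\<lambda>t x. tpoly k (\<lambda>i. B i x) t)" "regular {c..d} {a..b} (\<lambda>t x. tpoly' k (\<lambda>i. B i x) t)"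
    "regular {c..d} {a..b} (\<lambda>t x. tpoly k (\<lambda>i. pwd (B i) x) t)" by (intro regular_tpoly 1 2)+
qed

lemma tensor_derivative_x:
  assumes "\<And>i. pw0 (B i)" "x \<in> {a..b} - nodes"
  shows "((\<lambda>x. tpoly k (\<lambda>i. B i x) t) has_real_derivative tpoly k (\<lambda>i. pwd (B i) x) t) (at x)"
  unfolding tpoly_def by (auto intro!: derivative_eq_intros pw0_derivative[OF assms(1) assms(2)] sum.cong)

lemma tensor_integration_by_parts:
  assumes B: "\<And>i. pw0 (B i)" and \<psi>: "C1_function \<psi> \<psi>t \<psi>x" and cd: "c \<le> d"
  shows "(LINT z:{c..d} \<times> {a..b}|lborel. tpoly' k (\<lambda>i. B i (snd z)) (fst z) * \<psi> (fst z) (snd z) + tpoly k (\<lambda>i. B i (snd z)) (fst z) * \<psi>t (fst z) (snd z))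
      = integral {a..b} (\<lambda>x. tpoly k (\<lambda>i. B i x) d * \<psi> d x - tpoly k (\<lambda>i. B i x) c * \<psi> c x)"
    and "(LINT z:{c..d} \<times> {a..b}|lborel. tpoly k (\<lambda>i. pwd (B i) (snd z)) (fst z) * \<psi> (fst z) (snd z) + tpoly k (\<lambda>i. B i (snd z)) (fst z) * \<psi>x (fst z) (snd z)) = 0"
proof -
  note reg = regular_tensor[OF B, of c d] C1_functionD(6,7,8)[OF \<psi>, of c d a b]
  have t: "integral {c..d} (\<lambda>t. tpoly' k (\<lambda>i. B i x) t * \<psi> t x + tpoly k (\<lambda>i. B i x) t * \<psi>t t x)
      = tpoly k (\<lambda>i. B i x) d * \<psi> d x - tpoly k (\<lambda>i. B i x) c * \<psi> c x" for x
    by (rule integral_unique, rule fundamental_theorem_of_calculus)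
       (use cd in \<open>auto simp: has_real_derivative_iff_has_vector_derivative[symmetric] intro!: derivative_eq_intros C1_functionD(4)[OF \<psi>]\<close>)
  have x: "integral {a..b} (\<lambda>x. tpoly k (\<lambda>i. pwd (B i) x) t * \<psi> t x + tpoly k (\<lambda>i. B i x) t * \<psi>x t x) = 0" for t
  proof -
    have cB: "continuous_on S (\<lambda>x. tpoly k (\<lambda>i. B i x) t)" for S
      unfolding tpoly_def by (intro continuous_intros continuous_on_subset[OF pw0_continuous[OF B]]) auto
    have "((\<lambda>x. tpoly k (\<lambda>i. pwd (B i) x) t * \<psi> t x + tpoly k (\<lambda>i. B i x) t * \<psi>x t x) has_integral
        tpoly k (\<lambda>i. B i b) t * \<psi> t b - tpoly k (\<lambda>i. B i a) t * \<psi> t a) {a..b}"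
      by (rule fundamental_theorem_of_calculus_interior_strong[OF finite_nodes])
         (use ab in \<open>auto simp: has_real_derivative_iff_has_vector_derivative[symmetric]
           intro!: derivative_eq_intros tensor_derivative_x[OF B] C1_functionD(5)[OF \<psi>] continuous_intros cB C1_functionD(1)[OF \<psi>]\<close>)
    moreover have "tpoly k (\<lambda>i. B i a) t = 0" "tpoly k (\<lambda>i. B i b) t = 0"
      using pw0_outside[OF B] by (auto simp: tpoly_def)
    ultimately show ?thesis by (simp add: integral_unique)
  qed
  have r1: "regular {c..d} {a..b} (\<lambda>t x. tpoly' k (\<lambda>i. B i x) t * \<psi> t x + tpoly k (\<lambda>i. B i x) t * \<psi>t t x)"
    and r2: "regular {c..d} {a..b} (\<lambda>t x. tpoly k (\<lambda>i. pwd (B i) x) t * \<psi> t x + tpoly k (\<lambda>i. B i x) t * \<psi>x t x)"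
    by (intro regular_add regular_mult reg)+
  show "(LINT z:{c..d} \<times> {a..b}|lborel. tpoly' k (\<lambda>i. B i (snd z)) (fst z) * \<psi> (fst z) (snd z) + tpoly k (\<lambda>i. B i (snd z)) (fst z) * \<psi>t (fst z) (snd z))
      = integral {a..b} (\<lambda>x. tpoly k (\<lambda>i. B i x) d * \<psi> d x - tpoly k (\<lambda>i. B i x) c * \<psi> c x)"
    using regular_integral(4)[OF r1] by (simp only: t)
  show "(LINT z:{c..d} \<times> {a..b}|lborel. tpoly k (\<lambda>i. pwd (B i) (snd z)) (fst z) * \<psi> (fst z) (snd z) + tpoly k (\<lambda>i. B i (snd z)) (fst z) * \<psi>x (fst z) (snd z)) = 0"
    using regular_integral(5)[OF r2] by (simp only: x integral_0)
qed

end

lemma has_derivative_max0_square: "((\<lambda>u::real. (max 0 u)\<^sup>2) has_real_derivative 2 * max 0 u) (at u)"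
proof -
  consider "u < 0" | "u = 0" | "u > 0" by linarith
  then show ?thesis
  proof cases
    case 1
    have "((\<lambda>u::real. (max 0 u)\<^sup>2) has_real_derivative 0) (at u)"
      by (rule has_field_derivative_transform_within_open[OF DERIV_const[of 0], where S = "{..<0}"]) (use 1 in auto)
    then show ?thesis using 1 by simp
  next
    case 3
    have "((\<lambda>u::real. u\<^sup>2) has_real_derivative 2 * u) (at u)" by (auto intro!: derivative_eq_intros)
    then have "((\<lambda>u::real. (max 0 u)\<^sup>2) has_real_derivative 2 * u) (at u)"
      by (rule has_field_derivative_transform_within_open[where S = "{0<..}"]) (use 3 in auto)
    then show ?thesis using 3 by simp
  next
    case 2
    have "((\<lambda>y::real. (max 0 y)\<^sup>2 / y) \<longlongrightarrow> 0) (at 0)"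
    proof (rule Lim_null_comparison)
      show "\<forall>\<^sub>F y in at 0. norm ((max 0 y)\<^sup>2 / y) \<le> \<bar>y::real\<bar>"
        by (auto simp: eventually_at_filter max_def power2_eq_square)
      show "((\<lambda>y::real. \<bar>y\<bar>) \<longlongrightarrow> 0) (at 0)" by (auto intro!: tendsto_eq_intros)
    qed
    then show ?thesis using 2 by (simp add: has_field_derivative_iff)
  qed
qed

text \<open>
  The scheme for one component. \<open>U\<close> is the discrete component with coefficients \<open>A m i\<close> on slab
  \<open>m\<close>, \<open>w0\<close> the component of the initial value. The three sources \<open>s0\<close>, \<open>s1\<close>, \<open>s2\<close> are the
  components of \<open>b\<close> that occur when the scheme is tested with a multiple \<open>g e\<close> of the direction
  \<open>e\<close>: \<open>s0\<close> belongs to \<open>hat e\<close>, and \<open>s1\<close> and \<open>s2\<close> belong to the stabilizing terms \<open>g\<^sub>t\<close> and \<open>g\<^sub>x\<close>.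
  Accordingly there are three residuals. \<open>\<kappa>\<close> is the coupling of the time and space derivatives in
  the stabilizing term. All data vanish within the distance \<open>d\<close> from the ends.

  \<open>err\<close> is the functional that represents the error in the direction \<open>e\<close> when \<open>\<psi>\<close> is a dual
  solution.
\<close>

locale sd_transport = mesh +
  fixes M :: nat and \<delta>0 \<sigma> \<kappa> d Ci :: real
    and A :: "nat \<Rightarrow> nat \<Rightarrow> real \<Rightarrow> real" and w0 :: "real \<Rightarrow> real" and s0 s1 s2 :: "real \<Rightarrow> real \<Rightarrow> real"
  assumes M: "1 \<le> M" and \<delta>0: "0 < \<delta>0" and \<sigma>: "\<sigma> = 1 \<or> \<sigma> = - 1" and \<kappa>: "\<kappa> = 0 \<or> \<kappa> = \<sigma>"
    and d: "0 < d" "2 * d \<le> b - a" and Ci: "1 \<le> Ci"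
    and trace_inverse: "\<And>c t. (tpoly k c t)\<^sup>2 \<le> Ci / h * integral {t..t + h} (\<lambda>s. (tpoly k c s)\<^sup>2)"
    and deriv_inverse: "\<And>c t. integral {t..t + h} (\<lambda>s. (tpoly' k c s)\<^sup>2) \<le> Ci / h\<^sup>2 * integral {t..t + h} (\<lambda>s. (tpoly k c s)\<^sup>2)"
    and A: "\<And>m i. pw0 (A m i)"
    and w0: "continuous_on UNIV w0" "\<And>x. x \<notin> {a + d..b - d} \<Longrightarrow> w0 x = 0"
    and s_meas: "(\<lambda>z. s0 (fst z) (snd z)) \<in> borel_measurable borel" "(\<lambda>z. s1 (fst z) (snd z)) \<in> borel_measurable borel"
      "(\<lambda>z. s2 (fst z) (snd z)) \<in> borel_measurable borel"
    and s_sq: "\<And>m. m \<in> {1..M} \<Longrightarrow> set_integrable lborel ({(real m - 1) * h..(real m - 1) * h + h} \<times> {a..b}) (\<lambda>z. (s0 (fst z) (snd z))\<^sup>2)"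
      "\<And>m. m \<in> {1..M} \<Longrightarrow> set_integrable lborel ({(real m - 1) * h..(real m - 1) * h + h} \<times> {a..b}) (\<lambda>z. (s1 (fst z) (snd z))\<^sup>2)"
      "\<And>m. m \<in> {1..M} \<Longrightarrow> set_integrable lborel ({(real m - 1) * h..(real m - 1) * h + h} \<times> {a..b}) (\<lambda>z. (s2 (fst z) (snd z))\<^sup>2)"
    and s_supp: "\<And>t x. x \<notin> {a + d..b - d} \<Longrightarrow> s0 t x = 0 \<and> s1 t x = 0 \<and> s2 t x = 0"
begin

definition "start m = (real m - 1) * h"
abbreviation "slab m \<equiv> {start m..start m + h}"
definition "U m t x = tpoly k (\<lambda>i. A m i x) t"
definition "Ut m t x = tpoly' k (\<lambda>i. A m i x) t"
definition "Ux m t x = tpoly k (\<lambda>i. pwd (A m i) x) t"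
definition "r0 m t x = s0 t x - (Ut m t x + \<sigma> * Ux m t x)"
definition "r1 m t x = s1 t x - (Ut m t x + \<kappa> * Ux m t x)"
definition "r2 m t x = s2 t x - (\<kappa> * Ut m t x + Ux m t x)"
definition "prev m x = (if m = 1 then w0 x else U (m - 1) (start m) x)"
definition "jump m x = U m (start m) x - prev m x"

definition SI :: "nat \<Rightarrow> (real \<Rightarrow> real \<Rightarrow> real) \<Rightarrow> real" where
  "SI m F = (LINT z:slab m \<times> {a..b}|lborel. F (fst z) (snd z))"

definition "residual m = SI m (\<lambda>t x. (r0 m t x)\<^sup>2 + (r1 m t x)\<^sup>2 + (r2 m t x)\<^sup>2)"
definition "jump_sq m = integral {a..b} (\<lambda>x. (jump m x)\<^sup>2)"
definition "err m \<psi> = SI m (\<lambda>t x. r0 m t x * \<psi> t x) - integral {a..b} (\<lambda>x. jump m x * \<psi> (start m) x)"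

definition sq :: "nat \<Rightarrow> (real \<Rightarrow> real \<Rightarrow> real) \<Rightarrow> bool" where
  "sq m F \<longleftrightarrow> (\<lambda>z. F (fst z) (snd z)) \<in> borel_measurable borel \<and>
     set_integrable lborel (slab m \<times> {a..b}) (\<lambda>z. (F (fst z) (snd z))\<^sup>2)"

lemma start_Suc: "start (Suc m) = start m + h" by (simp add: start_def algebra_simps)

lemma slab_sets [simp]: "slab m \<times> {a..b} \<in> sets borel" by (intro borel_closed closed_Times) auto

lemma sq_regular: "regular (slab m) {a..b} F \<Longrightarrow> sq m F"
  using regular_integral(3)[OF regular_power[of _ _ F 2]] by (auto simp: sq_def regular_def)

lemma sq_mult_integrable: "sq m F \<Longrightarrow> sq m G \<Longrightarrow> set_integrable lborel (slab m \<times> {a..b}) (\<lambda>z. F (fst z) (snd z) * G (fst z) (snd z))"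
  unfolding sq_def by (intro integrable_product slab_sets) auto

lemma sq_power_integrable: "sq m F \<Longrightarrow> set_integrable lborel (slab m \<times> {a..b}) (\<lambda>z. (F (fst z) (snd z))\<^sup>2)"
  by (simp add: sq_def)

lemma sq_diff:
  assumes "sq m F" "sq m G"
  shows "sq m (\<lambda>t x. F t x - G t x)"
proof -
  have "set_integrable lborel (slab m \<times> {a..b}) (\<lambda>z. (F (fst z) (snd z))\<^sup>2 - 2 * (F (fst z) (snd z) * G (fst z) (snd z)) + (G (fst z) (snd z))\<^sup>2)"
    using assms by (intro set_integral_add set_integral_diff set_integrable_mult_right sq_mult_integrable) (auto simp: sq_def)
  moreover have "(F t x - G t x)\<^sup>2 = (F t x)\<^sup>2 - 2 * (F t x * G t x) + (G t x)\<^sup>2" for t x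
    by (simp add: power2_diff)
  ultimately show ?thesis using assms by (auto simp: sq_def)
qed

lemma regular_U: "regular {x..y} {a..b} (U m)" "regular {x..y} {a..b} (Ut m)" "regular {x..y} {a..b} (Ux m)"
proof -
  have 1: "regular {x..y} {a..b} (\<lambda>t x. A m i x)" for i by (rule regular_continuous_space[OF pw0_continuous[OF A]])
  have 2: "regular {x..y} {a..b} (\<lambda>t x. pwd (A m i) x)" for i
    using pwd_regular(2)[OF A, of m i] regular_space[OF pwd_regular(1)[OF A, of m i]] by blast
  show "regular {x..y} {a..b} (U m)" "regular {x..y} {a..b} (Ut m)" "regular {x..y} {a..b} (Ux m)"
    unfolding U_def [abs_def] Ut_def [abs_def] Ux_def [abs_def] by (intro regular_tpoly 1 2)+
qed

lemma sq_r:
  assumes "m \<in> {1..M}"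
  shows "sq m (r0 m)" "sq m (r1 m)" "sq m (r2 m)"
proof -
  have s: "sq m s0" "sq m s1" "sq m s2" using s_meas s_sq[OF assms] by (simp_all add: sq_def start_def)
  have u: "sq m (\<lambda>t x. Ut m t x + c * Ux m t x)" "sq m (\<lambda>t x. c * Ut m t x + Ux m t x)" for c
    by (intro sq_regular regular_add regular_mult regular_const regular_U)+
  show "sq m (r0 m)" "sq m (r1 m)" "sq m (r2 m)"
    unfolding r0_def [abs_def] r1_def [abs_def] r2_def [abs_def] by (intro sq_diff s u)+
qed

lemma SI_regular:
  assumes "regular (slab m) {a..b} F"
  shows "SI m F = integral {a..b} (\<lambda>x. integral (slab m) (\<lambda>t. F t x))"
    and "SI m F = integral (slab m) (\<lambda>t. integral {a..b} (F t))"
  unfolding SI_def using regular_integral(4,5)[OF assms] by auto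

lemma SI_space:
  assumes "regular (slab m) {a..b} (\<lambda>t x. f x)"
  shows "SI m (\<lambda>t x. f x) = h * integral {a..b} f"
  using SI_regular(1)[OF assms] h_pos by simp

lemma SI_young:
  assumes "sq m F" "sq m G" "0 < \<epsilon>"
  shows "2 * SI m (\<lambda>t x. F t x * G t x) \<le> \<epsilon> * SI m (\<lambda>t x. (F t x)\<^sup>2) + SI m (\<lambda>t x. (G t x)\<^sup>2) / \<epsilon>"
proof -
  have "SI m (\<lambda>t x. 2 * (F t x * G t x)) \<le> SI m (\<lambda>t x. \<epsilon> * (F t x)\<^sup>2 + (G t x)\<^sup>2 / \<epsilon>)"
    unfolding SI_def using assms
    by (intro set_integral_mono set_integral_add set_integrable_mult_right set_integrable_divide sq_mult_integrable sq_power_integrable young)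
  also have "\<dots> = \<epsilon> * SI m (\<lambda>t x. (F t x)\<^sup>2) + SI m (\<lambda>t x. (G t x)\<^sup>2) / \<epsilon>"
    unfolding SI_def using assms
    by (subst set_integral_add(2)) (auto intro!: set_integrable_mult_right set_integrable_divide sq_power_integrable)
  finally show ?thesis by (simp add: SI_def)
qed

lemma SI_mono:
  assumes "set_integrable lborel (slab m \<times> {a..b}) (\<lambda>z. F (fst z) (snd z))"
    "set_integrable lborel (slab m \<times> {a..b}) (\<lambda>z. G (fst z) (snd z))"
    "\<And>t x. t \<in> slab m \<Longrightarrow> x \<in> {a..b} \<Longrightarrow> F t x \<le> G t x"
  shows "SI m F \<le> SI m G"
  unfolding SI_def using assms by (intro set_integral_mono) auto

lemma residual_eq:
  assumes "m \<in> {1..M}"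
  shows "residual m = SI m (\<lambda>t x. (r0 m t x)\<^sup>2) + SI m (\<lambda>t x. (r1 m t x)\<^sup>2) + SI m (\<lambda>t x. (r2 m t x)\<^sup>2)"
  unfolding residual_def SI_def
  using sq_r[OF assms]
  by (subst set_integral_add(2); (subst set_integral_add(2))?) (auto intro!: sq_power_integrable set_integral_add)

lemma SI_sq_nonneg: "0 \<le> SI m (\<lambda>t x. (F t x)\<^sup>2)"
  unfolding SI_def set_lebesgue_integral_def by (intro Bochner_Integration.integral_nonneg) (auto simp: indicator_def)

lemma U_continuous: "continuous_on S (\<lambda>x. U m t x)"
  unfolding U_def tpoly_def using pw0_continuous[OF A] by (intro continuous_intros) (auto intro: continuous_on_subset)

lemma jump_continuous: "continuous_on S (jump m)"
  unfolding jump_def [abs_def] prev_def using w0(1)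
  by (cases "m = 1") (auto intro!: continuous_intros U_continuous intro: continuous_on_subset)

text \<open>
  Members of the discrete space vanish at the ends of the interval, so that no boundary terms in
  space appear.
\<close>

lemma slab_integration_by_parts:
  assumes \<psi>: "C1_function \<psi> \<psi>t \<psi>x"
  shows "SI m (\<lambda>t x. (Ut m t x + \<sigma> * Ux m t x) * \<psi> t x) + SI m (\<lambda>t x. U m t x * (\<psi>t t x + \<sigma> * \<psi>x t x))
    = integral {a..b} (\<lambda>x. U m (start m + h) x * \<psi> (start m + h) x - U m (start m) x * \<psi> (start m) x)"
proof -
  note C = C1_functionD(6,7,8)[OF \<psi>, of "start m" "start m + h" a b]
  have r: "regular (slab m) {a..b} (\<lambda>t x. Ut m t x * \<psi> t x + U m t x * \<psi>t t x)"
    "regular (slab m) {a..b} (\<lambda>t x. Ux m t x * \<psi> t x + U m t x * \<psi>x t x)"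
    "regular (slab m) {a..b} (\<lambda>t x. (Ut m t x + \<sigma> * Ux m t x) * \<psi> t x)"
    "regular (slab m) {a..b} (\<lambda>t x. U m t x * (\<psi>t t x + \<sigma> * \<psi>x t x))"
    by (intro regular_add regular_mult regular_const regular_U C)+
  note i = r[THEN regular_integral(3)]
  have "SI m (\<lambda>t x. (Ut m t x + \<sigma> * Ux m t x) * \<psi> t x) + SI m (\<lambda>t x. U m t x * (\<psi>t t x + \<sigma> * \<psi>x t x))
    = SI m (\<lambda>t x. (Ut m t x * \<psi> t x + U m t x * \<psi>t t x) + \<sigma> * (Ux m t x * \<psi> t x + U m t x * \<psi>x t x))"
    unfolding SI_def set_integral_add(2)[OF i(3,4), symmetric] by (simp add: algebra_simps)
  also have "\<dots> = SI m (\<lambda>t x. Ut m t x * \<psi> t x + U m t x * \<psi>t t x) + \<sigma> * SI m (\<lambda>t x. Ux m t x * \<psi> t x + U m t x * \<psi>x t x)"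
    unfolding SI_def set_integral_add(2)[OF i(1) set_integrable_mult_right[OF i(2)]] by simp
  finally show ?thesis
    using tensor_integration_by_parts[where B = "A m" and c = "start m" and d = "start m + h", OF A \<psi>] h_pos
    by (simp add: SI_def U_def Ut_def Ux_def)
qed

lemma integration_by_parts:
  assumes \<psi>: "C1_function \<psi> \<psi>t \<psi>x"
  shows "(\<Sum>m=1..M. SI m (\<lambda>t x. (Ut m t x + \<sigma> * Ux m t x) * \<psi> t x) + integral {a..b} (\<lambda>x. jump m x * \<psi> (start m) x))
    = - (\<Sum>m=1..M. SI m (\<lambda>t x. U m t x * (\<psi>t t x + \<sigma> * \<psi>x t x)))
      + integral {a..b} (\<lambda>x. U M (start M + h) x * \<psi> (start M + h) x) - integral {a..b} (\<lambda>x. w0 x * \<psi> 0 x)"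
proof -
  have c\<psi>: "continuous_on S (\<lambda>x. \<psi> t x)" for S t by (intro C1_functionD(1)[OF \<psi>] continuous_intros)
  have cp: "continuous_on S (prev m)" for S m
    unfolding prev_def using w0(1) by (cases "m = 1") (auto intro: U_continuous continuous_on_subset)
  define Z where "Z m = integral {a..b} (\<lambda>x. U m (start m + h) x * \<psi> (start m + h) x)" for m
  define Y where "Y m = integral {a..b} (\<lambda>x. prev m x * \<psi> (start m) x)" for m
  have one: "SI m (\<lambda>t x. (Ut m t x + \<sigma> * Ux m t x) * \<psi> t x) + integral {a..b} (\<lambda>x. jump m x * \<psi> (start m) x)
      = - SI m (\<lambda>t x. U m t x * (\<psi>t t x + \<sigma> * \<psi>x t x)) + (Z m - Y m)" for m
  proof -
    have i: "(\<lambda>x. U m (start m + h) x * \<psi> (start m + h) x) integrable_on {a..b}"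
      "(\<lambda>x. U m (start m) x * \<psi> (start m) x) integrable_on {a..b}"
      "(\<lambda>x. prev m x * \<psi> (start m) x) integrable_on {a..b}"
      by (intro integrable_continuous_real continuous_intros U_continuous c\<psi> cp)+
    have "integral {a..b} (\<lambda>x. jump m x * \<psi> (start m) x) = integral {a..b} (\<lambda>x. U m (start m) x * \<psi> (start m) x) - Y m"
      unfolding jump_def Y_def using integral_diff[OF i(2,3)] by (simp add: left_diff_distrib)
    then show ?thesis
      using slab_integration_by_parts[OF \<psi>, of m] integral_diff[OF i(1,2)] unfolding Z_def by linarith
  qed
  have tel: "(\<Sum>m=1..n. Z m - Y m) = (if n = 0 then 0 else Z n - integral {a..b} (\<lambda>x. w0 x * \<psi> 0 x))" for n
  proof (induction n)
    case (Suc n)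
    have "Y (Suc n) = (if n = 0 then integral {a..b} (\<lambda>x. w0 x * \<psi> 0 x) else Z n)"
    proof (cases "n = 0")
      case True
      then show ?thesis by (simp add: Y_def prev_def start_def)
    next
      case False
      then show ?thesis by (simp add: Y_def Z_def prev_def start_Suc)
    qed
    then show ?case using Suc by auto
  qed simp
  show ?thesis unfolding one sum.distrib sum_negf using tel[of M] M by (simp add: Z_def[of M])
qed

end

section \<open>Interpolating the dual solution\<close>

context sd_transport
begin

text \<open>
  The scheme in residual form, tested with functions in the given direction on one slab.
\<close>

definition "galerkin \<longleftrightarrow> (\<forall>m\<in>{1..M}. \<forall>B. (\<forall>i. pw0 (B i)) \<longrightarrow>
   SI m (\<lambda>t x. r0 m t x * tpoly k (\<lambda>i. B i x) t
     + \<delta>0 * h * (r1 m t x * tpoly' k (\<lambda>i. B i x) t + r2 m t x * tpoly k (\<lambda>i. pwd (B i) x) t))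
   = integral {a..b} (\<lambda>x. jump m x * tpoly k (\<lambda>i. B i x) (start m)))"

definition average :: "nat \<Rightarrow> (real \<Rightarrow> real \<Rightarrow> real) \<Rightarrow> real \<Rightarrow> real" where
  "average m \<psi> x = integral (slab m) (\<lambda>t. \<psi> t x) / h"

lemma average_square_le:
  assumes "continuous_on UNIV (\<lambda>z. \<psi> (fst z) (snd z))"
  shows "(average m \<psi> x)\<^sup>2 \<le> integral (slab m) (\<lambda>t. (\<psi> t x)\<^sup>2) / h"
proof -
  have c: "continuous_on S (\<lambda>t. \<psi> t x)" for S
    using continuous_on_compose2[OF assms continuous_on_Pair[OF continuous_on_id continuous_on_const] subset_UNIV] by simp
  have "(integral (slab m) (\<lambda>t. \<psi> t x))\<^sup>2 \<le> h * integral (slab m) (\<lambda>t. (\<psi> t x)\<^sup>2)"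
    using square_integral_le(1)[OF c, of "start m" "start m + h"] h_pos by simp
  then show ?thesis using h_pos by (simp add: average_def power_divide power2_eq_square field_simps)
qed

lemma average_deviation:
  assumes \<psi>: "C1_function \<psi> \<psi>t \<psi>x" and t: "t \<in> slab m"
  shows "(\<psi> t x - average m \<psi> x)\<^sup>2 \<le> h * integral (slab m) (\<lambda>s. (\<psi>t s x)\<^sup>2)"
proof -
  note c [continuous_intros] = C1_functionD(1,2)[OF \<psi>]
  define D where "D = integral (slab m) (\<lambda>s. \<bar>\<psi>t s x\<bar>)"
  have step: "\<bar>\<psi> w x - \<psi> u x\<bar> \<le> D" if "u \<in> slab m" "w \<in> slab m" "u \<le> w" for u w
  proof -
    have "\<psi> w x - \<psi> u x = integral {u..w} (\<lambda>s. \<psi>t s x)"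
      by (rule integral_unique[symmetric], rule fundamental_theorem_of_calculus)
         (use that C1_functionD(4)[OF \<psi>] in \<open>auto simp: has_real_derivative_iff_has_vector_derivative[symmetric]\<close>)
    also have "\<bar>\<dots>\<bar> \<le> integral {u..w} (\<lambda>s. \<bar>\<psi>t s x\<bar>)"
    proof -
      have "(\<lambda>s. \<psi>t s x) integrable_on {u..w}" "(\<lambda>s. \<bar>\<psi>t s x\<bar>) integrable_on {u..w}"
        by (intro integrable_continuous_real continuous_intros)+
      then show ?thesis
        using integral_norm_bound_integral[of "\<lambda>s. \<psi>t s x" "{u..w}" "\<lambda>s. \<bar>\<psi>t s x\<bar>"] by simp
    qed
    also have "\<dots> \<le> D" unfolding D_def
      using that by (intro integral_subset_le integrable_continuous_real continuous_intros) auto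
    finally show ?thesis .
  qed
  have D: "\<bar>\<psi> t x - \<psi> s x\<bar> \<le> D" if "s \<in> slab m" for s
    using step[OF that t] step[OF t that] by (cases "s \<le> t") (auto simp: abs_minus_commute)
  have "integral (slab m) (\<lambda>s. \<psi> s x) \<le> integral (slab m) (\<lambda>s. \<psi> t x + D)"
    by (rule integral_le) (use D in \<open>force intro!: integrable_continuous_real continuous_intros simp: abs_le_iff\<close>)+
  moreover have "integral (slab m) (\<lambda>s. \<psi> t x - D) \<le> integral (slab m) (\<lambda>s. \<psi> s x)"
    by (rule integral_le) (use D in \<open>force intro!: integrable_continuous_real continuous_intros simp: abs_le_iff\<close>)+
  ultimately have "\<bar>\<psi> t x - average m \<psi> x\<bar> \<le> D"
    using h_pos by (auto simp: average_def abs_le_iff field_simps)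
  then have "(\<psi> t x - average m \<psi> x)\<^sup>2 \<le> D\<^sup>2" by (metis abs_ge_zero power2_abs power_mono)
  also have "\<dots> \<le> h * integral (slab m) (\<lambda>s. \<bar>\<psi>t s x\<bar>\<^sup>2)"
  proof -
    have "continuous_on (slab m) (\<lambda>s. \<bar>\<psi>t s x\<bar>)" by (intro continuous_intros)
    from square_integral_le(1)[OF this] show ?thesis unfolding D_def using h_pos by simp
  qed
  finally show ?thesis by simp
qed

lemma average_derivative:
  assumes \<psi>: "C1_function \<psi> \<psi>t \<psi>x"
  shows "(average m \<psi> has_real_derivative average m \<psi>x x) (at x)" and "continuous_on S (average m \<psi>x)"
    and "continuous_on S (average m \<psi>)"
proof -
  have *: "((\<lambda>x. integral (cbox (start m) (start m + h)) (\<lambda>t. \<psi> t x)) has_real_derivative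
      integral (cbox (start m) (start m + h)) (\<lambda>t. \<psi>x t x)) (at x within UNIV)" for x
    by (rule leibniz_rule_field_derivative)
       (auto simp: case_prod_unfold intro!: C1_functionD(5)[OF \<psi>] C1_functionD(1,3)[OF \<psi>] continuous_intros integrable_continuous_real)
  show d: "(average m \<psi> has_real_derivative average m \<psi>x x) (at x)" for x
    unfolding average_def [abs_def] using DERIV_cdivide[OF *, of h] by simp
  have "continuous_on S (\<lambda>x. integral (cbox (start m) (start m + h)) (\<lambda>t. \<psi>x t x))"
    by (rule integral_continuous_on_param)
       (auto simp: case_prod_unfold intro!: C1_functionD(3)[OF \<psi>] continuous_intros)
  then show "continuous_on S (average m \<psi>x)"
    unfolding average_def [abs_def] using h_pos by (auto intro!: continuous_intros)
  show "continuous_on S (average m \<psi>)"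
    by (rule DERIV_continuous_on) (rule has_field_derivative_at_within[OF d])
qed

lemma jump_young:
  assumes f: "continuous_on {a..b} f" and "0 < \<epsilon>"
  shows "- 2 * integral {a..b} (\<lambda>x. jump m x * f x) \<le> \<epsilon> * jump_sq m + integral {a..b} (\<lambda>x. (f x)\<^sup>2) / \<epsilon>"
proof -
  have "- 2 * integral {a..b} (\<lambda>x. jump m x * f x) = integral {a..b} (\<lambda>x. - 2 * (jump m x * f x))" by simp
  also have "\<dots> \<le> integral {a..b} (\<lambda>x. \<epsilon> * (jump m x)\<^sup>2 + (f x)\<^sup>2 / \<epsilon>)"
  proof (rule integral_le)
    fix x show "- 2 * (jump m x * f x) \<le> \<epsilon> * (jump m x)\<^sup>2 + (f x)\<^sup>2 / \<epsilon>"
      using young[OF assms(2), of "jump m x" "- f x"] by simp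
  qed (use assms(2) in \<open>auto intro!: integrable_continuous_real continuous_intros jump_continuous f\<close>)
  also have "\<dots> = integral {a..b} (\<lambda>x. \<epsilon> * (jump m x)\<^sup>2) + integral {a..b} (\<lambda>x. (f x)\<^sup>2 / \<epsilon>)"
    by (rule integral_add) (use assms(2) in \<open>auto intro!: integrable_continuous_real continuous_intros jump_continuous f\<close>)
  finally show ?thesis by (simp add: jump_sq_def)
qed

lemma SI_integral_mono:
  assumes F: "regular (slab m) {a..b} F" and f: "f integrable_on {a..b}"
    and le: "\<And>x. x \<in> {a..b} \<Longrightarrow> integral (slab m) (\<lambda>t. F t x) \<le> f x"
  shows "SI m F \<le> integral {a..b} f"
  unfolding SI_regular(1)[OF F] by (rule integral_le[OF regular_integral(1)[OF F] f le])

lemma sum_square_le: "(x + y)\<^sup>2 \<le> 2 * (x\<^sup>2 + y\<^sup>2)" for x y :: real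
  using sum_squares_bound[of x y] by (simp add: power2_sum)

lemma integral_sum_square_le:
  fixes f g :: "real \<Rightarrow> real"
  assumes "continuous_on {a..b} f" "continuous_on {a..b} g"
  shows "integral {a..b} (\<lambda>x. (f x + g x)\<^sup>2) \<le> 2 * (integral {a..b} (\<lambda>x. (f x)\<^sup>2) + integral {a..b} (\<lambda>x. (g x)\<^sup>2))"
proof -
  have "integral {a..b} (\<lambda>x. (f x + g x)\<^sup>2) \<le> integral {a..b} (\<lambda>x. 2 * ((f x)\<^sup>2 + (g x)\<^sup>2))"
    using assms by (intro integral_le integrable_continuous_real continuous_intros sum_square_le)
  also have "\<dots> = 2 * (integral {a..b} (\<lambda>x. (f x)\<^sup>2) + integral {a..b} (\<lambda>x. (g x)\<^sup>2))"
    using assms by (simp add: integral_add integrable_continuous_real continuous_intros)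
  finally show ?thesis .
qed

text \<open>
  The discrete function that is subtracted from \<open>\<psi>\<close> is the interpolant in space of the average in
  time, which needs \<open>\<psi>\<close> to vanish at both ends. The errors of averaging and interpolating are each
  of order \<open>h\<close>, and so is the stabilizing term; the value at the beginning of the slab deviates
  from the average by order \<open>sqrt h\<close>, which matches the weight \<open>h\<close> of the squared jumps.
\<close>

lemma interpolation_error:
  assumes gal: galerkin and m: "m \<in> {1..M}" and \<psi>: "C1_function \<psi> \<psi>t \<psi>x"
    and ends: "\<And>t. t \<in> slab m \<Longrightarrow> \<psi> t a = 0" "\<And>t. t \<in> slab m \<Longrightarrow> \<psi> t b = 0" and \<epsilon>: "0 < \<epsilon>"
  shows "2 * err m \<psi> \<le> \<epsilon> * (h\<^sup>2 * residual m + h * jump_sq m)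
    + (4 + \<delta>0\<^sup>2) / \<epsilon> * (SI m (\<lambda>t x. (\<psi>t t x)\<^sup>2) + SI m (\<lambda>t x. (\<psi>x t x)\<^sup>2))"
proof -
  define v where "v = average m \<psi>"
  define v' where "v' = average m \<psi>x"
  define It where "It = SI m (\<lambda>t x. (\<psi>t t x)\<^sup>2)"
  define Ix where "Ix = SI m (\<lambda>t x. (\<psi>x t x)\<^sup>2)"
  note reg\<psi> = C1_functionD(6,7,8)[OF \<psi>, of "start m" "start m + h" a b]
  have c\<psi>: "continuous_on UNIV (\<lambda>z. \<psi> (fst z) (snd z))" "continuous_on UNIV (\<lambda>z. \<psi>x (fst z) (snd z))"
    using \<psi> by (auto simp: C1_function_def)
  have v: "(v has_real_derivative v' x) (at x)" "continuous_on S v'" "continuous_on S v" for x S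
    unfolding v_def v'_def by (rule average_derivative[OF \<psi>])+
  have "integral (slab m) (\<lambda>t. \<psi> t a) = integral (slab m) (\<lambda>t. 0)" "integral (slab m) (\<lambda>t. \<psi> t b) = integral (slab m) (\<lambda>t. 0)"
    by (intro integral_cong ends; assumption)+
  then have "v a = 0" "v b = 0" by (simp_all add: v_def average_def)
  from nodal_interpolation[OF v(1) v(2) this] obtain g where g: "pw0 g"
    "integral {a..b} (\<lambda>x. (v x - g x)\<^sup>2) \<le> h\<^sup>2 * integral {a..b} (\<lambda>x. (v' x)\<^sup>2)"
    "integral {a..b} (\<lambda>x. (pwd g x)\<^sup>2) \<le> integral {a..b} (\<lambda>x. (v' x)\<^sup>2)" by blast
  have cg: "continuous_on S g" for S using pw0_continuous[OF g(1)] continuous_on_subset by blast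
  have regg: "regular I {a..b} (\<lambda>t x. g x)" for I by (rule regular_continuous_space[OF cg])
  have regd: "regular I {a..b} (\<lambda>t x. pwd g x)" for I
    using pwd_regular(2)[OF g(1)] regular_space[OF pwd_regular(1)[OF g(1)]] by blast
  have regv: "regular I {a..b} (\<lambda>t x. v x)" for I by (rule regular_continuous_space[OF v(3)])
  \<comment> \<open>A function that is constant in time on the slab.\<close>
  define B where "B i = (if i = 0 then g else (\<lambda>_. 0))" for i :: nat
  have B: "\<forall>i. pw0 (B i)" using g(1) pw0_zero by (simp add: B_def)
  have pwd0: "pwd (\<lambda>_. 0) x = 0" for x by (simp add: pwd_def)
  have tp: "tpoly k (\<lambda>i. B i x) t = g x" "tpoly' k (\<lambda>i. B i x) t = 0" "tpoly k (\<lambda>i. pwd (B i) x) t = pwd g x" for t x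
    by (simp_all add: tpoly_def tpoly'_def B_def if_distrib[of "\<lambda>f. f x" for x] if_distrib[of pwd] pwd0
        if_distrib[of "\<lambda>y. y * z" for z] sum.delta cong: if_cong)
  have G: "SI m (\<lambda>t x. r0 m t x * g x + \<delta>0 * h * (r2 m t x * pwd g x)) = integral {a..b} (\<lambda>x. jump m x * g x)"
  proof -
    have "SI m (\<lambda>t x. r0 m t x * tpoly k (\<lambda>i. B i x) t
        + \<delta>0 * h * (r1 m t x * tpoly' k (\<lambda>i. B i x) t + r2 m t x * tpoly k (\<lambda>i. pwd (B i) x) t))
      = integral {a..b} (\<lambda>x. jump m x * tpoly k (\<lambda>i. B i x) (start m))"
      using gal m B unfolding galerkin_def by blast
    then show ?thesis by (simp only: tp mult_zero_right add_0_left)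
  qed
  note sqr = sq_r[OF m]
  have sqg: "sq m (\<lambda>t x. g x)" "sq m (\<lambda>t x. pwd g x)" "sq m \<psi>" "sq m (\<lambda>t x. \<psi> t x - g x)"
    by (intro sq_regular regg regd regular_diff reg\<psi>)+
  have i: "set_integrable lborel (slab m \<times> {a..b}) (\<lambda>z. r0 m (fst z) (snd z) * g (snd z))"
    "set_integrable lborel (slab m \<times> {a..b}) (\<lambda>z. r2 m (fst z) (snd z) * pwd g (snd z))"
    "set_integrable lborel (slab m \<times> {a..b}) (\<lambda>z. r0 m (fst z) (snd z) * \<psi> (fst z) (snd z))"
    using sq_mult_integrable[OF sqr(1) sqg(1)] sq_mult_integrable[OF sqr(3) sqg(2)] sq_mult_integrable[OF sqr(1) sqg(3)] by auto
  have "SI m (\<lambda>t x. r0 m t x * g x) + \<delta>0 * h * SI m (\<lambda>t x. r2 m t x * pwd g x) = integral {a..b} (\<lambda>x. jump m x * g x)"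
    using G i unfolding SI_def by (subst (asm) set_integral_add(2)) auto
  moreover have "SI m (\<lambda>t x. r0 m t x * (\<psi> t x - g x)) = SI m (\<lambda>t x. r0 m t x * \<psi> t x) - SI m (\<lambda>t x. r0 m t x * g x)"
    using i unfolding SI_def right_diff_distrib by (subst set_integral_diff(2)) auto
  moreover have "integral {a..b} (\<lambda>x. jump m x * (\<psi> (start m) x - g x)) = integral {a..b} (\<lambda>x. jump m x * \<psi> (start m) x) - integral {a..b} (\<lambda>x. jump m x * g x)"
    unfolding right_diff_distrib
    by (rule integral_diff) (intro integrable_continuous_real continuous_intros jump_continuous cg C1_functionD(1)[OF \<psi>])+
  moreover have "SI m (\<lambda>t x. r2 m t x * (- h * pwd g x)) = - h * SI m (\<lambda>t x. r2 m t x * pwd g x)"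
    unfolding SI_def set_integral_mult_right[symmetric] by (simp only: mult.left_commute)
  ultimately have err: "err m \<psi> = SI m (\<lambda>t x. r0 m t x * (\<psi> t x - g x)) + \<delta>0 * SI m (\<lambda>t x. r2 m t x * (- h * pwd g x))
     - integral {a..b} (\<lambda>x. jump m x * (\<psi> (start m) x - g x))"
    by (simp add: err_def algebra_simps)
  have v'2: "h * integral {a..b} (\<lambda>x. (v' x)\<^sup>2) \<le> Ix"
  proof -
    have "h * integral {a..b} (\<lambda>x. (v' x)\<^sup>2) = integral {a..b} (\<lambda>x. h * (v' x)\<^sup>2)" by simp
    also have "\<dots> \<le> integral {a..b} (\<lambda>x. integral (slab m) (\<lambda>t. (\<psi>x t x)\<^sup>2))"
    proof (rule integral_le)
      show "h * (v' x)\<^sup>2 \<le> integral (slab m) (\<lambda>t. (\<psi>x t x)\<^sup>2)" for x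
        using average_square_le[OF c\<psi>(2), of m x] h_pos by (simp add: v'_def field_simps)
    qed (auto intro!: integrable_continuous_real continuous_intros v regular_integral(1) regular_power reg\<psi>)
    finally show ?thesis by (simp add: Ix_def SI_regular(1)[OF regular_power[OF reg\<psi>(3)]])
  qed
  have E1: "SI m (\<lambda>t x. (\<psi> t x - g x)\<^sup>2) \<le> 2 * h\<^sup>2 * (It + Ix)"
  proof -
    have "SI m (\<lambda>t x. (\<psi> t x - g x)\<^sup>2) \<le> integral {a..b} (\<lambda>x. 2 * (h\<^sup>2 * integral (slab m) (\<lambda>t. (\<psi>t t x)\<^sup>2) + h * (v x - g x)\<^sup>2))"
    proof (rule SI_integral_mono)
      fix x
      have "integral (slab m) (\<lambda>t. (\<psi> t x - g x)\<^sup>2) \<le> integral (slab m) (\<lambda>t. 2 * (h * integral (slab m) (\<lambda>t. (\<psi>t t x)\<^sup>2) + (v x - g x)\<^sup>2))"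
      proof (rule integral_le)
        fix t assume "t \<in> slab m"
        from average_deviation[OF \<psi> this, of x] sum_square_le[of "\<psi> t x - v x" "v x - g x"]
        show "(\<psi> t x - g x)\<^sup>2 \<le> 2 * (h * integral (slab m) (\<lambda>t. (\<psi>t t x)\<^sup>2) + (v x - g x)\<^sup>2)" by (simp add: v_def)
      qed (auto intro!: integrable_continuous_real continuous_intros C1_functionD(1)[OF \<psi>])
      then show "integral (slab m) (\<lambda>t. (\<psi> t x - g x)\<^sup>2) \<le> 2 * (h\<^sup>2 * integral (slab m) (\<lambda>t. (\<psi>t t x)\<^sup>2) + h * (v x - g x)\<^sup>2)"
        using h_pos by (simp add: power2_eq_square algebra_simps)
    next
      show "(\<lambda>x. 2 * (h\<^sup>2 * integral (slab m) (\<lambda>t. (\<psi>t t x)\<^sup>2) + h * (v x - g x)\<^sup>2)) integrable_on {a..b}"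
        by (intro integrable_on_mult_right integrable_add regular_integral(1) regular_power reg\<psi>)
           (intro integrable_continuous_real continuous_intros v cg)
    qed (intro regular_power regular_diff reg\<psi> regg)
    also have "\<dots> = 2 * (h\<^sup>2 * It + h * integral {a..b} (\<lambda>x. (v x - g x)\<^sup>2))"
    proof -
      have "(\<lambda>x. h\<^sup>2 * integral (slab m) (\<lambda>t. (\<psi>t t x)\<^sup>2)) integrable_on {a..b}"
        by (intro integrable_on_mult_right regular_integral(1) regular_power reg\<psi>)
      moreover have "(\<lambda>x. h * (v x - g x)\<^sup>2) integrable_on {a..b}"
        by (intro integrable_continuous_real continuous_intros v cg)
      ultimately show ?thesis
        by (simp add: integral_add It_def SI_regular(1)[OF regular_power[OF reg\<psi>(2)]])
    qed
    also have "\<dots> \<le> 2 * (h\<^sup>2 * It + h * (h\<^sup>2 * integral {a..b} (\<lambda>x. (v' x)\<^sup>2)))"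
      using g(2) h_pos by (intro mult_left_mono add_left_mono) auto
    also have "h * (h\<^sup>2 * integral {a..b} (\<lambda>x. (v' x)\<^sup>2)) \<le> h\<^sup>2 * Ix"
      using mult_left_mono[OF v'2, of "h\<^sup>2"] by (simp add: mult_ac)
    finally show ?thesis by (simp add: algebra_simps)
  qed
  have E2: "SI m (\<lambda>t x. (- h * pwd g x)\<^sup>2) \<le> h\<^sup>2 * Ix"
  proof -
    have "regular (slab m) {a..b} (\<lambda>t x. (- h * pwd g x)\<^sup>2)" by (intro regular_power regular_mult regular_const regd)
    then have "SI m (\<lambda>t x. (- h * pwd g x)\<^sup>2) = h\<^sup>2 * (h * integral {a..b} (\<lambda>x. (pwd g x)\<^sup>2))"
      by (simp add: SI_space power_mult_distrib)
    also have "\<dots> \<le> h\<^sup>2 * (h * integral {a..b} (\<lambda>x. (v' x)\<^sup>2))" using g(3) h_pos by (intro mult_left_mono) auto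
    also have "\<dots> \<le> h\<^sup>2 * Ix" using v'2 by (intro mult_left_mono) auto
    finally show ?thesis .
  qed
  have E3: "integral {a..b} (\<lambda>x. (\<psi> (start m) x - g x)\<^sup>2) \<le> 2 * h * (It + Ix)"
  proof -
    have c0: "continuous_on {a..b} (\<lambda>x. \<psi> (start m) x - v x)" "continuous_on {a..b} (\<lambda>x. v x - g x)"
      by (intro continuous_intros C1_functionD(1)[OF \<psi>] v cg)+
    have "integral {a..b} (\<lambda>x. (\<psi> (start m) x - g x)\<^sup>2) \<le> 2 * (integral {a..b} (\<lambda>x. (\<psi> (start m) x - v x)\<^sup>2) + integral {a..b} (\<lambda>x. (v x - g x)\<^sup>2))"
      using integral_sum_square_le[OF c0] by simp
    also have "integral {a..b} (\<lambda>x. (\<psi> (start m) x - v x)\<^sup>2) \<le> integral {a..b} (\<lambda>x. h * integral (slab m) (\<lambda>s. (\<psi>t s x)\<^sup>2))"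
    proof (rule integral_le)
      show "(\<psi> (start m) x - v x)\<^sup>2 \<le> h * integral (slab m) (\<lambda>s. (\<psi>t s x)\<^sup>2)" for x
        using average_deviation[OF \<psi>, of "start m" m x] h_pos by (simp add: v_def)
      show "(\<lambda>x. h * integral (slab m) (\<lambda>s. (\<psi>t s x)\<^sup>2)) integrable_on {a..b}"
        by (intro integrable_on_mult_right regular_integral(1) regular_power reg\<psi>)
    qed (intro integrable_continuous_real continuous_intros c0)
    also have "\<dots> = h * It" by (simp add: It_def SI_regular(1)[OF regular_power[OF reg\<psi>(2)]])
    also have "integral {a..b} (\<lambda>x. (v x - g x)\<^sup>2) \<le> h * Ix"
    proof -
      have "h\<^sup>2 * integral {a..b} (\<lambda>x. (v' x)\<^sup>2) = h * (h * integral {a..b} (\<lambda>x. (v' x)\<^sup>2))"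
        by (simp only: power2_eq_square[of h] mult.assoc)
      then show ?thesis using g(2) mult_left_mono[OF v'2, of h] h_pos by linarith
    qed
    finally show ?thesis by (simp add: algebra_simps)
  qed
  have h2: "0 < \<epsilon> * h\<^sup>2" "0 < \<epsilon> * h" using \<epsilon> h_pos by auto
  have Y1: "2 * SI m (\<lambda>t x. r0 m t x * (\<psi> t x - g x)) \<le> \<epsilon> * h\<^sup>2 * SI m (\<lambda>t x. (r0 m t x)\<^sup>2) + 2 / \<epsilon> * (It + Ix)"
  proof -
    have "SI m (\<lambda>t x. (\<psi> t x - g x)\<^sup>2) / (\<epsilon> * h\<^sup>2) \<le> 2 * h\<^sup>2 * (It + Ix) / (\<epsilon> * h\<^sup>2)"
      using E1 h2 by (intro divide_right_mono) auto
    also have "\<dots> = 2 / \<epsilon> * (It + Ix)" using h_pos by simp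
    finally show ?thesis using SI_young[OF sqr(1) sqg(4) h2(1)] by linarith
  qed
  have Y2: "2 * (\<delta>0 * SI m (\<lambda>t x. r2 m t x * (- h * pwd g x))) \<le> \<epsilon> * h\<^sup>2 * SI m (\<lambda>t x. (r2 m t x)\<^sup>2) + \<delta>0\<^sup>2 / \<epsilon> * Ix"
  proof -
    have e: "0 < \<epsilon> * h\<^sup>2 / \<delta>0" using h2 \<delta>0 by simp
    have "sq m (\<lambda>t x. - h * pwd g x)" by (intro sq_regular regular_mult regular_const regd)
    from SI_young[OF sqr(3) this e]
    have "2 * SI m (\<lambda>t x. r2 m t x * (- h * pwd g x)) \<le> \<epsilon> * h\<^sup>2 / \<delta>0 * SI m (\<lambda>t x. (r2 m t x)\<^sup>2) + SI m (\<lambda>t x. (- h * pwd g x)\<^sup>2) / (\<epsilon> * h\<^sup>2 / \<delta>0)" .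
    also have "\<dots> \<le> \<epsilon> * h\<^sup>2 / \<delta>0 * SI m (\<lambda>t x. (r2 m t x)\<^sup>2) + h\<^sup>2 * Ix / (\<epsilon> * h\<^sup>2 / \<delta>0)"
      using E2 e by (intro add_left_mono divide_right_mono) auto
    finally have "2 * SI m (\<lambda>t x. r2 m t x * (- h * pwd g x)) \<le> \<epsilon> * h\<^sup>2 / \<delta>0 * SI m (\<lambda>t x. (r2 m t x)\<^sup>2) + \<delta>0 / \<epsilon> * Ix"
      using h_pos by (simp add: mult.commute[of Ix])
    then have "\<delta>0 * (2 * SI m (\<lambda>t x. r2 m t x * (- h * pwd g x)))
      \<le> \<delta>0 * (\<epsilon> * h\<^sup>2 / \<delta>0 * SI m (\<lambda>t x. (r2 m t x)\<^sup>2) + \<delta>0 / \<epsilon> * Ix)"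
      using \<delta>0 by (intro mult_left_mono) auto
    also have "\<dots> = \<epsilon> * h\<^sup>2 * SI m (\<lambda>t x. (r2 m t x)\<^sup>2) + \<delta>0\<^sup>2 / \<epsilon> * Ix"
      using \<delta>0 by (simp add: power2_eq_square distrib_left)
    finally show ?thesis by (simp only: mult.left_commute)
  qed
  have Y3: "- 2 * integral {a..b} (\<lambda>x. jump m x * (\<psi> (start m) x - g x)) \<le> \<epsilon> * h * jump_sq m + 2 / \<epsilon> * (It + Ix)"
  proof -
    have "integral {a..b} (\<lambda>x. (\<psi> (start m) x - g x)\<^sup>2) / (\<epsilon> * h) \<le> 2 * h * (It + Ix) / (\<epsilon> * h)"
      using E3 h2 by (intro divide_right_mono) auto
    also have "\<dots> = 2 / \<epsilon> * (It + Ix)" using h_pos by simp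
    finally have "integral {a..b} (\<lambda>x. (\<psi> (start m) x - g x)\<^sup>2) / (\<epsilon> * h) \<le> 2 / \<epsilon> * (It + Ix)" .
    moreover have "continuous_on {a..b} (\<lambda>x. \<psi> (start m) x - g x)"
      by (intro continuous_intros cg C1_functionD(1)[OF \<psi>])
    note jump_young[OF this h2(2), of m]
    ultimately show ?thesis by linarith
  qed
  have nn: "0 \<le> SI m (\<lambda>t x. (r1 m t x)\<^sup>2)" "0 \<le> It" by (auto simp: It_def SI_sq_nonneg)
  have "0 \<le> \<epsilon> * h\<^sup>2 * SI m (\<lambda>t x. (r1 m t x)\<^sup>2)" "0 \<le> \<delta>0\<^sup>2 / \<epsilon> * It"
    using nn h2 \<epsilon> by (auto intro!: mult_nonneg_nonneg)
  then have "2 * err m \<psi> \<le> \<epsilon> * h\<^sup>2 * residual m + \<epsilon> * h * jump_sq m + (2 / \<epsilon> * (It + Ix) + 2 / \<epsilon> * (It + Ix) + \<delta>0\<^sup>2 / \<epsilon> * (It + Ix))"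
    using Y1 Y2 Y3 unfolding err residual_eq[OF m] by (simp add: distrib_left)
  also have "2 / \<epsilon> * (It + Ix) + 2 / \<epsilon> * (It + Ix) + \<delta>0\<^sup>2 / \<epsilon> * (It + Ix) = (4 + \<delta>0\<^sup>2) / \<epsilon> * (It + Ix)"
    by (simp add: add_divide_distrib algebra_simps)
  finally show ?thesis by (simp add: It_def Ix_def algebra_simps)
qed

text \<open>
  Without subtracting anything a factor \<open>1 / h\<close> is lost, which is harmless on coarse meshes. Only
  the value of \<open>\<psi>\<close> at the beginning of the slab needs a derivative.
\<close>

lemma plain_error:
  assumes m: "m \<in> {1..M}" and \<psi>: "C1_function \<psi> \<psi>t \<psi>x" and \<epsilon>: "0 < \<epsilon>"
  shows "2 * err m \<psi> \<le> \<epsilon> * (h\<^sup>2 * residual m + h * jump_sq m)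
    + (3 / h\<^sup>2 * SI m (\<lambda>t x. (\<psi> t x)\<^sup>2) + 2 * SI m (\<lambda>t x. (\<psi>t t x)\<^sup>2)) / \<epsilon>"
proof -
  note reg\<psi> = C1_functionD(6,7,8)[OF \<psi>, of "start m" "start m + h" a b]
  have c\<psi>: "continuous_on UNIV (\<lambda>z. \<psi> (fst z) (snd z))" using \<psi> by (auto simp: C1_function_def)
  define I where "I = SI m (\<lambda>t x. (\<psi> t x)\<^sup>2)"
  define It where "It = SI m (\<lambda>t x. (\<psi>t t x)\<^sup>2)"
  have h2: "0 < \<epsilon> * h\<^sup>2" "0 < \<epsilon> * h" using \<epsilon> h_pos by auto
  have tr: "integral {a..b} (\<lambda>x. (\<psi> (start m) x)\<^sup>2) \<le> 2 * (h * It + I / h)"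
  proof -
    have "integral {a..b} (\<lambda>x. (\<psi> (start m) x)\<^sup>2) \<le> integral {a..b} (\<lambda>x. 2 * (h * integral (slab m) (\<lambda>s. (\<psi>t s x)\<^sup>2) + integral (slab m) (\<lambda>s. (\<psi> s x)\<^sup>2) / h))"
    proof (rule integral_le)
      fix x
      show "(\<psi> (start m) x)\<^sup>2 \<le> 2 * (h * integral (slab m) (\<lambda>s. (\<psi>t s x)\<^sup>2) + integral (slab m) (\<lambda>s. (\<psi> s x)\<^sup>2) / h)"
        using average_deviation[OF \<psi>, of "start m" m x] average_square_le[OF c\<psi>, of m x] h_pos
          sum_square_le[of "\<psi> (start m) x - average m \<psi> x" "average m \<psi> x"] by simp
      show "(\<lambda>x. 2 * (h * integral (slab m) (\<lambda>s. (\<psi>t s x)\<^sup>2) + integral (slab m) (\<lambda>s. (\<psi> s x)\<^sup>2) / h)) integrable_on {a..b}"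
        by (intro integrable_on_mult_right integrable_add integrable_on_divide regular_integral(1) regular_power reg\<psi>)
    qed (intro integrable_continuous_real continuous_intros C1_functionD(1)[OF \<psi>])
    also have "\<dots> = 2 * (h * It + I / h)"
    proof -
      have "(\<lambda>x. h * integral (slab m) (\<lambda>s. (\<psi>t s x)\<^sup>2)) integrable_on {a..b}"
        "(\<lambda>x. integral (slab m) (\<lambda>s. (\<psi> s x)\<^sup>2) / h) integrable_on {a..b}"
        by (intro integrable_on_mult_right integrable_on_divide regular_integral(1) regular_power reg\<psi>)+
      from integral_add[OF this]
      have "integral {a..b} (\<lambda>x. 2 * (h * integral (slab m) (\<lambda>s. (\<psi>t s x)\<^sup>2) + integral (slab m) (\<lambda>s. (\<psi> s x)\<^sup>2) / h))
        = 2 * (h * integral {a..b} (\<lambda>x. integral (slab m) (\<lambda>s. (\<psi>t s x)\<^sup>2)) + integral {a..b} (\<lambda>x. integral (slab m) (\<lambda>s. (\<psi> s x)\<^sup>2)) / h)"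
        by (simp only: integral_mult_right integral_divide)
      then show ?thesis
        unfolding It_def I_def SI_regular(1)[OF regular_power[OF reg\<psi>(2)]] SI_regular(1)[OF regular_power[OF reg\<psi>(1)]] .
    qed
    finally show ?thesis .
  qed
  have Y1: "2 * SI m (\<lambda>t x. r0 m t x * \<psi> t x) \<le> \<epsilon> * h\<^sup>2 * SI m (\<lambda>t x. (r0 m t x)\<^sup>2) + I / (\<epsilon> * h\<^sup>2)"
    using SI_young[OF sq_r(1)[OF m] sq_regular[OF reg\<psi>(1)] h2(1)] by (simp add: I_def)
  have Y3: "- 2 * integral {a..b} (\<lambda>x. jump m x * \<psi> (start m) x) \<le> \<epsilon> * h * jump_sq m + 2 * (h * It + I / h) / (\<epsilon> * h)"
  proof -
    have "continuous_on {a..b} (\<psi> (start m))" by (intro C1_functionD(1)[OF \<psi>] continuous_intros)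
    from jump_young[OF this h2(2), of m] show ?thesis
      using divide_right_mono[OF tr, of "\<epsilon> * h"] h2 by linarith
  qed
  have "0 \<le> \<epsilon> * h\<^sup>2 * SI m (\<lambda>t x. (r1 m t x)\<^sup>2)" "0 \<le> \<epsilon> * h\<^sup>2 * SI m (\<lambda>t x. (r2 m t x)\<^sup>2)"
    using h2 SI_sq_nonneg by (auto intro!: mult_nonneg_nonneg)
  with Y1 Y3 have "2 * err m \<psi> \<le> \<epsilon> * h\<^sup>2 * residual m + \<epsilon> * h * jump_sq m + (I / (\<epsilon> * h\<^sup>2) + 2 * (h * It + I / h) / (\<epsilon> * h))"
    unfolding err_def residual_eq[OF m] by (simp add: distrib_left)
  also have "I / (\<epsilon> * h\<^sup>2) + 2 * (h * It + I / h) / (\<epsilon> * h) = (3 / h\<^sup>2 * I + 2 * It) / \<epsilon>"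
    using h_pos \<epsilon> by (simp add: field_simps power2_eq_square)
  finally show ?thesis by (simp add: I_def It_def algebra_simps)
qed

end

section \<open>The discrete solution near the upstream end\<close>

lemma regular_if:
  assumes "regular I X F" "Measurable.pred borel P"
  shows "regular I X (\<lambda>t x. if P x then F t x else 0)"
proof -
  have "regular I X (\<lambda>t x. (if P x then 1 else 0) * F t x)"
    by (intro regular_mult regular_space[where B = 1] assms) (use assms(2) in auto)
  moreover have "(\<lambda>t x. (if P x then 1 else 0) * F t x) = (\<lambda>t x. if P x then F t x else 0)" by (auto simp: fun_eq_iff)
  ultimately show ?thesis by simp
qed

lemma integral_cutoff:
  fixes f :: "real \<Rightarrow> real"
  assumes "l \<le> c" "c \<le> r"
  shows "integral {l..r} (\<lambda>y. if y \<le> c then f y else 0) = integral {l..c} f"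
proof -
  have "integral {l..r} (\<lambda>y. if y \<in> {..c} then f y else 0) = integral ({..c} \<inter> {l..r}) f"
    by (rule Henstock_Kurzweil_Integration.integral_restrict_Int)
  moreover have "{..c} \<inter> {l..r} = {l..c}" using assms by auto
  ultimately show ?thesis by (simp only: atMost_iff)
qed

lemma tpoly_scale: "tpoly k (\<lambda>i. s * c i) t = s * tpoly k c t"
  by (simp add: tpoly_def sum_distrib_left mult.assoc)

lemma tpoly_cases:
  "tpoly k (\<lambda>i. if P then f i else if R then g i * w else 0) t = (if P then tpoly k f t else if R then tpoly k g t * w else 0)"
  "tpoly' k (\<lambda>i. if P then f i else if R then g i * w else 0) t = (if P then tpoly' k f t else if R then tpoly' k g t * w else 0)"
  by (auto simp: tpoly_def tpoly'_def sum_distrib_left sum_distrib_right mult_ac)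

context sd_transport
begin

text \<open>
  The upstream and the downstream end after the reflection \<open>y = \<sigma> x\<close>, which makes the transport go
  to the right.
\<close>

definition "L = (if \<sigma> = 1 then a else - b)"
definition "R = (if \<sigma> = 1 then b else - a)"

lemma L_R_forward: "\<sigma> = 1 \<Longrightarrow> L = a \<and> R = b" unfolding L_def R_def by simp

lemma L_R_backward: "\<sigma> = - 1 \<Longrightarrow> L = - b \<and> R = - a" unfolding L_def R_def by simp

lemma LR: "R - L = b - a" "L < R" using ab by (auto simp: L_def R_def)

lemma mem_LR: "\<sigma> * y \<in> {a..b} \<longleftrightarrow> y \<in> {L..R}" using \<sigma> by (auto simp: L_def R_def)

lemma \<sigma>\<sigma> [simp]: "\<sigma> * (\<sigma> * y) = y" "\<sigma> * \<sigma> = 1" using \<sigma> by auto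

lemma integral_flip: "integral {a..b} f = integral {L..R} (\<lambda>y. f (\<sigma> * y))" for f :: "real \<Rightarrow> real"
proof (cases "\<sigma> = 1")
  case False
  then have s: "\<sigma> = - 1" using \<sigma> by simp
  show ?thesis unfolding L_def R_def using Henstock_Kurzweil_Integration.integral_reflect_real[of b a f] by (simp add: s)
qed (use L_R_forward in simp)

lemma integrable_flip: "f integrable_on {a..b} \<longleftrightarrow> (\<lambda>y. f (\<sigma> * y)) integrable_on {L..R}" for f :: "real \<Rightarrow> real"
proof (cases "\<sigma> = 1")
  case False
  then have s: "\<sigma> = - 1" using \<sigma> by simp
  show ?thesis unfolding L_def R_def using Henstock_Kurzweil_Integration.integrable_reflect_real[of f b a] by (simp add: s)
qed (use L_R_forward in simp)

definition "Q m t x = (Ut m t x)\<^sup>2 + 2 * \<kappa> * (Ut m t x * Ux m t x) + (Ux m t x)\<^sup>2"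

lemma regular_Q: "regular {c..e} {a..b} (Q m)"
  unfolding Q_def [abs_def] by (intro regular_add regular_mult regular_power regular_const regular_U)

text \<open>
  The part of the scheme up to the distance \<open>3 d / 4\<close> from the upstream end, where no data are
  seen. The margin to \<open>d / 2\<close>, where the estimate is used, leaves room for windows of length \<open>3
  h\<close>.
\<close>

lemma upwind: "h \<le> d / 16 \<Longrightarrow> upwind h \<delta>0 (\<kappa> * \<sigma>) Ci L (L + 3 * d / 4) k M ((*) \<sigma> ` nodes) (\<lambda>m i y. A m i (\<sigma> * y)) (\<lambda>m i y. \<sigma> * pwd (A m i) (\<sigma> * y))"
proof unfold_locales
  assume hd: "h \<le> d / 16"
  show "0 < h" "0 < \<delta>0" "1 \<le> Ci" "1 \<le> M" by (rule h_pos \<delta>0 Ci M)+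
  show "\<kappa> * \<sigma> = 0 \<or> \<kappa> * \<sigma> = 1" using \<kappa> by auto
  show "(tpoly k c t)\<^sup>2 \<le> Ci / h * integral {t..t + h} (\<lambda>s. (tpoly k c s)\<^sup>2)" for c t by (rule trace_inverse)
  show "integral {t..t + h} (\<lambda>s. (tpoly' k c s)\<^sup>2) \<le> Ci / h\<^sup>2 * integral {t..t + h} (\<lambda>s. (tpoly k c s)\<^sup>2)" for c t
    by (rule deriv_inverse)
  show "finite ((*) \<sigma> ` nodes)" using finite_nodes by simp
  show "L \<le> L + 3 * d / 4" using d by simp
  show "continuous_on UNIV (\<lambda>y. A m i (\<sigma> * y))" for m i
    by (rule continuous_on_compose2[OF pw0_continuous[OF A]]) (auto intro: continuous_intros)
  show "(\<lambda>y. \<sigma> * pwd (A m i) (\<sigma> * y)) \<in> borel_measurable borel" for m i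
  proof -
    have "(\<lambda>y. pwd (A m i) (\<sigma> * y)) \<in> borel_measurable borel"
      by (rule measurable_compose[OF _ pwd_regular(1)[OF A]]) simp
    then show ?thesis by simp
  qed
  show "\<exists>B. \<forall>x. \<bar>\<sigma> * pwd (A m i) (\<sigma> * x)\<bar> \<le> B" for m i
  proof -
    obtain B where "\<And>x. \<bar>pwd (A m i) x\<bar> \<le> B" using pwd_regular(2)[OF A] by blast
    then show ?thesis using \<sigma> by (intro exI[of _ B]) (auto simp: abs_mult)
  qed
  show "((\<lambda>y. A m i (\<sigma> * y)) has_real_derivative \<sigma> * pwd (A m i) (\<sigma> * x)) (at x)"
    if "x \<in> {L<..<L + 3 * d / 4} - (*) \<sigma> ` nodes" for m i x
  proof -
    have "x \<in> {L..R}" using that d LR by auto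
    then have "\<sigma> * x \<in> {a..b}" using mem_LR by simp
    moreover have "\<sigma> * x \<notin> nodes" using that by (metis DiffD2 \<sigma>\<sigma>(1) image_eqI)
    ultimately have "(A m i has_real_derivative pwd (A m i) (\<sigma> * x)) (at (\<sigma> * x))" using pw0_derivative[OF A] by simp
    then have "((\<lambda>y. A m i (\<sigma> * y)) has_real_derivative pwd (A m i) (\<sigma> * x) * \<sigma>) (at x)"
      by (rule DERIV_chain'[rotated]) (auto intro!: derivative_eq_intros)
    then show ?thesis by (simp only: mult.commute)
  qed
  show "A m i (\<sigma> * L) = 0" for m i
    using \<sigma> pw0_outside[OF A] by (auto simp: L_def)
  show "\<exists>p\<in>(*) \<sigma> ` nodes. x \<le> p \<and> p \<le> x + h" if "L \<le> x" "x \<le> L + 3 * d / 4 - h" for x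
  proof (cases "\<sigma> = 1")
    case True
    then have "x \<in> {a..b}" "\<sigma> = 1" using that d h_pos L_R_forward by auto
    then show ?thesis using node_right[of x] by auto
  next
    case False
    then have s: "\<sigma> = - 1" using \<sigma> by simp
    then have "- x \<in> {a..b}" using that d h_pos L_R_backward by auto
    from node_left[OF this] obtain p where "p \<in> nodes" "- x - h \<le> p" "p \<le> - x" by auto
    then show ?thesis using s by (intro bexI[of _ "- p"]) auto
  qed
qed

text \<open>
  The constants of the upstream estimate, which depend only on \<open>\<delta>0\<close> and the inverse inequality.
\<close>

definition "K1 = 8 * (1 + 2 * \<delta>0 * (Ci + 1) + Ci) * (2 + \<delta>0)"
definition "K2 = 2 * (K1 + 5 + 4 * Ci)"

lemma K2_pos: "0 < K2" using \<delta>0 Ci by (auto simp: K1_def K2_def intro!: add_pos_pos mult_pos_pos)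

text \<open>
  Where the sources vanish the residuals are the derivatives of \<open>U\<close>, so that they control the
  stabilizing term.
\<close>

lemma Q_le_residual:
  assumes "x \<notin> {a + d..b - d}"
  shows "Q m t x \<le> (r0 m t x)\<^sup>2 + (r1 m t x)\<^sup>2 + (r2 m t x)\<^sup>2"
  using \<kappa>
proof
  assume \<kappa>: "\<kappa> = 0"
  then have "Q m t x = (r1 m t x)\<^sup>2 + (r2 m t x)\<^sup>2" using s_supp[OF assms] unfolding Q_def r1_def r2_def by simp
  then show ?thesis by simp
next
  assume \<kappa>: "\<kappa> = \<sigma>"
  have "\<sigma>\<^sup>2 = 1" by (simp add: power2_eq_square)
  then have "Q m t x = (r0 m t x)\<^sup>2"
    using s_supp[OF assms] unfolding Q_def r0_def unfolding \<kappa> by (simp add: power2_eq_square algebra_simps)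
  then show ?thesis by simp
qed

text \<open>
  The cut test functions are admissible in the scheme, and their support lies where all data
  vanish. The scheme tested with them therefore reads that \<open>energy_form\<close> and \<open>cut_form\<close> cancel,
  which is the hypothesis of the upstream estimate.
\<close>

lemma upstream_mass:
  assumes gal: galerkin and hd: "h \<le> d / 16"
  shows "(\<Sum>m=1..M. SI m (\<lambda>t x. if \<sigma> * x \<le> L + d / 2 then (U m t x)\<^sup>2 else 0))
    \<le> 3 * K2 * (h\<^sup>2 * (\<Sum>m=1..M. residual m) + h * (\<Sum>m=1..M. jump_sq m))"
proof -
  define c0 where "c0 = L + 3 * d / 4"
  interpret up: upwind h \<delta>0 "\<kappa> * \<sigma>" Ci L c0 k M "(*) \<sigma> ` nodes" "\<lambda>m i y. A m i (\<sigma> * y)" "\<lambda>m i y. \<sigma> * pwd (A m i) (\<sigma> * y)"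
    unfolding c0_def by (rule upwind[OF hd])
  have c0: "L < c0" "c0 < L + d" "c0 \<le> R" using d LR by (auto simp: c0_def)
  have free: "\<sigma> * y \<notin> {a + d..b - d}" if "y \<le> c0" for y
    using that \<sigma> c0(2) by (auto simp: L_def)
  have U: "up.U m t y = U m t (\<sigma> * y)" "up.Ut m t y = Ut m t (\<sigma> * y)" "up.Ux m t y = \<sigma> * Ux m t (\<sigma> * y)" for m t y
    by (simp_all add: up.U_def up.Ut_def up.Ux_def U_def Ut_def Ux_def tpoly_scale)
  have start: "up.start = start" by (simp add: up.start_def start_def fun_eq_iff)
  have jump: "up.jump m y = jump m (\<sigma> * y)" if "y \<le> c0" for m y
    using w0(2)[OF free[OF that]] by (simp add: up.jump_def jump_def up.prev_def prev_def U start)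
  have Q: "up.Q m t y = Q m t (\<sigma> * y)" for m t y
  proof -
    have "\<sigma>\<^sup>2 = 1" by (simp add: power2_eq_square)
    then show ?thesis unfolding up.Q_def Q_def U by (simp add: power_mult_distrib mult_ac)
  qed
  have cut: "integral {L..p} up.energy_form + integral {p..q} (up.cut_form p q) = 0"
    if p: "p \<in> (*) \<sigma> ` nodes" and q: "q \<in> (*) \<sigma> ` nodes" and pq: "L \<le> p" "p < q" "q \<le> c0" for p q
  proof -
    define px where "px = \<sigma> * p"
    define qx where "qx = \<sigma> * q"
    have px: "px \<in> nodes" "\<sigma> * px = p" and qx: "qx \<in> nodes" "\<sigma> * qx = q"
      using p q by (auto simp: px_def qx_def)
    have dpq: "qx - px = \<sigma> * (q - p)" by (simp add: px_def qx_def right_diff_distrib)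
    \<comment> \<open>The discrete solution upstream of \<open>p\<close>, continued by the ramp from \<open>p\<close> to \<open>q\<close>.\<close>
    define B where "B m i x = (if \<sigma> * x \<le> p then A m i x else if \<sigma> * x \<le> q then A m i px * ((qx - x) / (qx - px)) else 0)" for m i x
    have B: "pw0 (B m i)" for m i
      unfolding B_def [abs_def]
      by (rule cut_pw0(1)[OF A px(1) qx(1) \<sigma>, unfolded px(2) qx(2)]) (rule pq)
    have B': "pwd (B m i) x = (if \<sigma> * x \<le> p then pwd (A m i) x else if \<sigma> * x \<le> q then - (A m i px / (qx - px)) else 0)"
      if "x \<in> {a..b} - nodes" for m i x
      unfolding B_def [abs_def]
      by (rule cut_pw0(2)[OF A px(1) qx(1) \<sigma>, unfolded px(2) qx(2)]) (rule pq that)+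
    define \<gamma> where "\<gamma> m t x = tpoly k (\<lambda>i. B m i x) t" for m t x
    define \<gamma>t where "\<gamma>t m t x = tpoly' k (\<lambda>i. B m i x) t" for m t x
    define \<gamma>x where "\<gamma>x m t x = tpoly k (\<lambda>i. pwd (B m i) x) t" for m t x
    have \<gamma>: "\<gamma> m t x = (if \<sigma> * x \<le> p then U m t x else if \<sigma> * x \<le> q then U m t px * ((qx - x) / (qx - px)) else 0)" for m t x
      unfolding \<gamma>_def B_def U_def by (rule tpoly_cases(1))
    have \<gamma>t: "\<gamma>t m t x = (if \<sigma> * x \<le> p then Ut m t x else if \<sigma> * x \<le> q then Ut m t px * ((qx - x) / (qx - px)) else 0)" for m t x
      unfolding \<gamma>t_def B_def Ut_def by (rule tpoly_cases(2))
    have \<gamma>x: "\<gamma>x m t x = (if \<sigma> * x \<le> p then Ux m t x else if \<sigma> * x \<le> q then U m t px * (- (1 / (qx - px))) else 0)"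
      if "x \<in> {a..b} - nodes" for m t x
    proof -
      have "pwd (B m i) x = (if \<sigma> * x \<le> p then pwd (A m i) x else if \<sigma> * x \<le> q then A m i px * (- (1 / (qx - px))) else 0)" for i
        using B'[OF that, of m i] by simp
      then show ?thesis unfolding \<gamma>x_def U_def Ux_def by (simp only: tpoly_cases(1))
    qed
    have node0: "\<gamma>x m t x = 0" if "x \<in> nodes" for m t x
      using that by (simp add: \<gamma>x_def pwd_def tpoly_def)
    have reg: "regular {c..e} {a..b} (\<gamma> m)" "regular {c..e} {a..b} (\<gamma>t m)" "regular {c..e} {a..b} (\<gamma>x m)" for c e m
    proof -
      have 1: "regular {c..e} {a..b} (\<lambda>t x. B m i x)" for i by (rule regular_continuous_space[OF pw0_continuous[OF B]])
      have 2: "regular {c..e} {a..b} (\<lambda>t x. pwd (B m i) x)" for i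
        using pwd_regular(2)[OF B, of m i] regular_space[OF pwd_regular(1)[OF B, of m i]] by blast
      show "regular {c..e} {a..b} (\<gamma> m)" "regular {c..e} {a..b} (\<gamma>t m)" "regular {c..e} {a..b} (\<gamma>x m)"
        unfolding \<gamma>_def [abs_def] \<gamma>t_def [abs_def] \<gamma>x_def [abs_def] by (intro regular_tpoly 1 2)+
    qed
    define G where "G m t x = (Ut m t x + \<sigma> * Ux m t x) * \<gamma> m t x
      + \<delta>0 * h * ((Ut m t x + \<kappa> * Ux m t x) * \<gamma>t m t x + (\<kappa> * Ut m t x + Ux m t x) * \<gamma>x m t x)" for m t x
    have regG: "regular {c..e} {a..b} (G m)" for m c e
      unfolding G_def [abs_def] by (intro regular_add regular_mult regular_const regular_U reg)
    have cj: "(\<lambda>x. jump m x * \<gamma> m (start m) x) integrable_on {a..b}" for m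
      unfolding \<gamma>_def tpoly_def
      by (intro integrable_continuous_real continuous_intros jump_continuous continuous_on_subset[OF pw0_continuous[OF B]]) auto
    define Z where "Z m x = integral (slab m) (\<lambda>t. G m t x) + jump m x * \<gamma> m (start m) x" for m x
    have Zi: "Z m integrable_on {a..b}" for m
      unfolding Z_def [abs_def] by (intro integrable_add regular_integral(1) regG cj)
    have Z0: "integral {a..b} (Z m) = 0" if m: "m \<in> {1..M}" for m
    proof -
      have "SI m (\<lambda>t x. r0 m t x * \<gamma> m t x + \<delta>0 * h * (r1 m t x * \<gamma>t m t x + r2 m t x * \<gamma>x m t x))
        = integral {a..b} (\<lambda>x. jump m x * \<gamma> m (start m) x)"
        using gal m B unfolding galerkin_def \<gamma>_def \<gamma>t_def \<gamma>x_def by blast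
      moreover have "SI m (\<lambda>t x. r0 m t x * \<gamma> m t x + \<delta>0 * h * (r1 m t x * \<gamma>t m t x + r2 m t x * \<gamma>x m t x)) = SI m (\<lambda>t x. - G m t x)"
        unfolding SI_def
      proof (rule set_lebesgue_integral_cong)
        show "\<forall>z. z \<in> slab m \<times> {a..b} \<longrightarrow> r0 m (fst z) (snd z) * \<gamma> m (fst z) (snd z) + \<delta>0 * h * (r1 m (fst z) (snd z) * \<gamma>t m (fst z) (snd z) + r2 m (fst z) (snd z) * \<gamma>x m (fst z) (snd z)) = - G m (fst z) (snd z)"
        proof (intro allI impI)
          fix z assume z: "z \<in> slab m \<times> {a..b}"
          define t x where "t = fst z" and "x = snd z"
          have "r0 m t x * \<gamma> m t x + \<delta>0 * h * (r1 m t x * \<gamma>t m t x + r2 m t x * \<gamma>x m t x) = - G m t x"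
          proof (cases "\<sigma> * x \<le> q")
            case True
            then have "s0 t x = 0 \<and> s1 t x = 0 \<and> s2 t x = 0" using s_supp[of x t] free[of "\<sigma> * x"] pq by simp
            then show ?thesis by (simp add: r0_def r1_def r2_def G_def algebra_simps)
          next
            case False
            then have "\<gamma> m t x = 0" "\<gamma>t m t x = 0" using pq by (auto simp: \<gamma> \<gamma>t)
            moreover have "\<gamma>x m t x = 0"
              using False pq node0 \<gamma>x[of x m t] z by (cases "x \<in> nodes") (auto simp: x_def)
            ultimately show ?thesis by (simp add: G_def)
          qed
          then show "r0 m (fst z) (snd z) * \<gamma> m (fst z) (snd z) + \<delta>0 * h * (r1 m (fst z) (snd z) * \<gamma>t m (fst z) (snd z) + r2 m (fst z) (snd z) * \<gamma>x m (fst z) (snd z)) = - G m (fst z) (snd z)"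
            by (simp add: t_def x_def)
        qed
      qed (rule slab_sets[unfolded sets_lborel[symmetric]])
      moreover have "SI m (\<lambda>t x. - G m t x) = - SI m (G m)" unfolding SI_def set_lebesgue_integral_def by simp
      ultimately have "SI m (G m) + integral {a..b} (\<lambda>x. jump m x * \<gamma> m (start m) x) = 0" by simp
      then show ?thesis
        unfolding Z_def SI_regular(1)[OF regG]
        by (subst integral_add) (auto intro: regular_integral(1)[OF regG] cj)
    qed
    define F where "F y = (\<Sum>m=1..M. Z m (\<sigma> * y))" for y
    have Fi: "F integrable_on {L..R}" unfolding F_def [abs_def] using Zi integrable_flip by (intro integrable_sum) auto
    have "integral {L..R} F = (\<Sum>m=1..M. integral {L..R} (\<lambda>y. Z m (\<sigma> * y)))"
      unfolding F_def using Zi integrable_flip by (intro integral_sum) auto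
    then have F0: "integral {L..R} F = 0" using Z0 integral_flip by simp
    have N: "negligible ((*) \<sigma> ` nodes)" using finite_nodes by (intro negligible_finite) auto
    have off: "\<sigma> * y \<in> {a..b} - nodes" if "y \<in> {L..R} - (*) \<sigma> ` nodes" for y
      using that mem_LR[of y] by (metis DiffD1 DiffD2 DiffI \<sigma>\<sigma>(1) image_eqI)
    have 1: "integral {L..p} F = integral {L..p} up.energy_form"
    proof (rule integral_spike[OF N])
      fix y assume y: "y \<in> {L..p} - (*) \<sigma> ` nodes"
      then have yc: "y \<le> c0" "\<sigma> * y \<in> {a..b} - nodes" using off[of y] pq c0 by auto
      have G: "G m t (\<sigma> * y) = (up.Ut m t y + up.Ux m t y) * up.U m t y + \<delta>0 * h * up.Q m t y" for m t
        using y unfolding G_def \<gamma> \<gamma>t \<gamma>x[OF yc(2)] U Q Q_def by (simp add: power2_eq_square algebra_simps)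
      show "up.energy_form y = F y"
        using y by (simp add: up.energy_form_def F_def Z_def G start jump[OF yc(1)] \<gamma> U)
    qed
    have 2: "integral {p..q} F = integral {p..q} (up.cut_form p q)"
    proof (rule integral_spike[OF N])
      fix y assume y: "y \<in> {p..q} - (*) \<sigma> ` nodes"
      then have yc: "y \<le> c0" "\<sigma> * y \<in> {a..b} - nodes" using off[of y] pq c0 by auto
      have yp: "\<not> y \<le> p" "y \<le> q" using y p by (auto simp: order_le_less)
      have w: "(qx - \<sigma> * y) / (qx - px) = (q - y) / (q - p)"
        using \<sigma> by (auto simp: px_def qx_def divide_simps) (simp add: algebra_simps)
      have "1 / (\<sigma> * e) = \<sigma> / e" for e using \<sigma> by auto
      then have i: "1 / (qx - px) = \<sigma> / (q - p)" unfolding dpq .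
      have G: "G m t (\<sigma> * y) = (up.Ut m t y + up.Ux m t y) * (up.U m t p * ((q - y) / (q - p)))
     + \<delta>0 * h * (up.Ut m t y * (up.Ut m t p * ((q - y) / (q - p)))
        + \<kappa> * \<sigma> * (up.Ut m t y * (- (up.U m t p / (q - p))) + up.Ux m t y * (up.Ut m t p * ((q - y) / (q - p))))
        + up.Ux m t y * (- (up.U m t p / (q - p))))" for m t
      proof -
        have \<sigma>3: "\<sigma> * (\<sigma> * z) = z" "\<sigma> * (z * \<sigma>) = z" for z using \<sigma> by auto
        show ?thesis
          using yp unfolding G_def \<gamma> \<gamma>t \<gamma>x[OF yc(2)] U w i
          by (simp add: px_def[symmetric] algebra_simps \<sigma>3)
      qed
      show "up.cut_form p q y = F y"
        using yp by (simp add: up.cut_form_def Let_def F_def Z_def G start jump[OF yc(1)] \<gamma> U w px_def[symmetric])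
    qed
    have 3: "integral {q..R} F = integral {q..R} (\<lambda>_. 0)"
    proof (rule integral_spike[OF N])
      fix y assume y: "y \<in> {q..R} - (*) \<sigma> ` nodes"
      then have yc: "\<sigma> * y \<in> {a..b} - nodes" using off[of y] pq by auto
      have yq: "\<not> y \<le> q" "\<not> y \<le> p" using y q pq by (auto simp: order_le_less)
      show "0 = F y" using yq by (simp add: F_def Z_def G_def \<gamma> \<gamma>t \<gamma>x[OF yc])
    qed
    have "integral {L..p} F + integral {p..R} F = integral {L..R} F"
      using pq c0 Fi by (intro Henstock_Kurzweil_Integration.integral_combine) auto
    moreover have "integral {p..q} F + integral {q..R} F = integral {p..R} F"
      using pq c0 by (intro Henstock_Kurzweil_Integration.integral_combine integrable_on_subinterval[OF Fi]) auto
    ultimately show ?thesis using 1 2 3 F0 by simp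
  qed
  have "integral {L..L + d / 2} up.mass \<le> 3 * up.C2 * h * integral {L..c0} up.defect"
    by (rule up.upstream_estimate[OF _ _ cut]) (use d hd in \<open>auto simp: c0_def\<close>)
  also have "up.C2 = K2" by (simp add: up.C2_def up.C1_def K2_def K1_def)
  finally have up: "integral {L..L + d / 2} up.mass \<le> 3 * K2 * h * integral {L..c0} up.defect" .
  have left: "(\<Sum>m=1..M. SI m (\<lambda>t x. if \<sigma> * x \<le> L + d / 2 then (U m t x)\<^sup>2 else 0)) = integral {L..L + d / 2} up.mass"
  proof -
    have reg: "regular {c..e} {a..b} (\<lambda>t x. if \<sigma> * x \<le> L + d / 2 then (U m t x)\<^sup>2 else 0)" for c e m
      by (intro regular_if regular_power regular_U) simp
    have one: "SI m (\<lambda>t x. if \<sigma> * x \<le> L + d / 2 then (U m t x)\<^sup>2 else 0) = integral {L..L + d / 2} (\<lambda>y. integral (slab m) (\<lambda>t. (U m t (\<sigma> * y))\<^sup>2))" for m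
    proof -
      have "SI m (\<lambda>t x. if \<sigma> * x \<le> L + d / 2 then (U m t x)\<^sup>2 else 0)
        = integral {L..R} (\<lambda>y. integral (slab m) (\<lambda>t. if y \<le> L + d / 2 then (U m t (\<sigma> * y))\<^sup>2 else 0))"
        unfolding SI_regular(1)[OF reg] integral_flip by simp
      also have "\<dots> = integral {L..R} (\<lambda>y. if y \<le> L + d / 2 then integral (slab m) (\<lambda>t. (U m t (\<sigma> * y))\<^sup>2) else 0)"
        by (intro integral_cong) auto
      finally show ?thesis using integral_cutoff[of L "L + d / 2" R] d LR by simp
    qed
    have i: "(\<lambda>y. integral (slab m) (\<lambda>t. (U m t (\<sigma> * y))\<^sup>2)) integrable_on {L..L + d / 2}" for m
      by (rule integrable_on_subinterval[of _ "{L..R}"])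
         (use d LR integrable_flip[THEN iffD1, OF regular_integral(1)[OF regular_power[OF regular_U(1)]]] in auto)
    show ?thesis unfolding one up.mass_def U start by (rule integral_sum[symmetric]) (use i in auto)
  qed
  have right: "integral {L..c0} up.defect \<le> h * (\<Sum>m=1..M. residual m) + (\<Sum>m=1..M. jump_sq m)"
  proof -
    have iQ: "(\<lambda>y. integral (slab m) (\<lambda>t. Q m t (\<sigma> * y))) integrable_on {L..R}" for m
      using integrable_flip[THEN iffD1, OF regular_integral(1)[OF regular_Q]] by blast
    have iQ': "(\<lambda>y. integral (slab m) (\<lambda>t. Q m t (\<sigma> * y))) integrable_on {L..c0}" for m
      by (rule integrable_on_subinterval[OF iQ]) (use c0 in auto)
    have ij: "(\<lambda>y. (jump m (\<sigma> * y))\<^sup>2) integrable_on {u..v}" for m u v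
      by (intro integrable_continuous_real continuous_intros continuous_on_compose2[OF jump_continuous[of UNIV]]) auto
    have q: "integral {L..c0} (\<lambda>y. integral (slab m) (\<lambda>t. Q m t (\<sigma> * y))) \<le> residual m" if m: "m \<in> {1..M}" for m
    proof -
      have reg: "regular {c..e} {a..b} (\<lambda>t x. if \<sigma> * x \<le> c0 then Q m t x else 0)" for c e
        by (intro regular_if regular_Q) simp
      have "SI m (\<lambda>t x. if \<sigma> * x \<le> c0 then Q m t x else 0)
        = integral {L..R} (\<lambda>y. integral (slab m) (\<lambda>t. if y \<le> c0 then Q m t (\<sigma> * y) else 0))"
        unfolding SI_regular(1)[OF reg] integral_flip by simp
      also have "\<dots> = integral {L..R} (\<lambda>y. if y \<le> c0 then integral (slab m) (\<lambda>t. Q m t (\<sigma> * y)) else 0)"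
        by (intro integral_cong) auto
      also have "\<dots> = integral {L..c0} (\<lambda>y. integral (slab m) (\<lambda>t. Q m t (\<sigma> * y)))"
        using c0 by (intro integral_cutoff) auto
      finally have eq: "SI m (\<lambda>t x. if \<sigma> * x \<le> c0 then Q m t x else 0) = integral {L..c0} (\<lambda>y. integral (slab m) (\<lambda>t. Q m t (\<sigma> * y)))" .
      have "SI m (\<lambda>t x. if \<sigma> * x \<le> c0 then Q m t x else 0) \<le> residual m"
        unfolding residual_def
      proof (rule SI_mono)
        show "set_integrable lborel (slab m \<times> {a..b}) (\<lambda>z. if \<sigma> * snd z \<le> c0 then Q m (fst z) (snd z) else 0)"
          by (rule regular_integral(3)[OF reg])
        show "set_integrable lborel (slab m \<times> {a..b}) (\<lambda>z. (r0 m (fst z) (snd z))\<^sup>2 + (r1 m (fst z) (snd z))\<^sup>2 + (r2 m (fst z) (snd z))\<^sup>2)"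
          by (intro set_integral_add sq_power_integrable sq_r m)
        show "(if \<sigma> * x \<le> c0 then Q m t x else 0) \<le> (r0 m t x)\<^sup>2 + (r1 m t x)\<^sup>2 + (r2 m t x)\<^sup>2" for t x
          using Q_le_residual[of x m t] free[of "\<sigma> * x"] by auto
      qed
      then show ?thesis by (simp add: eq)
    qed
    have j: "integral {L..c0} (\<lambda>y. (jump m (\<sigma> * y))\<^sup>2) \<le> jump_sq m" for m
      unfolding jump_sq_def integral_flip using c0 by (intro integral_subset_le ij) auto
    have "integral {L..c0} up.defect = integral {L..c0} (\<lambda>y. \<Sum>m=1..M. h * integral (slab m) (\<lambda>t. Q m t (\<sigma> * y)) + (jump m (\<sigma> * y))\<^sup>2)"
      by (intro integral_cong) (simp add: up.defect_def Q start jump)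
    also have "\<dots> = (\<Sum>m=1..M. h * integral {L..c0} (\<lambda>y. integral (slab m) (\<lambda>t. Q m t (\<sigma> * y))) + integral {L..c0} (\<lambda>y. (jump m (\<sigma> * y))\<^sup>2))"
      by (subst integral_sum; (subst integral_add)?) (auto intro!: integrable_add integrable_on_mult_right iQ' ij)
    also have "\<dots> \<le> (\<Sum>m=1..M. h * residual m + jump_sq m)"
      using q j h_pos by (intro sum_mono add_mono mult_left_mono) auto
    finally show ?thesis by (simp add: sum.distrib sum_distrib_left)
  qed
  have "3 * K2 * h * integral {L..c0} up.defect \<le> 3 * K2 * h * (h * (\<Sum>m=1..M. residual m) + (\<Sum>m=1..M. jump_sq m))"
    using right K2_pos h_pos by (intro mult_left_mono) auto
  also have "\<dots> = 3 * K2 * (h\<^sup>2 * (\<Sum>m=1..M. residual m) + h * (\<Sum>m=1..M. jump_sq m))"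
    by (simp add: power2_eq_square algebra_simps)
  finally show ?thesis using up left by simp
qed

end

section \<open>Residuals against a dual solution\<close>

lemma C1_function_regular_square:
  assumes "C1_function \<psi> \<psi>t \<psi>x"
  shows "regular {c..d} {a..b} (\<lambda>t x. (\<psi> t x)\<^sup>2)" "regular {c..d} {a..b} (\<lambda>t x. (\<psi>t t x)\<^sup>2)" "regular {c..d} {a..b} (\<lambda>t x. (\<psi>x t x)\<^sup>2)"
  by (intro regular_power C1_functionD(6,7,8)[OF assms])+

context sd_transport
begin

definition "H1_sq m \<psi> \<psi>t \<psi>x = SI m (\<lambda>t x. (\<psi> t x)\<^sup>2) + SI m (\<lambda>t x. (\<psi>t t x)\<^sup>2) + SI m (\<lambda>t x. (\<psi>x t x)\<^sup>2)"

lemma SI_le_H1: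
  assumes \<psi>: "C1_function \<psi> \<psi>t \<psi>x" and F: "regular (slab m) {a..b} F" and c: "0 \<le> c0" "0 \<le> c1" "0 \<le> c2"
    and le: "\<And>t x. t \<in> slab m \<Longrightarrow> x \<in> {a..b} \<Longrightarrow> F t x \<le> c0 * (\<psi> t x)\<^sup>2 + c1 * (\<psi>t t x)\<^sup>2 + c2 * (\<psi>x t x)\<^sup>2"
  shows "SI m F \<le> (c0 + c1 + c2) * H1_sq m \<psi> \<psi>t \<psi>x"
proof -
  note reg = C1_function_regular_square[OF \<psi>, of "start m" "start m + h" a b, THEN regular_integral(3)]
  have "SI m F \<le> SI m (\<lambda>t x. c0 * (\<psi> t x)\<^sup>2 + c1 * (\<psi>t t x)\<^sup>2 + c2 * (\<psi>x t x)\<^sup>2)"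
    by (rule SI_mono[OF regular_integral(3)[OF F] _ le])
       (intro set_integral_add set_integrable_mult_right reg)
  also have "\<dots> = c0 * SI m (\<lambda>t x. (\<psi> t x)\<^sup>2) + c1 * SI m (\<lambda>t x. (\<psi>t t x)\<^sup>2) + c2 * SI m (\<lambda>t x. (\<psi>x t x)\<^sup>2)"
    unfolding SI_def using reg
    by (subst set_integral_add(2); (subst set_integral_add(2))?) (auto intro!: set_integral_add set_integrable_mult_right)
  also have "\<dots> \<le> (c0 + c1 + c2) * H1_sq m \<psi> \<psi>t \<psi>x"
  proof -
    have "0 \<le> SI m (\<lambda>t x. (\<psi> t x)\<^sup>2)" "0 \<le> SI m (\<lambda>t x. (\<psi>t t x)\<^sup>2)" "0 \<le> SI m (\<lambda>t x. (\<psi>x t x)\<^sup>2)"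
      by (rule SI_sq_nonneg)+
    moreover have "c0 * I + c1 * It + c2 * Ix \<le> (c0 + c1 + c2) * (I + It + Ix)"
      if "0 \<le> I" "0 \<le> It" "0 \<le> Ix" for I It Ix
    proof -
      have "c0 * I \<le> c0 * (I + It + Ix)" "c1 * It \<le> c1 * (I + It + Ix)" "c2 * Ix \<le> c2 * (I + It + Ix)"
        using that c by (auto intro!: mult_left_mono)
      then show ?thesis by (simp add: distrib_right)
    qed
    ultimately show ?thesis by (simp add: H1_sq_def)
  qed
  finally show ?thesis .
qed

lemma err_split:
  assumes m: "m \<in> {1..M}" and "C1_function \<phi> \<phi>t \<phi>x" "C1_function \<zeta> \<zeta>t \<zeta>x"
    and eq: "\<And>t x. \<psi> t x = \<phi> t x + \<zeta> t x"
  shows "err m \<psi> = err m \<phi> + err m \<zeta>"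
proof -
  have s: "sq m \<phi>" "sq m \<zeta>" using assms(2,3) by (auto intro: sq_regular C1_functionD(6))
  have "SI m (\<lambda>t x. r0 m t x * \<psi> t x) = SI m (\<lambda>t x. r0 m t x * \<phi> t x) + SI m (\<lambda>t x. r0 m t x * \<zeta> t x)"
    unfolding SI_def eq distrib_left
    by (rule set_integral_add(2)) (intro sq_mult_integrable sq_r m s)+
  moreover have "integral {a..b} (\<lambda>x. jump m x * \<psi> (start m) x) = integral {a..b} (\<lambda>x. jump m x * \<phi> (start m) x) + integral {a..b} (\<lambda>x. jump m x * \<zeta> (start m) x)"
    unfolding eq distrib_left
    by (rule integral_add)
       (intro integrable_continuous_real continuous_intros jump_continuous C1_functionD(1)[OF assms(2)] C1_functionD(1)[OF assms(3)])+
  ultimately show ?thesis by (simp add: err_def)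
qed

lemma start_less: "m \<in> {1..M} \<Longrightarrow> t \<in> slab m \<Longrightarrow> 0 \<le> t \<and> t \<le> real M * h"
proof -
  assume m: "m \<in> {1..M}" and t: "t \<in> slab m"
  have "0 \<le> (real m - 1) * h" using m h_pos by (intro mult_nonneg_nonneg) auto
  moreover have "real m * h \<le> real M * h" using m h_pos by (intro mult_right_mono) auto
  ultimately show ?thesis using t by (auto simp: start_def algebra_simps)
qed

lemma sum_start_end: "start M + h = real M * h" by (simp add: start_def algebra_simps)

text \<open>
  A cutoff that vanishes at the upstream end and is one at a distance of \<open>d / 2\<close>. It need not be
  smooth, and a quadratic profile has bounded explicit derivatives.
\<close>

definition "\<eta> x = 1 - (max 0 (1 - (\<sigma> * x - L) / (d / 2)))\<^sup>2"
definition "\<eta>' x = 4 * \<sigma> / d * max 0 (1 - (\<sigma> * x - L) / (d / 2))"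

lemma \<eta>_derivative: "(\<eta> has_real_derivative \<eta>' x) (at x)"
proof -
  have "((\<lambda>x. 1 - (\<sigma> * x - L) / (d / 2)) has_real_derivative - (2 * \<sigma> / d)) (at x)"
    using d by (auto intro!: derivative_eq_intros)
  from DERIV_chain'[OF this has_derivative_max0_square]
  have "((\<lambda>x. (max 0 (1 - (\<sigma> * x - L) / (d / 2)))\<^sup>2) has_real_derivative - \<eta>' x) (at x)"
    by (simp add: \<eta>'_def mult_ac)
  from DERIV_diff[OF DERIV_const[of 1] this] show ?thesis unfolding \<eta>_def [abs_def] by simp
qed

lemma \<eta>'_continuous: "continuous_on UNIV \<eta>'"
  unfolding \<eta>'_def [abs_def] using d by (intro continuous_intros) auto

lemma \<eta>_range:
  assumes "x \<in> {a..b}"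
  shows "0 \<le> \<eta> x" "\<eta> x \<le> 1" "(\<eta>' x)\<^sup>2 \<le> 16 / d\<^sup>2"
proof -
  define w where "w = max 0 (1 - (\<sigma> * x - L) / (d / 2))"
  have "\<sigma> * x \<in> {L..R}" using assms mem_LR[of "\<sigma> * x"] by simp
  then have w: "0 \<le> w" "w \<le> 1" using d by (auto simp: w_def)
  then have w2: "w\<^sup>2 \<le> 1" by (simp add: power_le_one)
  show "0 \<le> \<eta> x" "\<eta> x \<le> 1" using w2 unfolding \<eta>_def w_def[symmetric] by auto
  have "(\<eta>' x)\<^sup>2 = 16 / d\<^sup>2 * w\<^sup>2"
    unfolding \<eta>'_def w_def[symmetric] using \<sigma> by (auto simp: power_mult_distrib power_divide)
  also have "\<dots> \<le> 16 / d\<^sup>2 * 1" using w2 by (intro mult_left_mono) auto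
  finally show "(\<eta>' x)\<^sup>2 \<le> 16 / d\<^sup>2" by simp
qed

lemma \<eta>_one: "L + d / 2 \<le> \<sigma> * x \<Longrightarrow> \<eta> x = 1 \<and> \<eta>' x = 0"
  using d by (auto simp: \<eta>_def \<eta>'_def max_def field_simps)

lemma \<eta>_upstream: "\<sigma> * x = L \<Longrightarrow> \<eta> x = 0"
  by (simp add: \<eta>_def)

text \<open>
  A common bound of all constants in the two cases of the error estimate; the numbers leave room
  to spare.
\<close>

definition "K = 3 * K2 + (4 + \<delta>0\<^sup>2) * (3 + 32 / d\<^sup>2) + 1000 / d\<^sup>2 + 10"

lemma total_nonneg: "0 \<le> h\<^sup>2 * (\<Sum>m=1..M. residual m) + h * (\<Sum>m=1..M. jump_sq m)"
proof -
  have "0 \<le> residual m" if "m \<in> {1..M}" for m unfolding residual_eq[OF that] by (intro add_nonneg_nonneg SI_sq_nonneg)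
  moreover have "0 \<le> jump_sq m" for m unfolding jump_sq_def
    by (intro integral_nonneg integrable_continuous_real continuous_intros jump_continuous) auto
  ultimately show ?thesis using h_pos by (intro add_nonneg_nonneg mult_nonneg_nonneg sum_nonneg) auto
qed

text \<open>
  Near the upstream end the dual solution cannot be interpolated, since it does not vanish at the
  end. There the functional is transformed by integration by parts into a pairing of the discrete
  solution with derivatives of the dual solution, and the discrete solution is small by the
  upstream estimate.
\<close>

lemma upstream_error:
  assumes gal: galerkin and hd: "h \<le> d / 16" and \<psi>: "C1_function \<psi> \<psi>t \<psi>x"
    and final: "\<And>x. x \<in> {a..b} \<Longrightarrow> \<psi> (real M * h) x = 0" and \<epsilon>: "0 < \<epsilon>"
  shows "2 * (\<Sum>m=1..M. err m (\<lambda>t x. (1 - \<eta> x) * \<psi> t x))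
    \<le> \<epsilon> * (3 * K2 * (h\<^sup>2 * (\<Sum>m=1..M. residual m) + h * (\<Sum>m=1..M. jump_sq m)))
      + (6 + 48 / d\<^sup>2) * (\<Sum>m=1..M. H1_sq m \<psi> \<psi>t \<psi>x) / \<epsilon>"
proof -
  define \<zeta> where "\<zeta> t x = (1 - \<eta> x) * \<psi> t x" for t x
  define \<zeta>t where "\<zeta>t t x = (1 - \<eta> x) * \<psi>t t x" for t x
  define \<zeta>x where "\<zeta>x t x = - \<eta>' x * \<psi> t x + (1 - \<eta> x) * \<psi>x t x" for t x
  have \<zeta>: "C1_function \<zeta> \<zeta>t \<zeta>x"
    unfolding \<zeta>_def [abs_def] \<zeta>t_def [abs_def] \<zeta>x_def [abs_def]
  proof (rule C1_function_mult_x[OF \<psi>])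
    show "((\<lambda>x. 1 - \<eta> x) has_real_derivative - \<eta>' x) (at x)" for x
      using DERIV_diff[OF DERIV_const[of 1] \<eta>_derivative] by simp
    show "continuous_on UNIV (\<lambda>x. - \<eta>' x)" by (intro continuous_intros \<eta>'_continuous)
  qed
  define D where "D t x = \<zeta>t t x + \<sigma> * \<zeta>x t x" for t x
  have regD: "regular {u..v} {a..b} D" for u v
    unfolding D_def [abs_def] by (intro regular_add regular_mult regular_const C1_functionD(7,8)[OF \<zeta>])
  define V where "V m t x = (if \<sigma> * x \<le> L + d / 2 then U m t x else 0)" for m t x
  have regV: "regular {u..v} {a..b} (V m)" for u v m
    unfolding V_def [abs_def] by (intro regular_if regular_U) simp
  have far: "1 - \<eta> x = 0" if "x \<in> {a + d..b - d}" for x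
  proof -
    have "L + d / 2 \<le> \<sigma> * x" using that \<sigma> L_R_forward L_R_backward d by auto
    then show ?thesis using \<eta>_one by simp
  qed
  have err: "err m \<zeta> = - (SI m (\<lambda>t x. (Ut m t x + \<sigma> * Ux m t x) * \<zeta> t x) + integral {a..b} (\<lambda>x. jump m x * \<zeta> (start m) x))" for m
  proof -
    have "r0 m t x * \<zeta> t x = - ((Ut m t x + \<sigma> * Ux m t x) * \<zeta> t x)" for t x
    proof (cases "x \<in> {a + d..b - d}")
      case True then show ?thesis using far by (simp add: \<zeta>_def)
    next
      case False then show ?thesis using s_supp[OF False] by (simp add: r0_def algebra_simps)
    qed
    then show ?thesis by (simp add: err_def SI_def set_lebesgue_integral_def)
  qed
  have "integral {a..b} (\<lambda>x. U M (start M + h) x * \<zeta> (start M + h) x) = integral {a..b} (\<lambda>x. 0)"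
    by (rule integral_cong) (simp add: \<zeta>_def sum_start_end final)
  moreover have "integral {a..b} (\<lambda>x. w0 x * \<zeta> 0 x) = integral {a..b} (\<lambda>x. 0)"
    by (rule integral_cong) (use w0(2) far in \<open>force simp: \<zeta>_def\<close>)
  ultimately have "(\<Sum>m=1..M. err m \<zeta>) = (\<Sum>m=1..M. SI m (\<lambda>t x. U m t x * D t x))"
    using integration_by_parts[OF \<zeta>] unfolding err sum_negf D_def by simp
  also have "\<dots> = (\<Sum>m=1..M. SI m (\<lambda>t x. V m t x * D t x))"
  proof -
    have "U m t x * D t x = V m t x * D t x" for m t x
      using \<eta>_one[of x] by (auto simp: V_def D_def \<zeta>t_def \<zeta>x_def)
    then show ?thesis by (simp only:)
  qed
  finally have "2 * (\<Sum>m=1..M. err m \<zeta>) = (\<Sum>m=1..M. 2 * SI m (\<lambda>t x. V m t x * D t x))"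
    by (simp add: sum_distrib_left)
  also have "\<dots> \<le> (\<Sum>m=1..M. \<epsilon> * SI m (\<lambda>t x. (V m t x)\<^sup>2) + (6 + 48 / d\<^sup>2) * H1_sq m \<psi> \<psi>t \<psi>x / \<epsilon>)"
  proof (rule sum_mono)
    fix m assume "m \<in> {1..M}"
    have "SI m (\<lambda>t x. (D t x)\<^sup>2) \<le> (48 / d\<^sup>2 + 3 + 3) * H1_sq m \<psi> \<psi>t \<psi>x"
    proof (rule SI_le_H1[OF \<psi>])
      fix t x assume x: "x \<in> {a..b}"
      define e where "e = 1 - \<eta> x"
      have e: "0 \<le> e" "e \<le> 1" using \<eta>_range[OF x] by (auto simp: e_def)
      then have e2: "e\<^sup>2 \<le> 1" by (simp add: power_le_one)
      have "D t x = e * \<psi>t t x + (- \<sigma> * \<eta>' x) * \<psi> t x + (\<sigma> * e) * \<psi>x t x"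
        by (simp add: D_def \<zeta>t_def \<zeta>x_def e_def algebra_simps)
      also have "\<dots>\<^sup>2 \<le> 3 * ((e * \<psi>t t x)\<^sup>2 + ((- \<sigma> * \<eta>' x) * \<psi> t x)\<^sup>2 + ((\<sigma> * e) * \<psi>x t x)\<^sup>2)"
      proof -
        have "(p + q + r)\<^sup>2 \<le> 3 * (p\<^sup>2 + q\<^sup>2 + r\<^sup>2)" for p q r :: real
          using sum_squares_bound[of p q] sum_squares_bound[of p r] sum_squares_bound[of q r]
          by (simp add: power2_eq_square algebra_simps)
        then show ?thesis .
      qed
      also have "\<dots> = 3 * (e\<^sup>2 * (\<psi>t t x)\<^sup>2 + (\<eta>' x)\<^sup>2 * (\<psi> t x)\<^sup>2 + e\<^sup>2 * (\<psi>x t x)\<^sup>2)"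
        using \<sigma> by (auto simp: power_mult_distrib)
      also have "\<dots> \<le> 3 * (1 * (\<psi>t t x)\<^sup>2 + 16 / d\<^sup>2 * (\<psi> t x)\<^sup>2 + 1 * (\<psi>x t x)\<^sup>2)"
        using e2 \<eta>_range(3)[OF x] by (intro mult_left_mono add_mono mult_right_mono) auto
      finally show "(D t x)\<^sup>2 \<le> 48 / d\<^sup>2 * (\<psi> t x)\<^sup>2 + 3 * (\<psi>t t x)\<^sup>2 + 3 * (\<psi>x t x)\<^sup>2" by simp
    qed (auto intro: regular_power regD)
    then have "SI m (\<lambda>t x. (D t x)\<^sup>2) / \<epsilon> \<le> (6 + 48 / d\<^sup>2) * H1_sq m \<psi> \<psi>t \<psi>x / \<epsilon>"
      using \<epsilon> by (intro divide_right_mono) (auto simp: algebra_simps)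
    then show "2 * SI m (\<lambda>t x. V m t x * D t x) \<le> \<epsilon> * SI m (\<lambda>t x. (V m t x)\<^sup>2) + (6 + 48 / d\<^sup>2) * H1_sq m \<psi> \<psi>t \<psi>x / \<epsilon>"
      using SI_young[OF sq_regular[OF regV[of "start m" "start m + h" m]] sq_regular[OF regD] \<epsilon>] by linarith
  qed
  also have "\<dots> = \<epsilon> * (\<Sum>m=1..M. SI m (\<lambda>t x. (V m t x)\<^sup>2)) + (6 + 48 / d\<^sup>2) * (\<Sum>m=1..M. H1_sq m \<psi> \<psi>t \<psi>x) / \<epsilon>"
    by (simp add: sum.distrib sum_distrib_left sum_divide_distrib)
  also have "(\<Sum>m=1..M. SI m (\<lambda>t x. (V m t x)\<^sup>2)) = (\<Sum>m=1..M. SI m (\<lambda>t x. if \<sigma> * x \<le> L + d / 2 then (U m t x)\<^sup>2 else 0))"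
  proof -
    have "(V m t x)\<^sup>2 = (if \<sigma> * x \<le> L + d / 2 then (U m t x)\<^sup>2 else 0)" for m t x by (simp add: V_def)
    then show ?thesis by simp
  qed
  also have "\<epsilon> * \<dots> \<le> \<epsilon> * (3 * K2 * (h\<^sup>2 * (\<Sum>m=1..M. residual m) + h * (\<Sum>m=1..M. jump_sq m)))"
    using upstream_mass[OF gal hd] \<epsilon> by (intro mult_left_mono) auto
  finally show ?thesis by (simp add: \<zeta>_def [abs_def])
qed

text \<open>
  On coarse meshes the plain estimate suffices. Otherwise the dual solution is split into the part
  \<open>\<eta> \<psi>\<close>, which vanishes at both ends and is interpolated, and the part near the upstream end.
\<close>

lemma error_estimate:
  assumes gal: galerkin and \<psi>: "C1_function \<psi> \<psi>t \<psi>x"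
    and downstream: "\<And>t. 0 \<le> t \<Longrightarrow> t \<le> real M * h \<Longrightarrow> \<psi> t (\<sigma> * R) = 0"
    and final: "\<And>x. x \<in> {a..b} \<Longrightarrow> \<psi> (real M * h) x = 0" and \<epsilon>: "0 < \<epsilon>"
  shows "2 * (\<Sum>m=1..M. err m \<psi>) \<le> K * (\<epsilon> * (h\<^sup>2 * (\<Sum>m=1..M. residual m) + h * (\<Sum>m=1..M. jump_sq m))
     + (\<Sum>m=1..M. H1_sq m \<psi> \<psi>t \<psi>x) / \<epsilon>)"
proof -
  define X where "X = h\<^sup>2 * (\<Sum>m=1..M. residual m) + h * (\<Sum>m=1..M. jump_sq m)"
  define Y where "Y = (\<Sum>m=1..M. H1_sq m \<psi> \<psi>t \<psi>x)"
  have X0: "0 \<le> X" unfolding X_def by (rule total_nonneg)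
  have Hn: "0 \<le> H1_sq m \<psi> \<psi>t \<psi>x" for m unfolding H1_sq_def by (intro add_nonneg_nonneg SI_sq_nonneg)
  then have Y0: "0 \<le> Y" unfolding Y_def by (intro sum_nonneg) auto
  have d2: "0 < d\<^sup>2" using d by simp
  have final_step: "2 * (\<Sum>m=1..M. err m \<psi>) \<le> K * (\<epsilon> * X + Y / \<epsilon>)"
    if le: "2 * (\<Sum>m=1..M. err m \<psi>) \<le> \<epsilon> * (p * X) + q * Y / \<epsilon>" "p \<le> K" "q \<le> K" for p q
  proof -
    have "\<epsilon> * (p * X) \<le> K * (\<epsilon> * X)" using le(2) \<epsilon> X0 by (simp add: mult.left_commute[of \<epsilon>] mult_right_mono)
    moreover have "q * Y / \<epsilon> \<le> K * (Y / \<epsilon>)" using mult_right_mono[OF le(3), of "Y / \<epsilon>"] \<epsilon> Y0 by simp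
    ultimately show ?thesis using le(1) by (simp add: distrib_left)
  qed
  have Kp: "0 \<le> 3 * K2" "0 \<le> (4 + \<delta>0\<^sup>2) * (3 + 32 / d\<^sup>2)" "0 \<le> 1000 / d\<^sup>2" using K2_pos d2 by auto
  have "2 * (\<Sum>m=1..M. err m \<psi>) \<le> K * (\<epsilon> * X + Y / \<epsilon>)"
  proof (cases "h \<le> d / 16")
    case False
    have h: "3 / h\<^sup>2 \<le> 768 / d\<^sup>2"
    proof -
      have "(d / 16)\<^sup>2 \<le> h\<^sup>2" using False d by (intro power_mono) auto
      then have "3 / h\<^sup>2 \<le> 3 / (d / 16)\<^sup>2" using d h_pos by (intro divide_left_mono) auto
      then show ?thesis by (simp add: power_divide)
    qed
    have "2 * (\<Sum>m=1..M. err m \<psi>) = (\<Sum>m=1..M. 2 * err m \<psi>)" by (simp add: sum_distrib_left)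
    also have "\<dots> \<le> (\<Sum>m=1..M. \<epsilon> * (h\<^sup>2 * residual m + h * jump_sq m) + (768 / d\<^sup>2 + 2) * H1_sq m \<psi> \<psi>t \<psi>x / \<epsilon>)"
    proof (rule sum_mono)
      fix m assume m: "m \<in> {1..M}"
      have "3 / h\<^sup>2 * I + 2 * It \<le> (768 / d\<^sup>2 + 2) * (I + It + Ix)" if "0 \<le> I" "0 \<le> It" "0 \<le> Ix" for I It Ix :: real
      proof -
        have "3 / h\<^sup>2 * I \<le> 768 / d\<^sup>2 * (I + It + Ix)" using h that d2 by (intro mult_mono) auto
        moreover have "2 * It \<le> 2 * (I + It + Ix)" using that by simp
        ultimately show ?thesis by (simp add: distrib_right)
      qed
      then have "3 / h\<^sup>2 * SI m (\<lambda>t x. (\<psi> t x)\<^sup>2) + 2 * SI m (\<lambda>t x. (\<psi>t t x)\<^sup>2) \<le> (768 / d\<^sup>2 + 2) * H1_sq m \<psi> \<psi>t \<psi>x"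
        unfolding H1_sq_def by (simp add: SI_sq_nonneg)
      then have "(3 / h\<^sup>2 * SI m (\<lambda>t x. (\<psi> t x)\<^sup>2) + 2 * SI m (\<lambda>t x. (\<psi>t t x)\<^sup>2)) / \<epsilon> \<le> (768 / d\<^sup>2 + 2) * H1_sq m \<psi> \<psi>t \<psi>x / \<epsilon>"
        using \<epsilon> by (intro divide_right_mono) auto
      then show "2 * err m \<psi> \<le> \<epsilon> * (h\<^sup>2 * residual m + h * jump_sq m) + (768 / d\<^sup>2 + 2) * H1_sq m \<psi> \<psi>t \<psi>x / \<epsilon>"
        using plain_error[OF m \<psi> \<epsilon>] by linarith
    qed
    also have "\<dots> = \<epsilon> * (1 * X) + (768 / d\<^sup>2 + 2) * Y / \<epsilon>"
      by (simp add: X_def Y_def sum.distrib sum_distrib_left sum_divide_distrib distrib_left)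
    finally show ?thesis
    proof (rule final_step)
      have "768 / d\<^sup>2 \<le> 1000 / d\<^sup>2" by (intro divide_right_mono) auto
      then show "1 \<le> K" "768 / d\<^sup>2 + 2 \<le> K" using Kp unfolding K_def by linarith+
    qed
  next
    case True
    define \<phi> where "\<phi> t x = \<eta> x * \<psi> t x" for t x
    define \<phi>t where "\<phi>t t x = \<eta> x * \<psi>t t x" for t x
    define \<phi>x where "\<phi>x t x = \<eta>' x * \<psi> t x + \<eta> x * \<psi>x t x" for t x
    have \<phi>: "C1_function \<phi> \<phi>t \<phi>x"
      unfolding \<phi>_def [abs_def] \<phi>t_def [abs_def] \<phi>x_def [abs_def]
      by (rule C1_function_mult_x[OF \<psi> \<eta>_derivative \<eta>'_continuous])
    have \<zeta>: "C1_function (\<lambda>t x. (1 - \<eta> x) * \<psi> t x) (\<lambda>t x. (1 - \<eta> x) * \<psi>t t x) (\<lambda>t x. - \<eta>' x * \<psi> t x + (1 - \<eta> x) * \<psi>x t x)"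
    proof (rule C1_function_mult_x[OF \<psi>])
      show "((\<lambda>x. 1 - \<eta> x) has_real_derivative - \<eta>' x) (at x)" for x
        using DERIV_diff[OF DERIV_const[of 1] \<eta>_derivative] by simp
      show "continuous_on UNIV (\<lambda>x. - \<eta>' x)" by (intro continuous_intros \<eta>'_continuous)
    qed
    have "(\<Sum>m=1..M. err m \<psi>) = (\<Sum>m=1..M. err m \<phi> + err m (\<lambda>t x. (1 - \<eta> x) * \<psi> t x))"
      by (intro sum.cong refl err_split[OF _ \<phi> \<zeta>]) (auto simp: \<phi>_def algebra_simps)
    then have split: "2 * (\<Sum>m=1..M. err m \<psi>) = (\<Sum>m=1..M. 2 * err m \<phi>) + 2 * (\<Sum>m=1..M. err m (\<lambda>t x. (1 - \<eta> x) * \<psi> t x))"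
      by (simp add: sum.distrib sum_distrib_left distrib_left)
    have ends: "\<phi> t a = 0 \<and> \<phi> t b = 0" if "m \<in> {1..M}" "t \<in> slab m" for m t
    proof -
      have "\<psi> t (\<sigma> * R) = 0" using downstream start_less[OF that] by blast
      moreover have "\<eta> (\<sigma> * L) = 0" by (rule \<eta>_upstream) simp
      moreover have "(\<sigma> * L = a \<and> \<sigma> * R = b) \<or> (\<sigma> * L = b \<and> \<sigma> * R = a)"
        using \<sigma> L_R_forward L_R_backward by auto
      ultimately show ?thesis by (auto simp: \<phi>_def)
    qed
    have "(\<Sum>m=1..M. 2 * err m \<phi>) \<le> (\<Sum>m=1..M. \<epsilon> * (h\<^sup>2 * residual m + h * jump_sq m) + (4 + \<delta>0\<^sup>2) * (3 + 32 / d\<^sup>2) * H1_sq m \<psi> \<psi>t \<psi>x / \<epsilon>)"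
    proof (rule sum_mono)
      fix m assume m: "m \<in> {1..M}"
      note reg = C1_function_regular_square[OF \<phi>, of "start m" "start m + h" a b]
      have "SI m (\<lambda>t x. (\<phi>t t x)\<^sup>2) + SI m (\<lambda>t x. (\<phi>x t x)\<^sup>2) = SI m (\<lambda>t x. (\<phi>t t x)\<^sup>2 + (\<phi>x t x)\<^sup>2)"
        unfolding SI_def using reg[THEN regular_integral(3)] by (simp add: set_integral_add(2))
      also have "\<dots> \<le> (32 / d\<^sup>2 + 1 + 2) * H1_sq m \<psi> \<psi>t \<psi>x"
      proof (rule SI_le_H1[OF \<psi>])
        fix t x assume x: "x \<in> {a..b}"
        have e2: "(\<eta> x)\<^sup>2 \<le> 1" using \<eta>_range[OF x] by (simp add: power_le_one)
        have "(\<phi>t t x)\<^sup>2 \<le> 1 * (\<psi>t t x)\<^sup>2"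
          unfolding \<phi>t_def power_mult_distrib using e2 by (intro mult_right_mono) auto
        moreover have "(\<phi>x t x)\<^sup>2 \<le> 2 * ((\<eta>' x)\<^sup>2 * (\<psi> t x)\<^sup>2 + (\<eta> x)\<^sup>2 * (\<psi>x t x)\<^sup>2)"
          unfolding \<phi>x_def using sum_square_le[of "\<eta>' x * \<psi> t x" "\<eta> x * \<psi>x t x"] by (simp add: power_mult_distrib)
        moreover have "2 * ((\<eta>' x)\<^sup>2 * (\<psi> t x)\<^sup>2 + (\<eta> x)\<^sup>2 * (\<psi>x t x)\<^sup>2) \<le> 2 * (16 / d\<^sup>2 * (\<psi> t x)\<^sup>2 + 1 * (\<psi>x t x)\<^sup>2)"
          using e2 \<eta>_range(3)[OF x] by (intro mult_left_mono add_mono mult_right_mono) auto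
        ultimately show "(\<phi>t t x)\<^sup>2 + (\<phi>x t x)\<^sup>2 \<le> 32 / d\<^sup>2 * (\<psi> t x)\<^sup>2 + 1 * (\<psi>t t x)\<^sup>2 + 2 * (\<psi>x t x)\<^sup>2" by simp
      qed (auto intro: regular_add reg)
      finally have "(4 + \<delta>0\<^sup>2) / \<epsilon> * (SI m (\<lambda>t x. (\<phi>t t x)\<^sup>2) + SI m (\<lambda>t x. (\<phi>x t x)\<^sup>2)) \<le> (4 + \<delta>0\<^sup>2) / \<epsilon> * ((3 + 32 / d\<^sup>2) * H1_sq m \<psi> \<psi>t \<psi>x)"
        using \<epsilon> by (intro mult_left_mono) (auto simp: algebra_simps)
      moreover have "(4 + \<delta>0\<^sup>2) / \<epsilon> * ((3 + 32 / d\<^sup>2) * H1_sq m \<psi> \<psi>t \<psi>x) = (4 + \<delta>0\<^sup>2) * (3 + 32 / d\<^sup>2) * H1_sq m \<psi> \<psi>t \<psi>x / \<epsilon>" by simp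
      ultimately show "2 * err m \<phi> \<le> \<epsilon> * (h\<^sup>2 * residual m + h * jump_sq m) + (4 + \<delta>0\<^sup>2) * (3 + 32 / d\<^sup>2) * H1_sq m \<psi> \<psi>t \<psi>x / \<epsilon>"
        using interpolation_error[OF gal m \<phi> _ _ \<epsilon>] ends[OF m] by fastforce
    qed
    also have "\<dots> = \<epsilon> * X + (4 + \<delta>0\<^sup>2) * (3 + 32 / d\<^sup>2) * Y / \<epsilon>"
      by (simp add: X_def Y_def sum.distrib sum_distrib_left sum_divide_distrib distrib_left)
    finally have "2 * (\<Sum>m=1..M. err m \<psi>) \<le> \<epsilon> * ((1 + 3 * K2) * X) + ((4 + \<delta>0\<^sup>2) * (3 + 32 / d\<^sup>2) + (6 + 48 / d\<^sup>2)) * Y / \<epsilon>"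
    proof -
      assume 1: "(\<Sum>m=1..M. 2 * err m \<phi>) \<le> \<epsilon> * X + (4 + \<delta>0\<^sup>2) * (3 + 32 / d\<^sup>2) * Y / \<epsilon>"
      note 2 = upstream_error[OF gal True \<psi> final \<epsilon>, folded X_def Y_def]
      have "\<epsilon> * ((1 + 3 * K2) * X) + (p + q) * Y / \<epsilon> = (\<epsilon> * X + p * Y / \<epsilon>) + (\<epsilon> * (3 * K2 * X) + q * Y / \<epsilon>)" for p q
        by (simp add: distrib_left distrib_right add_divide_distrib)
      with add_mono[OF 1 2] split show ?thesis by simp
    qed
    then show ?thesis
    proof (rule final_step)
      show "1 + 3 * K2 \<le> K" using Kp unfolding K_def by linarith
      have "48 / d\<^sup>2 \<le> 1000 / d\<^sup>2" by (intro divide_right_mono) auto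
      then show "(4 + \<delta>0\<^sup>2) * (3 + 32 / d\<^sup>2) + (6 + 48 / d\<^sup>2) \<le> K" using Kp unfolding K_def by linarith
    qed
  qed
  then show ?thesis by (simp add: X_def Y_def)
qed

end

section \<open>Borel representatives\<close>

text \<open>
  Slab boundaries and nodes are null sets. Off these, classical derivatives of discrete functions
  agree with Borel functions that are defined everywhere.
\<close>

lemma AE_off_grid:
  fixes F F' :: "real set"
  assumes "finite F" "finite F'"
  shows "AE z in lebesgue. fst z \<notin> F \<and> snd z \<notin> F'"
proof -
  have "negligible {z::real \<times> real. fst z = c}" for c
    using negligible_hyperplane[of "(1::real, 0::real)" c] by (simp add: inner_prod_def zero_prod_def inner_real_def)
  moreover have "negligible {z::real \<times> real. snd z = c}" for c
    using negligible_hyperplane[of "(0::real, 1::real)" c] by (simp add: inner_prod_def zero_prod_def inner_real_def)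
  ultimately have "negligible ((\<Union>c\<in>F. {z::real \<times> real. fst z = c}) \<union> (\<Union>c\<in>F'. {z. snd z = c}))"
    using assms by (intro negligible_Un negligible_Union) auto
  then have "AE z in lebesgue. z \<notin> (\<Union>c\<in>F. {z::real \<times> real. fst z = c}) \<union> (\<Union>c\<in>F'. {z. snd z = c})"
    unfolding negligible_iff_null_sets by (rule AE_not_in)
  then show ?thesis by eventually_elim auto
qed

text \<open>
  Functions that agree almost everywhere with a Borel function are integrated over the completed
  measure in the same way as the Borel function; completeness provides their measurability.
\<close>

lemma lebesgue_eq_lborel:
  fixes f g :: "'a::euclidean_space \<Rightarrow> real"
  assumes eq: "AE z in lebesgue. indicator S z *\<^sub>R f z = indicator S' z *\<^sub>R g z"
    and g: "g \<in> borel_measurable borel" and S': "S' \<in> sets borel"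
  shows "(LINT z:S|lebesgue. f z) = (LINT z:S'|lborel. g z)"
    and "set_integrable lebesgue S f \<longleftrightarrow> set_integrable lborel S' g"
    and "set_borel_measurable lebesgue S f"
proof -
  have m: "(\<lambda>z. indicator S' z *\<^sub>R g z) \<in> borel_measurable lborel" using g S' by simp
  have m1: "(\<lambda>z. indicator S' z *\<^sub>R g z) \<in> borel_measurable lebesgue" by (rule measurable_completion[OF m])
  have eq': "AE z in lebesgue. indicator S' z *\<^sub>R g z = indicator S z *\<^sub>R f z" using eq by eventually_elim simp
  have m2: "(\<lambda>z. indicator S z *\<^sub>R f z) \<in> borel_measurable lebesgue" by (rule borel_measurable_AE[OF m1 eq'])
  then show "set_borel_measurable lebesgue S f" by (simp add: set_borel_measurable_def)
  show "(LINT z:S|lebesgue. f z) = (LINT z:S'|lborel. g z)"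
    unfolding set_lebesgue_integral_def integral_completion[OF m, symmetric] by (rule integral_cong_AE[OF m2 m1 eq])
  show "set_integrable lebesgue S f \<longleftrightarrow> set_integrable lborel S' g"
    unfolding set_integrable_def integrable_completion[OF m, symmetric] by (rule integrable_cong_AE[OF m2 m1 eq])
qed

text \<open>
  Borel measurability is required on the whole space, so that the restriction to smaller sets
  needs no further argument.
\<close>

definition L2_on :: "'a::euclidean_space set \<Rightarrow> ('a \<Rightarrow> real) \<Rightarrow> bool" where
  "L2_on S f \<longleftrightarrow> f \<in> borel_measurable borel \<and> set_integrable lborel S (\<lambda>z. (f z)\<^sup>2)"

lemma L2_on_mult: "S \<in> sets borel \<Longrightarrow> L2_on S f \<Longrightarrow> L2_on S g \<Longrightarrow> set_integrable lborel S (\<lambda>z. f z * g z)"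
  unfolding L2_on_def by (intro integrable_product) auto

lemma L2_on_add:
  assumes S: "S \<in> sets borel" and "L2_on S f" "L2_on S g"
  shows "L2_on S (\<lambda>z. f z + g z)"
proof -
  have "set_integrable lborel S (\<lambda>z. (f z)\<^sup>2 + 2 * (f z * g z) + (g z)\<^sup>2)"
    using assms by (intro set_integral_add set_integrable_mult_right L2_on_mult) (auto simp: L2_on_def)
  then have "set_integrable lborel S (\<lambda>z. (f z + g z)\<^sup>2)" by (simp add: power2_sum algebra_simps)
  then show ?thesis using assms by (auto simp: L2_on_def)
qed

lemma L2_on_cmult: "L2_on S f \<Longrightarrow> L2_on S (\<lambda>z. c * f z)"
  by (auto simp: L2_on_def power_mult_distrib)

lemma L2_on_diff: "S \<in> sets borel \<Longrightarrow> L2_on S f \<Longrightarrow> L2_on S g \<Longrightarrow> L2_on S (\<lambda>z. f z - g z)"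
  using L2_on_add[of S f "\<lambda>z. - 1 * g z"] L2_on_cmult[of S g "- 1"] by simp

lemma L2_on_subset: "L2_on S f \<Longrightarrow> S' \<in> sets borel \<Longrightarrow> S' \<subseteq> S \<Longrightarrow> L2_on S' f"
  unfolding L2_on_def by (metis set_integrable_subset sets_lborel)

lemma L2_on_bounded:
  assumes "f \<in> borel_measurable borel" "S \<in> sets borel" "bounded S" "\<And>z. z \<in> S \<Longrightarrow> \<bar>f z\<bar> \<le> B"
  shows "L2_on S f"
proof -
  have "\<bar>(f z)\<^sup>2\<bar> \<le> B\<^sup>2" if "z \<in> S" for z using power_mono[OF assms(4)[OF that], of 2] by simp
  then have "set_integrable lborel S (\<lambda>z. (f z)\<^sup>2)"
    using assms(1-3) by (intro bounded_set_integrable[where B = "B\<^sup>2"]) auto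
  then show ?thesis using assms(1) by (simp add: L2_on_def)
qed

lemma box_sets [simp]: "{c..d} \<times> {a..b::real} \<in> sets (borel :: (real \<times> real) measure)"
  by (intro borel_closed closed_Times) auto

lemma cylinder_lebesgue [simp]: "I \<in> sets borel \<Longrightarrow> I \<times> {a<..<b::real} \<in> sets (lebesgue :: (real \<times> real) measure)"
proof -
  assume "I \<in> sets borel"
  then have "I \<times> {a<..<b} \<in> sets (borel \<Otimes>\<^sub>M borel)" by (intro pair_measureI) auto
  then have "I \<times> {a<..<b} \<in> sets borel" by (simp only: borel_prod)
  then show ?thesis by (intro sets_completionI_sets) simp
qed

lemma nn_integral_finite_imp_L2:
  fixes f :: "'a::euclidean_space \<Rightarrow> real"
  assumes f: "f \<in> borel_measurable borel" and S: "S \<in> sets borel"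
    and fin: "(\<integral>\<^sup>+z. indicator S z * ennreal ((f z)\<^sup>2) \<partial>lborel) < \<infinity>"
  shows "L2_on S f"
proof -
  have "(\<integral>\<^sup>+z. ennreal (norm (indicator S z *\<^sub>R (f z)\<^sup>2)) \<partial>lborel) = (\<integral>\<^sup>+z. indicator S z * ennreal ((f z)\<^sup>2) \<partial>lborel)"
    by (intro nn_integral_cong) (auto simp: indicator_def)
  then show ?thesis using assms by (auto simp: L2_on_def set_integrable_def integrable_iff_bounded)
qed

section \<open>The source generated by a density\<close>

lemma source_inner:
  "source \<rho> f t x \<bullet> e = ((LINT v|lborel. f t x v) - \<rho> x) * e $ 1
     - (LINT v|lborel. vhat v $ 1 * f t x v) * e $ 2 - (LINT v|lborel. vhat v $ 2 * f t x v) * e $ 3"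
  by (simp add: source_def inner_vec_def sum_4) (simp add: vector_def)

lemma vhat_measurable [measurable]: "(\<lambda>v. vhat v $ i) \<in> borel_measurable borel"
proof -
  have "continuous_on UNIV (\<lambda>v. vhat v $ i)" unfolding vhat_def
    by (intro continuous_intros) (smt (verit) real_sqrt_gt_0_iff zero_le_power2)
  then show ?thesis by (rule borel_measurable_continuous_onI)
qed

lemma vhat_le: "\<bar>vhat v $ i\<bar> \<le> 1"
proof -
  have "\<bar>vhat v $ i\<bar> \<le> norm (vhat v)" by (rule component_le_norm_cart)
  also have "\<dots> = norm v / sqrt (1 + (norm v)\<^sup>2)" by (simp add: vhat_def divide_inverse mult.commute)
  also have "\<dots> \<le> 1"
  proof -
    have "norm v = sqrt ((norm v)\<^sup>2)" by simp
    also have "\<dots> \<le> sqrt (1 + (norm v)\<^sup>2)" by (intro real_sqrt_le_mono) simp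
    finally show ?thesis by (simp add: divide_le_eq_1) (smt (verit) real_sqrt_gt_0_iff zero_le_power2)
  qed
  finally show ?thesis .
qed

lemma nn_integral_lborel_triple:
  fixes g :: "'a::euclidean_space \<times> 'b::euclidean_space \<times> 'c::euclidean_space \<Rightarrow> ennreal"
  assumes g: "g \<in> borel_measurable borel"
  shows "(\<integral>\<^sup>+t. \<integral>\<^sup>+x. \<integral>\<^sup>+v. g (t, x, v) \<partial>lborel \<partial>lborel \<partial>lborel) = (\<integral>\<^sup>+p. g p \<partial>lborel)"
proof -
  have "(\<integral>\<^sup>+x. \<integral>\<^sup>+v. g (t, x, v) \<partial>lborel \<partial>lborel) = (\<integral>\<^sup>+y. g (t, y) \<partial>lborel)" for t
  proof -
    have "(\<lambda>y. g (t, y)) \<in> borel_measurable (lborel \<Otimes>\<^sub>M lborel)"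
      using measurable_compose[OF _ g, of "\<lambda>y. (t, y)" borel] by (simp add: lborel_prod borel_prod[symmetric])
    from lborel.nn_integral_fst[OF this] show ?thesis by (simp add: lborel_prod)
  qed
  moreover have "(\<integral>\<^sup>+t. \<integral>\<^sup>+y. g (t, y) \<partial>lborel \<partial>lborel) = (\<integral>\<^sup>+p. g p \<partial>lborel)"
  proof -
    have "g \<in> borel_measurable (lborel \<Otimes>\<^sub>M lborel)" using g by (simp add: lborel_prod)
    from lborel.nn_integral_fst[OF this] show ?thesis by (simp add: lborel_prod)
  qed
  ultimately show ?thesis by simp
qed

text \<open>
  The Cauchy-Schwarz inequality in the velocity, which uses that the velocity domain has finite
  measure; the weights \<open>1\<close> and \<open>vhat v\<close> are bounded by one.
\<close>

lemma velocity_average_L2: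
  assumes f: "approx_density T {a<..<b} K \<Omega>v f" and \<Omega>v: "bounded \<Omega>v" "open \<Omega>v" and K: "K \<subseteq> {a<..<b}"
    and w: "w \<in> borel_measurable borel" "\<And>v. \<bar>w v\<bar> \<le> 1"
  shows "L2_on ({0..T} \<times> {a..b}) (\<lambda>z. LINT v|lborel. w v * f (fst z) (snd z) v)"
proof (rule nn_integral_finite_imp_L2)
  have fm: "(\<lambda>(t, x, v). f t x v) \<in> borel_measurable borel" using f by (simp add: approx_density_def)
  have fm' [measurable]: "(\<lambda>(z, v). f (fst z) (snd z) v) \<in> borel_measurable ((borel \<Otimes>\<^sub>M borel) \<Otimes>\<^sub>M borel)"
  proof -
    have "(\<lambda>p. case (fst (fst p), snd (fst p), snd p) of (t, x, v) \<Rightarrow> f t x v) \<in> borel_measurable ((borel \<Otimes>\<^sub>M borel) \<Otimes>\<^sub>M borel)"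
      by (rule measurable_compose[OF _ fm]) (simp add: borel_prod[symmetric])
    then show ?thesis by (simp add: case_prod_unfold)
  qed
  have fm2 [measurable]: "(\<lambda>(z, v). f (fst z) (snd z) v) \<in> borel_measurable (borel \<Otimes>\<^sub>M lborel)"
  proof -
    have "sets (borel \<Otimes>\<^sub>M lborel :: ((real \<times> real) \<times> (real ^ 2)) measure) = sets ((borel \<Otimes>\<^sub>M borel) \<Otimes>\<^sub>M borel)"
      by (rule sets_pair_measure_cong) (simp_all only: borel_prod sets_lborel)
    from measurable_cong_sets[OF this refl] show ?thesis using fm' by blast
  qed
  have fv [measurable]: "f t x \<in> borel_measurable borel" for t x
    using measurable_compose[OF _ fm, of "\<lambda>v. (t, x, v)" borel] by (simp add: borel_prod[symmetric])
  have w' [measurable]: "(\<lambda>p. w (snd p)) \<in> borel_measurable ((borel :: (real \<times> real) measure) \<Otimes>\<^sub>M lborel)"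
    by (rule measurable_compose[OF measurable_snd]) (use w(1) in simp)
  have wf: "(\<lambda>p. w (snd p) * f (fst (fst p)) (snd (fst p)) (snd p)) \<in> borel_measurable (borel \<Otimes>\<^sub>M lborel)"
    using w' fm2 by (simp add: case_prod_unfold)
  show "(\<lambda>z. LINT v|lborel. w v * f (fst z) (snd z) v) \<in> borel_measurable borel"
    by (rule lborel.borel_measurable_lebesgue_integral) (use wf in \<open>simp add: case_prod_unfold\<close>)
  show "{0..T} \<times> {a..b} \<in> sets borel" by simp
  have \<Omega>f: "emeasure lborel \<Omega>v < \<infinity>" using \<Omega>v(1) by (rule emeasure_bounded_finite)
  have \<Omega>s [measurable]: "\<Omega>v \<in> sets borel" using \<Omega>v(2) by auto
  \<comment> \<open>Pointwise in time and space. The estimate is trivial where the average does not exist, as its value is zero then.\<close>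
  have cs: "ennreal ((LINT v|lborel. w v * f t x v)\<^sup>2) \<le> emeasure lborel \<Omega>v * (\<integral>\<^sup>+v. ennreal ((f t x v)\<^sup>2) \<partial>lborel)" for t x
  proof -
    have "ennreal \<bar>LINT v|lborel. w v * f t x v\<bar> \<le> (\<integral>\<^sup>+v. ennreal \<bar>f t x v\<bar> * indicator \<Omega>v v \<partial>lborel)"
    proof (cases "integrable lborel (\<lambda>v. w v * f t x v)")
      case True
      have "ennreal \<bar>LINT v|lborel. w v * f t x v\<bar> \<le> (\<integral>\<^sup>+v. ennreal \<bar>w v * f t x v\<bar> \<partial>lborel)"
        using integral_norm_bound_ennreal[OF True] by simp
      also have "\<dots> \<le> (\<integral>\<^sup>+v. ennreal \<bar>f t x v\<bar> * indicator \<Omega>v v \<partial>lborel)"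
      proof (rule nn_integral_mono)
        fix v
        have "\<bar>w v * f t x v\<bar> \<le> \<bar>f t x v\<bar>" using w(2)[of v] by (simp add: abs_mult mult_left_le_one_le)
        moreover have "v \<notin> \<Omega>v \<Longrightarrow> f t x v = 0" using f by (simp add: approx_density_def)
        ultimately show "ennreal \<bar>w v * f t x v\<bar> \<le> ennreal \<bar>f t x v\<bar> * indicator \<Omega>v v"
          by (cases "v \<in> \<Omega>v") (auto intro: ennreal_leI)
      qed
      finally show ?thesis .
    qed (simp add: not_integrable_integral_eq)
    then have "(ennreal \<bar>LINT v|lborel. w v * f t x v\<bar>)\<^sup>2 \<le> (\<integral>\<^sup>+v. ennreal \<bar>f t x v\<bar> * indicator \<Omega>v v \<partial>lborel)\<^sup>2"
      by (rule power_mono) simp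
    also have "\<dots> \<le> (\<integral>\<^sup>+v. (ennreal \<bar>f t x v\<bar>)\<^sup>2 \<partial>lborel) * (\<integral>\<^sup>+v. (indicator \<Omega>v v)\<^sup>2 \<partial>lborel)"
      by (rule Cauchy_Schwarz_nn_integral) auto
    also have "(\<integral>\<^sup>+v. (indicator \<Omega>v v)\<^sup>2 \<partial>lborel) = (\<integral>\<^sup>+v. indicator \<Omega>v v \<partial>lborel)"
      by (intro nn_integral_cong) (auto simp: indicator_def)
    finally show ?thesis by (simp add: ennreal_power power2_abs mult.commute)
  qed
  have le1: "(\<integral>\<^sup>+z. indicator ({0..T} \<times> {a..b}) z * ennreal ((LINT v|lborel. w v * f (fst z) (snd z) v)\<^sup>2) \<partial>lborel)
    \<le> (\<integral>\<^sup>+z. emeasure lborel \<Omega>v * (\<integral>\<^sup>+v. indicator ({0..T} \<times> {a..b}) z * ennreal ((f (fst z) (snd z) v)\<^sup>2) \<partial>lborel) \<partial>lborel)"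
    by (intro nn_integral_mono) (auto simp: indicator_def intro: cs)
  have inner: "(\<lambda>z. \<integral>\<^sup>+v. indicator ({0..T} \<times> {a..b}) z * ennreal ((f (fst z) (snd z) v)\<^sup>2) \<partial>lborel) \<in> borel_measurable borel"
  proof -
    have "(\<lambda>p. indicator ({0..T} \<times> {a..b}) (fst p) :: ennreal) \<in> borel_measurable ((borel :: (real \<times> real) measure) \<Otimes>\<^sub>M (lborel :: (real ^ 2) measure))"
      by (rule measurable_compose[OF measurable_fst borel_measurable_indicator[OF box_sets]])
    then have "(\<lambda>p. indicator ({0..T} \<times> {a..b}) (fst p) * ennreal ((f (fst (fst p)) (snd (fst p)) (snd p))\<^sup>2)) \<in> borel_measurable (borel \<Otimes>\<^sub>M lborel)"
      using fm2 by (simp add: case_prod_unfold)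
    from lborel.borel_measurable_nn_integral_fst[OF this] show ?thesis by simp
  qed
  have "(\<integral>\<^sup>+z. emeasure lborel \<Omega>v * (\<integral>\<^sup>+v. indicator ({0..T} \<times> {a..b}) z * ennreal ((f (fst z) (snd z) v)\<^sup>2) \<partial>lborel) \<partial>lborel)
    = emeasure lborel \<Omega>v * (\<integral>\<^sup>+z. (\<integral>\<^sup>+v. indicator ({0..T} \<times> {a..b}) z * ennreal ((f (fst z) (snd z) v)\<^sup>2) \<partial>lborel) \<partial>lborel)"
    by (rule nn_integral_cmult) (use inner in simp)
  also have "(\<integral>\<^sup>+z. (\<integral>\<^sup>+v. indicator ({0..T} \<times> {a..b}) z * ennreal ((f (fst z) (snd z) v)\<^sup>2) \<partial>lborel) \<partial>lborel)
    = (\<integral>\<^sup>+t. \<integral>\<^sup>+x. \<integral>\<^sup>+v. indicator ({0..T} \<times> {a..b}) (t, x) * ennreal ((f t x v)\<^sup>2) \<partial>lborel \<partial>lborel \<partial>lborel)"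
    unfolding lborel_prod[symmetric]
    by (subst lborel.nn_integral_fst[symmetric]) (use inner in \<open>auto simp: lborel_prod\<close>)
  also have "\<dots> = (\<integral>\<^sup>+t. \<integral>\<^sup>+x. \<integral>\<^sup>+v. ennreal (norm (indicator ({0..T} \<times> {a<..<b} \<times> \<Omega>v) (t, x, v) *\<^sub>R (f t x v)\<^sup>2)) \<partial>lborel \<partial>lborel \<partial>lborel)"
  proof -
    have "f t x v = 0" if "x \<notin> {a<..<b} \<or> v \<notin> \<Omega>v" for t x v
    proof -
      have "x \<notin> K \<or> v \<notin> \<Omega>v" using that K by blast
      then show ?thesis using f unfolding approx_density_def by blast
    qed
    then have "indicator ({0..T} \<times> {a..b}) (t, x) * ennreal ((f t x v)\<^sup>2) = ennreal (norm (indicator ({0..T} \<times> {a<..<b} \<times> \<Omega>v) (t, x, v) *\<^sub>R (f t x v)\<^sup>2))" for t x v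
      by (cases "x \<in> {a<..<b} \<and> v \<in> \<Omega>v") (auto simp: indicator_def)
    then show ?thesis by simp
  qed
  also have "\<dots> = (\<integral>\<^sup>+p. ennreal (norm (indicator ({0..T} \<times> {a<..<b} \<times> \<Omega>v) p *\<^sub>R (case p of (t, x, v) \<Rightarrow> (f t x v)\<^sup>2))) \<partial>lborel)"
  proof -
    have m: "(\<lambda>p. ennreal (norm (indicator ({0..T} \<times> {a<..<b} \<times> \<Omega>v) p *\<^sub>R (case p of (t, x, v) \<Rightarrow> (f t x v)\<^sup>2)))) \<in> borel_measurable borel"
    proof -
      have "{0..T} \<times> {a<..<b} \<times> \<Omega>v \<in> sets borel"
        unfolding borel_prod[symmetric] by (intro pair_measureI) (auto simp: \<Omega>s)
      moreover have "(\<lambda>p. case p of (t, x, v) \<Rightarrow> (f t x v)\<^sup>2) \<in> borel_measurable borel"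
        using fm by (simp add: case_prod_unfold)
      ultimately show ?thesis by simp
    qed
    from nn_integral_lborel_triple[OF this] show ?thesis by simp
  qed
  finally have le2: "(\<integral>\<^sup>+z. emeasure lborel \<Omega>v * (\<integral>\<^sup>+v. indicator ({0..T} \<times> {a..b}) z * ennreal ((f (fst z) (snd z) v)\<^sup>2) \<partial>lborel) \<partial>lborel)
    = emeasure lborel \<Omega>v * (\<integral>\<^sup>+p. ennreal (norm (indicator ({0..T} \<times> {a<..<b} \<times> \<Omega>v) p *\<^sub>R (case p of (t, x, v) \<Rightarrow> (f t x v)\<^sup>2))) \<partial>lborel)" .
  note le1
  also note le2
  finally have le: "(\<integral>\<^sup>+z. indicator ({0..T} \<times> {a..b}) z * ennreal ((LINT v|lborel. w v * f (fst z) (snd z) v)\<^sup>2) \<partial>lborel)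
    \<le> emeasure lborel \<Omega>v * (\<integral>\<^sup>+p. ennreal (norm (indicator ({0..T} \<times> {a<..<b} \<times> \<Omega>v) p *\<^sub>R (case p of (t, x, v) \<Rightarrow> (f t x v)\<^sup>2))) \<partial>lborel)" .
  note le
  also have "\<dots> < \<infinity>"
    using f \<Omega>f unfolding approx_density_def set_integrable_def integrable_iff_bounded by (simp add: ennreal_mult_less_top)
  finally show "(\<integral>\<^sup>+z. indicator ({0..T} \<times> {a..b}) z * ennreal ((LINT v|lborel. w v * f (fst z) (snd z) v)\<^sup>2) \<partial>lborel) < \<infinity>" .
qed

lemma source_L2:
  assumes f: "approx_density T {a<..<b} K \<Omega>v f" and \<Omega>v: "bounded \<Omega>v" "open \<Omega>v" and K: "K \<subseteq> {a<..<b}"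
    and \<rho>: "smooth1 \<rho>"
  shows "L2_on ({0..T} \<times> {a..b}) (\<lambda>z. source \<rho> f (fst z) (snd z) \<bullet> e)"
proof -
  have "continuous_on UNIV \<rho>" using \<rho> unfolding smooth1_def by (metis DERIV_continuous_on has_field_derivative_at_within)
  then have "regular {0..T} {a..b} (\<lambda>t x. \<rho> x)" by (rule regular_continuous_space)
  then obtain B where B: "(\<lambda>z. \<rho> (snd z)) \<in> borel_measurable (borel :: (real \<times> real) measure)" "\<And>t x. t \<in> {0..T} \<Longrightarrow> x \<in> {a..b} \<Longrightarrow> \<bar>\<rho> x\<bar> \<le> B"
    unfolding regular_def by blast
  have "L2_on ({0..T} \<times> {a..b}) (\<lambda>z. \<rho> (snd z))"
    by (rule L2_on_bounded[OF B(1), where B = B]) (use B(2) in \<open>auto intro: bounded_Times\<close>)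
  moreover have "L2_on ({0..T} \<times> {a..b}) (\<lambda>z. LINT v|lborel. f (fst z) (snd z) v)"
    using velocity_average_L2[OF assms(1-4), of "\<lambda>_. 1"] by simp
  ultimately have "L2_on ({0..T} \<times> {a..b}) (\<lambda>z. e $ 1 * ((LINT v|lborel. f (fst z) (snd z) v) - \<rho> (snd z))
     - e $ 2 * (LINT v|lborel. vhat v $ 1 * f (fst z) (snd z) v) - e $ 3 * (LINT v|lborel. vhat v $ 2 * f (fst z) (snd z) v))"
    by (intro L2_on_diff L2_on_cmult velocity_average_L2[OF assms(1-4)] vhat_measurable vhat_le box_sets)
  then show ?thesis by (simp add: source_inner mult.commute)
qed

lemma source_support:
  assumes "x \<notin> K" "\<And>x. x \<notin> K \<Longrightarrow> \<rho> x = 0" "\<And>t x v. x \<notin> K \<Longrightarrow> f t x v = 0"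
  shows "source \<rho> f t x = 0"
proof -
  have "f t x v = 0" for v using assms by blast
  then have "source \<rho> f t x \<bullet> e = 0" for e using assms(1,2) by (simp add: source_inner)
  then show ?thesis by (metis inner_eq_zero_iff)
qed

section \<open>Characteristic directions\<close>

text \<open>
  A direction \<open>e\<close> for which testing the equation with \<open>hat e\<close> yields a scalar transport equation
  for the component along \<open>e\<close>, with speed \<open>\<sigma>\<close>, and for which the stabilizing terms \<open>M1 e\<close> and \<open>M2
  e\<close> involve only the same component. The number \<open>\<kappa>\<close> is the inner product of the two, up to
  normalization; it vanishes for the direction of \<open>E\<^sub>1\<close>, where \<open>M1 e\<close> and \<open>M2 e\<close> are orthogonal.
\<close>

definition characteristic :: "real ^ 3 \<Rightarrow> real \<Rightarrow> real \<Rightarrow> bool" where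
  "characteristic e \<sigma> \<kappa> \<longleftrightarrow> (\<sigma> = 1 \<or> \<sigma> = - 1) \<and> (\<kappa> = 0 \<or> \<kappa> = \<sigma>) \<and>
     (\<forall>w. (M1 *v w) \<bullet> hat e = w \<bullet> e \<and> (M2 *v w) \<bullet> hat e = \<sigma> * (w \<bullet> e) \<and>
        (M1 *v w) \<bullet> (M1 *v e) = w \<bullet> e \<and> (M2 *v w) \<bullet> (M1 *v e) = \<kappa> * (w \<bullet> e) \<and>
        (M1 *v w) \<bullet> (M2 *v e) = \<kappa> * (w \<bullet> e) \<and> (M2 *v w) \<bullet> (M2 *v e) = w \<bullet> e) \<and>
     e \<bullet> e \<le> 2 \<and> hat e \<bullet> hat e \<le> 2"

definition e1 :: "real ^ 3" where "e1 = vector [1, 0, 0]"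
definition e2 :: "real ^ 3" where "e2 = vector [0, 1, 1]"
definition e3 :: "real ^ 3" where "e3 = vector [0, 1, - 1]"

lemma vector_4_nth:
  "(vector [p, q, r, s] :: ('a::zero) ^ 4) $ 1 = p" "(vector [p, q, r, s] :: 'a ^ 4) $ 2 = q"
  "(vector [p, q, r, s] :: 'a ^ 4) $ 3 = r" "(vector [p, q, r, s] :: 'a ^ 4) $ 4 = s"
  unfolding vector_def by simp_all

lemmas matrix_simps = M1_def M2_def hat_def matrix_vector_mult_def inner_vec_def sum_3 sum_4 vector_4_nth

lemma characteristic_e: "characteristic e1 1 0" "characteristic e2 1 1" "characteristic e3 (- 1) (- 1)"
  by (auto simp: characteristic_def matrix_simps e1_def e2_def e3_def)

lemma inner_expand_e:
  "w \<bullet> v = (w \<bullet> e1) * (v \<bullet> e1) + (w \<bullet> e2) * (v \<bullet> e2) / 2 + (w \<bullet> e3) * (v \<bullet> e3) / 2" for w v :: "real ^ 3"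
  by (simp add: e1_def e2_def e3_def inner_vec_def sum_3 algebra_simps add_divide_distrib diff_divide_distrib)

section \<open>The dual solution\<close>

lemma nn_integral_translate:
  fixes F :: "'a::euclidean_space \<Rightarrow> ennreal"
  assumes "F \<in> borel_measurable borel"
  shows "(\<integral>\<^sup>+z. F (c + z) \<partial>lborel) = (\<integral>\<^sup>+z. F z \<partial>lborel)"
proof -
  have "(\<integral>\<^sup>+z. F z \<partial>lborel) = (\<integral>\<^sup>+z. F z \<partial>distr lborel borel ((+) c))" by (simp add: lborel_distr_plus)
  also have "\<dots> = (\<integral>\<^sup>+z. F (c + z) \<partial>lborel)" using assms by (intro nn_integral_distr) auto
  finally show ?thesis by simp
qed

lemma ennreal_set_integral:
  fixes f :: "'a::euclidean_space \<Rightarrow> real"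
  assumes "set_integrable lborel S f" "\<And>z. 0 \<le> f z"
  shows "ennreal (LINT z:S|lborel. f z) = (\<integral>\<^sup>+z. indicator S z * ennreal (f z) \<partial>lborel)"
proof -
  have "(\<integral>\<^sup>+z. ennreal (indicator S z *\<^sub>R f z) \<partial>lborel) = ennreal (LINT z:S|lborel. f z)"
    unfolding set_lebesgue_integral_def using assms
    by (intro nn_integral_eq_integral) (auto simp: set_integrable_def)
  moreover have "(\<integral>\<^sup>+z. ennreal (indicator S z *\<^sub>R f z) \<partial>lborel) = (\<integral>\<^sup>+z. indicator S z * ennreal (f z) \<partial>lborel)"
    by (intro nn_integral_cong) (auto simp: indicator_def)
  ultimately show ?thesis by simp
qed

text \<open>
  By the Cauchy-Schwarz inequality the square of the integral is at most \<open>T\<close> times the integral of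
  the squares of translates, and all translates of \<open>g\<close> have the same norm.
\<close>

lemma along_norm:
  assumes g: "continuous_on UNIV (\<lambda>z. g (fst z) (snd z))" and T: "0 \<le> T"
    and supp: "\<And>t x. (t, x) \<notin> {0..T} \<times> {a..b} \<Longrightarrow> g t x = 0"
    and al: "continuous_on UNIV (\<lambda>z. along T \<sigma> g (fst z) (snd z))"
  shows "(LINT z:{0..T} \<times> {a..b}|lborel. (along T \<sigma> g (fst z) (snd z))\<^sup>2)
    \<le> T\<^sup>2 * (LINT z:{0..T} \<times> {a..b}|lborel. (g (fst z) (snd z))\<^sup>2)"
proof -
  let ?S = "{0..T} \<times> {a..b}"
  define G where "G z = (g (fst z) (snd z))\<^sup>2" for z
  have cg: "continuous_on S (\<lambda>r. g (u r) (v r))" if "continuous_on S u" "continuous_on S v" for S and u v :: "'z::topological_space \<Rightarrow> real"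
    using continuous_on_compose2[OF g continuous_on_Pair[OF that]] by simp
  have G0: "0 \<le> (LINT z:?S|lborel. G z)"
    unfolding set_lebesgue_integral_def G_def by (intro Bochner_Integration.integral_nonneg) auto
  have comp: "compact ?S" by (intro compact_Times) auto
  have iG: "set_integrable lborel ?S G"
    unfolding G_def [abs_def] by (rule continuous_on_imp_integrable_lborel[OF _ comp]) (intro continuous_intros g)
  have iA: "set_integrable lborel ?S (\<lambda>z. (along T \<sigma> g (fst z) (snd z))\<^sup>2)"
    by (rule continuous_on_imp_integrable_lborel[OF _ comp]) (intro continuous_intros al)
  have mG: "(\<lambda>z. ennreal (G z)) \<in> borel_measurable borel"
    unfolding G_def [abs_def] by (intro measurable_compose[OF _ measurable_ennreal] borel_measurable_continuous_onI continuous_intros g)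
  have point: "ennreal ((along T \<sigma> g t x)\<^sup>2) \<le> ennreal T * (\<integral>\<^sup>+r. indicator {0..T} r * ennreal (G ((r, \<sigma> * r) + (t, x))) \<partial>lborel)" for t x
  proof -
    have c: "continuous_on S (\<lambda>r. g (t + r) (x + \<sigma> * r))" for S by (intro cg continuous_intros)
    have "(along T \<sigma> g t x)\<^sup>2 \<le> T * integral {0..T} (\<lambda>r. (g (t + r) (x + \<sigma> * r))\<^sup>2)"
      unfolding along_def using square_integral_le(1)[OF c T] by simp
    also have "integral {0..T} (\<lambda>r. (g (t + r) (x + \<sigma> * r))\<^sup>2) = (LINT r:{0..T}|lborel. (g (t + r) (x + \<sigma> * r))\<^sup>2)"
      by (rule set_borel_integral_eq_integral(2)[symmetric], rule continuous_on_imp_integrable_lborel) (auto intro!: continuous_intros c)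
    finally have "ennreal ((along T \<sigma> g t x)\<^sup>2) \<le> ennreal (T * (LINT r:{0..T}|lborel. (g (t + r) (x + \<sigma> * r))\<^sup>2))"
      by (rule ennreal_leI)
    also have "\<dots> = ennreal T * ennreal (LINT r:{0..T}|lborel. (g (t + r) (x + \<sigma> * r))\<^sup>2)"
      using T by (intro ennreal_mult) (auto simp: set_lebesgue_integral_def intro!: Bochner_Integration.integral_nonneg)
    also have "ennreal (LINT r:{0..T}|lborel. (g (t + r) (x + \<sigma> * r))\<^sup>2) = (\<integral>\<^sup>+r. indicator {0..T} r * ennreal ((g (t + r) (x + \<sigma> * r))\<^sup>2) \<partial>lborel)"
      by (rule ennreal_set_integral) (auto intro!: continuous_on_imp_integrable_lborel continuous_intros c)
    finally show ?thesis by (simp add: G_def add.commute)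
  qed
  have mr: "(\<lambda>(z, r). indicator {0..T} r * ennreal (G ((r, \<sigma> * r) + z))) \<in> borel_measurable ((lborel :: (real \<times> real) measure) \<Otimes>\<^sub>M (lborel :: real measure))"
  proof -
    have "(\<lambda>p::(real \<times> real) \<times> real. G ((snd p, \<sigma> * snd p) + fst p)) \<in> borel_measurable borel"
      unfolding G_def by (intro borel_measurable_continuous_onI continuous_intros cg)
    then have 1: "(\<lambda>p::(real \<times> real) \<times> real. ennreal (G ((snd p, \<sigma> * snd p) + fst p))) \<in> borel_measurable borel"
      by (rule measurable_compose[OF _ measurable_ennreal])
    have "(snd :: (real \<times> real) \<times> real \<Rightarrow> real) \<in> borel_measurable borel"
      by (intro borel_measurable_continuous_onI continuous_intros)
    then have 2: "(\<lambda>p::(real \<times> real) \<times> real. indicator {0..T} (snd p) :: ennreal) \<in> borel_measurable borel"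
      by (rule measurable_compose) simp
    from borel_measurable_times_ennreal[OF 2 1]
    have "(\<lambda>p::(real \<times> real) \<times> real. indicator {0..T} (snd p) * ennreal (G ((snd p, \<sigma> * snd p) + fst p))) \<in> borel_measurable borel" .
    then show ?thesis by (simp add: lborel_prod case_prod_unfold)
  qed
  have "ennreal (LINT z:?S|lborel. (along T \<sigma> g (fst z) (snd z))\<^sup>2) = (\<integral>\<^sup>+z. indicator ?S z * ennreal ((along T \<sigma> g (fst z) (snd z))\<^sup>2) \<partial>lborel)"
    by (rule ennreal_set_integral[OF iA]) simp
  also have "\<dots> \<le> (\<integral>\<^sup>+z. ennreal T * (\<integral>\<^sup>+r. indicator {0..T} r * ennreal (G ((r, \<sigma> * r) + z)) \<partial>lborel) \<partial>lborel)"
    using point[of "fst z" "snd z" for z] by (intro nn_integral_mono) (auto simp: indicator_def)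
  also have "\<dots> = ennreal T * (\<integral>\<^sup>+z. (\<integral>\<^sup>+r. indicator {0..T} r * ennreal (G ((r, \<sigma> * r) + z)) \<partial>lborel) \<partial>lborel)"
    by (rule nn_integral_cmult) (use lborel.borel_measurable_nn_integral_fst[OF mr] in simp)
  also have "(\<integral>\<^sup>+z. (\<integral>\<^sup>+r. indicator {0..T} r * ennreal (G ((r, \<sigma> * r) + z)) \<partial>lborel) \<partial>lborel)
     = (\<integral>\<^sup>+r. (\<integral>\<^sup>+z. indicator {0..T} r * ennreal (G ((r, \<sigma> * r) + z)) \<partial>lborel) \<partial>lborel)"
    using lborel_pair.Fubini[OF mr] by simp
  also have "\<dots> = (\<integral>\<^sup>+r. indicator {0..T} r * (\<integral>\<^sup>+z. ennreal (G z) \<partial>lborel) \<partial>lborel)"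
  proof (rule nn_integral_cong)
    fix r :: real
    have "(\<lambda>z. ennreal (G ((r, \<sigma> * r) + z))) \<in> borel_measurable lborel"
      using measurable_compose[OF _ mG, of "\<lambda>z. (r, \<sigma> * r) + z" borel] by simp
    then show "(\<integral>\<^sup>+z. indicator {0..T} r * ennreal (G ((r, \<sigma> * r) + z)) \<partial>lborel) = indicator {0..T} r * (\<integral>\<^sup>+z. ennreal (G z) \<partial>lborel)"
      by (simp add: nn_integral_cmult nn_integral_translate[OF mG])
  qed
  also have "\<dots> = (\<integral>\<^sup>+z. ennreal (G z) \<partial>lborel) * ennreal T"
    using T by (subst nn_integral_multc) (auto simp: mult.commute)
  also have "(\<integral>\<^sup>+z. ennreal (G z) \<partial>lborel) = (\<integral>\<^sup>+z. indicator ?S z * ennreal (G z) \<partial>lborel)"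
  proof (rule nn_integral_cong)
    fix z show "ennreal (G z) = indicator ?S z * ennreal (G z)"
      using supp[of "fst z" "snd z"] by (cases "z \<in> ?S") (auto simp: G_def indicator_def)
  qed
  also have "\<dots> = ennreal (LINT z:?S|lborel. G z)"
    by (rule ennreal_set_integral[OF iG, symmetric]) (simp add: G_def)
  also have "ennreal T * (ennreal (LINT z:?S|lborel. G z) * ennreal T) = ennreal (T\<^sup>2 * (LINT z:?S|lborel. G z))"
    using T G0 by (simp add: ennreal_mult power2_eq_square mult_ac)
  finally have "ennreal (LINT z:?S|lborel. (along T \<sigma> g (fst z) (snd z))\<^sup>2) \<le> ennreal (T\<^sup>2 * (LINT z:?S|lborel. G z))" .
  then have "(LINT z:?S|lborel. (along T \<sigma> g (fst z) (snd z))\<^sup>2) \<le> T\<^sup>2 * (LINT z:?S|lborel. G z)"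
    by (subst (asm) ennreal_le_iff) (auto intro: mult_nonneg_nonneg G0)
  then show ?thesis by (simp add: G_def [abs_def])
qed

lemma smooth_family_support:
  fixes D :: "nat \<Rightarrow> nat \<Rightarrow> real \<Rightarrow> real \<Rightarrow> real"
  assumes D: "smooth_family D" and A: "closed A" and supp: "\<And>t x. (t, x) \<notin> A \<Longrightarrow> D 0 0 t x = 0"
  shows "(t, x) \<notin> A \<Longrightarrow> D i j t x = 0"
proof -
  have step: "f' = 0" if "(f has_vector_derivative f') (at s)" "open S" "s \<in> S" "\<And>y. y \<in> S \<Longrightarrow> f y = (0::real)" for f f' s S
  proof -
    have "(f has_vector_derivative 0) (at s)"
      by (rule has_vector_derivative_transform_within_open[OF _ that(2,3), of "\<lambda>_. 0"]) (use that(4) in auto)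
    then show ?thesis using that(1) by (metis vector_derivative_unique_at)
  qed
  have op: "open {s. (s, x) \<notin> A}" "open {y. (t, y) \<notin> A}" for t x
  proof -
    have "open ((\<lambda>s. (s, x)) -` (- A))" "open ((\<lambda>y. (t, y)) -` (- A))"
      using A by (auto intro!: open_vimage continuous_intros)
    then show "open {s. (s, x) \<notin> A}" "open {y. (t, y) \<notin> A}" by (simp_all add: vimage_def)
  qed
  have 0: "D i 0 t x = 0" if "(t, x) \<notin> A" for i t x
    using that
  proof (induction i arbitrary: t)
    case (Suc i)
    show ?case by (rule step[OF smooth_family_deriv(1)[OF D] op(1)]) (use Suc in auto)
  qed (use supp in auto)
  show "(t, x) \<notin> A \<Longrightarrow> D i j t x = 0"
  proof (induction j arbitrary: x)
    case (Suc j)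
    show ?case by (rule step[OF smooth_family_deriv(2)[OF D] op(2)]) (use Suc in auto)
  qed (use 0 in auto)
qed

text \<open>
  The integrand of the left-hand side is the derivative of \<open>g\<close> along the characteristic.
\<close>

lemma along_transport:
  fixes D :: "nat \<Rightarrow> nat \<Rightarrow> real \<Rightarrow> real \<Rightarrow> real"
  assumes D: "smooth_family D" and T: "0 \<le> T"
  shows "along T \<sigma> (D 1 0) t x + \<sigma> * along T \<sigma> (D 0 1) t x = D 0 0 (t + T) (x + \<sigma> * T) - D 0 0 t x"
proof -
  have c: "continuous_on S (\<lambda>r. D i j (t + r) (x + \<sigma> * r))" for S i j
    by (intro smooth_family_continuous[OF D] continuous_intros)
  have total: "((\<lambda>z. D 0 0 (fst z) (snd z)) has_derivative (\<lambda>v. fst v * D 1 0 t x + snd v * D 0 1 t x)) (at (t, x))" for t x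
  proof -
    have "((\<lambda>(t, x). D 0 0 t x) has_derivative (\<lambda>(v, w). v *\<^sub>R D 1 0 t x + blinfun_apply (blinfun_scaleR_left (D 0 1 t x)) w)) (at (t, x) within UNIV \<times> UNIV)"
    proof (rule has_derivative_partialsI)
      show "((\<lambda>t. D 0 0 t x) has_derivative (\<lambda>v. v *\<^sub>R D 1 0 t x)) (at t)"
        using smooth_family_deriv(1)[OF D, of 0 0 x t] by (simp add: has_vector_derivative_def)
      show "(D 0 0 t has_derivative blinfun_apply (blinfun_scaleR_left (D 0 1 t x))) (at x)" for t x
        using smooth_family_deriv(2)[OF D, of 0 0 t x] by (simp add: has_vector_derivative_def)
      have "continuous_on UNIV (\<lambda>z. blinfun_scaleR_left (D 0 1 (fst z) (snd z)))"
        by (intro continuous_intros smooth_family_continuous[OF D])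
      then show "continuous (at (t, x) within UNIV \<times> UNIV) (\<lambda>(x, y). blinfun_scaleR_left (D 0 1 x y))"
        by (simp add: case_prod_unfold continuous_on_eq_continuous_within)
    qed auto
    then show ?thesis by (simp add: case_prod_unfold)
  qed
  have "((\<lambda>r. D 0 0 (t + r) (x + \<sigma> * r)) has_vector_derivative D 1 0 (t + r) (x + \<sigma> * r) + \<sigma> * D 0 1 (t + r) (x + \<sigma> * r)) (at r within {0..T})" for r
  proof -
    have "((\<lambda>r. (t + r, x + \<sigma> * r)) has_vector_derivative (1, \<sigma>)) (at r within {0..T})"
      by (auto intro!: derivative_eq_intros has_vector_derivative_Pair)
    from vector_derivative_diff_chain_within[OF this has_derivative_at_withinI[OF total]]
    show ?thesis by (simp add: o_def)
  qed
  then have "((\<lambda>r. D 1 0 (t + r) (x + \<sigma> * r) + \<sigma> * D 0 1 (t + r) (x + \<sigma> * r)) has_integral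
      D 0 0 (t + T) (x + \<sigma> * T) - D 0 0 (t + 0) (x + \<sigma> * 0)) {0..T}"
    using T by (intro fundamental_theorem_of_calculus) auto
  then have "integral {0..T} (\<lambda>r. D 1 0 (t + r) (x + \<sigma> * r) + \<sigma> * D 0 1 (t + r) (x + \<sigma> * r)) = D 0 0 (t + T) (x + \<sigma> * T) - D 0 0 t x"
    by (simp add: integral_unique)
  moreover have "integral {0..T} (\<lambda>r. D 1 0 (t + r) (x + \<sigma> * r) + \<sigma> * D 0 1 (t + r) (x + \<sigma> * r))
     = along T \<sigma> (D 1 0) t x + \<sigma> * along T \<sigma> (D 0 1) t x"
    unfolding along_def by (subst integral_add) (auto intro!: integrable_continuous_real continuous_intros c)
  ultimately show ?thesis by simp
qed

section \<open>The exact solution in weak form\<close>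

lemma compact_margin:
  assumes "compact K" "K \<subseteq> {a<..<b}" "a < (b::real)"
  shows "\<exists>d>0. 2 * d \<le> b - a \<and> K \<subseteq> {a + d..b - d}"
proof (cases "K = {}")
  case False
  obtain u v where u: "u \<in> K" "\<And>x. x \<in> K \<Longrightarrow> u \<le> x" and v: "v \<in> K" "\<And>x. x \<in> K \<Longrightarrow> x \<le> v"
    using compact_attains_inf[OF assms(1) False] compact_attains_sup[OF assms(1) False] by metis
  define d where "d = min (min (u - a) (b - v)) ((b - a) / 2)"
  have "d \<le> u - a" "d \<le> b - v" "d \<le> (b - a) / 2" unfolding d_def by linarith+
  moreover have "0 < d" using u(1) v(1) assms(2,3) by (auto simp: d_def)
  moreover have "K \<subseteq> {a + d..b - d}"
  proof
    fix x assume "x \<in> K"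
    then show "x \<in> {a + d..b - d}" using u(2)[of x] v(2)[of x] \<open>d \<le> u - a\<close> \<open>d \<le> b - v\<close> by simp
  qed
  ultimately show ?thesis by (intro exI[of _ d]) simp
qed (use assms(3) in \<open>auto intro!: exI[of _ "(b - a) / 2"]\<close>)

lemma in_L2_mult_continuous:
  fixes W :: "real \<Rightarrow> real \<Rightarrow> 'a::euclidean_space"
  assumes W: "in_L2 S W" and S: "S \<in> sets lebesgue" "bounded S" and F: "continuous_on UNIV (F :: real \<times> real \<Rightarrow> real)"
  shows "set_integrable lebesgue S (\<lambda>z. (W (fst z) (snd z) \<bullet> e) * F z)"
proof -
  have Wm: "(\<lambda>z. indicator S z *\<^sub>R W (fst z) (snd z)) \<in> borel_measurable lebesgue"
    using W by (simp add: in_L2_def set_borel_measurable_def case_prod_unfold)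
  have Wi: "integrable lebesgue (\<lambda>z. indicator S z *\<^sub>R (norm (W (fst z) (snd z)))\<^sup>2)"
    using W by (simp add: in_L2_def set_integrable_def case_prod_unfold)
  have Fm: "F \<in> borel_measurable lebesgue"
    using borel_measurable_continuous_onI[OF F] by (intro measurable_completion) simp
  have "compact (closure S)" using S(2) by simp
  then have "bounded (F ` closure S)" by (intro compact_imp_bounded compact_continuous_image continuous_on_subset[OF F]) auto
  then obtain C where C: "\<And>z. z \<in> S \<Longrightarrow> \<bar>F z\<bar> \<le> C"
    unfolding bounded_iff using closure_subset[of S] by (metis imageI real_norm_def subsetD)
  have fin: "integrable lebesgue (\<lambda>z. indicator S z *\<^sub>R (norm e * C)\<^sup>2 :: real)"
    using bounded_set_imp_lmeasurable[OF S(2,1)]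
    by (intro integrable_scaleR_left) (auto simp: integrable_indicator_iff fmeasurable_def)
  show ?thesis
    unfolding set_integrable_def
  proof (rule Bochner_Integration.integrable_bound[OF Bochner_Integration.integrable_add[OF Wi fin]])
    have "(\<lambda>z. (indicator S z *\<^sub>R W (fst z) (snd z)) \<bullet> e * F z) \<in> borel_measurable lebesgue"
      using Wm Fm by (intro borel_measurable_times borel_measurable_inner) auto
    then show "(\<lambda>z. indicator S z *\<^sub>R (W (fst z) (snd z) \<bullet> e * F z)) \<in> borel_measurable lebesgue" by (simp add: mult.assoc)
    show "AE z in lebesgue. norm (indicator S z *\<^sub>R (W (fst z) (snd z) \<bullet> e * F z)) \<le> norm (indicator S z *\<^sub>R (norm (W (fst z) (snd z)))\<^sup>2 + indicator S z *\<^sub>R (norm e * C)\<^sup>2 :: real)"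
    proof (rule AE_I2)
      fix z
      show "norm (indicator S z *\<^sub>R (W (fst z) (snd z) \<bullet> e * F z)) \<le> norm (indicator S z *\<^sub>R (norm (W (fst z) (snd z)))\<^sup>2 + indicator S z *\<^sub>R (norm e * C)\<^sup>2 :: real)"
      proof (cases "z \<in> S")
        case True
        define w where "w = norm (W (fst z) (snd z))"
        have C0: "0 \<le> C" using C[OF True] by linarith
        have "\<bar>W (fst z) (snd z) \<bullet> e * F z\<bar> \<le> (w * norm e) * C"
          unfolding abs_mult w_def using C[OF True] by (intro mult_mono Cauchy_Schwarz_ineq2) auto
        also have "\<dots> = w * (norm e * C)" by simp
        also have "\<dots> \<le> w\<^sup>2 + (norm e * C)\<^sup>2"
        proof -
          have "2 * (w * (norm e * C)) \<le> w\<^sup>2 + (norm e * C)\<^sup>2" using young[of 1 w "norm e * C"] by simp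
          moreover have "0 \<le> w * (norm e * C)" using C0 by (simp add: w_def)
          ultimately show ?thesis by linarith
        qed
        finally show ?thesis using True by (simp add: w_def)
      qed simp
    qed
  qed
qed

lemma smooth_family_C1:
  fixes D :: "nat \<Rightarrow> nat \<Rightarrow> real \<Rightarrow> real \<Rightarrow> real"
  assumes "smooth_family D"
  shows "C1_function (D 0 0) (D 1 0) (D 0 1)"
  unfolding C1_function_def
  using smooth_family_deriv[OF assms, of 0 0]
  by (auto intro!: smooth_family_continuous[OF assms] continuous_intros simp: has_real_derivative_iff_has_vector_derivative)

text \<open>
  The dual solution is not supported inside the interval and hence not a test function. As the
  exact solution and its data vanish off \<open>K\<close>, it may be multiplied by a smooth cutoff in space
  that equals one on \<open>K\<close>.
\<close>

lemma weak_identity: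
  fixes D :: "nat \<Rightarrow> nat \<Rightarrow> real \<Rightarrow> real \<Rightarrow> real"
  assumes sol: "maxwell_solution T {a<..<b} K B W0 W" and K: "compact K" "K \<subseteq> {a<..<b}" and ab: "a < b"
    and ch: "characteristic e \<sigma> \<kappa>"
    and B: "\<And>t x. x \<notin> K \<Longrightarrow> B t x = 0" and W0: "\<And>x. x \<notin> K \<Longrightarrow> W0 x = 0"
    and D: "smooth_family D" and lo: "\<And>t x. t \<le> - T \<Longrightarrow> D 0 0 t x = 0"
    and hi: "T1 < T" "\<And>t x. T1 \<le> t \<Longrightarrow> D 0 0 t x = 0"
  shows "(LINT z:{0..T} \<times> {a<..<b}|lebesgue. (W (fst z) (snd z) \<bullet> e) * (D 1 0 (fst z) (snd z) + \<sigma> * D 0 1 (fst z) (snd z)))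
    = - (LINT z:{0..T} \<times> {a<..<b}|lebesgue. (B (fst z) (snd z) \<bullet> hat e) * D 0 0 (fst z) (snd z))
      - (LINT x:{a<..<b}|lebesgue. (W0 x \<bullet> e) * D 0 0 0 x)"
proof -
  let ?S = "{0..T} \<times> {a<..<b}"
  have S: "?S \<in> sets lebesgue" "bounded ?S" by (auto intro: bounded_Times)
  obtain d where "0 < d" "K \<subseteq> {a + d..b - d}" using compact_margin[OF K ab] by blast
  then obtain a' b' where ab': "a < a'" "b' < b" "K \<subseteq> {a'..b'}" by (intro that[of "a + d" "b - d"]) auto
  obtain \<theta> where \<theta>: "deriv_chain \<theta>" "\<And>x. x \<notin> {(a + a') / 2..(b + b') / 2} \<Longrightarrow> \<theta> 0 x = 0"
    "\<And>x. x \<in> {a'..b'} \<Longrightarrow> \<theta> 0 x = 1 \<and> \<theta> 1 x = 0"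
    using smooth_cutoff[of "(a + a') / 2" a' b' "(b + b') / 2"] ab' by auto
  define F where "F i j t x = leibniz (\<lambda>p. \<theta> p x) (\<lambda>q. D i q t x) j 0 0" for i j t x
  have F: "smooth_family F" unfolding F_def [abs_def] by (rule smooth_family_mult_x[OF \<theta>(1) D])
  define \<phi> where "\<phi> t x = F 0 0 t x *\<^sub>R hat e" for t x
  have FK: "F 0 0 t x = D 0 0 t x" "F 1 0 t x = D 1 0 t x" "F 0 1 t x = D 0 1 t x" if "x \<in> K" for t x
    using \<theta>(3)[of x] ab' that by (auto simp: F_def)
  note deriv = smooth_family_deriv[OF smooth_family_scaleR[OF F, of "hat e"], of 0 0]
  have dt: "dt \<phi> t x = F 1 0 t x *\<^sub>R hat e" for t x
    unfolding dt_def \<phi>_def using deriv(1)[of x t] by (intro vector_derivative_at) simp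
  have dx: "dx \<phi> t x = F 0 1 t x *\<^sub>R hat e" for t x
    unfolding dx_def \<phi>_def using deriv(2)[of t x] by (intro vector_derivative_at) simp
  have "\<phi> \<in> C0_infinity ({..<T} \<times> {a<..<b})"
    unfolding C0_infinity_def
  proof (intro CollectI conjI exI[of _ "{- T..T1} \<times> {(a + a') / 2..(b + b') / 2}"] allI impI)
    show "smooth2 \<phi>" unfolding smooth2_iff \<phi>_def [abs_def] using smooth_family_scaleR[OF F, of "hat e"] by blast
    show "compact ({- T..T1} \<times> {(a + a') / 2..(b + b') / 2})" by (intro compact_Times) auto
    show "{- T..T1} \<times> {(a + a') / 2..(b + b') / 2} \<subseteq> {..<T} \<times> {a<..<b}"
      using ab' hi(1) by (auto simp: field_simps)
    fix t x assume tx: "(t, x) \<notin> {- T..T1} \<times> {(a + a') / 2..(b + b') / 2}"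
    have "D 0 0 t x = 0 \<or> \<theta> 0 x = 0"
    proof (cases "x \<in> {(a + a') / 2..(b + b') / 2}")
      case True
      then have "t \<notin> {- T..T1}" using tx by blast
      then show ?thesis using lo[of t x] hi(2)[of t x] by (cases "t \<le> - T") auto
    qed (use \<theta>(2) in blast)
    then show "\<phi> t x = 0" by (auto simp: \<phi>_def F_def)
  qed
  with sol have eq: "- inner_L2 ?S (\<lambda>t x. M1 *v W t x) (dt \<phi>) - inner_L2 ?S (\<lambda>t x. M2 *v W t x) (dx \<phi>)
        - (LINT x:{a<..<b}|lebesgue. (M1 *v W0 x) \<bullet> \<phi> 0 x) = inner_L2 ?S B \<phi>"
    unfolding maxwell_solution_def by blast
  have Wz: "W t x = 0" if "t \<in> {0..T}" "x \<notin> K" for t x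
    using sol that unfolding maxwell_solution_def by blast
  have c: "(M1 *v w) \<bullet> hat e = w \<bullet> e" "(M2 *v w) \<bullet> hat e = \<sigma> * (w \<bullet> e)" for w
    using ch unfolding characteristic_def by blast+
  have 1: "inner_L2 ?S (\<lambda>t x. M1 *v W t x) (dt \<phi>) = (LINT z:?S|lebesgue. (W (fst z) (snd z) \<bullet> e) * D 1 0 (fst z) (snd z))"
    unfolding inner_L2_def
  proof (rule set_lebesgue_integral_cong[OF S(1)], intro allI impI)
    fix z assume "z \<in> ?S"
    then show "(M1 *v W (fst z) (snd z)) \<bullet> dt \<phi> (fst z) (snd z) = W (fst z) (snd z) \<bullet> e * D 1 0 (fst z) (snd z)"
      using Wz[of "fst z" "snd z"] FK[of "snd z" "fst z"] by (cases "snd z \<in> K") (auto simp: dt c)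
  qed
  have 2: "inner_L2 ?S (\<lambda>t x. M2 *v W t x) (dx \<phi>) = (LINT z:?S|lebesgue. (W (fst z) (snd z) \<bullet> e) * (\<sigma> * D 0 1 (fst z) (snd z)))"
    unfolding inner_L2_def
  proof (rule set_lebesgue_integral_cong[OF S(1)], intro allI impI)
    fix z assume "z \<in> ?S"
    then show "(M2 *v W (fst z) (snd z)) \<bullet> dx \<phi> (fst z) (snd z) = W (fst z) (snd z) \<bullet> e * (\<sigma> * D 0 1 (fst z) (snd z))"
      using Wz[of "fst z" "snd z"] FK[of "snd z" "fst z"] by (cases "snd z \<in> K") (auto simp: dx c)
  qed
  have 3: "inner_L2 ?S B \<phi> = (LINT z:?S|lebesgue. (B (fst z) (snd z) \<bullet> hat e) * D 0 0 (fst z) (snd z))"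
    unfolding inner_L2_def
  proof (rule set_lebesgue_integral_cong[OF S(1)], intro allI impI)
    fix z
    show "B (fst z) (snd z) \<bullet> \<phi> (fst z) (snd z) = B (fst z) (snd z) \<bullet> hat e * D 0 0 (fst z) (snd z)"
      using B[of "snd z" "fst z"] FK[of "snd z" "fst z"] by (cases "snd z \<in> K") (auto simp: \<phi>_def)
  qed
  have 4: "(LINT x:{a<..<b}|lebesgue. (M1 *v W0 x) \<bullet> \<phi> 0 x) = (LINT x:{a<..<b}|lebesgue. (W0 x \<bullet> e) * D 0 0 0 x)"
  proof (rule set_lebesgue_integral_cong, simp, intro allI impI)
    fix x show "(M1 *v W0 x) \<bullet> \<phi> 0 x = (W0 x \<bullet> e) * D 0 0 0 x"
      using W0[of x] FK[of x 0] by (cases "x \<in> K") (auto simp: \<phi>_def c)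
  qed
  have L2: "in_L2 ?S W" using sol unfolding maxwell_solution_def by blast
  have i: "set_integrable lebesgue ?S (\<lambda>z. (W (fst z) (snd z) \<bullet> e) * D 1 0 (fst z) (snd z))"
    "set_integrable lebesgue ?S (\<lambda>z. (W (fst z) (snd z) \<bullet> e) * (\<sigma> * D 0 1 (fst z) (snd z)))"
    by (intro in_L2_mult_continuous[OF L2 S] continuous_intros smooth_family_continuous[OF D])+
  have "(LINT z:?S|lebesgue. (W (fst z) (snd z) \<bullet> e) * (D 1 0 (fst z) (snd z) + \<sigma> * D 0 1 (fst z) (snd z)))
    = (LINT z:?S|lebesgue. (W (fst z) (snd z) \<bullet> e) * D 1 0 (fst z) (snd z))
      + (LINT z:?S|lebesgue. (W (fst z) (snd z) \<bullet> e) * (\<sigma> * D 0 1 (fst z) (snd z)))"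
    unfolding distrib_left using i by (rule set_integral_add(2))
  then show ?thesis using eq unfolding 1 2 3 4 by linarith
qed

section \<open>Coefficients and test functions of the discrete space\<close>

text \<open>
  Derivatives of discrete functions are known only off the nodes and inside the slab; the values
  elsewhere do not affect the integrals.
\<close>

lemma slab_lebesgue:
  fixes f g :: "real \<Rightarrow> real \<Rightarrow> real"
  assumes N: "finite N" and g: "(\<lambda>z. g (fst z) (snd z)) \<in> borel_measurable borel"
    and eq: "\<And>t x. t \<in> {s<..<s'} \<Longrightarrow> x \<in> {a<..<b} - N \<Longrightarrow> f t x = g t x"
    and S: "{s<..<s'} \<times> {a<..<b} \<subseteq> S" "S \<subseteq> {s..s'} \<times> {a..b}"
  shows "(LINT z:S|lebesgue. f (fst z) (snd z)) = (LINT z:{s..s'} \<times> {a..b}|lborel. g (fst z) (snd z))"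
    and "set_integrable lebesgue S (\<lambda>z. f (fst z) (snd z)) \<longleftrightarrow> set_integrable lborel ({s..s'} \<times> {a..b}) (\<lambda>z. g (fst z) (snd z))"
    and "set_borel_measurable lebesgue S (\<lambda>z. f (fst z) (snd z))"
proof -
  have "AE z in lebesgue. fst z \<notin> {s, s'} \<and> snd z \<notin> N \<union> {a, b}" by (rule AE_off_grid) (use N in auto)
  then have "AE z in lebesgue. indicator S z *\<^sub>R f (fst z) (snd z) = indicator ({s..s'} \<times> {a..b}) z *\<^sub>R g (fst z) (snd z)"
  proof eventually_elim
    case (elim z)
    show ?case
    proof (cases "z \<in> {s..s'} \<times> {a..b}")
      case True
      then have "fst z \<in> {s<..<s'}" "snd z \<in> {a<..<b} - N" using elim by (auto simp: less_le)
      moreover from this have "z \<in> S" using S(1) by (auto simp: mem_Times_iff)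
      ultimately show ?thesis using True eq by simp
    next
      case False
      then have "z \<notin> S" using S(2) by blast
      then show ?thesis using False by simp
    qed
  qed
  note * = lebesgue_eq_lborel[OF this g box_sets]
  show "(LINT z:S|lebesgue. f (fst z) (snd z)) = (LINT z:{s..s'} \<times> {a..b}|lborel. g (fst z) (snd z))"
    "set_integrable lebesgue S (\<lambda>z. f (fst z) (snd z)) \<longleftrightarrow> set_integrable lborel ({s..s'} \<times> {a..b}) (\<lambda>z. g (fst z) (snd z))"
    "set_borel_measurable lebesgue S (\<lambda>z. f (fst z) (snd z))" by (rule *)+
qed

lemma tpoly_unique:
  assumes "infinite S" and "\<And>t. t \<in> S \<Longrightarrow> tpoly k c t = tpoly k c' t" and "i \<le> k"
  shows "c i = c' i"
proof (rule ccontr)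
  assume "c i \<noteq> c' i"
  then have "\<exists>i\<le>k. c i - c' i \<noteq> 0" using assms(3) by auto
  then have "finite {t. (\<Sum>i\<le>k. (c i - c' i) * t ^ i) = 0}" using polyfun_finite_roots[of "\<lambda>i. c i - c' i" k] by blast
  moreover have "S \<subseteq> {t. (\<Sum>i\<le>k. (c i - c' i) * t ^ i) = 0}"
    using assms(2) by (auto simp: tpoly_def left_diff_distrib sum_subtractf)
  ultimately show False using assms(1) finite_subset by blast
qed

context mesh
begin

lemma slab_infinite: "infinite (slab_time h m)"
  unfolding slab_time_def using h_pos by (simp add: infinite_Ioc algebra_simps)

text \<open>
  The description of members of the discrete space element by element gives coefficients in time
  on each element. Since powers are linearly independent on the slab, the coefficients from
  neighbouring elements agree at the nodes and those at the boundary vanish, so that each of them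
  is a function of class \<open>pw0\<close>.
\<close>

lemma V_space_coefficients:
  assumes W: "W \<in> V_space {a<..<b} h M \<T> k"
  shows "\<exists>A. (\<forall>m i. pw0 (A m i)) \<and>
    (\<forall>m\<in>{1..M}. \<forall>t\<in>slab_time h m. \<forall>x\<in>{a..b}. W t x \<bullet> e = tpoly k (\<lambda>i. A m i x) t)"
proof -
  have "\<exists>c. \<forall>t\<in>slab_time h m. \<forall>x\<in>\<tau>. W t x \<bullet> e = tpoly k (\<lambda>i. tpoly k (c i) x) t"
    if m: "m \<in> {1..M}" and \<tau>: "\<tau> \<in> \<T>" for m \<tau>
  proof -
    have "\<forall>l. \<exists>c :: nat \<Rightarrow> nat \<Rightarrow> real. \<forall>t\<in>slab_time h m. \<forall>x\<in>\<tau>. W t x $ l = (\<Sum>i\<le>k. \<Sum>j\<le>k. c i j * t ^ i * x ^ j)"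
      using W m \<tau> unfolding V_space_def by blast
    from choice[OF this] obtain c :: "3 \<Rightarrow> nat \<Rightarrow> nat \<Rightarrow> real"
      where "\<forall>l. \<forall>t\<in>slab_time h m. \<forall>x\<in>\<tau>. W t x $ l = (\<Sum>i\<le>k. \<Sum>j\<le>k. c l i j * t ^ i * x ^ j)" ..
    then have c: "W t x $ l = (\<Sum>i\<le>k. \<Sum>j\<le>k. c l i j * t ^ i * x ^ j)" if "t \<in> slab_time h m" "x \<in> \<tau>" for l t x
      using that by blast
    have lin: "tpoly k (\<lambda>i. p i * u + q i * v + r i * w) s = tpoly k p s * u + tpoly k q s * v + tpoly k r s * w"
      for p q r :: "nat \<Rightarrow> real" and u v w s :: real
      by (simp add: tpoly_def algebra_simps sum.distrib sum_distrib_left)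
    have tensor: "(\<Sum>i\<le>k. \<Sum>j\<le>k. p i j * t ^ i * x ^ j) = tpoly k (\<lambda>i. tpoly k (p i) x) t" for p :: "nat \<Rightarrow> nat \<Rightarrow> real" and t x
      by (simp add: tpoly_def sum_distrib_left sum_distrib_right mult_ac)
    have "W t x \<bullet> e = tpoly k (\<lambda>i. tpoly k (\<lambda>j. c 1 i j * e $ 1 + c 2 i j * e $ 2 + c 3 i j * e $ 3) x) t"
      if "t \<in> slab_time h m" "x \<in> \<tau>" for t x
      unfolding inner_vec_def sum_3 inner_real_def c[OF that] tensor lin ..
    then show ?thesis by (intro exI[of _ "\<lambda>i j. c 1 i j * e $ 1 + c 2 i j * e $ 2 + c 3 i j * e $ 3"]) blast
  qed
  then obtain c where c: "\<And>m \<tau> t x. m \<in> {1..M} \<Longrightarrow> \<tau> \<in> \<T> \<Longrightarrow> t \<in> slab_time h m \<Longrightarrow> x \<in> \<tau> \<Longrightarrow>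
      W t x \<bullet> e = tpoly k (\<lambda>i. tpoly k (c m \<tau> i) x) t" by metis
  have bd: "W t x \<bullet> e = 0" if "m \<in> {1..M}" "t \<in> slab_time h m" "x = a \<or> x = b" for m t x
  proof -
    have "frontier {a<..<b} = {a, b}" using ab by (auto simp: frontier_def)
    then have "W t x $ l = 0" for l using W that unfolding V_space_def H0_space_def by blast
    then show ?thesis by (simp add: inner_vec_def)
  qed
  define sel where "sel x = (SOME \<tau>. \<tau> \<in> \<T> \<and> x \<in> \<tau>)" for x
  have sel: "sel x \<in> \<T>" "x \<in> sel x" if "x \<in> {a..b}" for x
    unfolding sel_def using someI_ex[of "\<lambda>\<tau>. \<tau> \<in> \<T> \<and> x \<in> \<tau>"] cover[OF that] by blast+
  define A where "A m i x = (if m \<in> {1..M} \<and> i \<le> k \<and> x \<in> {a<..<b} then tpoly k (c m (sel x) i) x else 0)" for m i x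
  \<comment> \<open>Polynomials in time that agree on a slab have the same coefficients.\<close>
  have A: "A m i x = tpoly k (c m \<tau> i) x" if m: "m \<in> {1..M}" and i: "i \<le> k" and \<tau>: "\<tau> \<in> \<T>" "x \<in> \<tau>" for m i x \<tau>
  proof (cases "x \<in> {a<..<b}")
    case True
    then have x: "x \<in> {a..b}" by auto
    have "tpoly k (c m (sel x) i) x = tpoly k (c m \<tau> i) x"
      by (rule tpoly_unique[OF slab_infinite _ i, of m]) (use c[OF m sel(1)[OF x] _ sel(2)[OF x]] c[OF m \<tau>(1) _ \<tau>(2)] in force)
    then show ?thesis using m i True by (simp add: A_def)
  next
    case False
    have "x \<in> {a..b}" using division_ofD(2)[OF division \<tau>(1)] \<tau>(2) by auto
    with False have ab: "x = a \<or> x = b" by auto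
    have "(0::real) = tpoly k (c m \<tau> i) x"
      by (rule tpoly_unique[OF slab_infinite _ i, of m "\<lambda>_. 0"]) (use c[OF m \<tau>(1) _ \<tau>(2)] bd[OF m _ ab] in \<open>simp add: tpoly_def\<close>)
    then show ?thesis using False by (auto simp: A_def)
  qed
  show ?thesis
  proof (intro exI[of _ A] conjI allI ballI)
    fix m i
    show "pw0 (A m i)" unfolding pw0_def
    proof (intro conjI ballI allI impI)
      fix \<tau> assume \<tau>: "\<tau> \<in> \<T>"
      show "\<exists>c. \<forall>x\<in>\<tau>. A m i x = tpoly k c x"
      proof (cases "m \<in> {1..M} \<and> i \<le> k")
        case True then show ?thesis using A \<tau> by blast
      next
        case False then show ?thesis by (intro exI[of _ "\<lambda>_. 0"]) (auto simp: A_def tpoly_def)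
      qed
    qed (auto simp: A_def)
  next
    fix m t x assume m: "m \<in> {1..M}" and t: "t \<in> slab_time h m" and x: "x \<in> {a..b}"
    have "W t x \<bullet> e = tpoly k (\<lambda>i. tpoly k (c m (sel x) i) x) t" by (rule c[OF m sel(1)[OF x] t sel(2)[OF x]])
    also have "\<dots> = tpoly k (\<lambda>i. A m i x) t"
      unfolding tpoly_def[of k "\<lambda>i. tpoly k (c m (sel x) i) x"] tpoly_def[of k "\<lambda>i. A m i x"]
      by (intro sum.cong refl) (simp add: A[OF m _ sel(1)[OF x] sel(2)[OF x]])
    finally show "W t x \<bullet> e = tpoly k (\<lambda>i. A m i x) t" .
  qed
qed

text \<open>
  The weak derivatives are the classical ones off the nodes, by integration by parts.
\<close>

lemma tensor_in_H1:
  assumes B: "\<And>i. pw0 (B i)" and S: "S = {s<..s + h} \<times> {a<..<b}"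
    and w: "\<And>t x. t \<in> {s<..s + h} \<Longrightarrow> x \<in> {a<..<b} \<Longrightarrow> w t x = c * tpoly k (\<lambda>i. B i x) t"
  shows "in_H1 S w"
proof -
  have SS: "{s<..<s + h} \<times> {a<..<b} \<subseteq> S" "S \<subseteq> {s..s + h} \<times> {a..b}" by (auto simp: S)
  have wb: "w t x = c * tpoly k (\<lambda>i. B i x) t" if "t \<in> {s<..<s + h}" "x \<in> {a<..<b} - {}" for t x
    using w that by auto
  note reg = regular_tensor[OF B, of s "s + h"]
  have L2: "in_L2 S u" if "regular {s..s + h} {a..b} g" "\<And>t x. t \<in> {s<..<s + h} \<Longrightarrow> x \<in> {a<..<b} - {} \<Longrightarrow> u t x = g t x" for u g :: "real \<Rightarrow> real \<Rightarrow> real"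
  proof -
    have m: "(\<lambda>z. g (fst z) (snd z)) \<in> borel_measurable borel" using that(1) by (simp add: regular_def)
    have "regular {s..s + h} {a..b} (\<lambda>t x. (g t x)\<^sup>2)" by (intro regular_power that(1))
    note r2 = this regular_integral(3)[OF this]
    have m2: "(\<lambda>z. (g (fst z) (snd z))\<^sup>2) \<in> borel_measurable borel" using r2(1) by (simp add: regular_def)
    have "set_borel_measurable lebesgue S (\<lambda>z. u (fst z) (snd z))"
      by (rule slab_lebesgue(3)[OF finite.emptyI m that(2) SS])
    moreover have "set_integrable lebesgue S (\<lambda>z. (u (fst z) (snd z))\<^sup>2)"
      using slab_lebesgue(2)[OF finite.emptyI m2 _ SS, of "\<lambda>t x. (u t x)\<^sup>2"] that(2) r2(2) by auto
    ultimately show ?thesis by (simp add: in_L2_def case_prod_unfold)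
  qed
  define wt where "wt t x = c * tpoly' k (\<lambda>i. B i x) t" for t x
  define wx where "wx t x = c * tpoly k (\<lambda>i. pwd (B i) x) t" for t x
  have parts: "inner_L2 S w (dt \<phi>) = - inner_L2 S wt \<phi> \<and> inner_L2 S w (dx \<phi>) = - inner_L2 S wx \<phi>"
    if \<phi>: "\<phi> \<in> C0_infinity (interior S)" for \<phi> :: "real \<Rightarrow> real \<Rightarrow> real"
  proof -
    obtain D where D: "smooth_family D" "D 0 0 = \<phi>" using \<phi> unfolding C0_infinity_def smooth2_iff by blast
    have "interior S \<subseteq> {s<..<s + h} \<times> {a<..<b}"
      using interior_mono[OF SS(2)] by (simp add: interior_Times)
    then have ends: "\<phi> s x = 0" "\<phi> (s + h) x = 0" for x using \<phi> unfolding C0_infinity_def by force+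
    have C: "C1_function \<phi> (D 1 0) (D 0 1)" using smooth_family_C1[OF D(1)] D(2) by simp
    have dt: "dt \<phi> t x = D 1 0 t x" and dx: "dx \<phi> t x = D 0 1 t x" for t x
      unfolding dt_def dx_def D(2)[symmetric] using smooth_family_deriv[OF D(1), of 0 0] by (auto intro: vector_derivative_at)
    note regC = C1_functionD(6,7,8)[OF C, of s "s + h" a b]
    have conv: "inner_L2 S u v = (LINT z:{s..s + h} \<times> {a..b}|lborel. g (fst z) (snd z) * v (fst z) (snd z))"
      if "regular {s..s + h} {a..b} g" "regular {s..s + h} {a..b} v" "\<And>t x. t \<in> {s<..<s + h} \<Longrightarrow> x \<in> {a<..<b} - {} \<Longrightarrow> u t x = g t x" for u v g
      unfolding inner_L2_def
    proof (rule slab_lebesgue(1)[OF finite.emptyI _ _ SS])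
      show "(\<lambda>z. g (fst z) (snd z) * v (fst z) (snd z)) \<in> borel_measurable borel"
        using regular_mult[OF that(1,2)] by (simp add: regular_def)
    qed (use that(3) in auto)
    have 0: "dt \<phi> = D 1 0" "dx \<phi> = D 0 1" using dt dx by (auto simp: fun_eq_iff)
    have rB: "regular {s..s + h} {a..b} (\<lambda>t x. c * tpoly k (\<lambda>i. B i x) t)" "regular {s..s + h} {a..b} wt" "regular {s..s + h} {a..b} wx"
      unfolding wt_def [abs_def] wx_def [abs_def] by (intro regular_mult regular_const reg)+
    note i = regular_integral(3)[OF regular_mult[OF rB(1) regC(2)]] regular_integral(3)[OF regular_mult[OF rB(2) regC(1)]]
      regular_integral(3)[OF regular_mult[OF rB(1) regC(3)]] regular_integral(3)[OF regular_mult[OF rB(3) regC(1)]]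
    have c1: "inner_L2 S w (dt \<phi>) = (LINT z:{s..s + h} \<times> {a..b}|lborel. (c * tpoly k (\<lambda>i. B i (snd z)) (fst z)) * D 1 0 (fst z) (snd z))"
      unfolding 0 by (rule conv[OF rB(1) regC(2)]) (rule wb)
    have c2: "inner_L2 S w (dx \<phi>) = (LINT z:{s..s + h} \<times> {a..b}|lborel. (c * tpoly k (\<lambda>i. B i (snd z)) (fst z)) * D 0 1 (fst z) (snd z))"
      unfolding 0 by (rule conv[OF rB(1) regC(3)]) (rule wb)
    have c3: "inner_L2 S wt \<phi> = (LINT z:{s..s + h} \<times> {a..b}|lborel. wt (fst z) (snd z) * \<phi> (fst z) (snd z))"
      by (rule conv[OF rB(2) regC(1)]) (rule refl)
    have c4: "inner_L2 S wx \<phi> = (LINT z:{s..s + h} \<times> {a..b}|lborel. wx (fst z) (snd z) * \<phi> (fst z) (snd z))"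
      by (rule conv[OF rB(3) regC(1)]) (rule refl)
    have "inner_L2 S wt \<phi> + inner_L2 S w (dt \<phi>)
      = (LINT z:{s..s + h} \<times> {a..b}|lborel. c * (tpoly' k (\<lambda>i. B i (snd z)) (fst z) * \<phi> (fst z) (snd z) + tpoly k (\<lambda>i. B i (snd z)) (fst z) * D 1 0 (fst z) (snd z)))"
      unfolding c1 c3
      by (subst set_integral_add(2)[OF i(2,1), symmetric]) (simp add: wt_def distrib_left mult.assoc)
    moreover have "inner_L2 S wx \<phi> + inner_L2 S w (dx \<phi>)
      = (LINT z:{s..s + h} \<times> {a..b}|lborel. c * (tpoly k (\<lambda>i. pwd (B i) (snd z)) (fst z) * \<phi> (fst z) (snd z) + tpoly k (\<lambda>i. B i (snd z)) (fst z) * D 0 1 (fst z) (snd z)))"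
      unfolding c2 c4
      by (subst set_integral_add(2)[OF i(4,3), symmetric]) (simp add: wx_def distrib_left mult.assoc)
    ultimately show ?thesis
      using tensor_integration_by_parts[OF B C, of s "s + h"] h_pos by (simp add: ends)
  qed
  have "in_L2 S w" by (rule L2[OF regular_mult[OF regular_const reg(1)] wb])
  moreover have "in_L2 S wt" unfolding wt_def [abs_def] by (rule L2[OF regular_mult[OF regular_const reg(2)] refl])
  moreover have "in_L2 S wx" unfolding wx_def [abs_def] by (rule L2[OF regular_mult[OF regular_const reg(3)] refl])
  ultimately show ?thesis unfolding in_H1_def using parts by blast
qed

lemma V_space_test:
  assumes B: "\<And>i. pw0 (B i)"
  shows "(\<lambda>t x. (if t \<in> slab_time h m then tpoly k (\<lambda>i. B i x) t else 0) *\<^sub>R e) \<in> V_space {a<..<b} h M \<T> k"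
  unfolding V_space_def H0_space_def
proof (intro CollectI allI conjI ballI)
  fix l :: 3 and m'
  define s where "s = (real m' - 1) * h"
  have s: "slab_time h m' = {s<..s + h}" by (simp add: slab_time_def s_def algebra_simps)
  have same: "m' = m" if "t \<in> slab_time h m" "t \<in> slab_time h m'" for t
  proof -
    have "real m - 1 < t / h" "t / h \<le> real m" "real m' - 1 < t / h" "t / h \<le> real m'"
      using that h_pos by (auto simp: slab_time_def field_simps)
    then show ?thesis by linarith
  qed
  define B' where "B' i x = (if m' = m then B i x else 0)" for i x
  have B': "pw0 (B' i)" for i using B pw0_zero by (cases "m' = m") (auto simp: B'_def [abs_def])
  have val: "((if t \<in> slab_time h m then tpoly k (\<lambda>i. B i x) t else 0) *\<^sub>R e) $ l = e $ l * tpoly k (\<lambda>i. B' i x) t"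
    if "t \<in> slab_time h m'" for t x
  proof (cases "m' = m")
    case True
    then show ?thesis using that by (simp add: B'_def)
  next
    case False
    then have "t \<notin> slab_time h m" using same[OF _ that] by blast
    then show ?thesis using False by (simp add: B'_def tpoly_def)
  qed
  show "in_H1 (slab_time h m' \<times> {a<..<b}) (\<lambda>t x. ((if t \<in> slab_time h m then tpoly k (\<lambda>i. B i x) t else 0) *\<^sub>R e) $ l)"
    by (rule tensor_in_H1[where B = B' and s = s and c = "e $ l", OF B']) (use val s in auto)
  show "((if t \<in> slab_time h m then tpoly k (\<lambda>i. B i x) t else 0) *\<^sub>R e) $ l = 0"
    if "t \<in> slab_time h m'" "x \<in> frontier {a<..<b}" for t x
  proof -
    have "x \<notin> {a<..<b}" using that(2) by (simp add: frontier_def)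
    then have "B' i x = 0" for i using pw0_outside[OF B'] by blast
    then show ?thesis unfolding val[OF that(1)] by (simp add: tpoly_def)
  qed
  fix \<tau> assume \<tau>: "\<tau> \<in> \<T>"
  have "\<forall>i. \<exists>c. \<forall>x\<in>\<tau>. B' i x = tpoly k c x" using B' \<tau> by (auto simp: pw0_def)
  then obtain c where c: "\<And>i x. x \<in> \<tau> \<Longrightarrow> B' i x = tpoly k (c i) x" by metis
  show "\<exists>c :: nat \<Rightarrow> nat \<Rightarrow> real. \<forall>t\<in>slab_time h m'. \<forall>x\<in>\<tau>.
    ((if t \<in> slab_time h m then tpoly k (\<lambda>i. B i x) t else 0) *\<^sub>R e) $ l = (\<Sum>i\<le>k. \<Sum>j\<le>k. c i j * t ^ i * x ^ j)"
  proof (intro exI[of _ "\<lambda>i j. e $ l * c i j"] ballI)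
    fix t x assume t: "t \<in> slab_time h m'" and x: "x \<in> \<tau>"
    show "((if t \<in> slab_time h m then tpoly k (\<lambda>i. B i x) t else 0) *\<^sub>R e) $ l = (\<Sum>i\<le>k. \<Sum>j\<le>k. e $ l * c i j * t ^ i * x ^ j)"
      unfolding val[OF t] c[OF x] by (simp add: tpoly_def sum_distrib_left sum_distrib_right mult_ac)
  qed
qed

end

section \<open>One step of the iteration\<close>

text \<open>
  If one of the functions is not measurable, then neither is the other one, and both integrals are
  zero.
\<close>

lemma lebesgue_integral_cong_AE:
  fixes f g :: "'a::euclidean_space \<Rightarrow> real"
  assumes eq: "AE z in lebesgue. f z = g z"
  shows "(LINT z|lebesgue. f z) = (LINT z|lebesgue. g z)" and "integrable lebesgue f \<longleftrightarrow> integrable lebesgue g"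
proof -
  have eq': "AE z in lebesgue. g z = f z" using eq by eventually_elim simp
  have m: "f \<in> borel_measurable lebesgue \<longleftrightarrow> g \<in> borel_measurable lebesgue"
    using borel_measurable_AE[OF _ eq] borel_measurable_AE[OF _ eq'] by blast
  have "(LINT z|lebesgue. f z) = (LINT z|lebesgue. g z) \<and> (integrable lebesgue f \<longleftrightarrow> integrable lebesgue g)"
  proof (cases "f \<in> borel_measurable lebesgue")
    case True
    with m show ?thesis using eq by (auto intro: integral_cong_AE integrable_cong_AE_imp integrable_cong_AE_imp[OF _ _ eq'])
  next
    case False
    then have "\<not> integrable lebesgue f" "\<not> integrable lebesgue g" using m by (auto dest: borel_measurable_integrable)
    then show ?thesis by (simp add: not_integrable_integral_eq)
  qed
  then show "(LINT z|lebesgue. f z) = (LINT z|lebesgue. g z)" "integrable lebesgue f \<longleftrightarrow> integrable lebesgue g" by auto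
qed

text \<open>Open, closed and half-open cylinders differ by null sets only.\<close>

lemma cylinder_cong:
  fixes f :: "real \<times> real \<Rightarrow> real"
  assumes "{0<..<T} \<times> {a<..<b} \<subseteq> S" "S \<subseteq> {0..T} \<times> {a..b}" "{0<..<T} \<times> {a<..<b} \<subseteq> S'" "S' \<subseteq> {0..T} \<times> {a..b}"
  shows "(LINT z:S|lebesgue. f z) = (LINT z:S'|lebesgue. f z)"
    and "set_integrable lebesgue S f \<longleftrightarrow> set_integrable lebesgue S' f"
proof -
  have "AE z in lebesgue. fst z \<notin> {0, T} \<and> snd z \<notin> {a, b}" by (rule AE_off_grid) auto
  then have *: "AE z in lebesgue. indicator S z *\<^sub>R f z = indicator S' z *\<^sub>R f z"
  proof eventually_elim
    case (elim z)
    have "z \<in> {0..T} \<times> {a..b} \<Longrightarrow> z \<in> {0<..<T} \<times> {a<..<b}" using elim by (cases z) auto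
    then have "z \<in> S \<longleftrightarrow> z \<in> S'" using assms by blast
    then show ?case by (auto simp: indicator_def)
  qed
  show "(LINT z:S|lebesgue. f z) = (LINT z:S'|lebesgue. f z)"
    unfolding set_lebesgue_integral_def by (rule lebesgue_integral_cong_AE(1)[OF *])
  show "set_integrable lebesgue S f \<longleftrightarrow> set_integrable lebesgue S' f"
    unfolding set_integrable_def by (rule lebesgue_integral_cong_AE(2)[OF *])
qed

lemma open_interval_integral:
  fixes f g :: "real \<Rightarrow> real"
  assumes f: "continuous_on {a..b} f" and eq: "\<And>x. x \<in> {a<..<b} \<Longrightarrow> g x = f x"
  shows "(LINT x:{a<..<b}|lebesgue. g x) = integral {a..b} f"
proof -
  have "(LINT x:{a<..<b}|lebesgue. g x) = (LINT x:{a<..<b}|lebesgue. f x)"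
    by (rule set_lebesgue_integral_cong) (use eq in auto)
  also have "f absolutely_integrable_on {a<..<b}"
    by (rule set_integrable_subset[OF absolutely_integrable_continuous_real[OF f]]) auto
  then have "(LINT x:{a<..<b}|lebesgue. f x) = integral {a<..<b} f" by (rule set_lebesgue_integral_eq_integral)
  finally show ?thesis by (simp add: integral_open_interval_real)
qed

text \<open>
  One step of the iteration: \<open>B\<close> is the source that is generated by the previous density, \<open>Wi\<close> and
  \<open>Wh\<close> are the exact and the discrete solution for it. The margin \<open>d\<close> separates the support \<open>Ks\<close>
  of the data from the boundary.
\<close>

locale maxwell_step = mesh +
  fixes M :: nat and T \<delta>0 d Ci :: real and Ks :: "real set"
    and B :: "real \<Rightarrow> real \<Rightarrow> real ^ 4" and W0 :: "real \<Rightarrow> real ^ 3" and Wi Wh :: "real \<Rightarrow> real \<Rightarrow> real ^ 3"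
  assumes steps: "1 \<le> M" and final_time: "real M * h = T" and \<delta>0_pos: "0 < \<delta>0"
    and margin: "0 < d" "2 * d \<le> b - a" "compact Ks" "Ks \<subseteq> {a<..<b}" "Ks \<subseteq> {a + d..b - d}"
    and Ci_ge: "1 \<le> Ci"
    and inverse_trace: "\<And>c t. (tpoly k c t)\<^sup>2 \<le> Ci / h * integral {t..t + h} (\<lambda>s. (tpoly k c s)\<^sup>2)"
    and inverse_deriv: "\<And>c t. integral {t..t + h} (\<lambda>s. (tpoly' k c s)\<^sup>2) \<le> Ci / h\<^sup>2 * integral {t..t + h} (\<lambda>s. (tpoly k c s)\<^sup>2)"
    and source_square: "\<And>e. L2_on ({0..T} \<times> {a..b}) (\<lambda>z. B (fst z) (snd z) \<bullet> e)"
    and source_zero: "\<And>t x. x \<notin> Ks \<Longrightarrow> B t x = 0"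
    and initial: "continuous_on UNIV W0" "\<And>x. x \<notin> Ks \<Longrightarrow> W0 x = 0"
    and exact: "maxwell_solution T {a<..<b} Ks B W0 Wi"
    and discrete: "sd_solution {a<..<b} h M \<T> k (\<delta>0 * h) B W0 Wh"
begin

definition coef :: "real ^ 3 \<Rightarrow> nat \<Rightarrow> nat \<Rightarrow> real \<Rightarrow> real" where
  "coef e = (SOME A. (\<forall>m i. pw0 (A m i)) \<and>
     (\<forall>m\<in>{1..M}. \<forall>t\<in>slab_time h m. \<forall>x\<in>{a..b}. Wh t x \<bullet> e = tpoly k (\<lambda>i. A m i x) t))"

lemma coef: "pw0 (coef e m i)"
  "m \<in> {1..M} \<Longrightarrow> t \<in> slab_time h m \<Longrightarrow> x \<in> {a..b} \<Longrightarrow> Wh t x \<bullet> e = tpoly k (\<lambda>i. coef e m i x) t"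
proof -
  have "Wh \<in> V_space {a<..<b} h M \<T> k" using discrete unfolding sd_solution_def by blast
  from someI_ex[OF V_space_coefficients[OF this, of e]]
  have "(\<forall>m i. pw0 (coef e m i)) \<and>
     (\<forall>m\<in>{1..M}. \<forall>t\<in>slab_time h m. \<forall>x\<in>{a..b}. Wh t x \<bullet> e = tpoly k (\<lambda>i. coef e m i x) t)"
    unfolding coef_def .
  then show "pw0 (coef e m i)"
    "m \<in> {1..M} \<Longrightarrow> t \<in> slab_time h m \<Longrightarrow> x \<in> {a..b} \<Longrightarrow> Wh t x \<bullet> e = tpoly k (\<lambda>i. coef e m i x) t" by blast+
qed

definition "begins m = (real m - 1) * h"

lemma slab_time_eq: "slab_time h m = {begins m<..begins m + h}"
  by (simp add: slab_time_def begins_def algebra_simps)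

lemma begins_range:
  assumes "m \<in> {1..M}" shows "0 \<le> begins m" "begins m + h \<le> T"
proof -
  have "real m * h \<le> real M * h" using assms h_pos by (intro mult_right_mono) auto
  then show "begins m + h \<le> T" using final_time by (simp add: begins_def algebra_simps)
  show "0 \<le> begins m" using assms h_pos by (simp add: begins_def)
qed

lemma has_vector_derivative_inner_Basis:
  fixes u :: "real \<Rightarrow> 'z::euclidean_space"
  assumes "\<And>i. i \<in> Basis \<Longrightarrow> ((\<lambda>s. u s \<bullet> i) has_real_derivative D i) (at t)"
  shows "(u has_vector_derivative (\<Sum>i\<in>Basis. D i *\<^sub>R i)) (at t)"
proof -
  have "((\<lambda>s. \<Sum>i\<in>Basis. (u s \<bullet> i) *\<^sub>R i) has_vector_derivative (\<Sum>i\<in>Basis. D i *\<^sub>R i)) (at t)"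
    by (intro has_vector_derivative_sum) (auto intro!: derivative_eq_intros assms)
  then show ?thesis by (simp add: euclidean_representation)
qed

lemma derivatives:
  assumes m: "m \<in> {1..M}" and t: "t \<in> {begins m<..<begins m + h}" and x: "x \<in> {a<..<b} - nodes"
  shows "dt Wh t x \<bullet> e = tpoly' k (\<lambda>i. coef e m i x) t" "dx Wh t x \<bullet> e = tpoly k (\<lambda>i. pwd (coef e m i) x) t"
proof -
  have tc: "((\<lambda>s. Wh s x \<bullet> e) has_real_derivative tpoly' k (\<lambda>i. coef e m i x) t) (at t)" for e
    by (rule has_field_derivative_transform_within_open[where S = "{begins m<..<begins m + h}" and f = "\<lambda>s. tpoly k (\<lambda>i. coef e m i x) s"])
       (use t x coef(2)[OF m] in \<open>auto simp: slab_time_eq intro!: tpoly_has_derivative\<close>)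
  have xc: "((\<lambda>y. Wh t y \<bullet> e) has_real_derivative tpoly k (\<lambda>i. pwd (coef e m i) x) t) (at x)" for e
    by (rule has_field_derivative_transform_within_open[where S = "{a<..<b}" and f = "\<lambda>y. tpoly k (\<lambda>i. coef e m i y) t"])
       (use t x coef(2)[OF m] in \<open>auto simp: slab_time_eq intro!: tensor_derivative_x coef(1)\<close>)
  have "((\<lambda>s. Wh s x \<bullet> e) has_vector_derivative dt Wh t x \<bullet> e) (at t)"
    unfolding dt_def by (rule bounded_linear.has_vector_derivative[OF bounded_linear_inner_left])
      (rule vector_derivative_works[THEN iffD1], rule differentiableI_vector, rule has_vector_derivative_inner_Basis, rule tc)
  then show "dt Wh t x \<bullet> e = tpoly' k (\<lambda>i. coef e m i x) t"
    using tc[of e] by (metis has_real_derivative_iff_has_vector_derivative vector_derivative_unique_at)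
  have "((\<lambda>y. Wh t y \<bullet> e) has_vector_derivative dx Wh t x \<bullet> e) (at x)"
    unfolding dx_def by (rule bounded_linear.has_vector_derivative[OF bounded_linear_inner_left])
      (rule vector_derivative_works[THEN iffD1], rule differentiableI_vector, rule has_vector_derivative_inner_Basis, rule xc)
  then show "dx Wh t x \<bullet> e = tpoly k (\<lambda>i. pwd (coef e m i) x) t"
    using xc[of e] by (metis has_real_derivative_iff_has_vector_derivative vector_derivative_unique_at)
qed

lemma Lim_inner:
  fixes u :: "real \<Rightarrow> 'z::euclidean_space"
  assumes F: "F \<noteq> bot" and lim: "\<And>e. ((\<lambda>s. u s \<bullet> e) \<longlongrightarrow> l e) F"
  shows "Lim F u \<bullet> e = l e"
proof -
  have "((\<lambda>s. \<Sum>i\<in>Basis. (u s \<bullet> i) *\<^sub>R i) \<longlongrightarrow> (\<Sum>i\<in>Basis. l i *\<^sub>R i)) F"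
    by (intro tendsto_intros lim)
  then have *: "(u \<longlongrightarrow> (\<Sum>i\<in>Basis. l i *\<^sub>R i)) F" by (simp add: euclidean_representation)
  then have "((\<lambda>s. u s \<bullet> e) \<longlongrightarrow> Lim F u \<bullet> e) F" using tendsto_Lim[OF F *] by (intro tendsto_intros) simp
  then show ?thesis using tendsto_unique[OF F _ lim] by blast
qed

text \<open>
  The value from which the component along \<open>e\<close> jumps at the beginning of slab \<open>m\<close>, which on the
  first slab is the initial value.
\<close>

definition "before e m x = (if m = 1 then W0 x \<bullet> e else tpoly k (\<lambda>i. coef e (m - 1) i x) (begins m))"

lemma tpoly_tendsto: "filterlim f (nhds t) F \<Longrightarrow> ((\<lambda>s. tpoly k c (f s)) \<longlongrightarrow> tpoly k c t) F"
  unfolding tpoly_def by (intro tendsto_intros)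

lemma traces:
  assumes m: "m \<in> {1..M}" and x: "x \<in> {a..b}"
  shows "trace_plus Wh (begins m) x \<bullet> e = tpoly k (\<lambda>i. coef e m i x) (begins m)"
    "trace_minus W0 Wh (begins m) x \<bullet> e = before e m x"
proof -
  have "((\<lambda>s. Wh s x \<bullet> e) \<longlongrightarrow> tpoly k (\<lambda>i. coef e m i x) (begins m)) (at_right (begins m))" for e
  proof (rule Lim_transform_eventually[OF tpoly_tendsto[OF tendsto_ident_at]])
    have "\<forall>\<^sub>F s in at_right (begins m). s \<in> {begins m<..<begins m + h}"
      using h_pos by (intro eventually_at_right_real) simp
    then show "\<forall>\<^sub>F s in at_right (begins m). tpoly k (\<lambda>i. coef e m i x) s = Wh s x \<bullet> e"
      by eventually_elim (use coef(2)[OF m _ x] in \<open>auto simp: slab_time_eq\<close>)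
  qed
  then show "trace_plus Wh (begins m) x \<bullet> e = tpoly k (\<lambda>i. coef e m i x) (begins m)"
    unfolding trace_plus_def by (intro Lim_inner) auto
  show "trace_minus W0 Wh (begins m) x \<bullet> e = before e m x"
  proof (cases "m = 1")
    case True
    then show ?thesis by (simp add: trace_minus_def before_def begins_def)
  next
    case False
    then have m': "m - 1 \<in> {1..M}" "begins m = begins (m - 1) + h" "begins m \<noteq> 0"
      using m h_pos by (auto simp: begins_def of_nat_diff algebra_simps)
    have "((\<lambda>s. Wh s x \<bullet> e) \<longlongrightarrow> tpoly k (\<lambda>i. coef e (m - 1) i x) (begins m)) (at_left (begins m))" for e
    proof (rule Lim_transform_eventually[OF tpoly_tendsto[OF tendsto_ident_at]])
      have "\<forall>\<^sub>F s in at_left (begins m). s \<in> {begins (m - 1)<..<begins m}"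
        using h_pos m'(2) by (intro eventually_at_left_real) simp
      then show "\<forall>\<^sub>F s in at_left (begins m). tpoly k (\<lambda>i. coef e (m - 1) i x) s = Wh s x \<bullet> e"
        by eventually_elim (use coef(2)[OF m'(1) _ x] m'(2) in \<open>auto simp: slab_time_eq\<close>)
    qed
    then have "Lim (at_left (begins m)) (\<lambda>s. Wh s x) \<bullet> e = tpoly k (\<lambda>i. coef e (m - 1) i x) (begins m)"
      by (intro Lim_inner) auto
    then show ?thesis using False m'(3) by (simp add: trace_minus_def before_def)
  qed
qed

lemma slabs_disjoint: "t \<in> slab_time h m \<Longrightarrow> t \<in> slab_time h m' \<Longrightarrow> m = m'"
proof -
  assume "t \<in> slab_time h m" "t \<in> slab_time h m'"
  then have "real m - 1 < t / h" "t / h \<le> real m" "real m' - 1 < t / h" "t / h \<le> real m'"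
    using h_pos by (auto simp: slab_time_def field_simps)
  then show ?thesis by linarith
qed

lemma slabs_cover: "(\<Union>m\<in>{1..M}. slab_time h m) = {0<..T}"
proof (intro equalityI subsetI)
  fix t assume t: "t \<in> {0<..T}"
  define m where "m = nat \<lceil>t / h\<rceil>"
  have th: "0 < t / h" "t / h \<le> real M" using t h_pos final_time by (auto simp: field_simps)
  then have c: "1 \<le> \<lceil>t / h\<rceil>" "\<lceil>t / h\<rceil> \<le> int M" by linarith+
  then have im: "int m = \<lceil>t / h\<rceil>" unfolding m_def by linarith
  with c have "1 \<le> int m" "int m \<le> int M" by linarith+
  then have m: "real m = of_int \<lceil>t / h\<rceil>" "m \<in> {1..M}" using arg_cong[OF im, of "of_int :: int \<Rightarrow> real"] by simp_all
  have "real m - 1 < t / h" "t / h \<le> real m" unfolding m(1) by linarith+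
  then have "t \<in> slab_time h m" using h_pos by (auto simp: slab_time_def field_simps)
  then show "t \<in> (\<Union>m\<in>{1..M}. slab_time h m)" using m by blast
next
  fix t assume "t \<in> (\<Union>m\<in>{1..M}. slab_time h m)"
  then obtain m where m: "m \<in> {1..M}" "t \<in> slab_time h m" by blast
  then show "t \<in> {0<..T}" using begins_range[OF m(1)] by (auto simp: slab_time_eq)
qed

lemma slab_sum:
  fixes f :: "real \<Rightarrow> real \<Rightarrow> real"
  assumes g: "\<And>m. m \<in> {1..M} \<Longrightarrow> (\<lambda>z. g m (fst z) (snd z)) \<in> borel_measurable borel"
    "\<And>m. m \<in> {1..M} \<Longrightarrow> set_integrable lborel ({begins m..begins m + h} \<times> {a..b}) (\<lambda>z. g m (fst z) (snd z))"
    and eq: "\<And>m t x. m \<in> {1..M} \<Longrightarrow> t \<in> {begins m<..<begins m + h} \<Longrightarrow> x \<in> {a<..<b} - nodes \<Longrightarrow> f t x = g m t x"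
    and S: "{0<..<T} \<times> {a<..<b} \<subseteq> S" "S \<subseteq> {0..T} \<times> {a..b}"
  shows "(LINT z:S|lebesgue. f (fst z) (snd z)) = (\<Sum>m=1..M. LINT z:{begins m..begins m + h} \<times> {a..b}|lborel. g m (fst z) (snd z))"
    and "set_integrable lebesgue S (\<lambda>z. f (fst z) (snd z))"
proof -
  let ?C = "\<lambda>m. slab_time h m \<times> {a<..<b}"
  have C: "{begins m<..<begins m + h} \<times> {a<..<b} \<subseteq> ?C m" "?C m \<subseteq> {begins m..begins m + h} \<times> {a..b}" for m
    by (auto simp: slab_time_eq)
  have un: "(\<Union>m\<in>{1..M}. ?C m) = {0<..T} \<times> {a<..<b}" using slabs_cover by blast
  have sets: "?C m \<in> sets lebesgue" for m by (simp add: slab_time_eq)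
  have S': "{0<..<T} \<times> {a<..<b} \<subseteq> {0<..T} \<times> {a<..<b}" "{0<..T} \<times> {a<..<b} \<subseteq> {0..T} \<times> {a..b}" by auto
  note one = slab_lebesgue[OF finite_nodes g(1) eq C]
  have i: "set_integrable lebesgue (?C m) (\<lambda>z. f (fst z) (snd z))" if "m \<in> {1..M}" for m
    using one(2)[OF that that] g(2)[OF that] by blast
  have "set_integrable lebesgue (\<Union>m\<in>{1..M}. ?C m) (\<lambda>z. f (fst z) (snd z))"
    by (rule set_integrable_UN) (use i sets in auto)
  then show "set_integrable lebesgue S (\<lambda>z. f (fst z) (snd z))"
    using cylinder_cong(2)[OF S S'] un by simp
  have "(LINT z:S|lebesgue. f (fst z) (snd z)) = (LINT z:(\<Union>m\<in>{1..M}. ?C m)|lebesgue. f (fst z) (snd z))"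
    unfolding un by (rule cylinder_cong(1)[OF S S'])
  also have "\<dots> = (\<Sum>m=1..M. LINT z:?C m|lebesgue. f (fst z) (snd z))"
    by (rule set_integral_finite_Union) (use i sets slabs_disjoint in \<open>auto simp: disjoint_family_on_def\<close>)
  also have "\<dots> = (\<Sum>m=1..M. LINT z:{begins m..begins m + h} \<times> {a..b}|lborel. g m (fst z) (snd z))"
    by (intro sum.cong refl one(1))
  finally show "(LINT z:S|lebesgue. f (fst z) (snd z)) = (\<Sum>m=1..M. LINT z:{begins m..begins m + h} \<times> {a..b}|lborel. g m (fst z) (snd z))" .
qed

end

section \<open>The scheme in a characteristic direction\<close>

context maxwell_step
begin

lemma residual_component:
  assumes "m \<in> {1..M}" "t \<in> {begins m<..<begins m + h}" "x \<in> {a<..<b} - nodes"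
  shows "residual1 B Wh t x \<bullet> i
    = B t x \<bullet> i - (tpoly' k (\<lambda>j. coef (i v* M1) m j x) t + tpoly k (\<lambda>j. pwd (coef (i v* M2) m j) x) t)"
proof -
  have mv: "(N *v w) \<bullet> i = w \<bullet> (i v* N)" for N :: "real ^ 3 ^ 4" and w
    by (metis dot_lmul_matrix inner_commute)
  show ?thesis
    by (simp add: residual1_def maxwell_op_def inner_diff_left inner_add_left mv derivatives[OF assms])
qed

lemma slab_in_cylinder: "m \<in> {1..M} \<Longrightarrow> {begins m..begins m + h} \<times> {a..b} \<subseteq> {0..T} \<times> {a..b}"
  using begins_range[of m] by auto

lemma source_on_slab: "m \<in> {1..M} \<Longrightarrow> L2_on ({begins m..begins m + h} \<times> {a..b}) (\<lambda>z. B (fst z) (snd z) \<bullet> i)"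
  by (rule L2_on_subset[OF source_square box_sets slab_in_cylinder])

lemma regular_L2: "regular {c..c'} {a..b} F \<Longrightarrow> L2_on ({c..c'} \<times> {a..b}) (\<lambda>z. F (fst z) (snd z))"
  using regular_integral(3)[OF regular_power] unfolding L2_on_def regular_def by blast

end

text \<open>
  In a characteristic direction the components of data and discrete solution form a scalar
  transport scheme.
\<close>

locale direction = maxwell_step +
  fixes e :: "real ^ 3" and \<sigma> \<kappa> :: real
  assumes ch: "characteristic e \<sigma> \<kappa>"

sublocale direction \<subseteq> sd_transport a b h \<T> k M \<delta>0 \<sigma> \<kappa> d Ci "coef e" "\<lambda>x. W0 x \<bullet> e"
    "\<lambda>t x. B t x \<bullet> hat e" "\<lambda>t x. B t x \<bullet> (M1 *v e)" "\<lambda>t x. B t x \<bullet> (M2 *v e)"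
proof unfold_locales
  show "continuous_on UNIV (\<lambda>x. W0 x \<bullet> e)" by (intro continuous_intros initial)
  have off: "x \<notin> Ks" if "x \<notin> {a + d..b - d}" for x using that margin(5) by blast
  show "W0 x \<bullet> e = 0" if "x \<notin> {a + d..b - d}" for x using initial(2)[OF off[OF that]] by simp
  show "B t x \<bullet> hat e = 0 \<and> B t x \<bullet> (M1 *v e) = 0 \<and> B t x \<bullet> (M2 *v e) = 0" if "x \<notin> {a + d..b - d}" for t x
    using source_zero[OF off[OF that]] by simp
  show "(\<lambda>z. B (fst z) (snd z) \<bullet> hat e) \<in> borel_measurable borel" "(\<lambda>z. B (fst z) (snd z) \<bullet> (M1 *v e)) \<in> borel_measurable borel"
    "(\<lambda>z. B (fst z) (snd z) \<bullet> (M2 *v e)) \<in> borel_measurable borel"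
    using source_square by (auto simp: L2_on_def)
  show "set_integrable lborel ({(real m - 1) * h..(real m - 1) * h + h} \<times> {a..b}) (\<lambda>z. (B (fst z) (snd z) \<bullet> hat e)\<^sup>2)"
    "set_integrable lborel ({(real m - 1) * h..(real m - 1) * h + h} \<times> {a..b}) (\<lambda>z. (B (fst z) (snd z) \<bullet> (M1 *v e))\<^sup>2)"
    "set_integrable lborel ({(real m - 1) * h..(real m - 1) * h + h} \<times> {a..b}) (\<lambda>z. (B (fst z) (snd z) \<bullet> (M2 *v e))\<^sup>2)"
    if "m \<in> {1..M}" for m
    using source_on_slab[OF that] by (auto simp: L2_on_def begins_def)
  show "(tpoly k c t)\<^sup>2 \<le> Ci / h * integral {t..t + h} (\<lambda>s. (tpoly k c s)\<^sup>2)" for c t by (rule inverse_trace)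
  show "integral {t..t + h} (\<lambda>s. (tpoly' k c s)\<^sup>2) \<le> Ci / h\<^sup>2 * integral {t..t + h} (\<lambda>s. (tpoly k c s)\<^sup>2)" for c t by (rule inverse_deriv)
qed (use steps \<delta>0_pos margin Ci_ge coef(1) ch in \<open>auto simp: characteristic_def\<close>)

context direction
begin

lemma begins_start: "begins m = start m" by (simp add: begins_def start_def)

lemma ch_inner:
  "(M1 *v w) \<bullet> hat e = w \<bullet> e" "(M2 *v w) \<bullet> hat e = \<sigma> * (w \<bullet> e)"
  "(M1 *v w) \<bullet> (M1 *v e) = w \<bullet> e" "(M2 *v w) \<bullet> (M1 *v e) = \<kappa> * (w \<bullet> e)"
  "(M1 *v w) \<bullet> (M2 *v e) = \<kappa> * (w \<bullet> e)" "(M2 *v w) \<bullet> (M2 *v e) = w \<bullet> e"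
  "e \<bullet> e \<le> 2" "hat e \<bullet> hat e \<le> 2"
  using ch unfolding characteristic_def by blast+

lemma operator_components:
  assumes "m \<in> {1..M}" "t \<in> {start m<..<start m + h}" "x \<in> {a<..<b} - nodes"
  shows "maxwell_op Wh t x \<bullet> hat e = Ut m t x + \<sigma> * Ux m t x"
    "maxwell_op Wh t x \<bullet> (M1 *v e) = Ut m t x + \<kappa> * Ux m t x"
    "maxwell_op Wh t x \<bullet> (M2 *v e) = \<kappa> * Ut m t x + Ux m t x"
  using derivatives[of m t x e] assms
  by (simp_all add: maxwell_op_def inner_add_left ch_inner Ut_def Ux_def begins_start)

lemma residual_components:
  assumes "m \<in> {1..M}" "t \<in> {start m<..<start m + h}" "x \<in> {a<..<b} - nodes"
  shows "residual1 B Wh t x \<bullet> hat e = r0 m t x" "residual1 B Wh t x \<bullet> (M1 *v e) = r1 m t x"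
    "residual1 B Wh t x \<bullet> (M2 *v e) = r2 m t x"
  using operator_components[OF assms] by (simp_all add: residual1_def inner_diff_left r0_def r1_def r2_def)

lemma trace_components:
  assumes "m \<in> {1..M}" "x \<in> {a..b}"
  shows "trace_plus Wh (start m) x \<bullet> e = U m (start m) x" "trace_minus W0 Wh (start m) x \<bullet> e = prev m x"
  using traces[OF assms, of e] by (simp_all add: U_def prev_def before_def begins_start)

text \<open>
  Testing the scheme with a scalar discrete function times \<open>e\<close>, supported in one slab. The
  definition of a characteristic direction reduces all inner products to scalar expressions.
\<close>

lemma is_galerkin: galerkin
  unfolding galerkin_def
proof (intro ballI allI impI)
  fix m and P :: "nat \<Rightarrow> real \<Rightarrow> real" assume m: "m \<in> {1..M}" and "\<forall>i. pw0 (P i)"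
  then have P: "\<And>i. pw0 (P i)" by blast
  define p where "p t x = tpoly k (\<lambda>i. P i x) t" for t x
  define pt where "pt t x = tpoly' k (\<lambda>i. P i x) t" for t x
  define px where "px t x = tpoly k (\<lambda>i. pwd (P i) x) t" for t x
  define g where "g t x = (if t \<in> slab_time h m then p t x else 0) *\<^sub>R e" for t x
  have gV: "g \<in> V_space {a<..<b} h M \<T> k" unfolding g_def p_def by (rule V_space_test[OF P])
  have st: "slab_time h m = {start m<..start m + h}" by (simp add: slab_time_eq begins_start)
  have start: "(real m - 1) * h = start m" by (simp add: start_def)
  let ?t = "\<lambda>t x. hat (g t x) + (\<delta>0 * h) *\<^sub>R maxwell_op g t x"
  have eq: "inner_L2 (slab_time h m \<times> {a<..<b}) (maxwell_op Wh) ?t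
        + (LINT x:{a<..<b}|lebesgue. trace_plus Wh (start m) x \<bullet> trace_plus g (start m) x)
      = inner_L2 (slab_time h m \<times> {a<..<b}) B ?t
        + (LINT x:{a<..<b}|lebesgue. trace_minus W0 Wh (start m) x \<bullet> trace_plus g (start m) x)"
    using discrete[unfolded sd_solution_def, THEN conjunct2, rule_format, OF m gV] by (simp only: start)
  have test: "?t t x = p t x *\<^sub>R hat e + (\<delta>0 * h) *\<^sub>R (pt t x *\<^sub>R (M1 *v e) + px t x *\<^sub>R (M2 *v e))"
    if t: "t \<in> {start m<..<start m + h}" and x: "x \<in> {a<..<b} - nodes" for t x
  proof -
    have "((\<lambda>s. p s x *\<^sub>R e) has_vector_derivative pt t x *\<^sub>R e) (at t)"
      unfolding p_def pt_def by (auto intro!: derivative_eq_intros tpoly_has_derivative)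
    then have "((\<lambda>s. g s x) has_vector_derivative pt t x *\<^sub>R e) (at t)"
      by (rule has_vector_derivative_transform_within_open[OF _ open_greaterThanLessThan t]) (auto simp: g_def st)
    then have 1: "dt g t x = pt t x *\<^sub>R e" unfolding dt_def by (rule vector_derivative_at)
    have "((\<lambda>y. p t y *\<^sub>R e) has_vector_derivative px t x *\<^sub>R e) (at x)"
      unfolding p_def px_def using tensor_derivative_x[where B = P and x = x and t = t, OF P] x by (auto intro!: derivative_eq_intros)
    then have "((\<lambda>y. g t y) has_vector_derivative px t x *\<^sub>R e) (at x)"
      using t by (simp add: g_def st)
    then have 2: "dx g t x = px t x *\<^sub>R e" unfolding dx_def by (rule vector_derivative_at)
    have "g t x = p t x *\<^sub>R e" using t by (simp add: g_def st)
    moreover have "hat (c *\<^sub>R e) = c *\<^sub>R hat e" for c by (simp add: hat_def vec_eq_iff forall_4 vector_4_nth)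
    ultimately show ?thesis by (simp add: maxwell_op_def 1 2 matrix_vector_mult_scaleR)
  qed
  note reg = regular_tensor[where B = P and c = "start m" and d = "start m + h", OF P, folded p_def pt_def px_def]
  note P2 = sq_regular[OF reg(1)] sq_regular[OF reg(2)] sq_regular[OF reg(3)]
  define G1 where "G1 t x = (Ut m t x + \<sigma> * Ux m t x) * p t x
      + \<delta>0 * h * ((Ut m t x + \<kappa> * Ux m t x) * pt t x + (\<kappa> * Ut m t x + Ux m t x) * px t x)" for t x
  define G2 where "G2 t x = (B t x \<bullet> hat e) * p t x
      + \<delta>0 * h * ((B t x \<bullet> (M1 *v e)) * pt t x + (B t x \<bullet> (M2 *v e)) * px t x)" for t x
  have sB: "sq m (\<lambda>t x. B t x \<bullet> i)" for i
    using source_on_slab[OF m, of i] by (simp add: sq_def L2_on_def begins_start)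
  have "regular (slab m) {a..b} G1"
    unfolding G1_def [abs_def] by (intro regular_add regular_mult regular_const regular_U reg)
  then have iG1: "set_integrable lborel (slab m \<times> {a..b}) (\<lambda>z. G1 (fst z) (snd z))" "(\<lambda>z. G1 (fst z) (snd z)) \<in> borel_measurable borel"
    using regular_integral(3) by (auto simp: regular_def)
  have iG2: "set_integrable lborel (slab m \<times> {a..b}) (\<lambda>z. G2 (fst z) (snd z))"
    unfolding G2_def by (intro set_integral_add set_integrable_mult_right sq_mult_integrable sB P2)
  have mG2: "(\<lambda>z. G2 (fst z) (snd z)) \<in> borel_measurable borel"
    using P2[unfolded sq_def, THEN conjunct1] sB[unfolded sq_def, THEN conjunct1] unfolding G2_def
    by (intro borel_measurable_add borel_measurable_times borel_measurable_const)
  have cyl: "{start m<..<start m + h} \<times> {a<..<b} \<subseteq> slab_time h m \<times> {a<..<b}" "slab_time h m \<times> {a<..<b} \<subseteq> slab m \<times> {a..b}"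
    by (auto simp: st)
  have I1: "inner_L2 (slab_time h m \<times> {a<..<b}) (maxwell_op Wh) ?t = SI m G1"
    unfolding inner_L2_def SI_def
  proof (rule slab_lebesgue(1)[OF finite_nodes iG1(2) _ cyl])
    fix t x assume tx: "t \<in> {start m<..<start m + h}" "x \<in> {a<..<b} - nodes"
    show "maxwell_op Wh t x \<bullet> ?t t x = G1 t x"
      unfolding test[OF tx] inner_add_right inner_scaleR_right operator_components[OF m tx] G1_def by (simp add: mult.commute)
  qed
  have I2: "inner_L2 (slab_time h m \<times> {a<..<b}) B ?t = SI m G2"
    unfolding inner_L2_def SI_def
  proof (rule slab_lebesgue(1)[OF finite_nodes mG2 _ cyl])
    fix t x assume tx: "t \<in> {start m<..<start m + h}" "x \<in> {a<..<b} - nodes"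
    show "B t x \<bullet> ?t t x = G2 t x"
      unfolding test[OF tx] inner_add_right inner_scaleR_right G2_def by (simp add: mult.commute)
  qed
  have tg: "trace_plus g (start m) x = p (start m) x *\<^sub>R e" for x
    unfolding trace_plus_def
  proof (rule tendsto_Lim)
    show "((\<lambda>s. g s x) \<longlongrightarrow> p (start m) x *\<^sub>R e) (at_right (start m))"
    proof (rule Lim_transform_eventually)
      show "((\<lambda>s. p s x *\<^sub>R e) \<longlongrightarrow> p (start m) x *\<^sub>R e) (at_right (start m))"
        unfolding p_def by (intro tendsto_intros tpoly_tendsto)
      have "\<forall>\<^sub>F s in at_right (start m). s \<in> {start m<..<start m + h}"
        using h_pos by (intro eventually_at_right_real) simp
      then show "\<forall>\<^sub>F s in at_right (start m). p s x *\<^sub>R e = g s x" by eventually_elim (simp add: g_def st)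
    qed
  qed simp
  have cp: "continuous_on S (\<lambda>x. p (start m) x)" for S
    unfolding p_def tpoly_def by (intro continuous_intros continuous_on_subset[OF pw0_continuous[OF P]]) auto
  have cprev: "continuous_on S (prev m)" for S
    unfolding prev_def using w0(1) by (cases "m = 1") (auto intro: U_continuous continuous_on_subset)
  have T1: "(LINT x:{a<..<b}|lebesgue. trace_plus Wh (start m) x \<bullet> trace_plus g (start m) x) = integral {a..b} (\<lambda>x. U m (start m) x * p (start m) x)"
    by (rule open_interval_integral) (auto simp: tg trace_components[OF m] intro!: continuous_intros U_continuous cp)
  have T2: "(LINT x:{a<..<b}|lebesgue. trace_minus W0 Wh (start m) x \<bullet> trace_plus g (start m) x) = integral {a..b} (\<lambda>x. prev m x * p (start m) x)"
    by (rule open_interval_integral) (auto simp: tg trace_components[OF m] intro!: continuous_intros cprev cp)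
  have "SI m G2 - SI m G1 = SI m (\<lambda>t x. G2 t x - G1 t x)"
    unfolding SI_def by (rule set_integral_diff(2)[OF iG2 iG1(1), symmetric])
  also have "(\<lambda>t x. G2 t x - G1 t x) = (\<lambda>t x. r0 m t x * p t x + \<delta>0 * h * (r1 m t x * pt t x + r2 m t x * px t x))"
    by (simp add: G1_def G2_def r0_def r1_def r2_def fun_eq_iff algebra_simps)
  finally have "SI m (\<lambda>t x. r0 m t x * p t x + \<delta>0 * h * (r1 m t x * pt t x + r2 m t x * px t x)) = SI m G2 - SI m G1" by simp
  also have "\<dots> = integral {a..b} (\<lambda>x. U m (start m) x * p (start m) x) - integral {a..b} (\<lambda>x. prev m x * p (start m) x)"
    using eq unfolding I1 I2 T1 T2 by linarith
  also have "\<dots> = integral {a..b} (\<lambda>x. U m (start m) x * p (start m) x - prev m x * p (start m) x)"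
    by (rule integral_diff[symmetric]; intro integrable_continuous_real continuous_intros U_continuous cprev cp)
  finally show "SI m (\<lambda>t x. r0 m t x * tpoly k (\<lambda>i. P i x) t
        + \<delta>0 * h * (r1 m t x * tpoly' k (\<lambda>i. P i x) t + r2 m t x * tpoly k (\<lambda>i. pwd (P i) x) t))
      = integral {a..b} (\<lambda>x. jump m x * tpoly k (\<lambda>i. P i x) (start m))"
    by (simp add: p_def pt_def px_def jump_def left_diff_distrib)
qed

end

section \<open>Comparing residual norms and pairing with test functions\<close>

text \<open>
  The compact support leaves room before the final time, uniformly in space, and the derivatives
  vanish off the support as well.
\<close>

lemma test_family:
  fixes \<phi> :: "real \<Rightarrow> real \<Rightarrow> 'a::euclidean_space"
  assumes \<phi>: "\<phi> \<in> C0_infinity ({0<..<T} \<times> {a<..<b})"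
  obtains D T1 where "smooth_family D" "D 0 0 = \<phi>" "T1 < T"
    "\<And>i j t x. D i j t x \<noteq> 0 \<Longrightarrow> 0 < t \<and> t < T1 \<and> a < x \<and> x < b"
proof -
  obtain D where D: "smooth_family D" "D 0 0 = \<phi>" using \<phi> unfolding C0_infinity_def smooth2_iff by blast
  obtain A where A: "compact A" "A \<subseteq> {0<..<T} \<times> {a<..<b}" "\<And>t x. (t, x) \<notin> A \<Longrightarrow> \<phi> t x = 0"
    using \<phi> unfolding C0_infinity_def by blast
  have "\<exists>T1<T. \<forall>z\<in>A. fst z < T1"
  proof (cases "A = {}")
    case True
    then show ?thesis by (intro exI[of _ "T - 1"]) auto
  next
    case False
    have "compact (fst ` A)" by (intro compact_continuous_image A(1) continuous_intros)
    from compact_attains_sup[OF this] False obtain u where u: "u \<in> fst ` A" "\<And>t. t \<in> fst ` A \<Longrightarrow> t \<le> u" by auto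
    have "u < T" using u(1) A(2) by auto
    moreover have "fst z < (u + T) / 2" if "z \<in> A" for z using u(2)[OF imageI[OF that]] \<open>u < T\<close> by simp
    ultimately show ?thesis by (intro exI[of _ "(u + T) / 2"]) auto
  qed
  then obtain T1 where T1: "T1 < T" "\<And>z. z \<in> A \<Longrightarrow> fst z < T1" by blast
  have "(t, x) \<in> A" if "D i j t x \<noteq> 0" for i j t x
  proof (rule ccontr)
    assume "(t, x) \<notin> A"
    then have "D i j t x \<bullet> e = 0" for e
      using smooth_family_support[OF smooth_family_inner[OF D(1)] compact_imp_closed[OF A(1)], of e t x i j] A(3) D(2) by simp
    then show False using that by (metis inner_eq_zero_iff)
  qed
  then have "0 < t \<and> t < T1 \<and> a < x \<and> x < b" if "D i j t x \<noteq> 0" for i j t x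
    using that A(2) T1(2)[of "(t, x)"] by fastforce
  then show ?thesis using that[OF D T1(1)] by blast
qed

context maxwell_step
begin

abbreviation "cyl \<equiv> {0..T} \<times> {a<..<b}"
abbreviation "cyl_int \<equiv> {0<..<T} \<times> {a<..<b}"
abbreviation "R1 \<equiv> residual1 B Wh"
abbreviation "R2 \<equiv> residual2 h W0 Wh"

lemma T_pos: "0 < T" using final_time h_pos steps by (metis less_le_trans mult_pos_pos of_nat_0_less_iff zero_less_one)

lemma cyl_sets:
  "{0<..<T} \<times> {a<..<b} \<subseteq> {0<..<T} \<times> {a<..<b}" "{0<..<T} \<times> {a<..<b} \<subseteq> {0..T} \<times> {a..b}"
  "{0<..<T} \<times> {a<..<b} \<subseteq> cyl" "cyl \<subseteq> {0..T} \<times> {a..b}" "{0<..<T} \<times> {a<..<b} \<subseteq> {0..T} \<times> {a..b}"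
  by auto

lemma residual1_integrable: "set_integrable lebesgue cyl (\<lambda>z. R1 (fst z) (snd z) \<bullet> R1 (fst z) (snd z))"
proof -
  define g where "g m t x = (\<Sum>i\<in>Basis. (B t x \<bullet> i - (tpoly' k (\<lambda>j. coef (i v* M1) m j x) t + tpoly k (\<lambda>j. pwd (coef (i v* M2) m j) x) t))\<^sup>2)" for m t x
  have L2: "L2_on ({begins m..begins m + h} \<times> {a..b}) (\<lambda>z. B (fst z) (snd z) \<bullet> i - (tpoly' k (\<lambda>j. coef (i v* M1) m j (snd z)) (fst z) + tpoly k (\<lambda>j. pwd (coef (i v* M2) m j) (snd z)) (fst z)))"
    if "m \<in> {1..M}" for m i
    by (intro L2_on_diff box_sets source_on_slab that regular_L2[where F = "\<lambda>t x. tpoly' k (\<lambda>j. coef (i v* M1) m j x) t + tpoly k (\<lambda>j. pwd (coef (i v* M2) m j) x) t"]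
        regular_add regular_tensor coef(1))
  show ?thesis
  proof (rule slab_sum(2)[where g = g, OF _ _ _ cyl_sets(3,4)])
    fix m assume m: "m \<in> {1..M}"
    show "(\<lambda>z. g m (fst z) (snd z)) \<in> borel_measurable borel"
      unfolding g_def using L2[OF m] by (intro borel_measurable_sum borel_measurable_power) (auto simp: L2_on_def)
    show "set_integrable lborel ({begins m..begins m + h} \<times> {a..b}) (\<lambda>z. g m (fst z) (snd z))"
      unfolding g_def using L2[OF m] unfolding L2_on_def set_integrable_def scaleR_sum_right
      by (intro Bochner_Integration.integrable_sum) blast
    fix t x assume "t \<in> {begins m<..<begins m + h}" "x \<in> {a<..<b} - nodes"
    then show "R1 t x \<bullet> R1 t x = g m t x"
      unfolding g_def euclidean_inner[of "R1 t x" "R1 t x"]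
      by (intro sum.cong refl) (simp add: residual_component[OF m] power2_eq_square)
  qed
qed

lemma residual2_slab:
  assumes "m \<in> {1..M}" "t \<in> {begins m<..<begins m + h}"
  shows "h *\<^sub>R R2 t x = trace_plus Wh (begins m) x - trace_minus W0 Wh (begins m) x"
proof -
  have "real m - 1 < t / h" "t / h \<le> real m" using assms h_pos by (auto simp: begins_def field_simps)
  then have "\<lceil>t / h\<rceil> = int m" by (intro ceiling_unique) auto
  then show ?thesis using h_pos by (simp add: residual2_def Let_def begins_def)
qed

lemma before_continuous: "continuous_on S (before e m)"
proof (cases "m = 1")
  case True
  then show ?thesis unfolding before_def using continuous_on_subset[OF initial(1)] by (auto intro!: continuous_intros)
next
  case False
  then show ?thesis unfolding before_def tpoly_def
    by (auto intro!: continuous_intros continuous_on_subset[OF pw0_continuous[OF coef(1)]])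
qed

definition "step_jump e m x = tpoly k (\<lambda>i. coef e m i x) (begins m) - before e m x"

lemma step_jump_continuous: "continuous_on S (step_jump e m)"
  unfolding step_jump_def tpoly_def
  by (intro continuous_intros before_continuous continuous_on_subset[OF pw0_continuous[OF coef(1)]]) auto

lemma residual2_component:
  assumes "m \<in> {1..M}" "t \<in> {begins m<..<begins m + h}" "x \<in> {a<..<b} - nodes"
  shows "(h *\<^sub>R R2 t x) \<bullet> e = step_jump e m x"
  using assms by (simp add: residual2_slab[OF assms(1,2)] inner_diff_left traces step_jump_def del: inner_scaleR_left)

lemma residual2_integrable: "set_integrable lebesgue cyl (\<lambda>z. (h *\<^sub>R R2 (fst z) (snd z)) \<bullet> (h *\<^sub>R R2 (fst z) (snd z)))"
proof -
  have reg: "regular I {a..b} (\<lambda>t x. \<Sum>i\<in>Basis. (step_jump i m x)\<^sup>2)" for I m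
    by (rule regular_continuous_space) (intro continuous_intros step_jump_continuous)
  show ?thesis
  proof (rule slab_sum(2)[where g = "\<lambda>m t x. \<Sum>i\<in>Basis. (step_jump i m x)\<^sup>2", OF _ _ _ cyl_sets(3,4)])
    fix m assume m: "m \<in> {1..M}"
    show "set_integrable lborel ({begins m..begins m + h} \<times> {a..b}) (\<lambda>z. \<Sum>i\<in>Basis. (step_jump i m (snd z))\<^sup>2)"
      using regular_integral(3)[OF reg] by blast
    show "(\<lambda>z::real \<times> real. \<Sum>i\<in>Basis. (step_jump i m (snd z))\<^sup>2) \<in> borel_measurable borel"
      using reg[of UNIV m] by (simp add: regular_def)
    fix t x assume tx: "t \<in> {begins m<..<begins m + h}" "x \<in> {a<..<b} - nodes"
    show "(h *\<^sub>R R2 t x) \<bullet> (h *\<^sub>R R2 t x) = (\<Sum>i\<in>Basis. (step_jump i m x)\<^sup>2)"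
      unfolding euclidean_inner[of "h *\<^sub>R R2 t x" "h *\<^sub>R R2 t x"]
      by (simp only: residual2_component[OF m tx] power2_eq_square)
  qed
qed

lemma continuous_square_sum:
  fixes F :: "real \<Rightarrow> real \<Rightarrow> real"
  assumes F: "continuous_on UNIV (\<lambda>z. F (fst z) (snd z))"
  shows "(\<Sum>m=1..M. LINT z:{begins m..begins m + h} \<times> {a..b}|lborel. (F (fst z) (snd z))\<^sup>2) = (LINT z:{0..T} \<times> {a..b}|lborel. (F (fst z) (snd z))\<^sup>2)"
proof -
  have reg: "regular {c..c'} {a..b} (\<lambda>t x. (F t x)\<^sup>2)" for c c' by (intro regular_power regular_continuous F)
  have m: "(\<lambda>z. (F (fst z) (snd z))\<^sup>2) \<in> borel_measurable borel" using reg by (simp add: regular_def)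
  have "(LINT z:{0..T} \<times> {a..b}|lebesgue. (F (fst z) (snd z))\<^sup>2) = (\<Sum>m=1..M. LINT z:{begins m..begins m + h} \<times> {a..b}|lborel. (F (fst z) (snd z))\<^sup>2)"
    by (rule slab_sum(1)) (use m regular_integral(3)[OF reg] in auto)
  moreover have "(LINT z:{0..T} \<times> {a..b}|lebesgue. (F (fst z) (snd z))\<^sup>2) = (LINT z:{0..T} \<times> {a..b}|lborel. (F (fst z) (snd z))\<^sup>2)"
    by (rule slab_lebesgue(1)[where N = "{}" and g = "\<lambda>t x. (F t x)\<^sup>2"]) (use m in auto)
  ultimately show ?thesis by simp
qed

lemma component_square_le:
  fixes u :: "real \<Rightarrow> real \<Rightarrow> 'z::euclidean_space"
  assumes u: "continuous_on UNIV (\<lambda>z. u (fst z) (snd z))" and e: "e \<bullet> e \<le> 2"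
  shows "(LINT z:{0..T} \<times> {a..b}|lborel. (u (fst z) (snd z) \<bullet> e)\<^sup>2) \<le> 2 * inner_L2 cyl_int u u"
proof -
  have reg: "regular {0..T} {a..b} (\<lambda>t x. u t x \<bullet> u t x)" by (intro regular_continuous continuous_intros u)
  have i: "set_integrable lborel ({0..T} \<times> {a..b}) (\<lambda>z. u (fst z) (snd z) \<bullet> u (fst z) (snd z))"
    by (rule regular_integral(3)[OF reg])
  have i': "set_integrable lborel ({0..T} \<times> {a..b}) (\<lambda>z. (u (fst z) (snd z) \<bullet> e)\<^sup>2)"
    by (rule continuous_on_imp_integrable_lborel) (auto intro!: continuous_intros compact_Times continuous_on_subset[OF u])
  have "(u t x \<bullet> e)\<^sup>2 \<le> 2 * (u t x \<bullet> u t x)" for t x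
  proof -
    have "(u t x \<bullet> e)\<^sup>2 \<le> (u t x \<bullet> u t x) * (e \<bullet> e)" by (rule Cauchy_Schwarz_ineq)
    also have "\<dots> \<le> (u t x \<bullet> u t x) * 2" by (intro mult_left_mono e) auto
    finally show ?thesis by simp
  qed
  then have "(LINT z:{0..T} \<times> {a..b}|lborel. (u (fst z) (snd z) \<bullet> e)\<^sup>2) \<le> (LINT z:{0..T} \<times> {a..b}|lborel. 2 * (u (fst z) (snd z) \<bullet> u (fst z) (snd z)))"
    by (intro set_integral_mono i' set_integrable_mult_right i)
  also have "\<dots> = 2 * (LINT z:{0..T} \<times> {a..b}|lborel. u (fst z) (snd z) \<bullet> u (fst z) (snd z))" by simp
  also have "(LINT z:{0..T} \<times> {a..b}|lborel. u (fst z) (snd z) \<bullet> u (fst z) (snd z)) = inner_L2 cyl_int u u"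
    unfolding inner_L2_def
    by (rule slab_lebesgue(1)[where N = "{}" and g = "\<lambda>t x. u t x \<bullet> u t x", symmetric]) (use reg in \<open>auto simp: regular_def\<close>)
  finally show ?thesis .
qed

end

lemma norm_L2_square: "(norm_L2 S u)\<^sup>2 = inner_L2 S u u"
proof -
  have "0 \<le> inner_L2 S u u"
    unfolding inner_L2_def set_lebesgue_integral_def by (intro Bochner_Integration.integral_nonneg) auto
  then show ?thesis by (simp add: norm_L2_def)
qed

lemma norm_L2_nonneg: "0 \<le> norm_L2 S u"
proof -
  have "0 \<le> inner_L2 S u u" unfolding norm_L2_square[symmetric] by simp
  then show ?thesis by (simp add: norm_L2_def)
qed

lemma norm_H1_square: "(norm_H1 S u)\<^sup>2 = inner_L2 S u u + inner_L2 S (dt u) (dt u) + inner_L2 S (dx u) (dx u)"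
  unfolding norm_H1_def by (simp add: norm_L2_square[symmetric])

context direction
begin

text \<open>
  The scalar residuals are inner products of the vector residual with three vectors whose squared
  lengths are at most two.
\<close>

lemma residual_sum_le: "h\<^sup>2 * (\<Sum>m=1..M. residual m) \<le> 6 * (norm_L2 cyl (\<lambda>t x. h *\<^sub>R R1 t x))\<^sup>2"
proof -
  define f where "f t x = (R1 t x \<bullet> hat e)\<^sup>2 + (R1 t x \<bullet> (M1 *v e))\<^sup>2 + (R1 t x \<bullet> (M2 *v e))\<^sup>2" for t x
  have m: "(\<lambda>z. (r0 m (fst z) (snd z))\<^sup>2 + (r1 m (fst z) (snd z))\<^sup>2 + (r2 m (fst z) (snd z))\<^sup>2) \<in> borel_measurable borel"
    "set_integrable lborel ({begins m..begins m + h} \<times> {a..b}) (\<lambda>z. (r0 m (fst z) (snd z))\<^sup>2 + (r1 m (fst z) (snd z))\<^sup>2 + (r2 m (fst z) (snd z))\<^sup>2)"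
    if "m \<in> {1..M}" for m
  proof -
    note r = sq_r[OF that]
    show "(\<lambda>z. (r0 m (fst z) (snd z))\<^sup>2 + (r1 m (fst z) (snd z))\<^sup>2 + (r2 m (fst z) (snd z))\<^sup>2) \<in> borel_measurable borel"
      using r unfolding sq_def by (intro borel_measurable_add borel_measurable_power) blast+
    show "set_integrable lborel ({begins m..begins m + h} \<times> {a..b}) (\<lambda>z. (r0 m (fst z) (snd z))\<^sup>2 + (r1 m (fst z) (snd z))\<^sup>2 + (r2 m (fst z) (snd z))\<^sup>2)"
      unfolding begins_start by (intro set_integral_add(1) sq_power_integrable r)
  qed
  have eq: "f t x = (r0 m t x)\<^sup>2 + (r1 m t x)\<^sup>2 + (r2 m t x)\<^sup>2"
    if "m \<in> {1..M}" "t \<in> {begins m<..<begins m + h}" "x \<in> {a<..<b} - nodes" for m t x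
    using that by (simp add: f_def residual_components begins_start)
  note slab = slab_sum[where f = f and g = "\<lambda>m t x. (r0 m t x)\<^sup>2 + (r1 m t x)\<^sup>2 + (r2 m t x)\<^sup>2", OF m eq cyl_sets(3,4)]
  have sum: "(LINT z:cyl|lebesgue. f (fst z) (snd z)) = (\<Sum>m=1..M. residual m)"
    using slab(1) by (simp add: residual_def SI_def begins_start)
  have "f t x \<le> 6 * (R1 t x \<bullet> R1 t x)" for t x
  proof -
    have le: "(R1 t x \<bullet> v)\<^sup>2 \<le> 2 * (R1 t x \<bullet> R1 t x)" if "v \<bullet> v \<le> 2" for v
    proof -
      have "(R1 t x \<bullet> v)\<^sup>2 \<le> (R1 t x \<bullet> R1 t x) * (v \<bullet> v)" by (rule Cauchy_Schwarz_ineq)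
      also have "\<dots> \<le> (R1 t x \<bullet> R1 t x) * 2" by (intro mult_left_mono that) auto
      finally show ?thesis by simp
    qed
    show ?thesis using le[of "hat e"] le[of "M1 *v e"] le[of "M2 *v e"] ch_inner(3,6)[of e] ch_inner(7,8) by (simp add: f_def)
  qed
  then have "(LINT z:cyl|lebesgue. f (fst z) (snd z)) \<le> (LINT z:cyl|lebesgue. 6 * (R1 (fst z) (snd z) \<bullet> R1 (fst z) (snd z)))"
    by (intro set_integral_mono slab(2) set_integrable_mult_right residual1_integrable)
  then have "(\<Sum>m=1..M. residual m) \<le> 6 * (LINT z:cyl|lebesgue. R1 (fst z) (snd z) \<bullet> R1 (fst z) (snd z))"
    unfolding sum by simp
  then have "h\<^sup>2 * (\<Sum>m=1..M. residual m) \<le> h\<^sup>2 * (6 * (LINT z:cyl|lebesgue. R1 (fst z) (snd z) \<bullet> R1 (fst z) (snd z)))"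
    by (rule mult_left_mono) simp
  also have "\<dots> = 6 * (norm_L2 cyl (\<lambda>t x. h *\<^sub>R R1 t x))\<^sup>2"
    unfolding norm_L2_square inner_L2_def by (simp add: power2_eq_square mult.assoc)
  finally show ?thesis .
qed

lemma jump_eq: "jump m x = step_jump e m x"
  by (simp add: jump_def step_jump_def prev_def before_def U_def begins_start)

lemma jump_sum_le: "h * (\<Sum>m=1..M. jump_sq m) \<le> 2 * (norm_L2 cyl (\<lambda>t x. h *\<^sub>R R2 t x))\<^sup>2"
proof -
  define f where "f t x = ((h *\<^sub>R R2 t x) \<bullet> e)\<^sup>2" for t x
  have reg: "regular I {a..b} (\<lambda>t x. (jump m x)\<^sup>2)" for I m
    by (rule regular_continuous_space) (intro continuous_intros jump_continuous)
  have m: "(\<lambda>z::real \<times> real. (jump m (snd z))\<^sup>2) \<in> borel_measurable borel"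
    "set_integrable lborel ({begins m..begins m + h} \<times> {a..b}) (\<lambda>z. (jump m (snd z))\<^sup>2)" for m
    using reg[of UNIV m] regular_integral(3)[OF reg] by (auto simp: regular_def)
  have eq: "f t x = (jump m x)\<^sup>2"
    if "m \<in> {1..M}" "t \<in> {begins m<..<begins m + h}" "x \<in> {a<..<b} - nodes" for m t x
    unfolding f_def residual2_component[OF that] jump_eq ..
  note slab = slab_sum[where f = f and g = "\<lambda>m t x. (jump m x)\<^sup>2", OF m eq cyl_sets(3,4)]
  have "(LINT z:{begins m..begins m + h} \<times> {a..b}|lborel. (jump m (snd z))\<^sup>2) = h * jump_sq m" for m
    using SI_space[OF reg, of m m] by (simp add: SI_def begins_start jump_sq_def)
  then have sum: "(LINT z:cyl|lebesgue. f (fst z) (snd z)) = h * (\<Sum>m=1..M. jump_sq m)"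
    using slab(1) by (simp add: sum_distrib_left)
  have "f t x \<le> 2 * ((h *\<^sub>R R2 t x) \<bullet> (h *\<^sub>R R2 t x))" for t x
  proof -
    have "f t x \<le> ((h *\<^sub>R R2 t x) \<bullet> (h *\<^sub>R R2 t x)) * (e \<bullet> e)" unfolding f_def by (rule Cauchy_Schwarz_ineq)
    also have "\<dots> \<le> ((h *\<^sub>R R2 t x) \<bullet> (h *\<^sub>R R2 t x)) * 2" by (rule mult_left_mono[OF ch_inner(7) inner_ge_zero])
    finally show ?thesis by simp
  qed
  then have "(LINT z:cyl|lebesgue. f (fst z) (snd z)) \<le> (LINT z:cyl|lebesgue. 2 * ((h *\<^sub>R R2 (fst z) (snd z)) \<bullet> (h *\<^sub>R R2 (fst z) (snd z))))"
    by (intro set_integral_mono slab(2) set_integrable_mult_right residual2_integrable)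
  then show ?thesis unfolding sum norm_L2_square inner_L2_def by (simp only: set_integral_mult_right)
qed

text \<open>
  The error is paired with the right-hand side of the dual equation. On the side of the exact
  solution this gives source and initial value paired with \<open>\<psi>\<close>; on the side of the discrete
  solution the initial value appears as well and cancels.
\<close>

lemma error_identity:
  fixes D :: "nat \<Rightarrow> nat \<Rightarrow> real \<Rightarrow> real \<Rightarrow> real"
  assumes D: "smooth_family D" and T1: "T1 < T" and supp: "\<And>i j t x. D i j t x \<noteq> 0 \<Longrightarrow> 0 < t \<and> t < T1 \<and> a < x \<and> x < b"
  shows "set_integrable lebesgue cyl_int (\<lambda>z. ((Wi (fst z) (snd z) - Wh (fst z) (snd z)) \<bullet> e) * D 0 0 (fst z) (snd z))"
    and "(LINT z:cyl_int|lebesgue. ((Wi (fst z) (snd z) - Wh (fst z) (snd z)) \<bullet> e) * D 0 0 (fst z) (snd z)) = (\<Sum>m=1..M. err m (along T \<sigma> (D 0 0)))"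
proof -
  define \<psi> where "\<psi> i j = along T \<sigma> (D i j)" for i j
  have \<psi>: "smooth_family \<psi>" unfolding \<psi>_def [abs_def] by (rule smooth_family_along[OF D])
  note C = smooth_family_C1[OF \<psi>]
  have hi: "\<psi> 0 0 t x = 0" if "T1 \<le> t" for t x
  proof -
    have "D 0 0 (t + r) (x + \<sigma> * r) = 0" if "r \<in> {0..T}" for r using supp[of 0 0 "t + r" "x + \<sigma> * r"] that \<open>T1 \<le> t\<close> by force
    then show ?thesis unfolding \<psi>_def along_def by (metis (no_types, lifting) integral_cong integral_0)
  qed
  have lo: "\<psi> 0 0 t x = 0" if "t \<le> - T" for t x
  proof -
    have "D 0 0 (t + r) (x + \<sigma> * r) = 0" if "r \<in> {0..T}" for r using supp[of 0 0 "t + r" "x + \<sigma> * r"] that \<open>t \<le> - T\<close> by force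
    then show ?thesis unfolding \<psi>_def along_def by (metis (no_types, lifting) integral_cong integral_0)
  qed
  have transport: "\<psi> 1 0 t x + \<sigma> * \<psi> 0 1 t x = - D 0 0 t x" if "0 \<le> t" for t x
  proof -
    have "D 0 0 (t + T) (x + \<sigma> * T) = 0" using supp[of 0 0 "t + T" "x + \<sigma> * T"] that T1 by force
    then show ?thesis unfolding \<psi>_def using along_transport[OF D less_imp_le[OF T_pos], of \<sigma> t x] by simp
  qed
  have cD: "continuous_on UNIV (\<lambda>z. D 0 0 (fst z) (snd z))" by (intro smooth_family_continuous[OF D] continuous_intros)
  have cyl_leb: "cyl \<in> sets lebesgue" "bounded cyl" by (auto intro: bounded_Times)
  have Wi2: "in_L2 cyl Wi" using exact unfolding maxwell_solution_def by blast
  have iWi: "set_integrable lebesgue cyl_int (\<lambda>z. (Wi (fst z) (snd z) \<bullet> e) * D 0 0 (fst z) (snd z))"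
    using in_L2_mult_continuous[OF Wi2 cyl_leb cD, of e] cylinder_cong(2)[OF cyl_sets(1,2,3,4)] by blast
  have regD: "regular {c..c'} {a..b} (D 0 0)" for c c' by (rule regular_continuous[OF cD])
  have regUD: "regular {c..c'} {a..b} (\<lambda>t x. U m t x * D 0 0 t x)" for c c' m by (intro regular_mult regular_U regD)
  have mUD: "(\<lambda>z. U m (fst z) (snd z) * D 0 0 (fst z) (snd z)) \<in> borel_measurable borel" for m using regUD by (simp add: regular_def)
  have eqUD: "Wh t x \<bullet> e * D 0 0 t x = U m t x * D 0 0 t x"
    if "m \<in> {1..M}" "t \<in> {begins m<..<begins m + h}" "x \<in> {a<..<b} - nodes" for m t x
    using coef(2)[OF that(1), of t x e] that(2,3) by (simp add: U_def slab_time_eq)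
  note Wh = slab_sum[where f = "\<lambda>t x. Wh t x \<bullet> e * D 0 0 t x" and g = "\<lambda>m t x. U m t x * D 0 0 t x",
      OF mUD regular_integral(3)[OF regUD] eqUD cyl_sets(1,2)]
  show "set_integrable lebesgue cyl_int (\<lambda>z. ((Wi (fst z) (snd z) - Wh (fst z) (snd z)) \<bullet> e) * D 0 0 (fst z) (snd z))"
    unfolding inner_diff_left left_diff_distrib by (rule set_integral_diff(1)[OF iWi Wh(2)])
  have split: "(LINT z:cyl_int|lebesgue. ((Wi (fst z) (snd z) - Wh (fst z) (snd z)) \<bullet> e) * D 0 0 (fst z) (snd z))
      = (LINT z:cyl|lebesgue. (Wi (fst z) (snd z) \<bullet> e) * D 0 0 (fst z) (snd z)) - (\<Sum>m=1..M. SI m (\<lambda>t x. U m t x * D 0 0 t x))"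
  proof -
    have "(LINT z:cyl_int|lebesgue. ((Wi (fst z) (snd z) - Wh (fst z) (snd z)) \<bullet> e) * D 0 0 (fst z) (snd z))
        = (LINT z:cyl_int|lebesgue. (Wi (fst z) (snd z) \<bullet> e) * D 0 0 (fst z) (snd z)) - (LINT z:cyl_int|lebesgue. (Wh (fst z) (snd z) \<bullet> e) * D 0 0 (fst z) (snd z))"
      unfolding inner_diff_left left_diff_distrib by (rule set_integral_diff(2)[OF iWi Wh(2)])
    also have "(LINT z:cyl_int|lebesgue. (Wi (fst z) (snd z) \<bullet> e) * D 0 0 (fst z) (snd z)) = (LINT z:cyl|lebesgue. (Wi (fst z) (snd z) \<bullet> e) * D 0 0 (fst z) (snd z))"
      by (rule cylinder_cong(1)[OF cyl_sets(1,2,3,4)])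
    finally show ?thesis using Wh(1) by (simp add: SI_def begins_start)
  qed
  have sq\<psi>: "sq m (\<psi> 0 0)" for m by (intro sq_regular C1_functionD(6)[OF C])
  have sB: "sq m (\<lambda>t x. B t x \<bullet> hat e)" if "m \<in> {1..M}" for m
    using source_on_slab[OF that, of "hat e"] by (simp add: sq_def L2_on_def begins_start)
  have s\<psi>: "(LINT z:cyl|lebesgue. (B (fst z) (snd z) \<bullet> hat e) * \<psi> 0 0 (fst z) (snd z)) = (\<Sum>m=1..M. SI m (\<lambda>t x. (B t x \<bullet> hat e) * \<psi> 0 0 t x))"
    unfolding SI_def begins_start[symmetric]
  proof (rule slab_sum(1)[where f = "\<lambda>t x. (B t x \<bullet> hat e) * \<psi> 0 0 t x" and g = "\<lambda>m t x. (B t x \<bullet> hat e) * \<psi> 0 0 t x", OF _ _ refl cyl_sets(3,4)])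
    fix m assume m: "m \<in> {1..M}"
    show "(\<lambda>z. (B (fst z) (snd z) \<bullet> hat e) * \<psi> 0 0 (fst z) (snd z)) \<in> borel_measurable borel"
      using sB[OF m] sq\<psi> unfolding sq_def by (intro borel_measurable_times) blast+
    show "set_integrable lborel ({begins m..begins m + h} \<times> {a..b}) (\<lambda>z. (B (fst z) (snd z) \<bullet> hat e) * \<psi> 0 0 (fst z) (snd z))"
      unfolding begins_start by (rule sq_mult_integrable[OF sB[OF m] sq\<psi>])
  qed
  have w0\<psi>: "(LINT x:{a<..<b}|lebesgue. (W0 x \<bullet> e) * \<psi> 0 0 0 x) = integral {a..b} (\<lambda>x. (W0 x \<bullet> e) * \<psi> 0 0 0 x)"
    by (rule open_interval_integral) (auto intro!: continuous_intros continuous_on_subset[OF initial(1)] C1_functionD(1)[OF C])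
  have "- (LINT z:cyl|lebesgue. (Wi (fst z) (snd z) \<bullet> e) * D 0 0 (fst z) (snd z))
      = (LINT z:cyl|lebesgue. (Wi (fst z) (snd z) \<bullet> e) * (\<psi> 1 0 (fst z) (snd z) + \<sigma> * \<psi> 0 1 (fst z) (snd z)))"
  proof -
    have "(LINT z:cyl|lebesgue. (Wi (fst z) (snd z) \<bullet> e) * (\<psi> 1 0 (fst z) (snd z) + \<sigma> * \<psi> 0 1 (fst z) (snd z)))
       = (LINT z:cyl|lebesgue. - 1 * ((Wi (fst z) (snd z) \<bullet> e) * D 0 0 (fst z) (snd z)))"
      by (rule set_lebesgue_integral_cong[OF cyl_leb(1)]) (auto simp: transport[simplified])
    then show ?thesis unfolding set_integral_mult_right by simp
  qed
  also have "\<dots> = - (LINT z:cyl|lebesgue. (B (fst z) (snd z) \<bullet> hat e) * \<psi> 0 0 (fst z) (snd z))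
      - (LINT x:{a<..<b}|lebesgue. (W0 x \<bullet> e) * \<psi> 0 0 0 x)"
    by (rule weak_identity[OF exact margin(3,4) ab ch source_zero initial(2) \<psi> lo T1 hi])
  finally have exact_side: "(LINT z:cyl|lebesgue. (Wi (fst z) (snd z) \<bullet> e) * D 0 0 (fst z) (snd z))
      = (\<Sum>m=1..M. SI m (\<lambda>t x. (B t x \<bullet> hat e) * \<psi> 0 0 t x)) + integral {a..b} (\<lambda>x. (W0 x \<bullet> e) * \<psi> 0 0 0 x)"
    unfolding s\<psi> w0\<psi> by linarith
  have "SI m (\<lambda>t x. U m t x * (\<psi> 1 0 t x + \<sigma> * \<psi> 0 1 t x)) = - SI m (\<lambda>t x. U m t x * D 0 0 t x)" if "m \<in> {1..M}" for m
  proof -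
    have "SI m (\<lambda>t x. U m t x * (\<psi> 1 0 t x + \<sigma> * \<psi> 0 1 t x)) = SI m (\<lambda>t x. - 1 * (U m t x * D 0 0 t x))"
      unfolding SI_def by (rule set_lebesgue_integral_cong) (use start_less[OF that] in \<open>auto simp: transport[simplified]\<close>)
    then show ?thesis unfolding SI_def set_integral_mult_right by simp
  qed
  then have "(\<Sum>m=1..M. SI m (\<lambda>t x. U m t x * (\<psi> 1 0 t x + \<sigma> * \<psi> 0 1 t x))) = - (\<Sum>m=1..M. SI m (\<lambda>t x. U m t x * D 0 0 t x))"
    by (simp only: sum_negf[symmetric] cong: sum.cong)
  moreover have "start M + h = T" using final_time by (simp only: sum_start_end)
  then have "integral {a..b} (\<lambda>x. U M (start M + h) x * \<psi> 0 0 (start M + h) x) = 0" using hi[of T] T1 by simp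
  ultimately have discrete_side: "(\<Sum>m=1..M. SI m (\<lambda>t x. U m t x * D 0 0 t x))
      = (\<Sum>m=1..M. SI m (\<lambda>t x. (Ut m t x + \<sigma> * Ux m t x) * \<psi> 0 0 t x) + integral {a..b} (\<lambda>x. jump m x * \<psi> 0 0 (start m) x))
        + integral {a..b} (\<lambda>x. (W0 x \<bullet> e) * \<psi> 0 0 0 x)"
    using integration_by_parts[OF C] by linarith
  have "SI m (\<lambda>t x. (B t x \<bullet> hat e) * \<psi> 0 0 t x) - (SI m (\<lambda>t x. (Ut m t x + \<sigma> * Ux m t x) * \<psi> 0 0 t x) + integral {a..b} (\<lambda>x. jump m x * \<psi> 0 0 (start m) x))
      = err m (\<psi> 0 0)" if "m \<in> {1..M}" for m
  proof -
    have "regular (slab m) {a..b} (\<lambda>t x. (Ut m t x + \<sigma> * Ux m t x) * \<psi> 0 0 t x)"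
      by (intro regular_mult regular_add regular_const regular_U C1_functionD(6)[OF C])
    from set_integral_diff(2)[OF sq_mult_integrable[OF sB[OF that] sq\<psi>] regular_integral(3)[OF this]]
    have "SI m (\<lambda>t x. (B t x \<bullet> hat e) * \<psi> 0 0 t x) - SI m (\<lambda>t x. (Ut m t x + \<sigma> * Ux m t x) * \<psi> 0 0 t x) = SI m (\<lambda>t x. r0 m t x * \<psi> 0 0 t x)"
      by (simp add: SI_def r0_def left_diff_distrib)
    then show ?thesis unfolding err_def by linarith
  qed
  then have "(\<Sum>m=1..M. err m (\<psi> 0 0)) = (\<Sum>m=1..M. SI m (\<lambda>t x. (B t x \<bullet> hat e) * \<psi> 0 0 t x)
      - (SI m (\<lambda>t x. (Ut m t x + \<sigma> * Ux m t x) * \<psi> 0 0 t x) + integral {a..b} (\<lambda>x. jump m x * \<psi> 0 0 (start m) x)))"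
    by (simp only: cong: sum.cong)
  then have "(\<Sum>m=1..M. err m (\<psi> 0 0)) = (\<Sum>m=1..M. SI m (\<lambda>t x. (B t x \<bullet> hat e) * \<psi> 0 0 t x))
      - (\<Sum>m=1..M. SI m (\<lambda>t x. (Ut m t x + \<sigma> * Ux m t x) * \<psi> 0 0 t x) + integral {a..b} (\<lambda>x. jump m x * \<psi> 0 0 (start m) x))"
    by (simp only: sum_subtractf)
  then show "(LINT z:cyl_int|lebesgue. ((Wi (fst z) (snd z) - Wh (fst z) (snd z)) \<bullet> e) * D 0 0 (fst z) (snd z)) = (\<Sum>m=1..M. err m (along T \<sigma> (D 0 0)))"
    unfolding split exact_side discrete_side \<psi>_def[symmetric] by linarith
qed

end

section \<open>Dual norm of the discretization error\<close>

context direction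
begin

lemma K_pos: "0 < K"
proof -
  have "0 \<le> (4 + \<delta>0\<^sup>2) * (3 + 32 / d\<^sup>2)" "0 \<le> 1000 / d\<^sup>2" by simp_all
  then show ?thesis unfolding K_def using K2_pos by linarith
qed

text \<open>
  The dual solution vanishes at the downstream end because the characteristics through that point
  have left the support of the test function, and at the final time because the support of the
  test function ends before. Young's inequality with free \<open>\<epsilon>\<close> then gives the product of the
  residual norms and the Sobolev norm.
\<close>

lemma direction_bound:
  fixes \<phi> :: "real \<Rightarrow> real \<Rightarrow> real ^ 3"
  assumes \<phi>: "\<phi> \<in> C0_infinity cyl_int"
  shows "set_integrable lebesgue cyl_int (\<lambda>z. ((Wi (fst z) (snd z) - Wh (fst z) (snd z)) \<bullet> e) * (\<phi> (fst z) (snd z) \<bullet> e))"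
    and "(LINT z:cyl_int|lebesgue. ((Wi (fst z) (snd z) - Wh (fst z) (snd z)) \<bullet> e) * (\<phi> (fst z) (snd z) \<bullet> e))
      \<le> 6 * K * T * (norm_L2 cyl (\<lambda>t x. h *\<^sub>R R1 t x) + norm_L2 cyl (\<lambda>t x. h *\<^sub>R R2 t x)) * norm_H1 cyl_int \<phi>"
proof -
  obtain F T1 where F: "smooth_family F" "F 0 0 = \<phi>" "T1 < T" "\<And>i j t x. F i j t x \<noteq> 0 \<Longrightarrow> 0 < t \<and> t < T1 \<and> a < x \<and> x < b"
    using test_family[OF \<phi>] by metis
  define D where "D i j t x = F i j t x \<bullet> e" for i j t x
  have D: "smooth_family D" unfolding D_def [abs_def] by (rule smooth_family_inner[OF F(1)])
  have supp: "0 < t \<and> t < T1 \<and> a < x \<and> x < b" if "D i j t x \<noteq> 0" for i j t x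
    using F(4)[of i j t x] that by (cases "F i j t x = 0") (auto simp: D_def)
  note id = error_identity[OF D F(3) supp]
  show "set_integrable lebesgue cyl_int (\<lambda>z. ((Wi (fst z) (snd z) - Wh (fst z) (snd z)) \<bullet> e) * (\<phi> (fst z) (snd z) \<bullet> e))"
    using id(1) by (simp add: D_def F(2))
  define \<psi> where "\<psi> i j = along T \<sigma> (D i j)" for i j
  have \<psi>: "smooth_family \<psi>" unfolding \<psi>_def [abs_def] by (rule smooth_family_along[OF D])
  have zero: "\<psi> 0 0 t x = 0" if "\<And>r. r \<in> {0..T} \<Longrightarrow> D 0 0 (t + r) (x + \<sigma> * r) = 0" for t x
    unfolding \<psi>_def along_def using that by (metis (no_types, lifting) integral_cong integral_0)
  have down: "\<psi> 0 0 t (\<sigma> * R) = 0" for t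
  proof (rule zero)
    fix r assume "r \<in> {0..T}"
    then have "\<not> (a < \<sigma> * R + \<sigma> * r \<and> \<sigma> * R + \<sigma> * r < b)" using \<sigma> L_R_forward L_R_backward by auto
    then show "D 0 0 (t + r) (\<sigma> * R + \<sigma> * r) = 0" using supp[of 0 0 "t + r" "\<sigma> * R + \<sigma> * r"] by blast
  qed
  have final: "\<psi> 0 0 (real M * h) x = 0" for x
    unfolding final_time
  proof (rule zero)
    fix r assume "r \<in> {0..T}"
    then show "D 0 0 (T + r) (x + \<sigma> * r) = 0" using supp[of 0 0 "T + r" "x + \<sigma> * r"] F(3) by force
  qed
  define E where "E = (\<Sum>m=1..M. err m (\<psi> 0 0))"
  define X where "X = h\<^sup>2 * (\<Sum>m=1..M. residual m) + h * (\<Sum>m=1..M. jump_sq m)"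
  define Y where "Y = (\<Sum>m=1..M. H1_sq m (\<psi> 0 0) (\<psi> 1 0) (\<psi> 0 1))"
  define N1 where "N1 = norm_L2 cyl (\<lambda>t x. h *\<^sub>R R1 t x)"
  define N2 where "N2 = norm_L2 cyl (\<lambda>t x. h *\<^sub>R R2 t x)"
  define N where "N = norm_H1 cyl_int \<phi>"
  have nonneg: "0 \<le> N1" "0 \<le> N2" "0 \<le> N"
    by (simp_all add: N1_def N2_def N_def norm_L2_nonneg norm_H1_def)
  note K0 = K_pos
  have X0: "0 \<le> X" unfolding X_def by (rule total_nonneg)
  have Y0: "0 \<le> Y" unfolding Y_def H1_sq_def by (intro sum_nonneg add_nonneg_nonneg SI_sq_nonneg)
  have "E / K \<le> sqrt X * sqrt Y"
  proof (rule le_sqrt_of_young[OF _ X0 Y0])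
    fix \<epsilon> :: real assume "0 < \<epsilon>"
    then have "2 * E \<le> K * (\<epsilon> * X + Y / \<epsilon>)"
      unfolding E_def X_def Y_def by (intro error_estimate is_galerkin smooth_family_C1[OF \<psi>] down final)
    then show "2 * (E / K) \<le> \<epsilon> * X + Y / \<epsilon>" using K0 by (simp add: field_simps)
  qed
  also have "\<dots> \<le> (3 * (N1 + N2)) * (2 * T * N)"
  proof (rule mult_mono)
    have "X \<le> 6 * N1\<^sup>2 + 2 * N2\<^sup>2"
      unfolding X_def N1_def N2_def by (intro add_mono residual_sum_le jump_sum_le)
    also have "\<dots> \<le> (3 * (N1 + N2))\<^sup>2"
    proof -
      have "0 \<le> N1 * N2" using nonneg by simp
      moreover have "(3 * (N1 + N2))\<^sup>2 = 9 * N1\<^sup>2 + 18 * (N1 * N2) + 9 * N2\<^sup>2" by (simp add: power2_eq_square algebra_simps)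
      ultimately show ?thesis using zero_le_power2[of N1] zero_le_power2[of N2] by linarith
    qed
    finally show "sqrt X \<le> 3 * (N1 + N2)" using nonneg by (intro real_le_lsqrt) auto
    have along: "(\<Sum>m=1..M. SI m (\<lambda>t x. (\<psi> i j t x)\<^sup>2)) \<le> T\<^sup>2 * (2 * inner_L2 cyl_int (F i j) (F i j))" for i j
    proof -
      have c: "continuous_on UNIV (\<lambda>z. \<psi> i j (fst z) (snd z))" "continuous_on UNIV (\<lambda>z. D i j (fst z) (snd z))"
        by (intro smooth_family_continuous[OF \<psi>] smooth_family_continuous[OF D] continuous_intros)+
      have cF: "continuous_on UNIV (\<lambda>z. F i j (fst z) (snd z))" by (intro smooth_family_continuous[OF F(1)] continuous_intros)
      have "(\<Sum>m=1..M. SI m (\<lambda>t x. (\<psi> i j t x)\<^sup>2)) = (LINT z:{0..T} \<times> {a..b}|lborel. (\<psi> i j (fst z) (snd z))\<^sup>2)"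
        using continuous_square_sum[OF c(1)] by (simp add: SI_def begins_start)
      also have "\<dots> \<le> T\<^sup>2 * (LINT z:{0..T} \<times> {a..b}|lborel. (D i j (fst z) (snd z))\<^sup>2)"
        unfolding \<psi>_def
      proof (rule along_norm[OF c(2) less_imp_le[OF T_pos]])
        fix t x assume "(t, x) \<notin> {0..T} \<times> {a..b}"
        then show "D i j t x = 0" using supp[of i j t x] F(3) by (cases "D i j t x = 0") auto
      qed (use c(1) in \<open>simp add: \<psi>_def\<close>)
      also have "\<dots> \<le> T\<^sup>2 * (2 * inner_L2 cyl_int (F i j) (F i j))"
        unfolding D_def by (intro mult_left_mono component_square_le cF ch_inner(7)) simp
      finally show ?thesis .
    qed
    have dt: "dt \<phi> = F 1 0" and dx: "dx \<phi> = F 0 1"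
      unfolding dt_def dx_def F(2)[symmetric] fun_eq_iff using smooth_family_deriv[OF F(1), of 0 0] by (auto intro: vector_derivative_at)
    have N: "N\<^sup>2 = inner_L2 cyl_int (F 0 0) (F 0 0) + inner_L2 cyl_int (F 1 0) (F 1 0) + inner_L2 cyl_int (F 0 1) (F 0 1)"
      unfolding N_def norm_H1_square dt dx F(2) ..
    have "Y = (\<Sum>m=1..M. SI m (\<lambda>t x. (\<psi> 0 0 t x)\<^sup>2)) + (\<Sum>m=1..M. SI m (\<lambda>t x. (\<psi> 1 0 t x)\<^sup>2)) + (\<Sum>m=1..M. SI m (\<lambda>t x. (\<psi> 0 1 t x)\<^sup>2))"
      unfolding Y_def H1_sq_def by (simp only: sum.distrib)
    also have "\<dots> \<le> T\<^sup>2 * (2 * N\<^sup>2)" using add_mono[OF add_mono[OF along[of 0 0] along[of 1 0]] along[of 0 1]] unfolding N by (simp only: distrib_left)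
    also have "\<dots> \<le> (2 * T * N)\<^sup>2"
    proof -
      have "0 \<le> (T * N)\<^sup>2" by simp
      then show ?thesis by (simp add: power_mult_distrib)
    qed
    finally show "sqrt Y \<le> 2 * T * N" using nonneg T_pos by (intro real_le_lsqrt) auto
  qed (use nonneg X0 Y0 in auto)
  finally have "E \<le> 6 * K * T * (N1 + N2) * N" using K0 by (simp add: divide_le_eq algebra_simps)
  moreover have "(LINT z:cyl_int|lebesgue. ((Wi (fst z) (snd z) - Wh (fst z) (snd z)) \<bullet> e) * (\<phi> (fst z) (snd z) \<bullet> e)) = E"
    using id(2) by (simp add: D_def F(2) E_def \<psi>_def)
  ultimately show "(LINT z:cyl_int|lebesgue. ((Wi (fst z) (snd z) - Wh (fst z) (snd z)) \<bullet> e) * (\<phi> (fst z) (snd z) \<bullet> e))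
      \<le> 6 * K * T * (norm_L2 cyl (\<lambda>t x. h *\<^sub>R R1 t x) + norm_L2 cyl (\<lambda>t x. h *\<^sub>R R2 t x)) * norm_H1 cyl_int \<phi>"
    by (simp add: N1_def N2_def N_def)
qed

end

text \<open>If the norm in the denominator is zero, then the quotient is zero by convention.\<close>

lemma quotient_le:
  assumes "inner_L2 G u \<psi> \<le> c * norm_H1 G \<psi>" "0 \<le> c"
  shows "inner_L2 G u \<psi> / norm_H1 G \<psi> \<le> c"
proof (cases "norm_H1 G \<psi> = 0")
  case False
  moreover have "0 \<le> norm_H1 G \<psi>" by (simp add: norm_H1_def)
  ultimately show ?thesis using assms(1) by (simp add: divide_le_eq)
qed (use assms(2) in simp)

context maxwell_step
begin

text \<open>
  The sum over the three directions, with weights \<open>1\<close>, \<open>1 / 2\<close> and \<open>1 / 2\<close> from the expansion of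
  the inner product.
\<close>

lemma dual_bound:
  fixes \<phi> :: "real \<Rightarrow> real \<Rightarrow> real ^ 3"
  assumes \<phi>: "\<phi> \<in> C0_infinity cyl_int"
  shows "set_integrable lebesgue cyl_int (\<lambda>z. (Wi (fst z) (snd z) - Wh (fst z) (snd z)) \<bullet> \<phi> (fst z) (snd z))"
    and "inner_L2 cyl_int (\<lambda>t x. Wi t x - Wh t x) \<phi>
      \<le> 12 * sd_transport.K \<delta>0 d Ci * T * (norm_L2 cyl (\<lambda>t x. h *\<^sub>R R1 t x) + norm_L2 cyl (\<lambda>t x. h *\<^sub>R R2 t x)) * norm_H1 cyl_int \<phi>"
proof -
  interpret d1: direction a b h \<T> k M T \<delta>0 d Ci Ks B W0 Wi Wh e1 1 0 by unfold_locales (rule characteristic_e)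
  interpret d2: direction a b h \<T> k M T \<delta>0 d Ci Ks B W0 Wi Wh e2 1 1 by unfold_locales (rule characteristic_e)
  interpret d3: direction a b h \<T> k M T \<delta>0 d Ci Ks B W0 Wi Wh e3 "- 1" "- 1" by unfold_locales (rule characteristic_e)
  let ?f = "\<lambda>e z. ((Wi (fst z) (snd z) - Wh (fst z) (snd z)) \<bullet> e) * (\<phi> (fst z) (snd z) \<bullet> e)"
  note i = d1.direction_bound(1)[OF \<phi>] d2.direction_bound(1)[OF \<phi>] d3.direction_bound(1)[OF \<phi>]
  note i' = i(1) set_integrable_divide[OF i(2), of 2] set_integrable_divide[OF i(3), of 2]
  have expand: "(\<lambda>z. (Wi (fst z) (snd z) - Wh (fst z) (snd z)) \<bullet> \<phi> (fst z) (snd z)) = (\<lambda>z. ?f e1 z + ?f e2 z / 2 + ?f e3 z / 2)"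
    by (rule ext) (rule inner_expand_e)
  show "set_integrable lebesgue cyl_int (\<lambda>z. (Wi (fst z) (snd z) - Wh (fst z) (snd z)) \<bullet> \<phi> (fst z) (snd z))"
    unfolding expand by (intro set_integral_add(1) i')
  have "inner_L2 cyl_int (\<lambda>t x. Wi t x - Wh t x) \<phi> = (LINT z:cyl_int|lebesgue. ?f e1 z) + (LINT z:cyl_int|lebesgue. ?f e2 z / 2) + (LINT z:cyl_int|lebesgue. ?f e3 z / 2)"
    unfolding inner_L2_def expand set_integral_add(2)[OF set_integral_add(1)[OF i'(1,2)] i'(3)] set_integral_add(2)[OF i'(1,2)] ..
  also have "\<dots> = (LINT z:cyl_int|lebesgue. ?f e1 z) + (LINT z:cyl_int|lebesgue. ?f e2 z) / 2 + (LINT z:cyl_int|lebesgue. ?f e3 z) / 2"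
    by (simp only: set_integral_divide_zero)
  also have "\<dots> \<le> 12 * sd_transport.K \<delta>0 d Ci * T * (norm_L2 cyl (\<lambda>t x. h *\<^sub>R R1 t x) + norm_L2 cyl (\<lambda>t x. h *\<^sub>R R2 t x)) * norm_H1 cyl_int \<phi>"
    using d1.direction_bound(2)[OF \<phi>] d2.direction_bound(2)[OF \<phi>] d3.direction_bound(2)[OF \<phi>]
    by linarith
  finally show "inner_L2 cyl_int (\<lambda>t x. Wi t x - Wh t x) \<phi>
      \<le> 12 * sd_transport.K \<delta>0 d Ci * T * (norm_L2 cyl (\<lambda>t x. h *\<^sub>R R1 t x) + norm_L2 cyl (\<lambda>t x. h *\<^sub>R R2 t x)) * norm_H1 cyl_int \<phi>" .
qed

end

section \<open>The a posteriori estimate\<close>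

lemma domain_real:
  assumes "domain (G :: real set)" shows "\<exists>a b. a < b \<and> G = {a<..<b}"
proof -
  have G: "open G" "connected G" "bounded G" "G \<noteq> {}" using assms by (auto simp: domain_def)
  note bdd = bounded_imp_bdd_above[OF G(3)] bounded_imp_bdd_below[OF G(3)]
  have inside: "Inf G < x \<and> x < Sup G" if xG: "x \<in> G" for x
  proof -
    obtain \<epsilon> where \<epsilon>: "0 < \<epsilon>" "ball x \<epsilon> \<subseteq> G" using openE[OF G(1) xG] by metis
    have "x - \<epsilon> / 2 \<in> ball x \<epsilon>" "x + \<epsilon> / 2 \<in> ball x \<epsilon>" using \<epsilon>(1) by (simp_all add: dist_real_def)
    then have "Inf G \<le> x - \<epsilon> / 2" "x + \<epsilon> / 2 \<le> Sup G" using cInf_lower[OF _ bdd(2)] cSup_upper[OF _ bdd(1)] \<epsilon>(2) by blast+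
    with \<epsilon>(1) show ?thesis by linarith
  qed
  have "x \<in> G" if x: "Inf G < x" "x < Sup G" for x
  proof -
    obtain y z where "y \<in> G" "y < x" "z \<in> G" "x < z"
      using x cInf_less_iff[OF G(4) bdd(2)] less_cSup_iff[OF G(4) bdd(1)] by blast
    then show ?thesis using connectedD_interval[OF G(2)] by (meson less_imp_le)
  qed
  with inside have "G = {Inf G<..<Sup G}" by auto
  moreover from this have "Inf G < Sup G" using G(4) by (metis greaterThanLessThan_empty_iff not_le)
  ultimately show ?thesis by blast
qed

text \<open>
  Integrability has to be required, because the pairing of functions that are not integrable is
  zero by convention, and then the pairing need not be additive.
\<close>

lemma Hneg1_triangle:
  assumes uv: "norm_Hneg1 G (\<lambda>t x. u t x - v t x) \<le> ereal c" and vw: "norm_Hneg1 G (\<lambda>t x. v t x - w t x) \<le> ereal c"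
    and i: "\<And>\<phi>. \<phi> \<in> C0_infinity G \<Longrightarrow> set_integrable lebesgue G (\<lambda>z. (u (fst z) (snd z) - v (fst z) (snd z)) \<bullet> \<phi> (fst z) (snd z))"
      "\<And>\<phi>. \<phi> \<in> C0_infinity G \<Longrightarrow> set_integrable lebesgue G (\<lambda>z. (v (fst z) (snd z) - w (fst z) (snd z)) \<bullet> \<phi> (fst z) (snd z))"
  shows "norm_Hneg1 G (\<lambda>t x. u t x - w t x) \<le> ereal (2 * c)"
  unfolding norm_Hneg1_def
proof (rule SUP_least)
  fix \<phi> :: "real \<Rightarrow> real \<Rightarrow> 'a" assume \<phi>: "\<phi> \<in> C0_infinity G - {\<lambda>_ _. 0}"
  have le: "inner_L2 G r \<phi> / norm_H1 G \<phi> \<le> c" if "norm_Hneg1 G r \<le> ereal c" for r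
    using order_trans[OF SUP_upper[OF \<phi>, of "\<lambda>\<psi>. ereal (inner_L2 G r \<psi> / norm_H1 G \<psi>)"]] that unfolding norm_Hneg1_def by force
  have "inner_L2 G (\<lambda>t x. u t x - w t x) \<phi>
      = (LINT z:G|lebesgue. (u (fst z) (snd z) - v (fst z) (snd z)) \<bullet> \<phi> (fst z) (snd z) + (v (fst z) (snd z) - w (fst z) (snd z)) \<bullet> \<phi> (fst z) (snd z))"
    unfolding inner_L2_def by (simp add: inner_diff_left)
  also have "\<dots> = inner_L2 G (\<lambda>t x. u t x - v t x) \<phi> + inner_L2 G (\<lambda>t x. v t x - w t x) \<phi>"
    unfolding inner_L2_def by (rule set_integral_add(2)) (use i \<phi> in blast)+
  finally show "ereal (inner_L2 G (\<lambda>t x. u t x - w t x) \<phi> / norm_H1 G \<phi>) \<le> ereal (2 * c)"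
    using le[OF uv] le[OF vw] by (simp add: add_divide_distrib)
qed

lemma inner_test_integrable:
  fixes u \<phi> :: "real \<Rightarrow> real \<Rightarrow> 'a::euclidean_space"
  assumes u: "continuous_on ({0..T} \<times> UNIV) (\<lambda>(t, x). u t x) \<or> in_L2 ({0..T} \<times> {a<..<b}) u"
    and \<phi>: "\<phi> \<in> C0_infinity ({0<..<T} \<times> {a<..<b})"
  shows "set_integrable lebesgue ({0<..<T} \<times> {a<..<b}) (\<lambda>z. u (fst z) (snd z) \<bullet> \<phi> (fst z) (snd z))"
proof -
  obtain D where D: "smooth_family D" "D 0 0 = \<phi>" using \<phi> unfolding C0_infinity_def smooth2_iff by blast
  have c: "continuous_on UNIV (\<lambda>z. \<phi> (fst z) (snd z))"
    unfolding D(2)[symmetric] by (intro smooth_family_continuous[OF D(1)] continuous_intros)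
  have borel: "{0<..<T} \<times> {a<..<b} \<in> sets lebesgue" "{0..T} \<times> {a<..<b} \<in> sets lebesgue" by simp_all
  from u show ?thesis
  proof
    assume cu: "continuous_on ({0..T} \<times> UNIV) (\<lambda>(t, x). u t x)"
    have "continuous_on (cbox (0, a) (T, b)) (\<lambda>z. u (fst z) (snd z) \<bullet> \<phi> (fst z) (snd z))"
      using continuous_on_subset[OF cu, of "cbox (0, a) (T, b)"]
      by (intro continuous_intros continuous_on_subset[OF c]) (auto simp: cbox_Pair_eq case_prod_unfold)
    from absolutely_integrable_continuous[OF this]
    show ?thesis by (rule set_integrable_subset) (use borel in \<open>auto simp: cbox_Pair_eq\<close>)
  next
    assume "in_L2 ({0..T} \<times> {a<..<b}) u"
    then have "set_integrable lebesgue ({0..T} \<times> {a<..<b}) (\<lambda>z. (u (fst z) (snd z) \<bullet> i) * (\<phi> (fst z) (snd z) \<bullet> i))" for i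
      by (rule in_L2_mult_continuous[OF _ borel(2)]) (auto intro: bounded_Times intro!: continuous_intros c)
    then have "set_integrable lebesgue ({0..T} \<times> {a<..<b}) (\<lambda>z. \<Sum>i\<in>Basis. (u (fst z) (snd z) \<bullet> i) * (\<phi> (fst z) (snd z) \<bullet> i))"
      unfolding set_integrable_def scaleR_sum_right by (intro Bochner_Integration.integrable_sum) blast
    then have "set_integrable lebesgue ({0..T} \<times> {a<..<b}) (\<lambda>z. u (fst z) (snd z) \<bullet> \<phi> (fst z) (snd z))"
      by (simp add: euclidean_inner[symmetric])
    then show ?thesis by (rule set_integrable_subset) (use borel in auto)
  qed
qed

theorem corollary3p3:
  fixes T \<delta>0 :: real and \<Omega>x K :: "real set" and \<Omega>v :: "(real ^ 2) set" and k :: nat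
  assumes "0 < T" and "domain \<Omega>x" and "domain \<Omega>v"
    and "compact K" and "K \<subseteq> \<Omega>x"
    and "1 \<le> k" and "0 < \<delta>0"
  shows "\<exists>C>0. \<forall>(h::real) (M::nat) (\<T>::real set set)
       (\<rho>::real \<Rightarrow> real) (f0::real \<Rightarrow> real ^ 2 \<Rightarrow> real) (E20::real \<Rightarrow> real) (B0::real \<Rightarrow> real)
       (f::real \<Rightarrow> real \<Rightarrow> real ^ 2 \<Rightarrow> real) (E1::real \<Rightarrow> real \<Rightarrow> real)
       (E2::real \<Rightarrow> real \<Rightarrow> real) (B::real \<Rightarrow> real \<Rightarrow> real)
       (fh::nat \<Rightarrow> real \<Rightarrow> real \<Rightarrow> real ^ 2 \<Rightarrow> real)
       (Wi::nat \<Rightarrow> real \<Rightarrow> real \<Rightarrow> real ^ 3) (Wh::nat \<Rightarrow> real \<Rightarrow> real \<Rightarrow> real ^ 3).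
     let G = {0<..<T} \<times> \<Omega>x;
         W = fields E1 E2 B;
         W0 = initial_fields \<rho> f0 E20 B0
     in
       discretization T \<Omega>x h M \<T> \<longrightarrow>
       vm_data K \<Omega>v \<rho> f0 E20 B0 \<longrightarrow>
       vm_solution T \<Omega>x K \<Omega>v \<rho> f0 E20 B0 f E1 E2 B \<longrightarrow>
       (\<forall>i. approx_density T \<Omega>x K \<Omega>v (fh i)) \<longrightarrow>
       (\<forall>i\<ge>1. maxwell_solution T \<Omega>x K (source \<rho> (fh (i - 1))) W0 (Wi i)) \<longrightarrow>
       (\<forall>i\<ge>1. sd_solution \<Omega>x h M \<T> k (\<delta>0 * h) (source \<rho> (fh (i - 1))) W0 (Wh i)) \<longrightarrow>
       (\<forall>\<^sub>F i in sequentially.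
          norm_Hneg1 G (\<lambda>t x. W t x - Wi i t x) \<le> norm_Hneg1 G (\<lambda>t x. Wi i t x - Wh i t x)) \<longrightarrow>
       (\<forall>\<^sub>F i in sequentially.
          norm_Hneg1 G (\<lambda>t x. W t x - Wh i t x)
          \<le> ereal (C * (norm_L2 ({0..T} \<times> \<Omega>x)
                           (\<lambda>t x. h *\<^sub>R residual1 (source \<rho> (fh (i - 1))) (Wh i) t x)
                        + norm_L2 ({0..T} \<times> \<Omega>x)
                           (\<lambda>t x. h *\<^sub>R residual2 h W0 (Wh i) t x))))"
proof -
  obtain a b where ab: "a < b" "\<Omega>x = {a<..<b}" using domain_real[OF assms(2)] by blast
  obtain d where d: "0 < d" "2 * d \<le> b - a" "K \<subseteq> {a + d..b - d}"
    using compact_margin[OF assms(4) _ ab(1)] assms(5) ab(2) by blast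
  obtain Ci where Ci: "1 \<le> Ci"
    "\<And>c t h. 0 < h \<Longrightarrow> (tpoly k c t)\<^sup>2 \<le> Ci / h * integral {t..t + h} (\<lambda>s. (tpoly k c s)\<^sup>2)"
    "\<And>c t h. 0 < h \<Longrightarrow> integral {t..t + h} (\<lambda>s. (tpoly' k c s)\<^sup>2) \<le> Ci / h\<^sup>2 * integral {t..t + h} (\<lambda>s. (tpoly k c s)\<^sup>2)"
    using inverse_inequality[of k] by blast
  \<comment> \<open>The absolute value makes nonnegativity evident, and the constant \<open>2 * S + 1\<close> in the end is positive.\<close>
  define S where "S = 12 * \<bar>sd_transport.K \<delta>0 d Ci\<bar> * T"
  have S0: "0 \<le> S" using assms(1) by (simp add: S_def)
  \<comment> \<open>The statement for a single step, in which \<open>fh\<close>, \<open>Wi\<close> and \<open>Wh\<close> no longer depend on the index.\<close>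
  have main: "norm_Hneg1 ({0<..<T} \<times> {a<..<b}) (\<lambda>t x. fields E1 E2 B t x - Wh t x)
      \<le> ereal ((2 * S + 1) * (norm_L2 ({0..T} \<times> {a<..<b}) (\<lambda>t x. h *\<^sub>R residual1 (source \<rho> fh) Wh t x)
          + norm_L2 ({0..T} \<times> {a<..<b}) (\<lambda>t x. h *\<^sub>R residual2 h (initial_fields \<rho> f0 E20 B0) Wh t x)))"
    if disc: "discretization T {a<..<b} h M \<T>" and data: "vm_data K \<Omega>v \<rho> f0 E20 B0"
      and sol: "vm_solution T {a<..<b} K \<Omega>v \<rho> f0 E20 B0 f E1 E2 B" and dens: "approx_density T {a<..<b} K \<Omega>v fh"
      and ex: "maxwell_solution T {a<..<b} K (source \<rho> fh) (initial_fields \<rho> f0 E20 B0) Wi"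
      and sd: "sd_solution {a<..<b} h M \<T> k (\<delta>0 * h) (source \<rho> fh) (initial_fields \<rho> f0 E20 B0) Wh"
      and dom: "norm_Hneg1 ({0<..<T} \<times> {a<..<b}) (\<lambda>t x. fields E1 E2 B t x - Wi t x)
        \<le> norm_Hneg1 ({0<..<T} \<times> {a<..<b}) (\<lambda>t x. Wi t x - Wh t x)"
    for h M \<T> \<rho> f0 E20 B0 f E1 E2 B fh Wi Wh
  proof -
    define W where "W = fields E1 E2 B"
    have hM: "real M * h = T" "1 \<le> M" using disc unfolding discretization_def by blast+
    then have h: "0 < h" using assms(1) by (metis of_nat_0_le_iff zero_less_mult_pos order_le_less mult_zero_left less_irrefl)
    have div: "\<T> division_of {a..b}" using disc ab(1) by (simp add: discretization_def)
    have cont: "continuous_on ({0..T} \<times> UNIV) (\<lambda>(t, x). W t x)"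
      and off: "\<And>t x. t \<in> {0..T} \<Longrightarrow> x \<notin> K \<Longrightarrow> W t x = 0"
      and init: "\<And>x. W 0 x = initial_fields \<rho> f0 E20 B0 x"
      using sol unfolding vm_solution_def W_def by blast+
    \<comment> \<open>The initial fields are continuous, as they are values of the classical solution.\<close>
    have init_cont: "continuous_on UNIV (initial_fields \<rho> f0 E20 B0)"
    proof -
      have c: "continuous_on UNIV (\<lambda>x::real. (0::real, x))" by (intro continuous_intros)
      have "(\<lambda>x::real. (0::real, x)) ` UNIV \<subseteq> {0..T} \<times> UNIV" using assms(1) by auto
      from continuous_on_compose2[OF cont c this] have "continuous_on UNIV (\<lambda>x. W 0 x)" by simp
      then show ?thesis by (simp add: init)
    qed
    have init_off: "initial_fields \<rho> f0 E20 B0 x = 0" if "x \<notin> K" for x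
      using off[of 0 x] that assms(1) init by simp
    have KG: "K \<subseteq> {a<..<b}" using assms(5) ab(2) by simp
    have \<rho>: "smooth1 \<rho>" "\<And>x. x \<notin> K \<Longrightarrow> \<rho> x = 0" using data unfolding vm_data_def by blast+
    have \<Omega>v: "bounded \<Omega>v" "open \<Omega>v" using assms(3) by (auto simp: domain_def)
    interpret maxwell_step a b h \<T> k M T \<delta>0 d Ci K "source \<rho> fh" "initial_fields \<rho> f0 E20 B0" Wi Wh
    proof unfold_locales
      show "interior \<tau> \<noteq> {}" "diameter \<tau> \<le> h" if "\<tau> \<in> \<T>" for \<tau>
        using disc that division_of_finite[OF div] by (auto simp: discretization_def intro: Max_ge)
      show "L2_on ({0..T} \<times> {a..b}) (\<lambda>z. source \<rho> fh (fst z) (snd z) \<bullet> e)" for e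
        by (rule source_L2[OF dens \<Omega>v KG \<rho>(1)])
      show "source \<rho> fh t x = 0" if "x \<notin> K" for t x
      proof (rule source_support[OF that \<rho>(2)])
        show "fh t x v = 0" if "x \<notin> K" for t x v using dens that unfolding approx_density_def by blast
      qed
      show "a < b" "0 < h" "1 \<le> k" "\<T> division_of {a..b}" "1 \<le> M" "real M * h = T" "0 < \<delta>0" "0 < d" "2 * d \<le> b - a"
        "compact K" "K \<subseteq> {a<..<b}" "K \<subseteq> {a + d..b - d}" "1 \<le> Ci"
        by (rule ab(1) h assms(6) div hM(2) hM(1) assms(7) d(1) d(2) assms(4) KG d(3) Ci(1))+
      show "(tpoly k c t)\<^sup>2 \<le> Ci / h * integral {t..t + h} (\<lambda>s. (tpoly k c s)\<^sup>2)"
        "integral {t..t + h} (\<lambda>s. (tpoly' k c s)\<^sup>2) \<le> Ci / h\<^sup>2 * integral {t..t + h} (\<lambda>s. (tpoly k c s)\<^sup>2)" for c t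
        by (rule Ci(2)[OF h], rule Ci(3)[OF h])
      show "continuous_on UNIV (initial_fields \<rho> f0 E20 B0)" by (rule init_cont)
      show "initial_fields \<rho> f0 E20 B0 x = 0" if "x \<notin> K" for x by (rule init_off[OF that])
      show "maxwell_solution T {a<..<b} K (source \<rho> fh) (initial_fields \<rho> f0 E20 B0) Wi" by (rule ex)
      show "sd_solution {a<..<b} h M \<T> k (\<delta>0 * h) (source \<rho> fh) (initial_fields \<rho> f0 E20 B0) Wh" by (rule sd)
    qed
    define N where "N = norm_L2 cyl (\<lambda>t x. h *\<^sub>R R1 t x) + norm_L2 cyl (\<lambda>t x. h *\<^sub>R R2 t x)"
    have N0: "0 \<le> N" unfolding N_def by (intro add_nonneg_nonneg norm_L2_nonneg)
    have vw: "norm_Hneg1 cyl_int (\<lambda>t x. Wi t x - Wh t x) \<le> ereal (S * N)"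
      unfolding norm_Hneg1_def
    proof (rule SUP_least)
      fix \<phi> :: "real \<Rightarrow> real \<Rightarrow> real ^ 3" assume "\<phi> \<in> C0_infinity cyl_int - {\<lambda>_ _. 0}"
      then have "inner_L2 cyl_int (\<lambda>t x. Wi t x - Wh t x) \<phi> \<le> 12 * sd_transport.K \<delta>0 d Ci * T * N * norm_H1 cyl_int \<phi>"
        using dual_bound(2)[of \<phi>] by (simp add: N_def)
      also have "\<dots> \<le> S * N * norm_H1 cyl_int \<phi>"
        unfolding S_def using N0 assms(1) by (intro mult_right_mono) (auto simp: norm_H1_def)
      finally show "ereal (inner_L2 cyl_int (\<lambda>t x. Wi t x - Wh t x) \<phi> / norm_H1 cyl_int \<phi>) \<le> ereal (S * N)"
        using quotient_le S0 N0 by (simp only: ereal_less_eq) force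
    qed
    have "norm_Hneg1 cyl_int (\<lambda>t x. W t x - Wh t x) \<le> ereal (2 * (S * N))"
    proof (rule Hneg1_triangle[OF order_trans[OF dom[folded W_def] vw] vw])
      fix \<phi> :: "real \<Rightarrow> real \<Rightarrow> real ^ 3" assume \<phi>: "\<phi> \<in> C0_infinity cyl_int"
      have "in_L2 cyl Wi" using ex unfolding maxwell_solution_def by blast
      then show "set_integrable lebesgue cyl_int (\<lambda>z. (W (fst z) (snd z) - Wi (fst z) (snd z)) \<bullet> \<phi> (fst z) (snd z))"
        unfolding inner_diff_left using cont by (intro set_integral_diff(1) inner_test_integrable \<phi>) blast+
      show "set_integrable lebesgue cyl_int (\<lambda>z. (Wi (fst z) (snd z) - Wh (fst z) (snd z)) \<bullet> \<phi> (fst z) (snd z))"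
        by (rule dual_bound(1)[OF \<phi>])
    qed
    also have "2 * (S * N) \<le> (2 * S + 1) * N" using N0 by (simp add: distrib_right)
    finally show ?thesis by (simp add: W_def N_def)
  qed
  show ?thesis
    unfolding Let_def ab(2)
  proof (intro exI[of _ "2 * S + 1"] conjI allI impI)
    show "0 < 2 * S + 1" using S0 by linarith
  next
    fix h M \<T> \<rho> f0 E20 B0 f E1 E2 B fh Wi Wh
    assume hyps: "discretization T {a<..<b} h M \<T>" "vm_data K \<Omega>v \<rho> f0 E20 B0" "vm_solution T {a<..<b} K \<Omega>v \<rho> f0 E20 B0 f E1 E2 B"
      "\<forall>i. approx_density T {a<..<b} K \<Omega>v (fh i)"
      "\<forall>i\<ge>1. maxwell_solution T {a<..<b} K (source \<rho> (fh (i - 1))) (initial_fields \<rho> f0 E20 B0) (Wi i)"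
      "\<forall>i\<ge>1. sd_solution {a<..<b} h M \<T> k (\<delta>0 * h) (source \<rho> (fh (i - 1))) (initial_fields \<rho> f0 E20 B0) (Wh i)"
      "\<forall>\<^sub>F i in sequentially. norm_Hneg1 ({0<..<T} \<times> {a<..<b}) (\<lambda>t x. fields E1 E2 B t x - Wi i t x)
        \<le> norm_Hneg1 ({0<..<T} \<times> {a<..<b}) (\<lambda>t x. Wi i t x - Wh i t x)"
    show "\<forall>\<^sub>F i in sequentially. norm_Hneg1 ({0<..<T} \<times> {a<..<b}) (\<lambda>t x. fields E1 E2 B t x - Wh i t x)
      \<le> ereal ((2 * S + 1) * (norm_L2 ({0..T} \<times> {a<..<b}) (\<lambda>t x. h *\<^sub>R residual1 (source \<rho> (fh (i - 1))) (Wh i) t x)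
          + norm_L2 ({0..T} \<times> {a<..<b}) (\<lambda>t x. h *\<^sub>R residual2 h (initial_fields \<rho> f0 E20 B0) (Wh i) t x)))"
      using hyps(7) eventually_ge_at_top[of 1]
    proof eventually_elim
      case (elim i)
      show ?case by (rule main[OF hyps(1-3) hyps(4)[rule_format] hyps(5)[rule_format, OF elim(2)] hyps(6)[rule_format, OF elim(2)] elim(1)])
    qed
  qed
qed

end
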